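(* Let $\mathbf F$ be a complex of (graded) free modules over $E$. Then $$\operatorname{lin}(\mathbf F)=\mathbf R\bigl(H^\bullet(K\otimes_E\mathbf F)\bigr)$$ (up to the identification $\omega_E\cong E$), where the $S$-module structure on $H^\bullet(K\otimes_E\mathbf F)$ is given by the action of $\operatorname{Ext}_E(K,K)=S$. Explicitly: $\operatorname{lin}(\mathbf F)$ is isomorphic to the complex whose term in cohomological degree $i$ is $E\otimes_KH^i(K\otimes_E\mathbf F)$ and whose differential is $e\otimes h\mapsto\sum_s ee_s\otimes x_sh$, where $(e_s)$, $(x_s)$ are dual bases of $V$ and $W$.
   Context: $K$ is a field; $V$ and $W=V^*$ are dual $K$-vector spaces of finite dimension $v$, with $W$ in degree $1$ and $V$ in degree $-1$; $E=\bigwedge V$ and $S=\operatorname{Sym}(W)=\operatorname{Ext}_E^\bullet(K,K)$ with induced gradings ($\bigwedge^jV$ in degree $-j$). Complexes are cohomological. $\omega_E=\operatorname{Hom}_K(E,K)=E\otimes_K\bigwedge^vW$, noncanonically isomorphic to $E(-v)$. For an $S$-module $M$ graded as $M=\bigoplus_iM_i$, $\mathbf R(M)$ is the complex with $\operatorname{Hom}_K(E,M_i)\cong\omega_E\otimes_KM_i$ in cohomological degree $i$ and differential $\alpha\mapsto[e\mapsto\sum_s x_s\alpha(e_se)]$. It is applied to $H^\bullet(K\otimes_E\mathbf F)$ with its grading by cohomological degree $i$ (each $H^i$ also being a graded vector space). $S$-module structure on $H^\bullet(K\otimes_E\mathbf F)$: let $(V)\subset E$ be the ideal generated by $V$. Tensoring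 the exact sequence $0\to V\to E/(V)^2\to K\to0$ with the free complex $\mathbf F$ gives an exact sequence of complexes whose connecting homomorphisms are maps $H^i(K\otimes_E\mathbf F)\to H^{i+1}(V\otimes_E\mathbf F)=V\otimes_KH^{i+1}(K\otimes_E\mathbf F)$, equivalently maps $W\otimes_KH^i(K\otimes_E\mathbf F)\to H^{i+1}(K\otimes_E\mathbf F)$, which give multiplication by elements of $W$. Linear part: a free complex over $E$ is minimal if its differentials are given by matrices with entries in the maximal ideal. For a minimal free complex, $\operatorname{lin}$ is obtained by erasing from these matrices all terms of absolute degree $>1$ (keeping only the components of the entries in $V$). For any free complex $\mathbf F$, $\operatorname{lin}(\mathbf F)$ is the linear part of a minimal free complex homotopy equivalent to $\mathbf F$. *)

theory Defs
  imports Complex_Main "HOL-Algebra.Module" "HOL-Algebra.AbelCoset" "HOL-Algebra.Free_Abelian_Groups"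
    "HOL-Library.Poly_Mapping"
begin

section \<open>The exterior algebra\<close>

text \<open>The ring \<open>E\<close> is a type of class \<^class>\<open>ring_1\<close> and the field \<open>K\<close> a type of class
  \<^class>\<open>Fields.field\<close>.  The record carries the \<open>K\<close>-algebra structure of \<open>E\<close> and the
  subspace \<open>V\<close> of generators.\<close>

record ('k, 'e) gen_algebra =
  scal :: "'k \<Rightarrow> 'e \<Rightarrow> 'e"
  gens :: "'e set"

abbreviation Kspan :: "('k::field, 'e::ring_1) gen_algebra \<Rightarrow> 'e set \<Rightarrow> 'e set" where
  "Kspan E \<equiv> Modules.module.span (scal E)"

abbreviation Kindependent :: "('k::field, 'e::ring_1) gen_algebra \<Rightarrow> 'e set \<Rightarrow> bool" where
  "Kindependent E S \<equiv> \<not> Modules.module.dependent (scal E) S"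

definition V_basis :: "('k::field, 'e::ring_1) gen_algebra \<Rightarrow> nat \<Rightarrow> (nat \<Rightarrow> 'e) \<Rightarrow> bool" where
  "V_basis E n e \<longleftrightarrow> inj_on e {..<n} \<and> Kindependent E (e ` {..<n}) \<and> Kspan E (e ` {..<n}) = gens E"

definition ordered_monomial :: "(nat \<Rightarrow> 'e::ring_1) \<Rightarrow> nat set \<Rightarrow> 'e" where
  "ordered_monomial e A = prod_list (map e (sorted_list_of_set A))"

text \<open>\<open>E\<close> is the exterior algebra of the finite-dimensional space \<open>V\<close>: a \<open>K\<close>-algebra
  containing \<open>V\<close>, in which vectors of \<open>V\<close> square to zero, and in which the
  products \<open>e\<^sub>i\<^sub>1 \<cdots> e\<^sub>i\<^sub>j\<close> with \<open>i\<^sub>1 < \<cdots> < i\<^sub>j\<close> form a \<open>K\<close>-basis for a basis \<open>e\<close> of \<open>V\<close>.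
  The case \<open>V = 0\<close>, \<open>E = K\<close> is included.\<close>

definition exterior_algebra :: "('k::field, 'e::ring_1) gen_algebra \<Rightarrow> bool" where
  "exterior_algebra E \<longleftrightarrow>
     vector_space (scal E) \<and>
     (\<forall>a x y. scal E a x * y = scal E a (x * y) \<and> x * scal E a y = scal E a (x * y)) \<and>
     (\<forall>v\<in>gens E. v * v = 0) \<and>
     (\<exists>n e. V_basis E n e \<and>
        inj_on (ordered_monomial e) (Pow {..<n}) \<and>
        Kindependent E (ordered_monomial e ` Pow {..<n}) \<and>
        Kspan E (ordered_monomial e ` Pow {..<n}) = UNIV)"

text \<open>\<open>W = V\<^sup>*\<close>; functionals on \<open>V\<close> are extended by \<open>0\<close> outside \<open>V\<close>.\<close>

definition dual_space :: "('k::field, 'e::ring_1) gen_algebra \<Rightarrow> ('e \<Rightarrow> 'k) set" where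
  "dual_space E = {w. (\<forall>u\<in>gens E. \<forall>v\<in>gens E. w (u + v) = w u + w v) \<and>
                      (\<forall>a. \<forall>v\<in>gens E. w (scal E a v) = a * w v) \<and>
                      (\<forall>v. v \<notin> gens E \<longrightarrow> w v = 0)}"

definition dual_bases ::
  "('k::field, 'e::ring_1) gen_algebra \<Rightarrow> nat \<Rightarrow> (nat \<Rightarrow> 'e) \<Rightarrow> (nat \<Rightarrow> 'e \<Rightarrow> 'k) \<Rightarrow> bool" where
  "dual_bases E n e x \<longleftrightarrow> V_basis E n e \<and> (\<forall>s<n. x s \<in> dual_space E) \<and>
     (\<forall>s<n. \<forall>t<n. x s (e t) = (if s = t then 1 else 0))"

definition ext_power :: "('k::field, 'e::ring_1) gen_algebra \<Rightarrow> nat \<Rightarrow> 'e set" where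
  "ext_power E j = Kspan E {prod_list vs | vs. length vs = j \<and> set vs \<subseteq> gens E}"

text \<open>\<open>\<And>\<^sup>jV\<close> sits in degree \<open>- j\<close>; the field \<open>K\<close> sits in degree \<open>0\<close>.\<close>

definition E_deg :: "('k::field, 'e::ring_1) gen_algebra \<Rightarrow> int \<Rightarrow> 'e set" where
  "E_deg E d = (if d \<le> 0 then ext_power E (nat (- d)) else {0})"

definition K_deg :: "int \<Rightarrow> 'k::field set" where
  "K_deg d = (if d = 0 then UNIV else {0})"

text \<open>The ideal \<open>(V)\<^sup>k\<close>.\<close>

definition V_ideal_power :: "('k::field, 'e::ring_1) gen_algebra \<Rightarrow> nat \<Rightarrow> 'e set" where
  "V_ideal_power E k = Kspan E {a * prod_list vs * b | a b vs. length vs = k \<and> set vs \<subseteq> gens E}"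

text \<open>The component in \<open>V\<close> of an element of \<open>E = \<Oplus>\<^sub>j \<And>\<^sup>jV\<close>.\<close>

definition V_component :: "('k::field, 'e::ring_1) gen_algebra \<Rightarrow> 'e \<Rightarrow> 'e" where
  "V_component E a = (THE u. u \<in> gens E \<and> a - u \<in> Kspan E (\<Union>j\<in>- {1}. ext_power E j))"


section \<open>Left modules\<close>

text \<open>\<open>Module.module\<close> requires a commutative ring, hence this locale.  The fields
  \<open>mult\<close> and \<open>one\<close> of the record are irrelevant.  It is used with scalars in \<open>E\<close> and in \<open>K\<close>.\<close>

locale left_module = abelian_group M
  for M :: "('r::ring_1, 'm) module" (structure) +
  assumes smult_closed: "x \<in> carrier M \<Longrightarrow> r \<odot> x \<in> carrier M"
    and smult_l_distr: "x \<in> carrier M \<Longrightarrow> (r + s) \<odot> x = r \<odot> x \<oplus> s \<odot> x"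
    and smult_r_distr: "x \<in> carrier M \<Longrightarrow> y \<in> carrier M \<Longrightarrow> r \<odot> (x \<oplus> y) = r \<odot> x \<oplus> r \<odot> y"
    and smult_assoc: "x \<in> carrier M \<Longrightarrow> (r * s) \<odot> x = r \<odot> (s \<odot> x)"
    and smult_one: "x \<in> carrier M \<Longrightarrow> 1 \<odot> x = x"

definition left_hom ::
  "('r::ring_1, 'm) module \<Rightarrow> ('r, 'n) module \<Rightarrow> ('m \<Rightarrow> 'n) \<Rightarrow> bool" where
  "left_hom M N f \<longleftrightarrow> f \<in> carrier M \<rightarrow> carrier N \<and>
     (\<forall>x\<in>carrier M. \<forall>y\<in>carrier M. f (x \<oplus>\<^bsub>M\<^esub> y) = f x \<oplus>\<^bsub>N\<^esub> f y) \<and>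
     (\<forall>r. \<forall>x\<in>carrier M. f (r \<odot>\<^bsub>M\<^esub> x) = r \<odot>\<^bsub>N\<^esub> f x)"

text \<open>\<open>M\<close> is the direct sum of the additive subgroups \<open>gr d\<close>, and \<open>D a \<cdot> gr d \<subseteq> gr (a + d)\<close>.\<close>

definition module_grading ::
  "(int \<Rightarrow> 'r::ring_1 set) \<Rightarrow> ('r, 'm) module \<Rightarrow> (int \<Rightarrow> 'm set) \<Rightarrow> bool" where
  "module_grading D M gr \<longleftrightarrow>
     (\<forall>d. subgroup (gr d) (add_monoid M)) \<and>
     (\<forall>m\<in>carrier M. \<exists>!f. (\<forall>d. f d \<in> gr d) \<and> finite {d. f d \<noteq> \<zero>\<^bsub>M\<^esub>} \<and>
        m = (\<Oplus>\<^bsub>M\<^esub>d\<in>{d. f d \<noteq> \<zero>\<^bsub>M\<^esub>}. f d)) \<and>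
     (\<forall>a d. \<forall>r\<in>D a. \<forall>m\<in>gr d. r \<odot>\<^bsub>M\<^esub> m \<in> gr (a + d))"

definition represents ::
  "('r::ring_1, 'm) module \<Rightarrow> 'm set \<Rightarrow> ('m \<Rightarrow> 'r) \<Rightarrow> 'm \<Rightarrow> bool" where
  "represents M B c m \<longleftrightarrow> finite {b. c b \<noteq> 0} \<and> {b. c b \<noteq> 0} \<subseteq> B \<and>
     m = (\<Oplus>\<^bsub>M\<^esub>b\<in>{b. c b \<noteq> 0}. c b \<odot>\<^bsub>M\<^esub> b)"

definition free_basis :: "('r::ring_1, 'm) module \<Rightarrow> 'm set \<Rightarrow> bool" where
  "free_basis M B \<longleftrightarrow> B \<subseteq> carrier M \<and> (\<forall>m\<in>carrier M. \<exists>!c. represents M B c m)"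

definition coords :: "('r::ring_1, 'm) module \<Rightarrow> 'm set \<Rightarrow> 'm \<Rightarrow> 'm \<Rightarrow> 'r" where
  "coords M B m = (THE c. represents M B c m)"

definition ideal_smult :: "'r::ring_1 set \<Rightarrow> ('r, 'm) module \<Rightarrow> 'm set" where
  "ideal_smult I M = {(\<Oplus>\<^bsub>M\<^esub>j\<in>{..<k}. r j \<odot>\<^bsub>M\<^esub> m j) | (k::nat) r m.
     (\<forall>j<k. r j \<in> I \<and> m j \<in> carrier M)}"

definition restrict_scalars ::
  "('k::field, 'e::ring_1) gen_algebra \<Rightarrow> ('e, 'm) module \<Rightarrow> ('k, 'm) module" where
  "restrict_scalars E M = \<lparr>carrier = carrier M, mult = mult M, one = one M, ring.zero = \<zero>\<^bsub>M\<^esub>,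
     add = add M, smult = (\<lambda>a m. scal E a 1 \<odot>\<^bsub>M\<^esub> m)\<rparr>"

definition quotient_module :: "('r::ring_1, 'm) module \<Rightarrow> 'm set \<Rightarrow> ('r, 'm set) module" where
  "quotient_module M N = \<lparr>carrier = a_rcosets\<^bsub>M\<^esub> N, mult = undefined, one = undefined,
     ring.zero = N, add = set_add M, smult = (\<lambda>r X. \<Union>m\<in>X. N +>\<^bsub>M\<^esub> (r \<odot>\<^bsub>M\<^esub> m))\<rparr>"

text \<open>The map \<open>M/N \<rightarrow> M'/N'\<close> induced by \<open>f : M \<rightarrow> M'\<close> with \<open>f(N) \<subseteq> N'\<close>, as a function of cosets.\<close>

definition quotient_map ::
  "('r::ring_1, 'n) module \<Rightarrow> 'n set \<Rightarrow> ('m \<Rightarrow> 'n) \<Rightarrow> 'm set \<Rightarrow> 'n set" where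
  "quotient_map M' N' f X = (\<Union>m\<in>X. N' +>\<^bsub>M'\<^esub> f m)"


section \<open>Complexes\<close>

text \<open>Cohomological complexes indexed by \<open>\<int>\<close>; \<open>cgr C i d\<close> is the part of internal degree \<open>d\<close> of
  the term in cohomological degree \<open>i\<close>.  The Boolean \<open>graded\<close> below selects between the
  category of graded modules with maps of degree \<open>0\<close> and that of ungraded modules, for
  which \<open>cgr\<close> is ignored.\<close>

record ('r, 'm) cochain_complex =
  cmod :: "int \<Rightarrow> ('r, 'm) module"
  cdiff :: "int \<Rightarrow> 'm \<Rightarrow> 'm"
  cgr :: "int \<Rightarrow> int \<Rightarrow> 'm set"

definition is_complex ::
  "bool \<Rightarrow> (int \<Rightarrow> 'r::ring_1 set) \<Rightarrow> ('r, 'm) cochain_complex \<Rightarrow> bool" where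
  "is_complex graded D C \<longleftrightarrow>
     (\<forall>i. left_module (cmod C i)) \<and>
     (\<forall>i. left_hom (cmod C i) (cmod C (i + 1)) (cdiff C i)) \<and>
     (\<forall>i. \<forall>m\<in>carrier (cmod C i). cdiff C (i + 1) (cdiff C i m) = \<zero>\<^bsub>cmod C (i + 1 + 1)\<^esub>) \<and>
     (graded \<longrightarrow> (\<forall>i. module_grading D (cmod C i) (cgr C i) \<and>
                   (\<forall>d. cdiff C i ` cgr C i d \<subseteq> cgr C (i + 1) d)))"

definition chain_map ::
  "bool \<Rightarrow> ('r::ring_1, 'm) cochain_complex \<Rightarrow> ('r, 'n) cochain_complex \<Rightarrow>
     (int \<Rightarrow> 'm \<Rightarrow> 'n) \<Rightarrow> bool" where
  "chain_map graded C D f \<longleftrightarrow>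
     (\<forall>i. left_hom (cmod C i) (cmod D i) (f i)) \<and>
     (\<forall>i. \<forall>m\<in>carrier (cmod C i). f (i + 1) (cdiff C i m) = cdiff D i (f i m)) \<and>
     (graded \<longrightarrow> (\<forall>i d. f i ` cgr C i d \<subseteq> cgr D i d))"

text \<open>\<open>f - g = d s + s d\<close> with \<open>s i : C i \<rightarrow> D (i - 1)\<close>.\<close>

definition chain_homotopic ::
  "bool \<Rightarrow> ('r::ring_1, 'm) cochain_complex \<Rightarrow> ('r, 'n) cochain_complex \<Rightarrow>
     (int \<Rightarrow> 'm \<Rightarrow> 'n) \<Rightarrow> (int \<Rightarrow> 'm \<Rightarrow> 'n) \<Rightarrow> bool" where
  "chain_homotopic graded C D f g \<longleftrightarrow> (\<exists>s.
     (\<forall>i. left_hom (cmod C i) (cmod D (i - 1)) (s i)) \<and>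
     (graded \<longrightarrow> (\<forall>i d. s i ` cgr C i d \<subseteq> cgr D (i - 1) d)) \<and>
     (\<forall>i. \<forall>m\<in>carrier (cmod C i).
        f i m \<ominus>\<^bsub>cmod D i\<^esub> g i m = cdiff D (i - 1) (s i m) \<oplus>\<^bsub>cmod D i\<^esub> s (i + 1) (cdiff C i m)))"

definition homotopy_equivalent_complexes ::
  "bool \<Rightarrow> ('r::ring_1, 'm) cochain_complex \<Rightarrow> ('r, 'n) cochain_complex \<Rightarrow> bool" where
  "homotopy_equivalent_complexes graded C D \<longleftrightarrow> (\<exists>f g.
     chain_map graded C D f \<and> chain_map graded D C g \<and>
     chain_homotopic graded C C (\<lambda>i. g i \<circ> f i) (\<lambda>i. id) \<and>
     chain_homotopic graded D D (\<lambda>i. f i \<circ> g i) (\<lambda>i. id))"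

text \<open>Isomorphism of complexes, raising the internal degree in the graded case by \<open>k\<close>.\<close>

definition complexes_isomorphic ::
  "bool \<Rightarrow> int \<Rightarrow> ('r::ring_1, 'm) cochain_complex \<Rightarrow> ('r, 'n) cochain_complex \<Rightarrow> bool" where
  "complexes_isomorphic graded k C D \<longleftrightarrow> (\<exists>\<phi>.
     (\<forall>i. left_hom (cmod C i) (cmod D i) (\<phi> i)) \<and>
     (\<forall>i. bij_betw (\<phi> i) (carrier (cmod C i)) (carrier (cmod D i))) \<and>
     (\<forall>i. \<forall>m\<in>carrier (cmod C i). \<phi> (i + 1) (cdiff C i m) = cdiff D i (\<phi> i m)) \<and>
     (graded \<longrightarrow> (\<forall>i d. \<phi> i ` cgr C i d = cgr D i (d + k))))"

definition cocycles :: "('r::ring_1, 'm) cochain_complex \<Rightarrow> int \<Rightarrow> ('r, 'm) module" where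
  "cocycles C i =
     (cmod C i)\<lparr>carrier := {z \<in> carrier (cmod C i). cdiff C i z = \<zero>\<^bsub>cmod C (i + 1)\<^esub>}\<rparr>"

definition coboundaries :: "('r::ring_1, 'm) cochain_complex \<Rightarrow> int \<Rightarrow> 'm set" where
  "coboundaries C i = cdiff C (i - 1) ` carrier (cmod C (i - 1))"

definition cohomology :: "('r::ring_1, 'm) cochain_complex \<Rightarrow> int \<Rightarrow> ('r, 'm set) module" where
  "cohomology C i = quotient_module (cocycles C i) (coboundaries C i)"

definition cohomology_class :: "('r::ring_1, 'm) cochain_complex \<Rightarrow> int \<Rightarrow> 'm \<Rightarrow> 'm set" where
  "cohomology_class C i z = coboundaries C i +>\<^bsub>cocycles C i\<^esub> z"

definition cohomology_gr :: "('r::ring_1, 'm) cochain_complex \<Rightarrow> int \<Rightarrow> int \<Rightarrow> 'm set set" where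
  "cohomology_gr C i d = cohomology_class C i ` (carrier (cocycles C i) \<inter> cgr C i d)"


section \<open>Free complexes and linear parts\<close>

definition homogeneous_free_bases ::
  "bool \<Rightarrow> ('r::ring_1, 'm) cochain_complex \<Rightarrow> (int \<Rightarrow> 'm set) \<Rightarrow> bool" where
  "homogeneous_free_bases graded C B \<longleftrightarrow>
     (\<forall>i. free_basis (cmod C i) (B i) \<and> (graded \<longrightarrow> B i \<subseteq> (\<Union>d. cgr C i d)))"

definition free_complex ::
  "bool \<Rightarrow> ('k::field, 'e::ring_1) gen_algebra \<Rightarrow> ('e, 'm) cochain_complex \<Rightarrow> bool" where
  "free_complex graded E F \<longleftrightarrow> is_complex graded (E_deg E) F \<and> (\<exists>B. homogeneous_free_bases graded F B)"

text \<open>The entries of the matrices of the differential: \<open>d b = \<Sum>\<^sub>b\<^sub>' (diff_entry F B i b b') b'\<close>.\<close>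

definition diff_entry ::
  "('e::ring_1, 'm) cochain_complex \<Rightarrow> (int \<Rightarrow> 'm set) \<Rightarrow> int \<Rightarrow> 'm \<Rightarrow> 'm \<Rightarrow> 'e" where
  "diff_entry F B i b b' = coords (cmod F (i + 1)) (B (i + 1)) (cdiff F i b) b'"

definition minimal_complex ::
  "('k::field, 'e::ring_1) gen_algebra \<Rightarrow> ('e, 'm) cochain_complex \<Rightarrow> (int \<Rightarrow> 'm set) \<Rightarrow> bool" where
  "minimal_complex E F B \<longleftrightarrow>
     (\<forall>i. \<forall>b\<in>B i. \<forall>b'\<in>B (i + 1). diff_entry F B i b b' \<in> V_ideal_power E 1)"

text \<open>The matrix entries of the differential are replaced by their components in \<open>V\<close>.\<close>

definition erase_nonlinear ::
  "('k::field, 'e::ring_1) gen_algebra \<Rightarrow> ('e, 'm) cochain_complex \<Rightarrow> (int \<Rightarrow> 'm set) \<Rightarrow>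
     ('e, 'm) cochain_complex" where
  "erase_nonlinear E F B = F\<lparr>cdiff := (\<lambda>i m.
     \<Oplus>\<^bsub>cmod F (i + 1)\<^esub>b\<in>{b. coords (cmod F i) (B i) m b \<noteq> 0}. coords (cmod F i) (B i) m b
       \<odot>\<^bsub>cmod F (i + 1)\<^esub> (\<Oplus>\<^bsub>cmod F (i + 1)\<^esub>b'\<in>{b'. diff_entry F B i b b' \<noteq> 0}.
         V_component E (diff_entry F B i b b') \<odot>\<^bsub>cmod F (i + 1)\<^esub> b'))\<rparr>"

text \<open>\<open>L\<close> is a linear part of \<open>F\<close>.  Since a minimal model and its bases are only determined
  up to isomorphism, so is \<open>L\<close>.\<close>

definition is_lin ::
  "bool \<Rightarrow> ('k::field, 'e::ring_1) gen_algebra \<Rightarrow> ('e, 'm) cochain_complex \<Rightarrow>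
     ('e, 'n) cochain_complex \<Rightarrow> bool" where
  "is_lin graded E F L \<longleftrightarrow> (\<exists>G B.
     is_complex graded (E_deg E) G \<and> homogeneous_free_bases graded G B \<and> minimal_complex E G B \<and>
     homotopy_equivalent_complexes graded F G \<and> L = erase_nonlinear E G B)"


section \<open>The \<open>S\<close>-module \<open>H\<^sup>\<bullet>(K \<otimes>\<^sub>E F)\<close>\<close>

text \<open>\<open>K \<otimes>\<^sub>E M = E/(V) \<otimes>\<^sub>E M\<close> is realized as \<open>M/(V)M\<close>.\<close>

definition K_tensor ::
  "('k::field, 'e::ring_1) gen_algebra \<Rightarrow> ('e, 'm) cochain_complex \<Rightarrow> ('k, 'm set) cochain_complex" where
  "K_tensor E F = (let VF = (\<lambda>i. ideal_smult (V_ideal_power E 1) (cmod F i)) in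
     \<lparr>cmod = (\<lambda>i. quotient_module (restrict_scalars E (cmod F i)) (VF i)),
      cdiff = (\<lambda>i. quotient_map (restrict_scalars E (cmod F (i + 1))) (VF (i + 1)) (cdiff F i)),
      cgr = (\<lambda>i d. (\<lambda>m. VF i +>\<^bsub>cmod F i\<^esub> m) ` cgr F i d)\<rparr>)"

text \<open>The class in \<open>H\<^sup>i(K \<otimes>\<^sub>E F)\<close> of \<open>1 \<otimes> z\<close>, for \<open>z\<close> with \<open>d z \<in> (V)F\<^sup>i\<^sup>+\<^sup>1\<close>.\<close>

definition K_class ::
  "('k::field, 'e::ring_1) gen_algebra \<Rightarrow> ('e, 'm) cochain_complex \<Rightarrow> int \<Rightarrow> 'm \<Rightarrow> 'm set set" where
  "K_class E F i z = cohomology_class (K_tensor E F) i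
     (ideal_smult (V_ideal_power E 1) (cmod F i) +>\<^bsub>cmod F i\<^esub> z)"

text \<open>Multiplication by \<open>w \<in> W\<close>, read off from the connecting homomorphism of
  \<open>0 \<rightarrow> V \<otimes>\<^sub>E F \<rightarrow> E/(V)\<^sup>2 \<otimes>\<^sub>E F \<rightarrow> K \<otimes>\<^sub>E F \<rightarrow> 0\<close>: a cocycle of \<open>K \<otimes>\<^sub>E F\<close> is lifted to \<open>z\<close>
  in \<open>F\<^sup>i\<close>; modulo \<open>(V)\<^sup>2 F\<^sup>i\<^sup>+\<^sup>1\<close> its differential is the image \<open>\<Sum>\<^sub>j v\<^sub>j y\<^sub>j\<close> of an element
  \<open>\<Sum>\<^sub>j v\<^sub>j \<otimes> y\<^sub>j\<close> of \<open>V \<otimes>\<^sub>E F\<^sup>i\<^sup>+\<^sup>1 = V \<otimes>\<^sub>K (K \<otimes>\<^sub>E F\<^sup>i\<^sup>+\<^sup>1)\<close>, which is then contracted with \<open>w\<close>.\<close>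

definition W_mult ::
  "('k::field, 'e::ring_1) gen_algebra \<Rightarrow> ('e, 'm) cochain_complex \<Rightarrow> int \<Rightarrow> ('e \<Rightarrow> 'k) \<Rightarrow>
     'm set set \<Rightarrow> 'm set set" where
  "W_mult E F i w X = (THE Y. \<exists>z (k::nat) v y.
     z \<in> carrier (cmod F i) \<and>
     cdiff F i z \<in> ideal_smult (V_ideal_power E 1) (cmod F (i + 1)) \<and>
     X = K_class E F i z \<and>
     (\<forall>j<k. v j \<in> gens E \<and> y j \<in> carrier (cmod F (i + 1))) \<and>
     cdiff F i z \<ominus>\<^bsub>cmod F (i + 1)\<^esub> (\<Oplus>\<^bsub>cmod F (i + 1)\<^esub>j\<in>{..<k}. v j \<odot>\<^bsub>cmod F (i + 1)\<^esub> y j)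
       \<in> ideal_smult (V_ideal_power E 2) (cmod F (i + 1)) \<and>
     Y = K_class E F (i + 1)
       (\<Oplus>\<^bsub>cmod F (i + 1)\<^esub>j\<in>{..<k}. scal E (w (v j)) 1 \<odot>\<^bsub>cmod F (i + 1)\<^esub> y j))"

text \<open>A graded module \<open>\<Oplus>\<^sub>i M\<^sub>i\<close> over \<open>S = Sym(W)\<close> is given by the \<open>K\<close>-spaces \<open>M\<^sub>i\<close> and pairwise
  commuting multiplications by the elements of \<open>W\<close>.  Each \<open>M\<^sub>i\<close> may carry an internal grading,
  for which \<open>W\<close> has degree \<open>1\<close>.\<close>

record ('k, 'e, 'h) sym_module =
  spart :: "int \<Rightarrow> ('k, 'h) module"
  sact :: "int \<Rightarrow> ('e \<Rightarrow> 'k) \<Rightarrow> 'h \<Rightarrow> 'h"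
  sgr :: "int \<Rightarrow> int \<Rightarrow> 'h set"

definition is_sym_module ::
  "bool \<Rightarrow> ('k::field, 'e::ring_1) gen_algebra \<Rightarrow> ('k, 'e, 'h) sym_module \<Rightarrow> bool" where
  "is_sym_module graded E M \<longleftrightarrow>
     (\<forall>i. left_module (spart M i)) \<and>
     (\<forall>i. \<forall>w\<in>dual_space E. left_hom (spart M i) (spart M (i + 1)) (sact M i w)) \<and>
     (\<forall>i. \<forall>w\<in>dual_space E. \<forall>w'\<in>dual_space E. \<forall>h\<in>carrier (spart M i).
        sact M i (\<lambda>v. w v + w' v) h = sact M i w h \<oplus>\<^bsub>spart M (i + 1)\<^esub> sact M i w' h) \<and>
     (\<forall>i a. \<forall>w\<in>dual_space E. \<forall>h\<in>carrier (spart M i).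
        sact M i (\<lambda>v. a * w v) h = a \<odot>\<^bsub>spart M (i + 1)\<^esub> sact M i w h) \<and>
     (\<forall>i. \<forall>w\<in>dual_space E. \<forall>w'\<in>dual_space E. \<forall>h\<in>carrier (spart M i).
        sact M (i + 1) w (sact M i w' h) = sact M (i + 1) w' (sact M i w h)) \<and>
     (graded \<longrightarrow> (\<forall>i. module_grading K_deg (spart M i) (sgr M i) \<and>
        (\<forall>w\<in>dual_space E. \<forall>d. sact M i w ` sgr M i d \<subseteq> sgr M (i + 1) (d + 1))))"

definition H_K_tensor ::
  "('k::field, 'e::ring_1) gen_algebra \<Rightarrow> ('e, 'm) cochain_complex \<Rightarrow>
     ('k, 'e, 'm set set) sym_module" where
  "H_K_tensor E F = \<lparr>spart = cohomology (K_tensor E F), sact = W_mult E F,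
     sgr = cohomology_gr (K_tensor E F)\<rparr>"


section \<open>The functor \<open>R\<close>\<close>

text \<open>\<open>Hom\<^sub>K(E, N)\<close> with the left \<open>E\<close>-module structure \<open>(a \<alpha>)(y) = \<alpha>(y a)\<close>.\<close>

definition Hom_K ::
  "('k::field, 'e::ring_1) gen_algebra \<Rightarrow> ('k, 'h) module \<Rightarrow> ('e, 'e \<Rightarrow> 'h) module" where
  "Hom_K E N = \<lparr>
     carrier = {\<alpha>. (\<forall>y. \<alpha> y \<in> carrier N) \<and> (\<forall>y z. \<alpha> (y + z) = \<alpha> y \<oplus>\<^bsub>N\<^esub> \<alpha> z) \<and>
                   (\<forall>a y. \<alpha> (scal E a y) = a \<odot>\<^bsub>N\<^esub> \<alpha> y)},
     mult = undefined, one = undefined,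
     ring.zero = (\<lambda>y. \<zero>\<^bsub>N\<^esub>), add = (\<lambda>\<alpha> \<beta> y. \<alpha> y \<oplus>\<^bsub>N\<^esub> \<beta> y), smult = (\<lambda>a \<alpha> y. \<alpha> (y * a))\<rparr>"

definition R_complex ::
  "('k::field, 'e::ring_1) gen_algebra \<Rightarrow> nat \<Rightarrow> (nat \<Rightarrow> 'e) \<Rightarrow> (nat \<Rightarrow> 'e \<Rightarrow> 'k) \<Rightarrow>
     ('k, 'e, 'h) sym_module \<Rightarrow> ('e, 'e \<Rightarrow> 'h) cochain_complex" where
  "R_complex E n e x M = \<lparr>
     cmod = (\<lambda>i. Hom_K E (spart M i)),
     cdiff = (\<lambda>i \<alpha> y. \<Oplus>\<^bsub>spart M (i + 1)\<^esub>s\<in>{..<n}. sact M i (x s) (\<alpha> (e s * y))),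
     cgr = (\<lambda>i d. {\<alpha> \<in> carrier (Hom_K E (spart M i)). \<forall>j. \<forall>y\<in>E_deg E j. \<alpha> y \<in> sgr M i (j + d)})\<rparr>"


section \<open>The explicit form of \<open>R\<close>\<close>

text \<open>\<open>E \<otimes>\<^sub>K N\<close> is the free abelian group on \<open>E \<times> N\<close> modulo the bilinearity relations;
  \<open>E\<close> acts on the left factor.\<close>

definition tensor_relations ::
  "('k::field, 'e::ring_1) gen_algebra \<Rightarrow> ('k, 'h) module \<Rightarrow> ('e \<times> 'h \<Rightarrow>\<^sub>0 int) set" where
  "tensor_relations E N = generate (free_Abelian_group (UNIV \<times> carrier N))
     ({frag_of (y + z, h) - frag_of (y, h) - frag_of (z, h) | y z h. h \<in> carrier N} \<union>
      {frag_of (y, h \<oplus>\<^bsub>N\<^esub> h') - frag_of (y, h) - frag_of (y, h') | y h h'.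
         h \<in> carrier N \<and> h' \<in> carrier N} \<union>
      {frag_of (scal E a y, h) - frag_of (y, a \<odot>\<^bsub>N\<^esub> h) | a y h. h \<in> carrier N})"

definition free_tensor :: "('k::field, 'h) module \<Rightarrow> ('e::ring_1, 'e \<times> 'h \<Rightarrow>\<^sub>0 int) module" where
  "free_tensor N = \<lparr>carrier = carrier (free_Abelian_group (UNIV \<times> carrier N)),
     mult = undefined, one = undefined, ring.zero = 0, add = (+),
     smult = (\<lambda>a. frag_extend (\<lambda>(y, h). frag_of (a * y, h)))\<rparr>"

definition E_tensor ::
  "('k::field, 'e::ring_1) gen_algebra \<Rightarrow> ('k, 'h) module \<Rightarrow> ('e, ('e \<times> 'h \<Rightarrow>\<^sub>0 int) set) module" where
  "E_tensor E N = quotient_module (free_tensor N) (tensor_relations E N)"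

definition pure_tensor ::
  "('k::field, 'e::ring_1) gen_algebra \<Rightarrow> ('k, 'h) module \<Rightarrow> 'e \<Rightarrow> 'h \<Rightarrow> ('e \<times> 'h \<Rightarrow>\<^sub>0 int) set" where
  "pure_tensor E N y h =
     tensor_relations E N +>\<^bsub>(free_tensor N :: ('e, 'e \<times> 'h \<Rightarrow>\<^sub>0 int) module)\<^esub> frag_of (y, h)"

definition tensor_complex ::
  "('k::field, 'e::ring_1) gen_algebra \<Rightarrow> nat \<Rightarrow> (nat \<Rightarrow> 'e) \<Rightarrow> (nat \<Rightarrow> 'e \<Rightarrow> 'k) \<Rightarrow>
     ('k, 'e, 'h) sym_module \<Rightarrow> ('e, ('e \<times> 'h \<Rightarrow>\<^sub>0 int) set) cochain_complex" where
  "tensor_complex E n e x M = \<lparr>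
     cmod = (\<lambda>i. E_tensor E (spart M i)),
     cdiff = (\<lambda>i. quotient_map (free_tensor (spart M (i + 1)) :: ('e, _) module)
       (tensor_relations E (spart M (i + 1)))
       (frag_extend (\<lambda>(y, h). \<Sum>s<n. frag_of (y * e s, sact M i (x s) h)))),
     cgr = (\<lambda>i d. {(\<Oplus>\<^bsub>E_tensor E (spart M i)\<^esub>j\<in>{..<k}. pure_tensor E (spart M i) (y j) (h j)) |
       (k::nat) y h. \<forall>j<k. \<exists>a. y j \<in> E_deg E a \<and> h j \<in> sgr M i (d - a)})\<rparr>"

end

theory Submission
  imports Defs "HOL-Library.Function_Algebras"
begin

text \<open>The cohomology of \<open>K \<otimes> F = F/(V)F\<close> is handled through representatives in \<open>F\<close>: a class of degree \<open>i\<close>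
  is given by \<open>z \<in> F\<^sup>i\<close> with \<open>d z \<in> (V)F\<^sup>i\<^sup>+\<^sup>1\<close>, and two of them agree if they differ by an element of
  \<open>d F\<^sup>i\<^sup>-\<^sup>1 + (V)F\<^sup>i\<close>.  Modulo \<open>(V)\<^sup>2\<close> one has \<open>d z \<equiv> \<Sum>\<^sub>s e\<^sub>s y\<^sub>s\<close>, and the \<open>y\<^sub>s\<close> are unique modulo \<open>(V)\<close>
  because \<open>F\<^sup>i\<^sup>+\<^sup>1\<close> is free.  The connecting homomorphism sends the class of \<open>z\<close> to \<open>\<Sum>\<^sub>s e\<^sub>s \<otimes> [y\<^sub>s]\<close>, so \<open>w \<in> W\<close>
  acts by \<open>[z] \<mapsto> \<Sum>\<^sub>s w(e\<^sub>s) [y\<^sub>s]\<close>, and \<open>x\<^sub>s\<close> reads off the \<open>s\<close>-th linear coefficient of the differential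
  (\<open>W_mult_eq\<close>).  That two elements of \<open>W\<close> commute is the vanishing of the coefficient of
  \<open>e\<^sub>s e\<^sub>t\<close> in \<open>d d z\<close> (\<open>dpart_dpart_symmetric\<close>).

  Let \<open>G\<close> be a minimal complex, homotopy equivalent to \<open>F\<close> through \<open>g : G \<rightarrow> F\<close>.  As \<open>d G \<subseteq> (V)G\<close>, every
  element of \<open>G\<close> represents a class, and only those of \<open>(V)G\<close> represent zero.  Hence
  \<open>\<Phi> m = [g m]\<close> is a surjection \<open>G\<^sup>i \<rightarrow> H\<^sup>i(K \<otimes> F)\<close> with kernel \<open>(V)G\<^sup>i\<close> (\<open>Phi_kernel\<close>, \<open>Phi_f\<close>), and
  \<open>x\<^sub>s (\<Phi> m) = \<Phi> y\<^sub>s\<close> for the linear coefficients \<open>y\<^sub>s\<close> of \<open>d m\<close> (\<open>Phi_action\<close>).  A free module \<open>G\<^sup>i\<close> is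
  \<open>E \<otimes> G\<^sup>i/(V)G\<^sup>i\<close> by \<open>b \<mapsto> 1 \<otimes> \<Phi> b\<close> on a basis.  The linear part of \<open>d b\<close> is \<open>\<Sum>\<^sub>s e\<^sub>s y\<^sub>s\<close>, which goes to
  \<open>\<Sum>\<^sub>s e\<^sub>s \<otimes> x\<^sub>s (\<Phi> b)\<close>: this is the differential of \<open>E \<otimes> H\<^sup>\<bullet>\<close> (\<open>isomorphic_tensor_complex\<close>).
  For \<open>\<^bold>R\<close>, the pairing \<open>(y, m) \<mapsto>\<close> coefficient of \<open>e\<^sub>0 \<cdots> e\<^sub>n\<^sub>-\<^sub>1\<close> in \<open>y m\<close> is perfect and identifies \<open>G\<^sup>i\<close>
  with \<open>Hom\<^sub>K(E, H\<^sup>i)\<close>.  It is compatible with the differentials up to the sign \<open>(-1)\<^sup>n\<^sup>-\<^sup>1\<close> that arises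
  when \<open>e\<^sub>s\<close> is moved from the right of an element to its left (\<open>isomorphic_R_complex\<close>).

  For the existence of a minimal model, a set \<open>C\<close> of basis elements is chosen such that \<open>d C\<close> is a basis of
  the coboundaries of \<open>K \<otimes> F\<close>, and \<open>d C\<close> is extended by homogeneous elements \<open>T\<close> to a basis of the cocycles.
  By Nakayama's lemma for the nilpotent ideal \<open>(V)\<close>, \<open>d C \<union> T \<union> C\<close> is a free basis of \<open>F\<^sup>i\<close> (\<open>lift_basis\<close>).
  The span of \<open>C\<close> and \<open>d C\<close> is contractible, and the span of \<open>T\<close> with the compressed
  differential is a minimal complex homotopy equivalent to \<open>F\<close> (\<open>min_model_equivalent\<close>).\<close>

(* Keeps the exponents in (V)^1 and (V)^(k+1) in numeral form. *)
declare One_nat_def [simp del]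

section \<open>Monomials in the exterior algebra\<close>

locale exterior_monomials = vector_space "scal E"
  for E :: "('k::field, 'e::ring_1) gen_algebra" +
  fixes n :: nat and e :: "nat \<Rightarrow> 'e"
  assumes scal_left: "\<And>a y z. scal E a y * z = scal E a (y * z)"
    and scal_right: "\<And>a y z. y * scal E a z = scal E a (y * z)"
    and gens_square: "\<And>v. v \<in> gens E \<Longrightarrow> v * v = 0"
    and V_basis: "V_basis E n e"
begin

abbreviation mon :: "nat set \<Rightarrow> 'e" where "mon \<equiv> ordered_monomial e"

lemma gens_eq_span: "gens E = span (e ` {..<n})"
  using V_basis by (simp add: V_basis_def)

lemma basis_gens [simp]: "i < n \<Longrightarrow> e i \<in> gens E"
  by (simp add: gens_eq_span span_base)

lemma gens_anticommute:
  assumes "u \<in> gens E" "v \<in> gens E" shows "u * v = - (v * u)"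
proof -
  have "(u + v) * (u + v) = 0"
    using assms gens_square by (simp add: gens_eq_span span_add)
  then show ?thesis
    using assms by (simp add: algebra_simps gens_square eq_neg_iff_add_eq_0)
qed

lemma mon_empty [simp]: "mon {} = 1"
  by (simp add: ordered_monomial_def)

lemma mon_insert_min:
  assumes "finite A" "\<And>a. a \<in> A \<Longrightarrow> i < a"
  shows "mon (insert i A) = e i * mon A"
proof -
  have "i \<notin> A" using assms(2) by blast
  have "insort i (sorted_list_of_set A) = i # sorted_list_of_set A"
    using assms by (intro insort_is_Cons) (auto simp: less_imp_le)
  then show ?thesis
    using assms \<open>i \<notin> A\<close> by (simp add: ordered_monomial_def)
qed

text \<open>The products of generators with monomials are computed only up to a sign, which is enough for
  dimension counts and for the vanishing of coefficients.\<close>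

lemma gen_times_mon:
  assumes "finite A" "A \<subseteq> {..<n}" "i < n"
  shows "if i \<in> A then e i * mon A = 0
         else (\<exists>\<sigma>\<in>{1, -1}. e i * mon A = scal E \<sigma> (mon (insert i A)))"
  using assms
proof (induction A rule: finite_linorder_min_induct)
  case empty
  have "e i * mon {} = scal E 1 (mon {i})"
    using mon_insert_min[of "{}" i] by simp
  then show ?case by (simp only: empty_iff if_False) blast
next
  case (insert b A)
  have m: "mon (insert b A) = e b * mon A"
    using insert by (intro mon_insert_min) auto
  consider "i < b" | "i = b" | "b < i" by linarith
  then show ?case
  proof cases
    case 1
    then have "i \<notin> insert b A" "mon (insert i (insert b A)) = e i * mon (insert b A)"
      using insert by (auto intro!: mon_insert_min)
    then show ?thesis by (metis insertI1 scale_one)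
  next
    case 2
    then show ?thesis using insert.prems by (simp add: m mult.assoc[symmetric] gens_square)
  next
    case 3
    have "e i * e b = - (e b * e i)"
      using insert.prems by (intro gens_anticommute) auto
    then have eq: "e i * mon (insert b A) = - (e b * (e i * mon A))"
      by (simp add: m mult.assoc[symmetric])
    show ?thesis
    proof (cases "i \<in> A")
      case True
      then show ?thesis using insert eq by auto
    next
      case False
      then obtain \<sigma> where \<sigma>: "\<sigma> \<in> {1, -1}" "e i * mon A = scal E \<sigma> (mon (insert i A))"
        using insert.IH insert.prems unfolding if_not_P[OF False] by blast
      have "mon (insert b (insert i A)) = e b * mon (insert i A)"
        using insert 3 by (intro mon_insert_min) auto
      then have "e i * mon (insert b A) = scal E (- \<sigma>) (mon (insert i (insert b A)))"
        using \<sigma> by (simp add: eq scal_right insert_commute)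
      moreover have "- \<sigma> \<in> {1, -1}" using \<sigma> by auto
      moreover have "i \<notin> insert b A" using False 3 by simp
      ultimately show ?thesis unfolding if_not_P[OF \<open>i \<notin> insert b A\<close>] by blast
    qed
  qed
qed

lemma mon_times_mon:
  assumes "A \<subseteq> {..<n}" "B \<subseteq> {..<n}"
  shows "if A \<inter> B = {} then (\<exists>\<sigma>\<in>{1, -1}. mon A * mon B = scal E \<sigma> (mon (A \<union> B)))
         else mon A * mon B = 0"
proof -
  have fin: "finite A" "finite B" using assms finite_subset by blast+
  from fin(1) show ?thesis using assms(1)
  proof (induction A rule: finite_linorder_min_induct)
    case empty
    then show ?case by (auto intro: bexI[of _ 1])
  next
    case (insert b A)
    have m: "mon (insert b A) * mon B = e b * (mon A * mon B)"
      using insert mon_insert_min[of A b] by (simp add: mult.assoc)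
    show ?case
    proof (cases "A \<inter> B = {}")
      case False
      then show ?thesis using insert m by auto
    next
      case True
      have "A \<subseteq> {..<n}" using insert.prems by auto
      then obtain \<sigma> where \<sigma>: "\<sigma> \<in> {1, -1}" "mon A * mon B = scal E \<sigma> (mon (A \<union> B))"
        using insert.IH unfolding if_P[OF True] by blast
      have eq: "mon (insert b A) * mon B = scal E \<sigma> (e b * mon (A \<union> B))"
        using \<sigma> by (simp add: m scal_right)
      have g: "if b \<in> A \<union> B then e b * mon (A \<union> B) = 0
         else (\<exists>\<sigma>\<in>{1, -1}. e b * mon (A \<union> B) = scal E \<sigma> (mon (insert b (A \<union> B))))"
        using insert assms fin by (intro gen_times_mon) auto
      have "b \<notin> A" using insert by blast
      show ?thesis
      proof (cases "b \<in> B")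
        case True
        then show ?thesis using g eq by auto
      next
        case False
        then obtain \<tau> where \<tau>: "\<tau> \<in> {1, -1}" "e b * mon (A \<union> B) = scal E \<tau> (mon (insert b (A \<union> B)))"
          using g \<open>b \<notin> A\<close> by (metis Un_iff)
        then have "mon (insert b A) * mon B = scal E (\<sigma> * \<tau>) (mon (insert b A \<union> B))"
          by (simp add: eq)
        moreover have "\<sigma> * \<tau> \<in> {1, -1}" using \<sigma> \<tau> by auto
        ultimately show ?thesis using True False by auto
      qed
    qed
  qed
qed

text \<open>Moving a generator past a monomial costs one sign for each factor.\<close>

lemma gen_mon_commute:
  assumes "A \<subseteq> {..<n}" "i < n"
  shows "e i * mon A = scal E ((-1) ^ card A) (mon A * e i)"
proof -
  have "finite A" using assms finite_subset by blast
  then show ?thesis using assms(1)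
  proof (induction A rule: finite_linorder_min_induct)
    case (insert b A)
    have m: "mon (insert b A) = e b * mon A"
      using insert by (intro mon_insert_min) auto
    have c: "card (insert b A) = Suc (card A)" using insert by (subst card_insert_disjoint) auto
    have "e i * (e b * mon A) = - (e b * (e i * mon A))"
      using insert.prems assms gens_anticommute[of "e i" "e b"] by (simp add: mult.assoc[symmetric])
    then show ?case
      using insert by (simp add: m c scal_right mult.assoc)
  qed simp
qed

text \<open>The span of the ordered monomials contains \<open>1\<close> and is stable under left multiplication by
  \<open>V\<close>, so that it contains every product of generators, in particular the monomials in
  any other basis of \<open>V\<close>.\<close>

lemma prod_gens_in_span_mon:
  assumes "set vs \<subseteq> gens E"
  shows "prod_list vs \<in> span (mon ` Pow {..<n})"
  using assms
proof (induction vs)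
  case Nil
  have "mon {} \<in> span (mon ` Pow {..<n})" by (rule span_base) blast
  then show ?case by simp
next
  case (Cons v vs)
  let ?S = "span (mon ` Pow {..<n})"
  have basic: "e i * mon A \<in> ?S" if "i < n" "A \<subseteq> {..<n}" for i A
  proof -
    have "finite A" using that finite_subset by blast
    show ?thesis
      using gen_times_mon[OF \<open>finite A\<close> that(2,1)] that
      by (metis (no_types, lifting) PowI image_eqI insert_subset lessThan_iff span_base span_scale span_zero)
  qed
  have gen: "e i * y \<in> ?S" if "i < n" "y \<in> ?S" for i y
    using that(2)
  proof (induction rule: span_induct_alt)
    case base then show ?case by (simp add: span_zero)
  next
    case (step c x y)
    then show ?case using basic[OF that(1)]
      by (auto simp: distrib_left scal_right intro!: span_add span_scale)
  qed
  have "v \<in> span (e ` {..<n})" using Cons gens_eq_span by auto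
  then show ?case
  proof (induction rule: span_induct_alt)
    case base then show ?case by (simp add: span_zero)
  next
    case (step c x y)
    then show ?case using Cons gen by (auto simp: distrib_right scal_left intro!: span_add span_scale)
  qed
qed

end

lemma exterior_monomialsI:
  assumes "exterior_algebra E" "V_basis E n e"
  shows "exterior_monomials E n e"
proof -
  interpret vector_space "scal E" using assms by (simp add: exterior_algebra_def)
  show ?thesis using assms by unfold_locales (auto simp: exterior_algebra_def)
qed

locale exterior_basis = exterior_monomials E n e
  for E :: "('k::field, 'e::ring_1) gen_algebra" and n e +
  assumes inj_mon: "inj_on mon (Pow {..<n})"
    and independent_mon: "independent (mon ` Pow {..<n})"
    and span_mon: "span (mon ` Pow {..<n}) = UNIV"

text \<open>The definition of an exterior algebra provides one basis of \<open>V\<close> whose monomials form a basis.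
  Any other basis of \<open>V\<close> has the same number \<open>n\<close> of elements, its \<open>2\<^sup>n\<close> monomials span, and a
  spanning family of \<open>2\<^sup>n\<close> vectors in a space of dimension \<open>2\<^sup>n\<close> is a basis.\<close>

lemma exterior_basisI:
  assumes "exterior_algebra E" "V_basis E n e"
  shows "exterior_basis E n e"
proof -
  interpret exterior_monomials E n e using assms by (rule exterior_monomialsI)
  obtain m f where f: "V_basis E m f" "inj_on (ordered_monomial f) (Pow {..<m})"
      "independent (ordered_monomial f ` Pow {..<m})"
      "span (ordered_monomial f ` Pow {..<m}) = UNIV"
    using assms unfolding exterior_algebra_def by blast
  have "card (f ` {..<m}) = card (e ` {..<n})"
    using f(1) V_basis unfolding V_basis_def
    by (metis dim_eq_card_independent dim_span)
  then have mn: "m = n"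
    using f(1) V_basis unfolding V_basis_def by (simp add: card_image)
  have "ordered_monomial f ` Pow {..<m} \<subseteq> span (mon ` Pow {..<n})"
  proof clarify
    fix A assume "A \<subseteq> {..<m}"
    then have fin: "finite A" using finite_subset by blast
    have "f i \<in> gens E" if "i < m" for i
      using f(1) that unfolding V_basis_def by (metis imageI lessThan_iff span_base)
    with \<open>A \<subseteq> {..<m}\<close> fin show "ordered_monomial f A \<in> span (mon ` Pow {..<n})"
      unfolding ordered_monomial_def[of f] by (intro prod_gens_in_span_mon) auto
  qed
  then have sp: "span (mon ` Pow {..<n}) = UNIV"
    using f(4) by (metis span_mono span_span top.extremum_uniqueI)
  have card: "card (ordered_monomial f ` Pow {..<m}) = 2 ^ n"
    using f(2) by (simp add: card_image card_Pow mn)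
  have fin: "finite (mon ` Pow {..<n})" by simp
  have ge: "2 ^ n \<le> card (mon ` Pow {..<n})"
    using independent_span_bound[OF fin f(3)] sp card by simp
  moreover have "card (mon ` Pow {..<n}) \<le> 2 ^ n"
    using card_image_le[of "Pow {..<n}" mon] by (simp add: card_Pow)
  ultimately have eq: "card (mon ` Pow {..<n}) = 2 ^ n" by simp
  then have "inj_on mon (Pow {..<n})"
    by (intro eq_card_imp_inj_on) (auto simp: card_Pow)
  moreover have "independent (mon ` Pow {..<n})"
  proof -
    obtain B where B: "B \<subseteq> mon ` Pow {..<n}" "independent B" "mon ` Pow {..<n} \<subseteq> span B"
      using maximal_independent_subset by blast
    have "span B = UNIV" using B(3) sp by (metis span_mono span_span top.extremum_uniqueI)
    then have "card B = 2 ^ n" using B(2) f(3,4) card by (metis dim_eq_card_independent dim_span)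
    then show ?thesis using B(1,2) eq fin card_subset_eq by metis
  qed
  ultimately show ?thesis using sp by unfold_locales
qed

section \<open>Coefficients with respect to the monomial basis\<close>

context exterior_basis
begin

definition coef :: "nat set \<Rightarrow> 'e \<Rightarrow> 'k" where
  "coef A y = representation (mon ` Pow {..<n}) y (mon A)"

lemma in_span_mon: "y \<in> span (mon ` Pow {..<n})"
  by (simp add: span_mon)

lemma coef_add [simp]: "coef A (y + z) = coef A y + coef A z"
  by (simp add: coef_def representation_add independent_mon in_span_mon)

lemma coef_scale [simp]: "coef A (scal E a y) = a * coef A y"
  by (simp add: coef_def representation_scale independent_mon in_span_mon)

lemma coef_0 [simp]: "coef A 0 = 0"
  by (simp add: coef_def representation_zero)

lemma coef_minus [simp]: "coef A (- y) = - coef A y"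
  using coef_scale[of A "-1" y] by simp

lemma coef_diff [simp]: "coef A (y - z) = coef A y - coef A z"
  using coef_add[of A y "- z"] by simp

lemma coef_sum [simp]: "coef A (sum f I) = (\<Sum>i\<in>I. coef A (f i))"
  by (induction I rule: infinite_finite_induct) auto

lemma coef_mon: "A \<subseteq> {..<n} \<Longrightarrow> B \<subseteq> {..<n} \<Longrightarrow> coef A (mon B) = (if A = B then 1 else 0)"
  using inj_mon
  by (auto simp: coef_def representation_basis independent_mon inj_on_def)

lemma expand: "y = (\<Sum>A\<in>Pow {..<n}. scal E (coef A y) (mon A))"
proof -
  have "(\<Sum>b\<in>mon ` Pow {..<n}. scal E (representation (mon ` Pow {..<n}) y b) b) = y"
    by (rule sum_representation_eq) (auto simp: independent_mon in_span_mon)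
  then show ?thesis
    by (simp add: sum.reindex[OF inj_mon] coef_def)
qed

lemma coef_eqI:
  assumes "\<And>A. A \<subseteq> {..<n} \<Longrightarrow> coef A y = coef A z" shows "y = z"
proof -
  have "(\<Sum>A\<in>Pow {..<n}. scal E (coef A y) (mon A)) = (\<Sum>A\<in>Pow {..<n}. scal E (coef A z) (mon A))"
    using assms by (intro sum.cong) auto
  then show ?thesis using expand[of y] expand[of z] by simp
qed

lemma coef_expansion:
  assumes "B \<subseteq> {..<n}"
  shows "coef B (\<Sum>A\<in>Pow {..<n}. scal E (c A) (mon A)) = c B"
proof -
  have "coef B (\<Sum>A\<in>Pow {..<n}. scal E (c A) (mon A)) = (\<Sum>A\<in>Pow {..<n}. if B = A then c A else 0)"
    unfolding coef_sum using assms by (intro sum.cong) (auto simp: coef_mon)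
  also have "\<dots> = c B" using assms by (simp add: sum.delta')
  finally show ?thesis .
qed

lemma coef_mult:
  "coef C (y * z) = (\<Sum>A\<in>Pow {..<n}. \<Sum>B\<in>Pow {..<n}. coef A y * coef B z * coef C (mon A * mon B))"
proof -
  have "y * z = (\<Sum>A\<in>Pow {..<n}. \<Sum>B\<in>Pow {..<n}. scal E (coef A y) (mon A) * scal E (coef B z) (mon B))"
    by (subst expand[of y], subst expand[of z]) (rule sum_product)
  then show ?thesis by (simp add: scal_left scal_right mult_ac)
qed

lemma coef_mon_mult_zero:
  assumes "A \<subseteq> {..<n}" "B \<subseteq> {..<n}" "C \<subseteq> {..<n}" "A \<inter> B \<noteq> {} \<or> A \<union> B \<noteq> C"
  shows "coef C (mon A * mon B) = 0"
  using mon_times_mon[OF assms(1,2)] assms coef_mon[OF assms(3), of "A \<union> B"] by (auto split: if_splits)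

lemma coef_mon_mult_nonzero:
  assumes "A \<subseteq> {..<n}" "B \<subseteq> {..<n}" "A \<inter> B = {}"
  shows "coef (A \<union> B) (mon A * mon B) \<noteq> 0"
  using mon_times_mon[OF assms(1,2)] assms coef_mon[of "A \<union> B" "A \<union> B"] by auto

text \<open>The product of \<open>e\<^sub>A\<close> and \<open>e\<^sub>B\<close> is a multiple of \<open>e\<^sub>A\<^sub>\<union>\<^sub>B\<close>, and zero if \<open>A\<close> and \<open>B\<close> meet, so only the disjoint
  decompositions of \<open>C\<close> contribute to the coefficient of \<open>e\<^sub>C\<close>.\<close>

lemma coef_mult_zeroI:
  assumes "C \<subseteq> {..<n}" "\<And>A B. A \<inter> B = {} \<Longrightarrow> A \<union> B = C \<Longrightarrow> coef A y = 0 \<or> coef B z = 0"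
  shows "coef C (y * z) = 0"
  apply (subst coef_mult)
proof (intro sum.neutral ballI)
  fix A B assume "A \<in> Pow {..<n}" "B \<in> Pow {..<n}"
  then show "coef A y * coef B z * coef C (mon A * mon B) = 0"
    using assms coef_mon_mult_zero[of A B C] by (cases "A \<inter> B = {} \<and> A \<union> B = C") auto
qed

lemma coef_empty_1 [simp]: "coef {} 1 = 1"
  using coef_mon[of "{}" "{}"] by simp

lemma coef_empty_mult [simp]: "coef {} (y * z) = coef {} y * coef {} z"
proof -
  have "coef {} (y * z) = coef {} (scal E (coef {} y) 1 * z) + coef {} ((y - scal E (coef {} y) 1) * z)"
    by (simp add: algebra_simps flip: coef_add)
  also have "coef {} ((y - scal E (coef {} y) 1) * z) = 0"
    by (rule coef_mult_zeroI) auto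
  finally show ?thesis by (simp add: scal_left)
qed

lemma e_eq_mon: "e i = mon {i}"
  using mon_insert_min[of "{}" i] by simp

lemma coef_e: "i < n \<Longrightarrow> A \<subseteq> {..<n} \<Longrightarrow> coef A (e i) = (if A = {i} then 1 else 0)"
  by (simp add: e_eq_mon coef_mon)

text \<open>The powers of \<open>(V)\<close>, the \<open>\<And>\<^sup>jV\<close> and the complement of \<open>V\<close> are defined as spans.  Each of them turns out to
  be the span of the monomials that it contains, which makes membership a condition on coefficients.\<close>

lemma span_eq_coef_zero:
  assumes "S \<subseteq> {y. \<forall>A\<subseteq>{..<n}. A \<notin> \<A> \<longrightarrow> coef A y = 0}" "\<And>A. A \<subseteq> {..<n} \<Longrightarrow> A \<in> \<A> \<Longrightarrow> mon A \<in> span S"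
  shows "span S = {y. \<forall>A\<subseteq>{..<n}. A \<notin> \<A> \<longrightarrow> coef A y = 0}"
proof
  have "subspace {y. \<forall>A\<subseteq>{..<n}. A \<notin> \<A> \<longrightarrow> coef A y = 0}"
    by (auto simp: subspace_def)
  then show "span S \<subseteq> {y. \<forall>A\<subseteq>{..<n}. A \<notin> \<A> \<longrightarrow> coef A y = 0}"
    by (rule span_minimal[OF assms(1)])
next
  show "{y. \<forall>A\<subseteq>{..<n}. A \<notin> \<A> \<longrightarrow> coef A y = 0} \<subseteq> span S"
  proof clarify
    fix y assume y: "\<forall>A\<subseteq>{..<n}. A \<notin> \<A> \<longrightarrow> coef A y = 0"
    have "(\<Sum>A\<in>Pow {..<n}. scal E (coef A y) (mon A)) \<in> span S"
      using y assms(2) by (intro span_sum) (metis PowD scale_zero_left span_scale span_zero)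
    then show "y \<in> span S" using expand[of y] by simp
  qed
qed

text \<open>In coordinates, \<open>filt k\<close> is the ideal \<open>(V)\<^sup>k\<close> and \<open>homog j\<close> is \<open>\<And>\<^sup>jV\<close>; see \<open>V_ideal_power_eq\<close> and
  \<open>ext_power_eq\<close>.\<close>

definition filt :: "nat \<Rightarrow> 'e set" where
  "filt k = {y. \<forall>A\<subseteq>{..<n}. card A < k \<longrightarrow> coef A y = 0}"

definition homog :: "nat \<Rightarrow> 'e set" where
  "homog j = {y. \<forall>A\<subseteq>{..<n}. card A \<noteq> j \<longrightarrow> coef A y = 0}"

lemma filt_mult:
  assumes "y \<in> filt j" "z \<in> filt k" shows "y * z \<in> filt (j + k)"
  unfolding filt_def
proof (clarify, rule coef_mult_zeroI)
  fix C A B assume C: "C \<subseteq> {..<n}" "card C < j + k" "A \<inter> B = {}" "A \<union> B = C"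
  then have "finite A" "finite B" using finite_subset by auto
  then have "card A < j \<or> card B < k" using C by (auto simp: card_Un_disjoint)
  then show "coef A y = 0 \<or> coef B z = 0" using C assms unfolding filt_def by auto
qed

lemma homog_mult:
  assumes "y \<in> homog j" "z \<in> homog k" shows "y * z \<in> homog (j + k)"
  unfolding homog_def
proof (clarify, rule coef_mult_zeroI)
  fix C A B assume C: "C \<subseteq> {..<n}" "card C \<noteq> j + k" "A \<inter> B = {}" "A \<union> B = C"
  then have "finite A" "finite B" using finite_subset by auto
  then have "card A \<noteq> j \<or> card B \<noteq> k" using C by (auto simp: card_Un_disjoint)
  then show "coef A y = 0 \<or> coef B z = 0" using C assms unfolding homog_def by auto
qed

lemma filt_0 [simp]: "filt 0 = UNIV"
  by (simp add: filt_def)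

lemma homog_subset_filt: "homog k \<subseteq> filt k"
  by (auto simp: homog_def filt_def)

lemma gens_subset_homog: "gens E \<subseteq> homog 1"
proof -
  have "subspace (homog 1)" by (auto simp: subspace_def homog_def)
  moreover have "e ` {..<n} \<subseteq> homog 1" by (auto simp: homog_def coef_e)
  ultimately show ?thesis by (simp add: gens_eq_span span_minimal)
qed

lemma prod_gens_homog: "set vs \<subseteq> gens E \<Longrightarrow> prod_list vs \<in> homog (length vs)"
proof (induction vs)
  case Nil
  then show ?case using coef_mon[of _ "{}"] by (auto simp: homog_def)
next
  case (Cons v vs)
  then show ?case using homog_mult[of v 1 "prod_list vs" "length vs"] gens_subset_homog by (auto simp: One_nat_def)
qed

lemma mon_split:
  assumes "A \<subseteq> {..<n}" "k \<le> card A"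
  shows "\<exists>vs b. mon A = prod_list vs * b \<and> length vs = k \<and> set vs \<subseteq> gens E \<and> (k = card A \<longrightarrow> b = 1)"
proof (intro exI conjI impI)
  let ?L = "sorted_list_of_set A"
  show "mon A = prod_list (map e (take k ?L)) * prod_list (map e (drop k ?L))"
    by (metis append_take_drop_id map_append ordered_monomial_def prod_list.append)
  show "length (map e (take k ?L)) = k" using assms by simp
  have "finite A" using assms finite_subset by blast
  then have "set (take k ?L) \<subseteq> {..<n}" using assms set_take_subset[of k ?L] by auto
  then show "set (map e (take k ?L)) \<subseteq> gens E" using basis_gens by auto
  show "prod_list (map e (drop k ?L)) = 1" if "k = card A" using that by simp
qed

lemma V_ideal_power_eq: "V_ideal_power E k = filt k"
proof -
  let ?S = "{a * prod_list vs * b | a b vs. length vs = k \<and> set vs \<subseteq> gens E}"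
  have "span ?S = {y. \<forall>A\<subseteq>{..<n}. A \<notin> {A. k \<le> card A} \<longrightarrow> coef A y = 0}"
  proof (rule span_eq_coef_zero)
    have "a * prod_list vs * b \<in> filt k" if "length vs = k" "set vs \<subseteq> gens E" for a b vs
    proof -
      have "prod_list vs \<in> filt k" using prod_gens_homog[OF that(2)] homog_subset_filt that by auto
      then have "a * prod_list vs \<in> filt (0 + k)" by (intro filt_mult) auto
      then have "a * prod_list vs * b \<in> filt (0 + k + 0)" by (rule filt_mult) auto
      then show ?thesis by simp
    qed
    then show "?S \<subseteq> {y. \<forall>A\<subseteq>{..<n}. A \<notin> {A. k \<le> card A} \<longrightarrow> coef A y = 0}"
      unfolding filt_def by (auto simp: not_le)
    show "mon A \<in> span ?S" if A: "A \<subseteq> {..<n}" "A \<in> {A. k \<le> card A}" for A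
    proof (rule span_base)
      obtain vs b where vs: "mon A = prod_list vs * b" "length vs = k" "set vs \<subseteq> gens E"
        using mon_split[OF A(1), of k] A(2) by auto
      have "mon A = 1 * prod_list vs * b" by (simp only: vs(1) mult_1)
      then show "mon A \<in> ?S" using vs(2,3) by blast
    qed
  qed
  then show ?thesis by (auto simp: V_ideal_power_def filt_def not_le)
qed

lemma ext_power_eq: "ext_power E j = homog j"
proof -
  let ?S = "{prod_list vs | vs. length vs = j \<and> set vs \<subseteq> gens E}"
  have "span ?S = {y. \<forall>A\<subseteq>{..<n}. A \<notin> {A. card A = j} \<longrightarrow> coef A y = 0}"
  proof (rule span_eq_coef_zero)
    show "?S \<subseteq> {y. \<forall>A\<subseteq>{..<n}. A \<notin> {A. card A = j} \<longrightarrow> coef A y = 0}"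
      using prod_gens_homog unfolding homog_def by auto
    show "mon A \<in> span ?S" if A: "A \<subseteq> {..<n}" "A \<in> {A. card A = j}" for A
    proof (rule span_base)
      obtain vs where "mon A = prod_list vs" "length vs = j" "set vs \<subseteq> gens E"
        using mon_split[OF A(1), of j] A(2) by auto
      then show "mon A \<in> ?S" by blast
    qed
  qed
  then show ?thesis by (simp add: ext_power_def homog_def)
qed

lemma gens_eq_homog: "gens E = homog 1"
proof
  show "homog 1 \<subseteq> gens E"
  proof
    fix y assume y: "y \<in> homog 1"
    have "scal E (coef A y) (mon A) \<in> gens E" if "A \<subseteq> {..<n}" for A
    proof (cases "card A = 1")
      case True
      then obtain i where "A = {i}" by (auto simp: card_1_singleton_iff One_nat_def)
      then show ?thesis
        using that unfolding gens_eq_span by (simp flip: e_eq_mon) (intro span_scale span_base, blast)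
    next
      case False
      then show ?thesis using y that by (simp add: homog_def gens_eq_span span_zero)
    qed
    then have "(\<Sum>A\<in>Pow {..<n}. scal E (coef A y) (mon A)) \<in> gens E"
      unfolding gens_eq_span by (intro span_sum) auto
    then show "y \<in> gens E" using expand[of y] by simp
  qed
qed (rule gens_subset_homog)

lemma gens_expand: "v \<in> gens E \<Longrightarrow> v = (\<Sum>i<n. scal E (coef {i} v) (e i))"
proof (rule coef_eqI)
  fix A assume v: "v \<in> gens E" and A: "A \<subseteq> {..<n}"
  show "coef A v = coef A (\<Sum>i<n. scal E (coef {i} v) (e i))"
  proof (cases "card A = 1")
    case True
    then obtain j where "A = {j}" by (auto simp: card_1_singleton_iff One_nat_def)
    moreover have "(\<Sum>i<n. coef {i} v * (if {j} = {i} then 1 else 0)) = (\<Sum>i<n. if j = i then coef {i} v else 0)"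
      by (intro sum.cong) auto
    ultimately show ?thesis using A by (simp add: coef_e)
  next
    case False
    then have "coef A v = 0" using v A by (simp add: gens_eq_homog homog_def)
    moreover have "coef A (\<Sum>i<n. scal E (coef {i} v) (e i)) = 0"
      unfolding coef_sum using False A by (intro sum.neutral) (auto simp: coef_e)
    ultimately show ?thesis by simp
  qed
qed

lemma V_component_eq: "V_component E a = (\<Sum>i<n. scal E (coef {i} a) (e i))"
proof -
  let ?u = "\<Sum>i<n. scal E (coef {i} a) (e i)"
  let ?N = "{y. \<forall>A\<subseteq>{..<n}. A \<notin> {A. card A \<noteq> 1} \<longrightarrow> coef A y = 0}"
  have sp: "span (\<Union>j\<in>-{1}. ext_power E j) = ?N"
  proof (rule span_eq_coef_zero)
    show "(\<Union>j\<in>-{1}. ext_power E j) \<subseteq> ?N" by (auto simp: ext_power_eq homog_def)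
    show "mon A \<in> span (\<Union>j\<in>-{1}. ext_power E j)" if "A \<subseteq> {..<n}" "A \<in> {A. card A \<noteq> 1}" for A
      using that by (intro span_base UN_I[of "card A"]) (auto simp: ext_power_eq homog_def coef_mon)
  qed
  have u: "?u \<in> gens E" unfolding gens_eq_span by (intro span_sum span_scale span_base) auto
  have cu: "coef {i} ?u = coef {i} a" if "i < n" for i
  proof -
    have "coef {i} ?u = (\<Sum>j<n. if i = j then coef {j} a else 0)"
      unfolding coef_sum using that by (intro sum.cong) (auto simp: coef_e)
    then show ?thesis using that by simp
  qed
  show ?thesis unfolding V_component_def sp
  proof (rule the_equality)
    show "?u \<in> gens E \<and> a - ?u \<in> ?N"
      using u cu by (auto simp: card_1_singleton_iff One_nat_def)
    fix w assume w: "w \<in> gens E \<and> a - w \<in> ?N"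
    have "coef {i} w = coef {i} a" if "i < n" for i
      using w that by (auto dest!: spec[of _ "{i}"])
    then show "w = ?u" using gens_expand[of w] w by simp
  qed
qed

lemma E_deg_eq: "E_deg E d = {y. \<forall>A\<subseteq>{..<n}. coef A y \<noteq> 0 \<longrightarrow> d = - int (card A)}"
proof (cases "d \<le> 0")
  case True
  then have "(d = - int k) = (k = nat (- d))" for k by auto
  then show ?thesis using True by (auto simp: E_deg_def ext_power_eq homog_def)
next
  case False
  then have "{y. \<forall>A\<subseteq>{..<n}. coef A y \<noteq> 0 \<longrightarrow> d = - int (card A)} = {0}"
    by (auto intro!: coef_eqI)
  then show ?thesis using False by (simp add: E_deg_def)
qed

text \<open>The pairing \<open>E \<times> E \<rightarrow> \<And>\<^sup>nV \<cong> K\<close> is perfect: up to scalars, complementary monomials are dual to each other.\<close>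

lemma top_pairing:
  assumes "A \<subseteq> {..<n}" "B \<subseteq> {..<n}"
  shows "coef {..<n} (mon A * mon B) \<noteq> 0 \<longleftrightarrow> B = {..<n} - A"
proof
  assume "coef {..<n} (mon A * mon B) \<noteq> 0"
  then show "B = {..<n} - A" using coef_mon_mult_zero[OF assms, of "{..<n}"] by blast
next
  assume "B = {..<n} - A"
  then show "coef {..<n} (mon A * mon B) \<noteq> 0"
    using coef_mon_mult_nonzero[of A B] assms by (simp add: Un_absorb1)
qed

text \<open>Only the monomial complementary to \<open>e\<^sub>i\<close> contributes to either side, and \<open>e\<^sub>i\<close> passes its
  \<open>n - 1\<close> factors.\<close>

lemma top_commute:
  assumes "i < n"
  shows "coef {..<n} (e i * y) = (-1) ^ (n - 1) * coef {..<n} (y * e i)"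
proof -
  have m: "coef {..<n} (e i * mon A) = (-1) ^ (n - 1) * coef {..<n} (mon A * e i)" if "A \<subseteq> {..<n}" for A
  proof (cases "A = {..<n} - {i}")
    case True
    then have "card A = n - 1" using assms by simp
    then show ?thesis using gen_mon_commute[OF that assms] by simp
  next
    case False
    then have "coef {..<n} (mon A * e i) = 0"
      using top_pairing[of A "{i}"] that assms by (auto simp: e_eq_mon)
    then show ?thesis using gen_mon_commute[OF that assms] by simp
  qed
  have "coef {..<n} (e i * y) = (\<Sum>A\<in>Pow {..<n}. coef A y * coef {..<n} (e i * mon A))"
    by (subst expand[of y], subst sum_distrib_left) (simp only: coef_sum coef_scale scal_right)
  also have "\<dots> = (\<Sum>A\<in>Pow {..<n}. coef A y * ((-1) ^ (n - 1) * coef {..<n} (mon A * e i)))"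
    using m by (intro sum.cong) auto
  also have "\<dots> = (-1) ^ (n - 1) * (\<Sum>A\<in>Pow {..<n}. coef A y * coef {..<n} (mon A * e i))"
    by (simp add: sum_distrib_left mult.left_commute)
  also have "(\<Sum>A\<in>Pow {..<n}. coef A y * coef {..<n} (mon A * e i)) = coef {..<n} (y * e i)"
    by (subst (2) expand[of y], subst sum_distrib_right) (simp only: coef_sum coef_scale scal_left)
  finally show ?thesis .
qed

end

section \<open>Left modules and free bases\<close>

context left_module
begin

lemma smult_zero_right [simp]: "r \<odot> \<zero> = \<zero>"
proof -
  have "r \<odot> \<zero> \<oplus> r \<odot> \<zero> = r \<odot> \<zero> \<oplus> \<zero>"
    using smult_r_distr[of \<zero> \<zero> r] by (simp add: smult_closed)
  then show ?thesis by (simp add: smult_closed)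
qed

lemma smult_zero_left [simp]: "x \<in> carrier M \<Longrightarrow> 0 \<odot> x = \<zero>"
proof -
  assume x: "x \<in> carrier M"
  then have "0 \<odot> x \<oplus> 0 \<odot> x = 0 \<odot> x \<oplus> \<zero>"
    using smult_l_distr[of x 0 0] by (simp add: smult_closed)
  then show ?thesis using x by (simp add: smult_closed)
qed

lemma smult_minus_one: "x \<in> carrier M \<Longrightarrow> \<ominus> x = (- 1) \<odot> x"
proof -
  assume x: "x \<in> carrier M"
  then have "(- 1) \<odot> x \<oplus> x = \<zero>"
    using smult_l_distr[of x "- 1" 1] by (simp add: smult_one)
  then show ?thesis using x by (simp add: minus_equality smult_closed)
qed

lemma minus_zero [simp]: "\<ominus> \<zero> = \<zero>"
  by (simp add: smult_minus_one)

lemma diff_zero_right [simp]: "x \<in> carrier M \<Longrightarrow> x \<ominus> \<zero> = x"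
  by (simp add: minus_eq)

lemma finsum_smult:
  assumes "f \<in> A \<rightarrow> carrier M"
  shows "r \<odot> (\<Oplus>i\<in>A. f i) = (\<Oplus>i\<in>A. r \<odot> f i)"
  using assms
proof (induction A rule: infinite_finite_induct)
  case (insert a A)
  then have "f a \<in> carrier M" "f \<in> A \<rightarrow> carrier M" by auto
  then show ?case using insert by (simp add: smult_r_distr smult_closed Pi_iff)
qed simp_all

lemma finsum_supset:
  assumes "finite A" "S \<subseteq> A" "f \<in> A \<rightarrow> carrier M" "\<And>i. i \<in> A - S \<Longrightarrow> f i = \<zero>"
  shows "finsum M f S = finsum M f A"
  using assms by (intro add.finprod_mono_neutral_cong_left) auto

lemma finsum_diff:
  assumes "f \<in> A \<rightarrow> carrier M" "g \<in> A \<rightarrow> carrier M"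
  shows "(\<Oplus>i\<in>A. f i \<ominus> g i) = (\<Oplus>i\<in>A. f i) \<ominus> (\<Oplus>i\<in>A. g i)"
proof -
  have "(\<Oplus>i\<in>A. f i \<ominus> g i) = (\<Oplus>i\<in>A. f i \<oplus> (- 1) \<odot> g i)"
    using assms by (intro finsum_cong') (auto simp: smult_minus_one minus_eq smult_closed Pi_iff)
  also have "\<dots> = (\<Oplus>i\<in>A. f i) \<oplus> (\<Oplus>i\<in>A. (- 1) \<odot> g i)"
    using assms by (intro finsum_addf) (auto intro!: smult_closed)
  also have "(\<Oplus>i\<in>A. (- 1) \<odot> g i) = (- 1) \<odot> (\<Oplus>i\<in>A. g i)"
    using assms by (simp add: finsum_smult)
  finally show ?thesis using assms by (simp add: smult_minus_one minus_eq)
qed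

lemma diff_eq_zero_iff: "x \<in> carrier M \<Longrightarrow> y \<in> carrier M \<Longrightarrow> x \<ominus> y = \<zero> \<longleftrightarrow> x = y"
  by (metis a_inv_closed minus_eq minus_equality minus_minus r_neg)

end

context
  fixes M :: "('r::ring_1, 'm) module" and N :: "('r, 'n) module" and f
  assumes M: "left_module M" and N: "left_module N" and f: "left_hom M N f"
begin

interpretation M: left_module M by (rule M)
interpretation N: left_module N by (rule N)

lemma left_hom_closed: "x \<in> carrier M \<Longrightarrow> f x \<in> carrier N"
  using f by (auto simp: left_hom_def)

lemma left_hom_add: "x \<in> carrier M \<Longrightarrow> y \<in> carrier M \<Longrightarrow> f (x \<oplus>\<^bsub>M\<^esub> y) = f x \<oplus>\<^bsub>N\<^esub> f y"
  using f by (simp add: left_hom_def)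

lemma left_hom_smult: "x \<in> carrier M \<Longrightarrow> f (r \<odot>\<^bsub>M\<^esub> x) = r \<odot>\<^bsub>N\<^esub> f x"
  using f by (simp add: left_hom_def)

lemma left_hom_zero: "f \<zero>\<^bsub>M\<^esub> = \<zero>\<^bsub>N\<^esub>"
  using left_hom_smult[of "\<zero>\<^bsub>M\<^esub>" 0] left_hom_closed[of "\<zero>\<^bsub>M\<^esub>"] by simp

lemma left_hom_minus: "x \<in> carrier M \<Longrightarrow> f (\<ominus>\<^bsub>M\<^esub> x) = \<ominus>\<^bsub>N\<^esub> f x"
  by (simp add: M.smult_minus_one N.smult_minus_one left_hom_smult left_hom_closed)

lemma left_hom_diff: "x \<in> carrier M \<Longrightarrow> y \<in> carrier M \<Longrightarrow> f (x \<ominus>\<^bsub>M\<^esub> y) = f x \<ominus>\<^bsub>N\<^esub> f y"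
  by (simp add: M.minus_eq N.minus_eq left_hom_add left_hom_minus)

lemma left_hom_finsum:
  "g \<in> A \<rightarrow> carrier M \<Longrightarrow> f (\<Oplus>\<^bsub>M\<^esub>i\<in>A. g i) = (\<Oplus>\<^bsub>N\<^esub>i\<in>A. f (g i))"
proof (induction A rule: infinite_finite_induct)
  case (insert a A)
  then have "g a \<in> carrier M" "g \<in> A \<rightarrow> carrier M" by auto
  then show ?case using insert by (simp add: left_hom_add left_hom_closed Pi_iff)
qed (simp_all add: left_hom_zero)

end

lemma left_hom_comp:
  assumes "left_hom M N f" "left_hom N P g"
  shows "left_hom M P (\<lambda>x. g (f x))"
  using assms unfolding left_hom_def by (auto simp: Pi_iff)

lemma left_hom_plus:
  assumes "left_module N" "left_hom M N f" "left_hom M N g"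
  shows "left_hom M N (\<lambda>x. f x \<oplus>\<^bsub>N\<^esub> g x)"
proof -
  interpret N: left_module N by fact
  show ?thesis
    using assms(2,3) unfolding left_hom_def
    by (auto simp: Pi_iff N.smult_r_distr N.a_ac N.add.m_assoc N.a_closed)
qed

lemma left_hom_const_zero: "left_module N \<Longrightarrow> left_hom M N (\<lambda>x. \<zero>\<^bsub>N\<^esub>)"
proof -
  assume "left_module N"
  then interpret N: left_module N .
  show ?thesis by (auto simp: left_hom_def)
qed

text \<open>The linear extension of \<open>\<phi>\<close> from the basis \<open>B\<close> to all of \<open>M\<close>.\<close>

definition lext :: "('r::ring_1, 'm) module \<Rightarrow> 'm set \<Rightarrow> ('r, 'n) module \<Rightarrow> ('m \<Rightarrow> 'n) \<Rightarrow> 'm \<Rightarrow> 'n" where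
  "lext M B N \<phi> m = (\<Oplus>\<^bsub>N\<^esub>b\<in>{b. coords M B m b \<noteq> 0}. coords M B m b \<odot>\<^bsub>N\<^esub> \<phi> b)"

locale free_module = left_module M
  for M :: "('r::ring_1, 'm) module" (structure) +
  fixes B :: "'m set"
  assumes free_basis: "free_basis M B"
begin

abbreviation crd :: "'m \<Rightarrow> 'm \<Rightarrow> 'r" where "crd \<equiv> coords M B"

definition lcomb :: "('m \<Rightarrow> 'r) \<Rightarrow> 'm" where
  "lcomb c = (\<Oplus>b\<in>{b. c b \<noteq> 0}. c b \<odot> b)"

lemma basis_closed: "b \<in> B \<Longrightarrow> b \<in> carrier M"
  using free_basis by (auto simp: free_basis_def)

lemma lcomb_eq:
  assumes "finite A" "A \<subseteq> B" "{b. c b \<noteq> 0} \<subseteq> A"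
  shows "lcomb c = (\<Oplus>b\<in>A. c b \<odot> b)"
  unfolding lcomb_def using assms by (intro finsum_supset) (auto simp: basis_closed smult_closed)

lemma lcomb_closed: "{b. c b \<noteq> 0} \<subseteq> B \<Longrightarrow> lcomb c \<in> carrier M"
  unfolding lcomb_def by (intro finsum_closed) (auto simp: basis_closed smult_closed)

lemma represents_unique: "m \<in> carrier M \<Longrightarrow> \<exists>!c. represents M B c m"
  using free_basis unfolding free_basis_def by (elim conjE) (rule bspec)

lemma represents_coords: "m \<in> carrier M \<Longrightarrow> represents M B (crd m) m"
  unfolding coords_def by (rule theI'[OF represents_unique])

lemma coords_unique:
  assumes "represents M B c m" shows "crd m = c"
proof -
  have "m \<in> carrier M"
    using assms lcomb_closed[of c] by (auto simp: represents_def lcomb_def)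
  then show ?thesis using assms represents_coords represents_unique by (metis (full_types))
qed

lemma coords_lcomb: "finite {b. c b \<noteq> 0} \<Longrightarrow> {b. c b \<noteq> 0} \<subseteq> B \<Longrightarrow> crd (lcomb c) = c"
  by (rule coords_unique) (auto simp: represents_def lcomb_def)

lemma lcomb_coords: "m \<in> carrier M \<Longrightarrow> lcomb (crd m) = m"
  using represents_coords by (simp add: represents_def lcomb_def)

lemma finite_coords: "m \<in> carrier M \<Longrightarrow> finite {b. crd m b \<noteq> 0}"
  using represents_coords by (simp add: represents_def)

lemma coords_subset: "m \<in> carrier M \<Longrightarrow> {b. crd m b \<noteq> 0} \<subseteq> B"
  using represents_coords by (simp add: represents_def)

lemma coords_outside: "m \<in> carrier M \<Longrightarrow> b \<notin> B \<Longrightarrow> crd m b = 0"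
  using coords_subset by blast

lemma coords_eqI:
  assumes "m \<in> carrier M" "m' \<in> carrier M" "\<And>b. b \<in> B \<Longrightarrow> crd m b = crd m' b" shows "m = m'"
proof -
  have "crd m = crd m'" using assms coords_outside by (metis ext)
  then show ?thesis using assms lcomb_coords by metis
qed

lemma coords_add:
  assumes "m \<in> carrier M" "m' \<in> carrier M"
  shows "crd (m \<oplus> m') b = crd m b + crd m' b"
proof -
  let ?A = "{b. crd m b \<noteq> 0} \<union> {b. crd m' b \<noteq> 0}" and ?c = "\<lambda>b. crd m b + crd m' b"
  have A: "finite ?A" "?A \<subseteq> B" "{b. ?c b \<noteq> 0} \<subseteq> ?A"
    using assms by (auto simp: finite_coords coords_outside intro: ccontr)
  have cl: "r \<odot> b \<in> carrier M" if "b \<in> ?A" for b r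
    using A that basis_closed smult_closed by blast
  have "lcomb ?c = (\<Oplus>b\<in>?A. ?c b \<odot> b)" using A by (rule lcomb_eq)
  also have "\<dots> = (\<Oplus>b\<in>?A. crd m b \<odot> b \<oplus> crd m' b \<odot> b)"
    using A basis_closed cl by (intro finsum_cong') (auto simp: smult_l_distr)
  also have "\<dots> = (\<Oplus>b\<in>?A. crd m b \<odot> b) \<oplus> (\<Oplus>b\<in>?A. crd m' b \<odot> b)"
    using cl by (intro finsum_addf) auto
  also have "(\<Oplus>b\<in>?A. crd m b \<odot> b) = lcomb (crd m)" using A by (intro lcomb_eq[symmetric]) auto
  also have "(\<Oplus>b\<in>?A. crd m' b \<odot> b) = lcomb (crd m')" using A by (intro lcomb_eq[symmetric]) auto
  finally have "lcomb ?c = m \<oplus> m'" using assms by (simp add: lcomb_coords)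
  moreover have "crd (lcomb ?c) = ?c"
    using A finite_subset by (intro coords_lcomb) blast+
  ultimately show ?thesis by metis
qed

lemma coords_smult:
  assumes "m \<in> carrier M" shows "crd (r \<odot> m) b = r * crd m b"
proof -
  let ?A = "{b. crd m b \<noteq> 0}" and ?c = "\<lambda>b. r * crd m b"
  have A: "finite ?A" "?A \<subseteq> B" "{b. ?c b \<noteq> 0} \<subseteq> ?A"
    using assms by (auto simp: finite_coords coords_outside intro: ccontr)
  have cl: "s \<odot> b \<in> carrier M" if "b \<in> ?A" for b s
    using A that basis_closed smult_closed by blast
  have "lcomb ?c = (\<Oplus>b\<in>?A. ?c b \<odot> b)" using A by (rule lcomb_eq)
  also have "\<dots> = (\<Oplus>b\<in>?A. r \<odot> (crd m b \<odot> b))"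
    using A basis_closed cl smult_closed by (intro finsum_cong') (auto simp: smult_assoc)
  also have "\<dots> = r \<odot> lcomb (crd m)"
    unfolding lcomb_def using cl by (intro finsum_smult[symmetric]) auto
  finally have "lcomb ?c = r \<odot> m" using assms by (simp add: lcomb_coords)
  moreover have "crd (lcomb ?c) = ?c"
    using A finite_subset by (intro coords_lcomb) blast+
  ultimately show ?thesis by metis
qed

lemma coords_zero: "crd \<zero> b = 0"
  using coords_smult[of \<zero> 0] by simp

lemma coords_minus: "m \<in> carrier M \<Longrightarrow> crd (\<ominus> m) b = - crd m b"
  by (simp add: smult_minus_one coords_smult)

lemma coords_diff: "m \<in> carrier M \<Longrightarrow> m' \<in> carrier M \<Longrightarrow> crd (m \<ominus> m') b = crd m b - crd m' b"
  by (simp add: minus_eq coords_add coords_minus)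

lemma coords_finsum:
  "f \<in> A \<rightarrow> carrier M \<Longrightarrow> crd (\<Oplus>i\<in>A. f i) b = (\<Sum>i\<in>A. crd (f i) b)"
proof (induction A rule: infinite_finite_induct)
  case (insert a A)
  then have "f a \<in> carrier M" "f \<in> A \<rightarrow> carrier M" by auto
  then show ?case using insert by (simp add: coords_add)
qed (simp_all add: coords_zero)

lemma coords_basis:
  assumes "b \<in> B" shows "crd b = (\<lambda>b'. if b' = b then 1 else 0)"
proof (rule coords_unique)
  have "{b'. (if b' = b then 1 else 0 :: 'r) \<noteq> 0} = {b}" by auto
  then show "represents M B (\<lambda>b'. if b' = b then 1 else 0) b"
    using assms by (simp add: represents_def basis_closed smult_one)
qed

lemmas coords_simps = coords_add coords_smult coords_zero coords_minus coords_diff coords_finsum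

lemma expand_basis:
  assumes "m \<in> carrier M" "finite A" "A \<subseteq> B" "{b. crd m b \<noteq> 0} \<subseteq> A"
  shows "m = (\<Oplus>b\<in>A. crd m b \<odot> b)"
  using lcomb_eq[OF assms(2-4)] lcomb_coords[OF assms(1)] by simp

text \<open>Coordinatewise maps, such as taking the coefficient of a monomial or the component of some degree in every
  coordinate; these are additive but not linear over the ring.\<close>

definition cmap :: "('m \<Rightarrow> 'r \<Rightarrow> 'r) \<Rightarrow> 'm \<Rightarrow> 'm" where
  "cmap h m = lcomb (\<lambda>b. h b (crd m b))"

lemma
  assumes "m \<in> carrier M" "\<And>b. h b 0 = 0"
  shows cmap_closed: "cmap h m \<in> carrier M" and coords_cmap: "crd (cmap h m) b = h b (crd m b)"
proof -
  have sub: "{b. h b (crd m b) \<noteq> 0} \<subseteq> {b. crd m b \<noteq> 0}" using assms(2) by auto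
  then have "finite {b. h b (crd m b) \<noteq> 0}" "{b. h b (crd m b) \<noteq> 0} \<subseteq> B"
    using assms(1) finite_coords coords_subset finite_subset by blast+
  then show "cmap h m \<in> carrier M" "crd (cmap h m) b = h b (crd m b)"
    unfolding cmap_def by (auto simp: lcomb_closed coords_lcomb)
qed

lemma lext_supset:
  assumes "left_module N" "\<phi> \<in> B \<rightarrow> carrier N" "m \<in> carrier M"
    "finite A" "A \<subseteq> B" "{b. crd m b \<noteq> 0} \<subseteq> A"
  shows "lext M B N \<phi> m = (\<Oplus>\<^bsub>N\<^esub>b\<in>A. crd m b \<odot>\<^bsub>N\<^esub> \<phi> b)"
proof -
  interpret N: left_module N by fact
  show ?thesis
    unfolding lext_def using assms
    by (intro N.finsum_supset) (auto intro!: N.smult_closed N.smult_zero_left)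
qed

lemma lext_left_hom:
  assumes "left_module N" "\<phi> \<in> B \<rightarrow> carrier N"
  shows "left_hom M N (lext M B N \<phi>)"
proof -
  interpret N: left_module N by fact
  have cl: "r \<odot>\<^bsub>N\<^esub> \<phi> b \<in> carrier N" if "b \<in> B" for b r
    using that assms by (auto intro: N.smult_closed)
  show ?thesis unfolding left_hom_def
  proof (intro conjI ballI allI)
    show "lext M B N \<phi> \<in> carrier M \<rightarrow> carrier N"
      unfolding lext_def using coords_subset cl by (auto intro!: N.finsum_closed)
  next
    fix x y assume xy: "x \<in> carrier M" "y \<in> carrier M"
    let ?A = "{b. crd x b \<noteq> 0} \<union> {b. crd y b \<noteq> 0}"
    have A: "finite ?A" "?A \<subseteq> B" "{b. crd (x \<oplus> y) b \<noteq> 0} \<subseteq> ?A"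
      using xy coords_subset by (auto simp: finite_coords coords_add)
    have "lext M B N \<phi> (x \<oplus> y) = (\<Oplus>\<^bsub>N\<^esub>b\<in>?A. crd (x \<oplus> y) b \<odot>\<^bsub>N\<^esub> \<phi> b)"
      using assms xy A by (intro lext_supset) auto
    also have "\<dots> = (\<Oplus>\<^bsub>N\<^esub>b\<in>?A. crd x b \<odot>\<^bsub>N\<^esub> \<phi> b \<oplus>\<^bsub>N\<^esub> crd y b \<odot>\<^bsub>N\<^esub> \<phi> b)"
      using assms A xy cl by (intro N.finsum_cong') (auto simp: coords_add N.smult_l_distr Pi_iff subset_iff)
    also have "\<dots> = (\<Oplus>\<^bsub>N\<^esub>b\<in>?A. crd x b \<odot>\<^bsub>N\<^esub> \<phi> b) \<oplus>\<^bsub>N\<^esub> (\<Oplus>\<^bsub>N\<^esub>b\<in>?A. crd y b \<odot>\<^bsub>N\<^esub> \<phi> b)"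
      using A cl by (intro N.finsum_addf) auto
    also have "(\<Oplus>\<^bsub>N\<^esub>b\<in>?A. crd x b \<odot>\<^bsub>N\<^esub> \<phi> b) = lext M B N \<phi> x"
      using assms A xy by (intro lext_supset[symmetric]) auto
    also have "(\<Oplus>\<^bsub>N\<^esub>b\<in>?A. crd y b \<odot>\<^bsub>N\<^esub> \<phi> b) = lext M B N \<phi> y"
      using assms A xy by (intro lext_supset[symmetric]) auto
    finally show "lext M B N \<phi> (x \<oplus> y) = lext M B N \<phi> x \<oplus>\<^bsub>N\<^esub> lext M B N \<phi> y" .
  next
    fix r x assume x: "x \<in> carrier M"
    let ?A = "{b. crd x b \<noteq> 0}"
    have A: "finite ?A" "?A \<subseteq> B" "{b. crd (r \<odot> x) b \<noteq> 0} \<subseteq> ?A"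
      using x coords_subset by (auto simp: finite_coords coords_smult)
    have "lext M B N \<phi> (r \<odot> x) = (\<Oplus>\<^bsub>N\<^esub>b\<in>?A. crd (r \<odot> x) b \<odot>\<^bsub>N\<^esub> \<phi> b)"
      using assms x A by (intro lext_supset smult_closed) auto
    also have "\<dots> = (\<Oplus>\<^bsub>N\<^esub>b\<in>?A. r \<odot>\<^bsub>N\<^esub> (crd x b \<odot>\<^bsub>N\<^esub> \<phi> b))"
      using assms A x cl N.smult_closed
      by (intro N.finsum_cong') (auto simp: coords_smult N.smult_assoc Pi_iff subset_iff)
    also have "\<dots> = r \<odot>\<^bsub>N\<^esub> lext M B N \<phi> x"
      unfolding lext_def using A cl by (intro N.finsum_smult[symmetric]) auto
    finally show "lext M B N \<phi> (r \<odot> x) = r \<odot>\<^bsub>N\<^esub> lext M B N \<phi> x" .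
  qed
qed

lemma lext_basis:
  assumes "left_module N" "\<phi> \<in> B \<rightarrow> carrier N" "b \<in> B"
  shows "lext M B N \<phi> b = \<phi> b"
proof -
  interpret N: left_module N by fact
  have "lext M B N \<phi> b = (\<Oplus>\<^bsub>N\<^esub>b'\<in>{b}. crd b b' \<odot>\<^bsub>N\<^esub> \<phi> b')"
    using assms basis_closed by (intro lext_supset) (auto simp: coords_basis)
  moreover have "\<phi> b \<in> carrier N" using assms by auto
  ultimately show ?thesis using assms by (simp add: coords_basis N.smult_one)
qed

lemma left_hom_expand:
  assumes "left_module N" "left_hom M N f" "m \<in> carrier M"
  shows "f m = lext M B N f m"
proof -
  interpret N: left_module N by fact
  let ?A = "{b. crd m b \<noteq> 0}"
  have A: "finite ?A" "?A \<subseteq> B" using assms coords_subset by (auto simp: finite_coords)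
  note h = left_module_axioms assms(1,2)
  have "f m = f (\<Oplus>b\<in>?A. crd m b \<odot> b)" using expand_basis[OF assms(3) A] by simp
  also have "\<dots> = (\<Oplus>\<^bsub>N\<^esub>b\<in>?A. f (crd m b \<odot> b))"
    using A basis_closed by (intro left_hom_finsum[OF h]) (auto simp: smult_closed)
  also have "\<dots> = (\<Oplus>\<^bsub>N\<^esub>b\<in>?A. crd m b \<odot>\<^bsub>N\<^esub> f b)"
    using A basis_closed left_hom_closed[OF h] N.smult_closed
    by (intro N.finsum_cong') (auto simp: left_hom_smult[OF h] subset_iff)
  finally show ?thesis by (simp add: lext_def)
qed

lemma left_hom_eqI:
  assumes "left_module N" "left_hom M N f" "left_hom M N g" "\<And>b. b \<in> B \<Longrightarrow> f b = g b" "m \<in> carrier M"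
  shows "f m = g m"
proof -
  interpret N: left_module N by fact
  have "lext M B N f m = lext M B N g m"
    unfolding lext_def using coords_subset[OF assms(5)] assms(4) left_hom_closed[OF left_module_axioms assms(1,3)] basis_closed
    by (intro N.finsum_cong') (auto simp: N.smult_closed)
  then show ?thesis using left_hom_expand[OF assms(1)] assms by metis
qed

end

section \<open>Gradings\<close>

text \<open>The homogeneous component of degree \<open>d\<close> of \<open>m\<close> is \<open>gcomp M gr m d\<close>.\<close>

definition gcomp :: "('r, 'm) module \<Rightarrow> (int \<Rightarrow> 'm set) \<Rightarrow> 'm \<Rightarrow> int \<Rightarrow> 'm" where
  "gcomp M gr m = (THE f. (\<forall>d. f d \<in> gr d) \<and> finite {d. f d \<noteq> \<zero>\<^bsub>M\<^esub>} \<and>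
        m = (\<Oplus>\<^bsub>M\<^esub>d\<in>{d. f d \<noteq> \<zero>\<^bsub>M\<^esub>}. f d))"

locale graded_left_module = left_module M
  for M :: "('r::ring_1, 'm) module" (structure) +
  fixes D :: "int \<Rightarrow> 'r set" and gr :: "int \<Rightarrow> 'm set"
  assumes grading: "module_grading D M gr"
begin

lemma gr_subgroup: "subgroup (gr d) (add_monoid M)"
  using grading by (simp add: module_grading_def)

lemma gr_closed: "x \<in> gr d \<Longrightarrow> x \<in> carrier M"
  using subgroup.mem_carrier[OF gr_subgroup] by simp

lemma gr_zero: "\<zero> \<in> gr d"
  using subgroup.one_closed[OF gr_subgroup] by simp

lemma gr_add: "x \<in> gr d \<Longrightarrow> y \<in> gr d \<Longrightarrow> x \<oplus> y \<in> gr d"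
  using subgroup.m_closed[OF gr_subgroup] by simp

lemma gr_finsum: "(\<And>i. i \<in> A \<Longrightarrow> f i \<in> gr d) \<Longrightarrow> (\<Oplus>i\<in>A. f i) \<in> gr d"
proof (induction A rule: infinite_finite_induct)
  case (insert a A)
  then have "f a \<in> carrier M" "f \<in> A \<rightarrow> carrier M" using gr_closed by auto
  then show ?case using insert by (simp add: gr_add)
qed (simp_all add: gr_zero)

lemma gr_smult: "r \<in> D a \<Longrightarrow> m \<in> gr d \<Longrightarrow> r \<odot> m \<in> gr (a + d)"
  using grading by (simp add: module_grading_def)

lemma gcomp_ex1:
  "m \<in> carrier M \<Longrightarrow> \<exists>!f. (\<forall>d. f d \<in> gr d) \<and> finite {d. f d \<noteq> \<zero>} \<and> m = (\<Oplus>d\<in>{d. f d \<noteq> \<zero>}. f d)"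
  using grading unfolding module_grading_def by (elim conjE) (rule bspec)

lemma gcomp_props:
  assumes "m \<in> carrier M"
  shows "(\<forall>d. gcomp M gr m d \<in> gr d) \<and> finite {d. gcomp M gr m d \<noteq> \<zero>} \<and>
        m = (\<Oplus>d\<in>{d. gcomp M gr m d \<noteq> \<zero>}. gcomp M gr m d)"
  unfolding gcomp_def by (rule theI'[OF gcomp_ex1[OF assms]])

lemma gcomp_unique:
  assumes "\<And>d. f d \<in> gr d" "finite A" "{d. f d \<noteq> \<zero>} \<subseteq> A" "m = (\<Oplus>d\<in>A. f d)"
  shows "gcomp M gr m = f"
proof -
  have fc: "f d \<in> carrier M" for d using assms(1) gr_closed by blast
  have "(\<Oplus>d\<in>{d. f d \<noteq> \<zero>}. f d) = (\<Oplus>d\<in>A. f d)"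
    using assms fc by (intro finsum_supset) auto
  then have *: "(\<forall>d. f d \<in> gr d) \<and> finite {d. f d \<noteq> \<zero>} \<and> m = (\<Oplus>d\<in>{d. f d \<noteq> \<zero>}. f d)"
    using assms finite_subset by auto
  have "m \<in> carrier M" using assms(4) fc by simp
  then show ?thesis
    unfolding gcomp_def using * by (intro the1_equality gcomp_ex1 \<open>m \<in> carrier M\<close>)
qed

lemma gcomp_in: "m \<in> carrier M \<Longrightarrow> gcomp M gr m d \<in> gr d"
  using gcomp_props by blast

lemma gcomp_closed: "m \<in> carrier M \<Longrightarrow> gcomp M gr m d \<in> carrier M"
  using gcomp_in gr_closed by blast

lemma gcomp_finite: "m \<in> carrier M \<Longrightarrow> finite {d. gcomp M gr m d \<noteq> \<zero>}"
  using gcomp_props by blast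

lemma gcomp_sum: "m \<in> carrier M \<Longrightarrow> m = (\<Oplus>d\<in>{d. gcomp M gr m d \<noteq> \<zero>}. gcomp M gr m d)"
  using gcomp_props by blast

lemma gcomp_homogeneous:
  assumes "m \<in> gr d" shows "gcomp M gr m = (\<lambda>d'. if d' = d then m else \<zero>)"
  by (rule gcomp_unique[of _ "{d}"]) (use assms gr_zero gr_closed in auto)

text \<open>The images of the components of \<open>m\<close> form a homogeneous decomposition of \<open>f m\<close>, and such decompositions are unique.\<close>

lemma gcomp_additive:
  assumes "graded_left_module N D' gr'"
    and closed: "\<And>x. x \<in> carrier M \<Longrightarrow> f x \<in> carrier N"
    and add: "\<And>x y. x \<in> carrier M \<Longrightarrow> y \<in> carrier M \<Longrightarrow> f (x \<oplus> y) = f x \<oplus>\<^bsub>N\<^esub> f y"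
    and deg: "\<And>d x. x \<in> gr d \<Longrightarrow> f x \<in> gr' (d + a)" and m: "m \<in> carrier M"
  shows "gcomp N gr' (f m) d = f (gcomp M gr m (d - a))"
proof -
  interpret N: graded_left_module N D' gr' by fact
  have "f \<zero> \<oplus>\<^bsub>N\<^esub> f \<zero> = f \<zero> \<oplus>\<^bsub>N\<^esub> \<zero>\<^bsub>N\<^esub>"
    using add[of \<zero> \<zero>] closed[of \<zero>] by simp
  then have f0: "f \<zero> = \<zero>\<^bsub>N\<^esub>" using closed[of \<zero>] by simp
  have fsum: "g \<in> A \<rightarrow> carrier M \<Longrightarrow> f (\<Oplus>i\<in>A. g i) = (\<Oplus>\<^bsub>N\<^esub>i\<in>A. f (g i))" for g :: "int \<Rightarrow> _" and A
  proof (induction A rule: infinite_finite_induct)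
    case (insert a A)
    then have "g a \<in> carrier M" "g \<in> A \<rightarrow> carrier M" by auto
    then show ?case using insert by (simp add: add closed Pi_iff)
  qed (simp_all add: f0)
  let ?S = "{d. gcomp M gr m d \<noteq> \<zero>}" and ?g = "gcomp M gr m"
  have "gcomp N gr' (f m) = (\<lambda>d. f (?g (d - a)))"
  proof (rule N.gcomp_unique)
    show "f (?g (d - a)) \<in> gr' d" for d using deg[of "?g (d - a)" "d - a"] gcomp_in[OF m] by simp
    show "finite ((\<lambda>d. d + a) ` ?S)" using gcomp_finite[OF m] by simp
    have "d \<in> (\<lambda>d. d + a) ` ?S" if "?g (d - a) \<noteq> \<zero>" for d
      using that by (intro image_eqI[of _ _ "d - a"]) auto
    then show "{d. f (?g (d - a)) \<noteq> \<zero>\<^bsub>N\<^esub>} \<subseteq> (\<lambda>d. d + a) ` ?S" using f0 by (metis (mono_tags, lifting) mem_Collect_eq subsetI)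
    have "f m = (\<Oplus>\<^bsub>N\<^esub>d\<in>?S. f (?g d))"
      using fsum[of ?g ?S] gcomp_closed[OF m] gcomp_sum[OF m] by simp
    also have "\<dots> = (\<Oplus>\<^bsub>N\<^esub>d\<in>(\<lambda>d. d + a) ` ?S. f (?g (d - a)))"
      using closed gcomp_closed[OF m] by (subst N.finsum_reindex) (auto simp: inj_on_def)
    finally show "f m = (\<Oplus>\<^bsub>N\<^esub>d\<in>(\<lambda>d. d + a) ` ?S. f (?g (d - a)))" .
  qed
  then show ?thesis by simp
qed

end

section \<open>Submodules and quotients\<close>

definition submodule_of :: "('r::ring_1, 'm) module \<Rightarrow> 'm set \<Rightarrow> bool" where
  "submodule_of M N \<longleftrightarrow> N \<subseteq> carrier M \<and> \<zero>\<^bsub>M\<^esub> \<in> N \<and>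
     (\<forall>x\<in>N. \<forall>y\<in>N. x \<oplus>\<^bsub>M\<^esub> y \<in> N) \<and> (\<forall>r. \<forall>x\<in>N. r \<odot>\<^bsub>M\<^esub> x \<in> N)"

text \<open>Quotients are formed for abelian groups with additive operators: a tensor product is
  the quotient of a free abelian group on which the ring acts by operators that become a module
  structure only modulo the relations.\<close>

locale operator_subgroup = abelian_group M
  for M :: "('r::ring_1, 'm) module" (structure) +
  fixes N :: "'m set"
  assumes op_closed: "x \<in> carrier M \<Longrightarrow> r \<odot> x \<in> carrier M"
    and op_add: "x \<in> carrier M \<Longrightarrow> y \<in> carrier M \<Longrightarrow> r \<odot> (x \<oplus> y) = r \<odot> x \<oplus> r \<odot> y"
    and sub_carrier: "x \<in> N \<Longrightarrow> x \<in> carrier M"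
    and sub_zero: "\<zero> \<in> N"
    and sub_add: "x \<in> N \<Longrightarrow> y \<in> N \<Longrightarrow> x \<oplus> y \<in> N"
    and sub_minus: "x \<in> N \<Longrightarrow> \<ominus> x \<in> N"
    and sub_smult: "x \<in> N \<Longrightarrow> r \<odot> x \<in> N"
begin

lemma sub_diff: "x \<in> N \<Longrightarrow> y \<in> N \<Longrightarrow> x \<ominus> y \<in> N"
  by (simp add: minus_eq sub_add sub_minus)

lemma coset_eq: "N +>\<^bsub>M\<^esub> x = {h \<oplus> x | h. h \<in> N}"
  by (auto simp: a_r_coset_def')

lemma mem_coset_iff:
  assumes "x \<in> carrier M" shows "y \<in> N +> x \<longleftrightarrow> y \<in> carrier M \<and> y \<ominus> x \<in> N"
proof
  assume "y \<in> N +> x"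
  then obtain h where h: "h \<in> N" "y = h \<oplus> x" by (auto simp: coset_eq)
  then have "y \<ominus> x = h" using assms sub_carrier[of h] by (simp add: minus_eq a_assoc r_neg)
  then show "y \<in> carrier M \<and> y \<ominus> x \<in> N" using h assms sub_carrier[of h] by simp
next
  assume y: "y \<in> carrier M \<and> y \<ominus> x \<in> N"
  then have "y = (y \<ominus> x) \<oplus> x" using assms by (simp add: minus_eq a_assoc l_neg)
  then show "y \<in> N +> x" using y by (auto simp: coset_eq)
qed

lemma coset_eq_iff:
  assumes "x \<in> carrier M" "y \<in> carrier M" shows "N +> x = N +> y \<longleftrightarrow> x \<ominus> y \<in> N"
proof
  assume "N +> x = N +> y"
  moreover have "x \<in> N +> x" using assms sub_zero by (simp add: mem_coset_iff minus_eq r_neg)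
  ultimately show "x \<ominus> y \<in> N" using assms by (simp add: mem_coset_iff)
next
  assume xy: "x \<ominus> y \<in> N"
  have 1: "z \<ominus> y = (z \<ominus> x) \<oplus> (x \<ominus> y)" if "z \<in> carrier M" for z
  proof -
    have "(z \<ominus> x) \<oplus> (x \<ominus> y) = z \<oplus> (\<ominus> x \<oplus> (x \<oplus> \<ominus> y))"
      using assms that by (simp add: minus_eq a_assoc)
    also have "\<ominus> x \<oplus> (x \<oplus> \<ominus> y) = \<ominus> y" using assms by (simp add: r_neg1)
    finally show ?thesis using that assms by (simp add: minus_eq)
  qed
  have 2: "z \<ominus> x = (z \<ominus> y) \<ominus> (x \<ominus> y)" if z: "z \<in> carrier M" for z
  proof -
    have "z \<ominus> x \<oplus> (x \<ominus> y) \<ominus> (x \<ominus> y) = z \<ominus> x"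
      using assms z by (simp add: minus_eq a_assoc r_neg)
    then show ?thesis using 1[OF z] by simp
  qed
  have "z \<ominus> x \<in> N \<longleftrightarrow> z \<ominus> y \<in> N" if z: "z \<in> carrier M" for z
    using 1[OF z] 2[OF z] sub_add[OF _ xy] sub_diff[OF _ xy] by metis
  then show "N +> x = N +> y"
    using assms by (intro Set.set_eqI) (simp add: mem_coset_iff cong: conj_cong)
qed

abbreviation Q where "Q \<equiv> quotient_module M N"

lemma coset_closed: "x \<in> carrier M \<Longrightarrow> N +> x \<in> carrier Q"
  by (auto simp: quotient_module_def A_RCOSETS_def')

lemma coset_surj: "X \<in> carrier Q \<Longrightarrow> \<exists>x\<in>carrier M. X = N +> x"
  by (auto simp: quotient_module_def A_RCOSETS_def')

lemma coset_add:
  assumes "x \<in> carrier M" "y \<in> carrier M"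
  shows "(N +> x) \<oplus>\<^bsub>Q\<^esub> (N +> y) = N +> (x \<oplus> y)"
proof -
  have eq: "(h \<oplus> x) \<oplus> (h' \<oplus> y) = (h \<oplus> h') \<oplus> (x \<oplus> y)" if "h \<in> N" "h' \<in> N" for h h'
    using that assms sub_carrier by (simp add: a_ac)
  have "(N +> x) <+> (N +> y) = N +> (x \<oplus> y)"
  proof
    show "(N +> x) <+> (N +> y) \<subseteq> N +> (x \<oplus> y)"
      using eq sub_add by (fastforce simp: coset_eq set_add_def')
    show "N +> (x \<oplus> y) \<subseteq> (N +> x) <+> (N +> y)"
    proof
      fix z assume "z \<in> N +> (x \<oplus> y)"
      then obtain h where h: "h \<in> N" "z = h \<oplus> (x \<oplus> y)" by (auto simp: coset_eq)
      then have "z = (h \<oplus> x) \<oplus> (\<zero> \<oplus> y)" using assms sub_carrier[of h] by (simp add: a_assoc)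
      then show "z \<in> (N +> x) <+> (N +> y)"
        using h sub_zero by (auto simp: coset_eq set_add_def')
    qed
  qed
  then show ?thesis by (simp add: quotient_module_def)
qed

lemma coset_zero: "N +> \<zero> = \<zero>\<^bsub>Q\<^esub>"
  using sub_carrier by (force simp: coset_eq quotient_module_def)

lemma coset_smult:
  assumes "x \<in> carrier M" shows "r \<odot>\<^bsub>Q\<^esub> (N +> x) = N +> (r \<odot> x)"
proof -
  have "N +> (r \<odot> y) = N +> (r \<odot> x)" if "y \<in> N +> x" for y
  proof -
    have y: "y \<in> carrier M" "y \<ominus> x \<in> N" using that assms by (auto simp: mem_coset_iff)
    have "r \<odot> y \<ominus> r \<odot> x = r \<odot> (y \<ominus> x)"
    proof -
      have "r \<odot> (y \<ominus> x) \<oplus> r \<odot> x = r \<odot> (y \<ominus> x \<oplus> x)"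
        using y assms by (simp add: op_add)
      also have "y \<ominus> x \<oplus> x = y" using y assms by (simp add: minus_eq a_assoc l_neg)
      finally have "r \<odot> y = r \<odot> (y \<ominus> x) \<oplus> r \<odot> x" by simp
      then show ?thesis using y assms op_closed by (simp add: minus_eq a_assoc r_neg)
    qed
    then show ?thesis using y assms sub_smult by (subst coset_eq_iff) (auto simp: op_closed)
  qed
  moreover have "N +> x \<noteq> {}" using sub_zero by (auto simp: coset_eq)
  ultimately have "(\<Union>y\<in>N +> x. N +> (r \<odot> y)) = N +> (r \<odot> x)" by (intro SUP_eq_const)
  then show ?thesis by (simp add: quotient_module_def)
qed

lemma abelian_group_quotient: "abelian_group Q"
proof (rule abelian_groupI)
  fix X Y assume "X \<in> carrier Q" "Y \<in> carrier Q"
  then show "X \<oplus>\<^bsub>Q\<^esub> Y \<in> carrier Q" "X \<oplus>\<^bsub>Q\<^esub> Y = Y \<oplus>\<^bsub>Q\<^esub> X"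
    by (auto dest!: coset_surj simp: coset_add coset_closed a_comm)
next
  fix X assume X: "X \<in> carrier Q"
  then show "\<zero>\<^bsub>Q\<^esub> \<oplus>\<^bsub>Q\<^esub> X = X"
    by (auto dest!: coset_surj simp: coset_add coset_zero[symmetric])
  obtain x where "x \<in> carrier M" "X = N +> x" using coset_surj[OF X] by blast
  then show "\<exists>Y\<in>carrier Q. Y \<oplus>\<^bsub>Q\<^esub> X = \<zero>\<^bsub>Q\<^esub>"
    by (intro bexI[of _ "N +> (\<ominus> x)"]) (simp_all add: coset_add coset_closed l_neg coset_zero)
next
  fix X Y Z assume "X \<in> carrier Q" "Y \<in> carrier Q" "Z \<in> carrier Q"
  then show "X \<oplus>\<^bsub>Q\<^esub> Y \<oplus>\<^bsub>Q\<^esub> Z = X \<oplus>\<^bsub>Q\<^esub> (Y \<oplus>\<^bsub>Q\<^esub> Z)"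
    by (auto dest!: coset_surj simp: coset_add a_assoc)
qed (use coset_closed[of \<zero>] in \<open>simp add: coset_zero\<close>)

lemma quotient_map_coset:
  assumes "operator_subgroup M' N'" "x \<in> carrier M"
    and closed: "\<And>x. x \<in> carrier M \<Longrightarrow> f x \<in> carrier M'"
    and add: "\<And>x y. x \<in> carrier M \<Longrightarrow> y \<in> carrier M \<Longrightarrow> f (x \<oplus> y) = f x \<oplus>\<^bsub>M'\<^esub> f y"
    and sub: "\<And>x. x \<in> N \<Longrightarrow> f x \<in> N'"
  shows "quotient_map M' N' f (N +> x) = N' +>\<^bsub>M'\<^esub> f x"
proof -
  interpret M': operator_subgroup M' N' by fact
  have "N' +>\<^bsub>M'\<^esub> f y = N' +>\<^bsub>M'\<^esub> f x" if y: "y \<in> N +> x" for y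
  proof -
    obtain h where h: "h \<in> N" "y = h \<oplus> x" using y by (auto simp: coset_eq)
    then have "f y \<ominus>\<^bsub>M'\<^esub> f x = f h"
      using assms(2) sub_carrier[of h] closed by (simp add: add M'.minus_eq M'.a_assoc M'.r_neg)
    moreover have "y \<in> carrier M" using h assms(2) sub_carrier by simp
    ultimately show ?thesis using h sub closed assms(2) by (subst M'.coset_eq_iff) auto
  qed
  moreover have "N +> x \<noteq> {}" using sub_zero by (auto simp: coset_eq)
  ultimately show ?thesis unfolding quotient_map_def by (intro SUP_eq_const)
qed

end

locale module_with_submodule = left_module M
  for M :: "('r::ring_1, 'm) module" (structure) +
  fixes N :: "'m set"
  assumes submodule: "submodule_of M N"
begin

sublocale operator_subgroup M N
proof unfold_locales
  show "x \<in> N \<Longrightarrow> \<ominus> x \<in> N" for x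
    using submodule smult_minus_one[of x] by (auto simp: submodule_of_def)
qed (use submodule in \<open>auto simp: submodule_of_def smult_closed smult_r_distr\<close>)

lemma left_module_sub: "left_module (M\<lparr>carrier := N\<rparr>)"
proof -
  have "abelian_group (M\<lparr>carrier := N\<rparr>)"
  proof (rule abelian_groupI)
    fix x assume "x \<in> carrier (M\<lparr>carrier := N\<rparr>)"
    then show "\<exists>y\<in>carrier (M\<lparr>carrier := N\<rparr>). y \<oplus>\<^bsub>M\<lparr>carrier := N\<rparr>\<^esub> x = \<zero>\<^bsub>M\<lparr>carrier := N\<rparr>\<^esub>"
      by (intro bexI[of _ "\<ominus> x"]) (auto simp: sub_carrier sub_minus l_neg)
  qed (auto simp: sub_add sub_zero sub_carrier a_ac)
  then show ?thesis
    by (auto simp: left_module_def left_module_axioms_def sub_smult sub_carrier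
        smult_l_distr smult_r_distr smult_assoc smult_one)
qed

lemma finsum_sub:
  assumes "f \<in> A \<rightarrow> N"
  shows "finsum (M\<lparr>carrier := N\<rparr>) f A = finsum M f A"
proof -
  interpret S: left_module "M\<lparr>carrier := N\<rparr>" by (rule left_module_sub)
  show ?thesis using assms
  proof (induction A rule: infinite_finite_induct)
    case (insert a A)
    then have "f a \<in> N" "f \<in> A \<rightarrow> N" "f \<in> A \<rightarrow> carrier M" using sub_carrier by auto
    then show ?case using insert by (simp add: sub_carrier)
  qed simp_all
qed

lemma left_module_quotient: "left_module Q"
  using abelian_group_quotient unfolding left_module_def left_module_axioms_def
  by (auto dest!: coset_surj simp: coset_add coset_smult coset_closed smult_closed
      smult_l_distr smult_r_distr smult_assoc smult_one)

end

section \<open>Free modules over the exterior algebra\<close>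

lemma ideal_smult_hom:
  assumes "left_module M" "left_module N" "left_hom M N f" "m \<in> ideal_smult I M"
  shows "f m \<in> ideal_smult I N"
proof -
  interpret M: left_module M by fact
  interpret N: left_module N by fact
  note h = assms(1-3)
  from assms(4) obtain k :: nat and r x
    where m: "m = (\<Oplus>\<^bsub>M\<^esub>j\<in>{..<k}. r j \<odot>\<^bsub>M\<^esub> x j)" "\<forall>j<k. r j \<in> I \<and> x j \<in> carrier M"
    unfolding ideal_smult_def by (elim CollectE exE conjE)
  have "f m = (\<Oplus>\<^bsub>N\<^esub>j\<in>{..<k}. f (r j \<odot>\<^bsub>M\<^esub> x j))"
    unfolding m(1) using m(2) by (intro left_hom_finsum[OF h]) (auto simp: M.smult_closed)
  also have "\<dots> = (\<Oplus>\<^bsub>N\<^esub>j\<in>{..<k}. r j \<odot>\<^bsub>N\<^esub> f (x j))"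
    using m(2) left_hom_closed[OF h] N.smult_closed
    by (intro N.finsum_cong') (auto simp: left_hom_smult[OF h])
  finally have "f m = (\<Oplus>\<^bsub>N\<^esub>j\<in>{..<k}. r j \<odot>\<^bsub>N\<^esub> f (x j))" .
  then show ?thesis unfolding ideal_smult_def using m(2) left_hom_closed[OF h]
    by (intro CollectI exI[of _ k] exI[of _ r] exI[of _ "\<lambda>j. f (x j)"]) simp
qed

context exterior_basis
begin

abbreviation V_smult :: "nat \<Rightarrow> ('e, 'm) module \<Rightarrow> 'm set" where
  "V_smult k M \<equiv> ideal_smult (V_ideal_power E k) M"

lemma filt_add: "y \<in> filt k \<Longrightarrow> z \<in> filt k \<Longrightarrow> y + z \<in> filt k"
  and filt_minus: "y \<in> filt k \<Longrightarrow> - y \<in> filt k"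
  and filt_diff: "y \<in> filt k \<Longrightarrow> z \<in> filt k \<Longrightarrow> y - z \<in> filt k"
  and filt_zero [simp]: "0 \<in> filt k"
  and filt_scal: "y \<in> filt k \<Longrightarrow> scal E a y \<in> filt k"
  by (auto simp: filt_def)

lemma filt_sum: "(\<And>i. i \<in> I \<Longrightarrow> f i \<in> filt k) \<Longrightarrow> sum f I \<in> filt k"
  by (induction I rule: infinite_finite_induct) (auto intro: filt_add)

lemma filt_mult_left: "y \<in> filt k \<Longrightarrow> z * y \<in> filt k"
  using filt_mult[of z 0 y k] by simp

lemma filt_mult_right: "y \<in> filt k \<Longrightarrow> y * z \<in> filt k"
  using filt_mult[of y k z 0] by simp

lemma filt_1_iff: "y \<in> filt 1 \<longleftrightarrow> coef {} y = 0"
  using finite_subset[OF _ finite_lessThan[of n]] by (auto simp: filt_def)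

lemma filt_2_iff: "y \<in> filt 2 \<longleftrightarrow> coef {} y = 0 \<and> (\<forall>i<n. coef {i} y = 0)"
proof -
  have "A = {} \<or> (\<exists>i<n. A = {i})" if "A \<subseteq> {..<n}" "card A < 2" for A
  proof -
    have "finite A" using that finite_subset by blast
    have "card A = 0 \<or> card A = 1" using that(2) by linarith
    then show ?thesis using \<open>finite A\<close> that(1) by (auto simp: card_1_singleton_iff One_nat_def)
  qed
  then show ?thesis by (auto simp: filt_def)
qed

lemma mon_in_filt: "A \<subseteq> {..<n} \<Longrightarrow> card A = k \<Longrightarrow> mon A \<in> filt k"
  by (auto simp: filt_def coef_mon)

lemma e_in_filt: "i < n \<Longrightarrow> e i \<in> filt 1"
  by (simp add: e_eq_mon mon_in_filt)

text \<open>Multiplying an element of \<open>(V)\<^sup>k\<close> by \<open>c\<close> affects its coefficients of degree \<open>k\<close> only through the constant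
  term of \<open>c\<close>.\<close>

lemma coef_leading_mult:
  assumes "A \<subseteq> {..<n}" "r \<in> filt (card A)"
  shows "coef A (r * c) = coef A r * coef {} c"
proof -
  have "coef A (r * (c - scal E (coef {} c) 1)) = 0"
  proof (rule coef_mult_zeroI[OF assms(1)])
    fix A' B assume AB: "A' \<inter> B = {}" "A' \<union> B = A"
    show "coef A' r = 0 \<or> coef B (c - scal E (coef {} c) 1) = 0"
    proof (cases "B = {}")
      case False
      have "finite A" using assms(1) finite_subset by blast
      then have "card A' < card A" using False AB by (intro psubset_card_mono) auto
      then show ?thesis using assms AB unfolding filt_def by blast
    qed simp
  qed
  then have "coef A (r * c) = coef A (r * scal E (coef {} c) 1)"
    by (simp add: right_diff_distrib)
  then show ?thesis by (simp add: scal_right)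
qed

definition degree_part :: "int \<Rightarrow> 'e \<Rightarrow> 'e" where
  "degree_part a y = (\<Sum>A\<in>Pow {..<n}. scal E (if a = - int (card A) then coef A y else 0) (mon A))"

lemma coef_degree_part:
  "A \<subseteq> {..<n} \<Longrightarrow> coef A (degree_part a y) = (if a = - int (card A) then coef A y else 0)"
  unfolding degree_part_def by (rule coef_expansion)

lemma degree_part_zero [simp]: "degree_part a 0 = 0"
  by (rule coef_eqI) (simp add: coef_degree_part)

lemma degree_part_in: "degree_part a y \<in> E_deg E a"
  by (auto simp: E_deg_eq coef_degree_part split: if_splits)

lemma degree_part_filt: "y \<in> filt k \<Longrightarrow> degree_part a y \<in> filt k"
  by (auto simp: filt_def coef_degree_part)

lemma scal_one_deg: "scal E a 1 \<in> E_deg E 0"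
  using coef_mon[of _ "{}"] by (auto simp: E_deg_eq)

lemma mon_deg: "A \<subseteq> {..<n} \<Longrightarrow> mon A \<in> E_deg E (- int (card A))"
  by (auto simp: E_deg_eq coef_mon)

lemma zero_deg [simp]: "0 \<in> E_deg E a"
  by (simp add: E_deg_eq)

end

locale free_E_module = exterior_basis E n e + free_module M B
  for E :: "('k::field, 'e::ring_1) gen_algebra" and n e
    and M :: "('e, 'm) module" (structure) and B :: "'m set"
begin

text \<open>The ideal \<open>(V)\<^sup>k\<close> is two-sided, so the coordinates of a combination with coefficients in \<open>(V)\<^sup>k\<close> lie in it; conversely,
  the expansion of \<open>m\<close> in the basis is such a combination.\<close>

lemma V_smult_iff: "m \<in> V_smult k M \<longleftrightarrow> m \<in> carrier M \<and> (\<forall>b. crd m b \<in> filt k)"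
proof
  assume "m \<in> V_smult k M"
  then obtain l :: nat and r x where m: "m = (\<Oplus>j\<in>{..<l}. r j \<odot> x j)"
      "\<forall>j<l. r j \<in> filt k \<and> x j \<in> carrier M"
    unfolding ideal_smult_def V_ideal_power_eq by (elim CollectE exE conjE)
  then have mem: "(\<lambda>j. r j \<odot> x j) \<in> {..<l} \<rightarrow> carrier M" by (auto simp: smult_closed)
  have "crd m b \<in> filt k" for b
    unfolding m(1) coords_finsum[OF mem]
    using m(2) by (intro filt_sum) (auto simp: coords_smult intro: filt_mult_right)
  then show "m \<in> carrier M \<and> (\<forall>b. crd m b \<in> filt k)" using mem m(1) by simp
next
  assume m: "m \<in> carrier M \<and> (\<forall>b. crd m b \<in> filt k)"
  let ?A = "{b. crd m b \<noteq> 0}"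
  have A: "finite ?A" "?A \<subseteq> B" using m finite_coords coords_subset by auto
  obtain h where h: "bij_betw h {0..<card ?A} ?A" using ex_bij_betw_nat_finite[OF A(1)] by blast
  have hB: "h j \<in> carrier M" if "j < card ?A" for j
    using bij_betwE[OF h] that A basis_closed by (metis atLeast0LessThan lessThan_iff subsetD)
  have "m = (\<Oplus>b\<in>?A. crd m b \<odot> b)" using m A by (intro expand_basis) auto
  also have "?A = h ` {..<card ?A}" using h by (simp add: bij_betw_def atLeast0LessThan)
  also have "(\<Oplus>b\<in>h ` {..<card ?A}. crd m b \<odot> b) = (\<Oplus>j\<in>{..<card ?A}. crd m (h j) \<odot> h j)"
    using h A basis_closed
    by (intro finsum_reindex) (auto simp: bij_betw_def atLeast0LessThan smult_closed subset_iff)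
  finally show "m \<in> V_smult k M"
    unfolding ideal_smult_def V_ideal_power_eq using m hB
    by (intro CollectI exI[of _ "card ?A"] exI[of _ "\<lambda>j. crd m (h j)"] exI[of _ h]) simp
qed

lemma V_smult_submodule: "submodule_of M (V_smult k M)"
  by (auto simp: submodule_of_def V_smult_iff coords_zero coords_add coords_smult smult_closed
      intro: filt_add filt_mult_left)

sublocale VM: module_with_submodule M "V_smult k M" for k
  by unfold_locales (rule V_smult_submodule)

lemma V_smult_closed: "m \<in> V_smult k M \<Longrightarrow> m \<in> carrier M"
  by (simp add: V_smult_iff)

lemma V_smult_mult:
  assumes "r \<in> filt j" "m \<in> V_smult k M" shows "r \<odot> m \<in> V_smult (j + k) M"
  using assms by (simp add: V_smult_iff coords_smult smult_closed filt_mult)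

text \<open>The coefficient of \<open>e\<^sub>A\<close> in the decomposition of \<open>M\<close> as the direct sum of the \<open>e\<^sub>A M\<^sub>0\<close>, where \<open>M\<^sub>0\<close> is the
  \<open>K\<close>-span of the free basis.\<close>

definition mcoef :: "nat set \<Rightarrow> 'm \<Rightarrow> 'm" where
  "mcoef A = cmap (\<lambda>b y. scal E (coef A y) 1)"

lemma mcoef_closed: "m \<in> carrier M \<Longrightarrow> mcoef A m \<in> carrier M"
  unfolding mcoef_def by (rule cmap_closed) auto

lemma coords_mcoef: "m \<in> carrier M \<Longrightarrow> crd (mcoef A m) b = scal E (coef A (crd m b)) 1"
  unfolding mcoef_def by (rule coords_cmap) auto

lemma mcoef_add: "x \<in> carrier M \<Longrightarrow> y \<in> carrier M \<Longrightarrow> mcoef A (x \<oplus> y) = mcoef A x \<oplus> mcoef A y"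
  by (rule coords_eqI) (simp_all add: mcoef_closed coords_mcoef coords_add scale_left_distrib)

lemma mcoef_scal:
  "x \<in> carrier M \<Longrightarrow> mcoef A (scal E a 1 \<odot> x) = scal E a 1 \<odot> mcoef A x"
  by (rule coords_eqI) (simp_all add: mcoef_closed smult_closed coords_mcoef coords_smult scal_left)

lemma mcoef_expand:
  assumes "m \<in> carrier M" shows "m = (\<Oplus>A\<in>Pow {..<n}. mon A \<odot> mcoef A m)"
proof (rule coords_eqI)
  fix b
  have "crd (\<Oplus>A\<in>Pow {..<n}. mon A \<odot> mcoef A m) b = (\<Sum>A\<in>Pow {..<n}. scal E (coef A (crd m b)) (mon A))"
    using assms by (subst coords_finsum) (auto simp: mcoef_closed smult_closed coords_smult coords_mcoef scal_right)
  then show "crd m b = crd (\<Oplus>A\<in>Pow {..<n}. mon A \<odot> mcoef A m) b"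
    using expand[of "crd m b"] by simp
qed (use assms in \<open>auto simp: mcoef_closed smult_closed\<close>)

text \<open>Removing the linear terms of an element of \<open>(V)M\<close> leaves no term of degree less than \<open>2\<close>.\<close>

lemma linear_expansion:
  assumes "m \<in> V_smult 1 M"
  shows "m \<ominus> (\<Oplus>s\<in>{..<n}. e s \<odot> mcoef {s} m) \<in> V_smult 2 M"
proof -
  have m: "m \<in> carrier M" using assms V_smult_closed by blast
  have cl: "(\<lambda>s. e s \<odot> mcoef {s} m) \<in> {..<n} \<rightarrow> carrier M" using m by (auto simp: mcoef_closed smult_closed)
  have "crd (m \<ominus> (\<Oplus>s\<in>{..<n}. e s \<odot> mcoef {s} m)) b
      = crd m b - (\<Sum>s<n. scal E (coef {s} (crd m b)) (e s))" for b
    using m cl by (simp add: coords_diff coords_finsum coords_smult mcoef_closed coords_mcoef scal_right)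
  moreover have "c - (\<Sum>s<n. scal E (coef {s} c) (e s)) \<in> filt 2" if c: "c \<in> filt 1" for c
  proof -
    have "coef {i} (\<Sum>s<n. scal E (coef {s} c) (e s)) = coef {i} c" if "i < n" for i
    proof -
      have "coef {i} (\<Sum>s<n. scal E (coef {s} c) (e s)) = (\<Sum>s<n. if i = s then coef {s} c else 0)"
        unfolding coef_sum using that by (intro sum.cong) (auto simp: coef_e)
      then show ?thesis using that by simp
    qed
    moreover have "coef {} (\<Sum>s<n. scal E (coef {s} c) (e s)) = 0"
      unfolding coef_sum by (intro sum.neutral) (auto simp: coef_e)
    ultimately show ?thesis using c by (simp add: filt_1_iff filt_2_iff)
  qed
  ultimately show ?thesis using assms m cl by (simp add: V_smult_iff)
qed

text \<open>By freeness, the coefficient of \<open>e\<^sub>s\<close> in \<open>\<Sum>\<^sub>t e\<^sub>t y\<^sub>t\<close> is the constant term of \<open>y\<^sub>s\<close>.\<close>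

lemma linear_coefficients_unique:
  assumes "\<And>s. s < n \<Longrightarrow> y s \<in> carrier M" "(\<Oplus>s\<in>{..<n}. e s \<odot> y s) \<in> V_smult 2 M" "s < n"
  shows "y s \<in> V_smult 1 M"
proof -
  have cl: "(\<lambda>s. e s \<odot> y s) \<in> {..<n} \<rightarrow> carrier M" using assms by (auto simp: smult_closed)
  have lead: "coef {s} (e t * c) = (if s = t then coef {} c else 0)" if "t < n" for t c
    using coef_leading_mult[of "{s}" "e t" c] e_in_filt[OF that] assms(3) that by (simp add: coef_e One_nat_def)
  have "coef {} (crd (y s) b) = 0" for b
  proof -
    have "coef {s} (crd (\<Oplus>t\<in>{..<n}. e t \<odot> y t) b) = (\<Sum>t<n. if s = t then coef {} (crd (y t) b) else 0)"
      unfolding coords_finsum[OF cl] coef_sum using assms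
      by (intro sum.cong) (auto simp: coords_smult lead)
    then show ?thesis using assms by (auto simp: V_smult_iff filt_2_iff)
  qed
  then show ?thesis using assms by (simp add: V_smult_iff filt_1_iff)
qed

end

lemma restrict_scalars_simps [simp]:
  "carrier (restrict_scalars E M) = carrier M" "add (restrict_scalars E M) = add M"
  "ring.zero (restrict_scalars E M) = ring.zero M"
  "smult (restrict_scalars E M) = (\<lambda>a m. scal E a 1 \<odot>\<^bsub>M\<^esub> m)"
  by (simp_all add: restrict_scalars_def)

lemma restrict_scalars_coset [simp]: "N +>\<^bsub>restrict_scalars E M\<^esub> x = N +>\<^bsub>M\<^esub> x"
  by (simp add: a_r_coset_def r_coset_def)

lemma (in exterior_basis) left_module_restrict_scalars:
  assumes "left_module M" shows "left_module (restrict_scalars E M)"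
proof -
  interpret left_module M by fact
  have "abelian_group (restrict_scalars E M)"
  proof (rule abelian_groupI)
    fix x assume "x \<in> carrier (restrict_scalars E M)"
    then show "\<exists>y\<in>carrier (restrict_scalars E M). y \<oplus>\<^bsub>restrict_scalars E M\<^esub> x = \<zero>\<^bsub>restrict_scalars E M\<^esub>"
      by (intro bexI[of _ "\<ominus>\<^bsub>M\<^esub> x"]) (auto simp: l_neg)
  qed (auto simp: a_ac)
  moreover have "scal E (a * b) 1 = scal E a 1 * scal E b 1" for a b
    by (simp add: scal_left)
  ultimately show ?thesis
    by (simp add: left_module_def left_module_axioms_def smult_closed scale_left_distrib
        smult_l_distr smult_r_distr smult_assoc smult_one)
qed

locale graded_free_E_module = free_E_module E n e M B + graded_left_module M "E_deg E" gr
  for E :: "('k::field, 'e::ring_1) gen_algebra" and n e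
    and M :: "('e, 'm) module" (structure) and B :: "'m set" and gr +
  assumes homogeneous_basis: "B \<subseteq> (\<Union>d. gr d)"
begin

definition bdeg :: "'m \<Rightarrow> int" where "bdeg b = (SOME d. b \<in> gr d)"

lemma bdeg: "b \<in> B \<Longrightarrow> b \<in> gr (bdeg b)"
  unfolding bdeg_def by (rule someI_ex) (use homogeneous_basis in auto)

lemma gr_coordsI:
  assumes "m \<in> carrier M" "\<And>b. b \<in> B \<Longrightarrow> crd m b \<in> E_deg E (d - bdeg b)" shows "m \<in> gr d"
proof -
  let ?A = "{b. crd m b \<noteq> 0}"
  have A: "?A \<subseteq> B" "finite ?A" using assms coords_subset finite_coords by auto
  have "(\<Oplus>b\<in>?A. crd m b \<odot> b) \<in> gr d"
  proof (rule gr_finsum)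
    fix b assume "b \<in> ?A"
    then have "crd m b \<odot> b \<in> gr ((d - bdeg b) + bdeg b)" using A assms bdeg by (intro gr_smult) auto
    then show "crd m b \<odot> b \<in> gr d" by simp
  qed
  then show ?thesis using expand_basis[OF assms(1) A(2,1)] by simp
qed

text \<open>The coordinate of a homogeneous element of degree \<open>d\<close> at \<open>b\<close> has degree \<open>d\<close> minus the degree of \<open>b\<close>, so
  homogeneous components can be taken in each coordinate.\<close>

lemma gcomp_eq_cmap:
  assumes m: "m \<in> carrier M"
  shows "gcomp M gr m = (\<lambda>d. cmap (\<lambda>b. degree_part (d - bdeg b)) m)"
proof -
  let ?A = "{b. crd m b \<noteq> 0}" and ?f = "\<lambda>d. cmap (\<lambda>b. degree_part (d - bdeg b)) m"
  \<comment> \<open>\<open>E\<close> lives in the degrees from \<open>-n\<close> to \<open>0\<close>, which bounds the degrees that can occur.\<close>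
  let ?S = "\<Union>b\<in>?A. {bdeg b - int n..bdeg b}"
  have cl: "?f d \<in> carrier M" for d using m by (intro cmap_closed) auto
  have cr: "crd (?f d) b = degree_part (d - bdeg b) (crd m b)" for d b using m by (intro coords_cmap) auto
  have bound: "card A \<le> n" if "A \<subseteq> {..<n}" for A using card_mono[OF finite_lessThan that] by simp
  have zero: "degree_part (d - bdeg b) (crd m b) = 0" if "d \<notin> ?S" for d b
  proof (rule coef_eqI)
    fix A assume A: "A \<subseteq> {..<n}"
    show "coef A (degree_part (d - bdeg b) (crd m b)) = coef A 0"
    proof (cases "crd m b = 0")
      case False
      have "d \<notin> {bdeg b - int n..bdeg b}"
      proof
        assume "d \<in> {bdeg b - int n..bdeg b}"
        then have "d \<in> ?S" by (rule UN_I[rotated]) (simp add: False)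
        then show False using that by (rule notE[rotated])
      qed
      then have "d - bdeg b \<noteq> - int (card A)"
      proof (rule contrapos_nn)
        assume "d - bdeg b = - int (card A)"
        then have "d = bdeg b - int (card A)" by linarith
        then show "d \<in> {bdeg b - int n..bdeg b}" using bound[OF A] by simp
      qed
      then show ?thesis by (simp add: coef_degree_part[OF A])
    qed simp
  qed
  show ?thesis
  proof (rule gcomp_unique)
    show "?f d \<in> gr d" for d using cl by (rule gr_coordsI) (simp add: cr degree_part_in)
    show "finite ?S" using finite_coords[OF m] by simp
    show "{d. ?f d \<noteq> \<zero>} \<subseteq> ?S"
    proof clarify
      fix d assume "?f d \<noteq> \<zero>"
      then obtain b where "b \<in> B" "crd (?f d) b \<noteq> crd \<zero> b" using coords_eqI[OF cl zero_closed] by blast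
      then show "d \<in> ?S" using zero by (auto simp: cr coords_zero)
    qed
    show "m = (\<Oplus>d\<in>?S. ?f d)"
    proof (rule coords_eqI)
      fix b assume "b \<in> B"
      have "(\<Sum>d\<in>?S. degree_part (d - bdeg b) (crd m b)) = crd m b"
      proof (cases "crd m b = 0")
        case False
        show ?thesis
        proof (rule coef_eqI)
          fix A assume A: "A \<subseteq> {..<n}"
          have "bdeg b - int (card A) \<in> ?S" using False bound[OF A] by force
          have "coef A (\<Sum>d\<in>?S. degree_part (d - bdeg b) (crd m b))
              = (\<Sum>d\<in>?S. if bdeg b - int (card A) = d then coef A (crd m b) else 0)"
            unfolding coef_sum using A by (intro sum.cong) (auto simp: coef_degree_part)
          also have "\<dots> = coef A (crd m b)"
            using \<open>bdeg b - int (card A) \<in> ?S\<close> \<open>finite ?S\<close> by (simp only: sum.delta' if_True)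
          finally show "coef A (\<Sum>d\<in>?S. degree_part (d - bdeg b) (crd m b)) = coef A (crd m b)" .
        qed
      qed simp
      then show "crd m b = crd (\<Oplus>d\<in>?S. ?f d) b" using cl by (subst coords_finsum) (auto simp: cr)
    qed (use m cl in auto)
  qed
qed

lemma coords_gcomp: "m \<in> carrier M \<Longrightarrow> crd (gcomp M gr m d) b = degree_part (d - bdeg b) (crd m b)"
  by (simp add: gcomp_eq_cmap coords_cmap)

lemma gr_coordsD: "m \<in> gr d \<Longrightarrow> crd m b \<in> E_deg E (d - bdeg b)"
  using coords_gcomp[of m d b] gr_closed[of m d] gcomp_homogeneous[of m d] degree_part_in[of "d - bdeg b" "crd m b"]
  by simp

lemma V_smult_gcomp: "m \<in> V_smult k M \<Longrightarrow> gcomp M gr m d \<in> V_smult k M"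
  by (simp add: V_smult_iff coords_gcomp gcomp_closed degree_part_filt)

lemma mcoef_gr:
  assumes "m \<in> gr d" "A \<subseteq> {..<n}" shows "mcoef A m \<in> gr (d + int (card A))"
proof (rule gr_coordsI)
  fix b
  have "scal E (coef A (crd m b)) 1 \<in> E_deg E (d + int (card A) - bdeg b)"
  proof (cases "coef A (crd m b) = 0")
    case False
    then have "d - bdeg b = - int (card A)" using gr_coordsD[OF assms(1), of b] assms(2) by (simp add: E_deg_eq)
    then show ?thesis using scal_one_deg by (simp add: algebra_simps)
  qed simp
  then show "crd (mcoef A m) b \<in> E_deg E (d + int (card A) - bdeg b)"
    using gr_closed[OF assms(1)] by (simp add: coords_mcoef)
qed (use assms gr_closed mcoef_closed in blast)

lemma lext_gr:
  assumes N: "graded_left_module N (E_deg E) gr'" and \<phi>: "\<And>b d. b \<in> B \<Longrightarrow> b \<in> gr d \<Longrightarrow> \<phi> b \<in> gr' (d + a)"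
    and m: "m \<in> gr d"
  shows "lext M B N \<phi> m \<in> gr' (d + a)"
proof -
  interpret N: graded_left_module N "E_deg E" gr' by fact
  show ?thesis unfolding lext_def
  proof (rule N.gr_finsum)
    fix b assume "b \<in> {b. crd m b \<noteq> 0}"
    then have b: "b \<in> B" using coords_subset gr_closed[OF m] by auto
    have "crd m b \<odot>\<^bsub>N\<^esub> \<phi> b \<in> gr' ((d - bdeg b) + (bdeg b + a))"
      using gr_coordsD[OF m] \<phi>[OF b bdeg[OF b]] by (intro N.gr_smult)
    then show "crd m b \<odot>\<^bsub>N\<^esub> \<phi> b \<in> gr' (d + a)" by simp
  qed
qed

end

section \<open>Cohomology classes of \<open>K \<otimes> F\<close>\<close>

locale complex_with_bases = exterior_basis E n e
  for E :: "('k::field, 'e::ring_1) gen_algebra" and n e +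
  fixes graded :: bool and F :: "('e, 'm) cochain_complex" and B :: "int \<Rightarrow> 'm set"
  assumes cplx: "is_complex graded (E_deg E) F"
    and bases: "homogeneous_free_bases graded F B"
begin

lemma free_E_module_F: "free_E_module E n e (cmod F i) (B i)"
  using cplx bases
  by (auto simp: is_complex_def homogeneous_free_bases_def free_E_module_def free_module_def
      free_module_axioms_def exterior_basis_axioms)

sublocale F: free_E_module E n e "cmod F i" "B i" for i
  by (rule free_E_module_F)

lemma graded_F: "graded \<Longrightarrow> graded_free_E_module E n e (cmod F i) (B i) (cgr F i)"
  using cplx bases free_E_module_F
  by (auto simp: is_complex_def homogeneous_free_bases_def graded_free_E_module_def
      graded_free_E_module_axioms_def graded_left_module_def graded_left_module_axioms_def F.left_module_axioms)

lemma d_hom: "left_hom (cmod F i) (cmod F (i + 1)) (cdiff F i)"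
  using cplx by (simp add: is_complex_def)

lemma d_hom': "left_hom (cmod F (i - 1)) (cmod F i) (cdiff F (i - 1))"
  using d_hom[of "i - 1"] by simp

lemma d_d: "m \<in> carrier (cmod F i) \<Longrightarrow> cdiff F (i + 1) (cdiff F i m) = \<zero>\<^bsub>cmod F (i + 1 + 1)\<^esub>"
  using cplx by (simp add: is_complex_def)

lemma d_d': "m \<in> carrier (cmod F (i - 1)) \<Longrightarrow> cdiff F i (cdiff F (i - 1) m) = \<zero>\<^bsub>cmod F (i + 1)\<^esub>"
  using d_d[of m "i - 1"] by simp

lemmas d_simps =
  left_hom_closed[OF F.left_module_axioms F.left_module_axioms d_hom]
  left_hom_add[OF F.left_module_axioms F.left_module_axioms d_hom]
  left_hom_smult[OF F.left_module_axioms F.left_module_axioms d_hom]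
  left_hom_zero[OF F.left_module_axioms F.left_module_axioms d_hom]
  left_hom_minus[OF F.left_module_axioms F.left_module_axioms d_hom]
  left_hom_diff[OF F.left_module_axioms F.left_module_axioms d_hom]
  left_hom_finsum[OF F.left_module_axioms F.left_module_axioms d_hom]

lemmas d_simps' =
  left_hom_closed[OF F.left_module_axioms F.left_module_axioms d_hom']
  left_hom_add[OF F.left_module_axioms F.left_module_axioms d_hom']
  left_hom_smult[OF F.left_module_axioms F.left_module_axioms d_hom']
  left_hom_zero[OF F.left_module_axioms F.left_module_axioms d_hom']
  left_hom_minus[OF F.left_module_axioms F.left_module_axioms d_hom']

lemma d_V_smult: "m \<in> V_smult k (cmod F i) \<Longrightarrow> cdiff F i m \<in> V_smult k (cmod F (i + 1))"
  by (rule ideal_smult_hom[OF F.left_module_axioms F.left_module_axioms d_hom])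

lemma d_gr: "graded \<Longrightarrow> m \<in> cgr F i d \<Longrightarrow> cdiff F i m \<in> cgr F (i + 1) d"
  using cplx unfolding is_complex_def by blast

lemma d_gr': "graded \<Longrightarrow> m \<in> cgr F (i - 1) d \<Longrightarrow> cdiff F (i - 1) m \<in> cgr F i d"
  using d_gr[of m "i - 1" d] by simp

text \<open>The representatives in \<open>F\<close> of cocycles and coboundaries of \<open>K \<otimes> F = F/(V)F\<close>.\<close>

definition Zc :: "int \<Rightarrow> 'm set" where
  "Zc i = {z \<in> carrier (cmod F i). cdiff F i z \<in> V_smult 1 (cmod F (i + 1))}"

definition Bc :: "int \<Rightarrow> 'm set" where
  "Bc i = {cdiff F (i - 1) u \<oplus>\<^bsub>cmod F i\<^esub> r | u r. u \<in> carrier (cmod F (i - 1)) \<and> r \<in> V_smult 1 (cmod F i)}"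

lemma Zc_closed: "z \<in> Zc i \<Longrightarrow> z \<in> carrier (cmod F i)"
  by (simp add: Zc_def)

lemma V_smult_Zc: "z \<in> V_smult 1 (cmod F i) \<Longrightarrow> z \<in> Zc i"
  using d_V_smult F.V_smult_closed by (auto simp: Zc_def)

lemma submodule_Zc: "submodule_of (cmod F i) (Zc i)"
  by (auto simp: submodule_of_def Zc_def d_simps F.VM.sub_zero F.VM.sub_add F.VM.sub_smult F.smult_closed)

sublocale Z: module_with_submodule "cmod F i" "Zc i" for i
  by unfold_locales (rule submodule_Zc)

lemma BcI: "u \<in> carrier (cmod F (i - 1)) \<Longrightarrow> r \<in> V_smult 1 (cmod F i) \<Longrightarrow> cdiff F (i - 1) u \<oplus>\<^bsub>cmod F i\<^esub> r \<in> Bc i"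
  by (auto simp: Bc_def)

lemma V_smult_Bc: "r \<in> V_smult 1 (cmod F i) \<Longrightarrow> r \<in> Bc i"
  using BcI[of "\<zero>\<^bsub>cmod F (i - 1)\<^esub>" i r] F.V_smult_closed by (simp add: d_simps')

lemma d_Bc: "u \<in> carrier (cmod F (i - 1)) \<Longrightarrow> cdiff F (i - 1) u \<in> Bc i"
  using BcI[of u i "\<zero>\<^bsub>cmod F i\<^esub>"] by (simp add: d_simps' F.VM.sub_zero)

lemma Bc_subset_Zc: "Bc i \<subseteq> Zc i"
proof
  fix b assume "b \<in> Bc i"
  then obtain u r where b: "b = cdiff F (i - 1) u \<oplus>\<^bsub>cmod F i\<^esub> r"
      "u \<in> carrier (cmod F (i - 1))" "r \<in> V_smult 1 (cmod F i)"
    by (auto simp: Bc_def)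
  have "cdiff F (i - 1) u \<in> Zc i"
    using b(2) by (simp add: Zc_def d_simps' d_d' F.VM.sub_zero)
  then show "b \<in> Zc i" using b V_smult_Zc Z.sub_add by simp
qed

abbreviation qV :: "int \<Rightarrow> 'm \<Rightarrow> 'm set" where
  "qV i m \<equiv> V_smult 1 (cmod F i) +>\<^bsub>cmod F i\<^esub> m"

abbreviation KF where "KF \<equiv> K_tensor E F"

lemma module_KM: "module_with_submodule (restrict_scalars E (cmod F i)) (V_smult 1 (cmod F i))"
proof -
  interpret R: left_module "restrict_scalars E (cmod F i)"
    by (rule left_module_restrict_scalars) (rule F.left_module_axioms)
  show ?thesis
    using F.V_smult_submodule by unfold_locales (simp add: submodule_of_def)
qed

interpretation KM: module_with_submodule "restrict_scalars E (cmod F i)" "V_smult 1 (cmod F i)" for i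
  by (rule module_KM)

lemma cmod_KF: "cmod KF i = quotient_module (restrict_scalars E (cmod F i)) (V_smult 1 (cmod F i))"
  by (simp add: K_tensor_def Let_def)

lemma qV_eq_iff:
  "x \<in> carrier (cmod F i) \<Longrightarrow> y \<in> carrier (cmod F i) \<Longrightarrow> qV i x = qV i y \<longleftrightarrow> x \<ominus>\<^bsub>cmod F i\<^esub> y \<in> V_smult 1 (cmod F i)"
  by (rule F.VM.coset_eq_iff)

lemma cdiff_KF:
  "z \<in> carrier (cmod F i) \<Longrightarrow> cdiff KF i (qV i z) = qV (i + 1) (cdiff F i z)"
  using KM.quotient_map_coset[OF KM.operator_subgroup_axioms, of z i "cdiff F i" "i + 1"] d_V_smult
  by (simp add: K_tensor_def Let_def d_simps)

lemma zero_KF: "\<zero>\<^bsub>cmod KF i\<^esub> = qV i \<zero>\<^bsub>cmod F i\<^esub>"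
  using KM.coset_zero[of i] by (simp add: cmod_KF)

lemma qV_zero_iff: "z \<in> carrier (cmod F i) \<Longrightarrow> qV i z = \<zero>\<^bsub>cmod KF i\<^esub> \<longleftrightarrow> z \<in> V_smult 1 (cmod F i)"
  by (simp add: zero_KF qV_eq_iff F.minus_eq)

lemma carrier_cocycles: "carrier (cocycles KF i) = qV i ` Zc i"
proof -
  have "X \<in> carrier (cmod KF i) \<and> cdiff KF i X = \<zero>\<^bsub>cmod KF (i + 1)\<^esub> \<longleftrightarrow> X \<in> qV i ` Zc i" for X
  proof
    assume X: "X \<in> carrier (cmod KF i) \<and> cdiff KF i X = \<zero>\<^bsub>cmod KF (i + 1)\<^esub>"
    then obtain z where z: "z \<in> carrier (cmod F i)" "X = qV i z"
      using KM.coset_surj[of X i] by (auto simp: cmod_KF)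
    then have "z \<in> Zc i" using X by (simp add: cdiff_KF qV_zero_iff d_simps Zc_def)
    then show "X \<in> qV i ` Zc i" using z by blast
  next
    assume "X \<in> qV i ` Zc i"
    then obtain z where z: "z \<in> Zc i" "X = qV i z" by blast
    then show "X \<in> carrier (cmod KF i) \<and> cdiff KF i X = \<zero>\<^bsub>cmod KF (i + 1)\<^esub>"
      using KM.coset_closed[of z i] by (auto simp: cdiff_KF qV_zero_iff d_simps Zc_def) (simp add: cmod_KF)
  qed
  then show ?thesis by (auto simp: cocycles_def)
qed

lemma coboundaries_KF: "coboundaries KF i = (\<lambda>u. qV i (cdiff F (i - 1) u)) ` carrier (cmod F (i - 1))"
proof -
  have "carrier (cmod KF (i - 1)) = qV (i - 1) ` carrier (cmod F (i - 1))"
    using KM.coset_surj[of _ "i - 1"] KM.coset_closed[of _ "i - 1"] by (auto simp: cmod_KF)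
  then show ?thesis
    using cdiff_KF[of _ "i - 1"] by (auto simp: coboundaries_def image_image intro!: image_cong)
qed

lemma qV_add: "x \<in> carrier (cmod F i) \<Longrightarrow> y \<in> carrier (cmod F i) \<Longrightarrow>
    qV i x \<oplus>\<^bsub>cmod KF i\<^esub> qV i y = qV i (x \<oplus>\<^bsub>cmod F i\<^esub> y)"
  using KM.coset_add[of x i y] by (simp add: cmod_KF)

lemma qV_smult: "x \<in> carrier (cmod F i) \<Longrightarrow> a \<odot>\<^bsub>cmod KF i\<^esub> qV i x = qV i (scal E a 1 \<odot>\<^bsub>cmod F i\<^esub> x)"
  using KM.coset_smult[of x i a] by (simp add: cmod_KF)

lemma left_module_cocycles: "left_module (cocycles KF i)"
proof -
  interpret K: left_module "cmod KF i" unfolding cmod_KF by (rule KM.left_module_quotient)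
  have "submodule_of (cmod KF i) (carrier (cocycles KF i))"
    unfolding submodule_of_def carrier_cocycles
  proof (intro conjI ballI allI)
    show "qV i ` Zc i \<subseteq> carrier (cmod KF i)"
      using KM.coset_closed[of _ i] Zc_closed by (auto simp: cmod_KF)
    show "\<zero>\<^bsub>cmod KF i\<^esub> \<in> qV i ` Zc i" using Z.sub_zero by (auto simp: zero_KF)
  qed (auto simp: qV_add qV_smult Zc_closed Z.sub_add Z.sub_smult)
  then interpret K: module_with_submodule "cmod KF i" "carrier (cocycles KF i)" by unfold_locales
  show ?thesis using K.left_module_sub by (simp add: cocycles_def)
qed

lemma module_HM: "module_with_submodule (cocycles KF i) (coboundaries KF i)"
proof -
  interpret C: left_module "cocycles KF i" by (rule left_module_cocycles)
  have "submodule_of (cocycles KF i) (coboundaries KF i)"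
    unfolding submodule_of_def
  proof (intro conjI ballI allI)
    show "coboundaries KF i \<subseteq> carrier (cocycles KF i)"
      unfolding coboundaries_KF carrier_cocycles using d_Bc Bc_subset_Zc by blast
    show "\<zero>\<^bsub>cocycles KF i\<^esub> \<in> coboundaries KF i"
      unfolding coboundaries_KF
      by (rule image_eqI[of _ _ "\<zero>\<^bsub>cmod F (i - 1)\<^esub>"]) (auto simp: cocycles_def zero_KF d_simps')
  next
    fix x y assume "x \<in> coboundaries KF i" "y \<in> coboundaries KF i"
    then show "x \<oplus>\<^bsub>cocycles KF i\<^esub> y \<in> coboundaries KF i"
      by (auto simp: coboundaries_KF cocycles_def qV_add d_simps'(1) d_simps'(2)[symmetric] intro!: imageI)
  next
    fix a x assume "x \<in> coboundaries KF i"
    then show "a \<odot>\<^bsub>cocycles KF i\<^esub> x \<in> coboundaries KF i"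
      by (auto simp: coboundaries_KF cocycles_def qV_smult d_simps'(1) d_simps'(3)[symmetric] F.smult_closed
          intro!: imageI)
  qed
  then show ?thesis by unfold_locales
qed

interpretation HM: module_with_submodule "cocycles KF i" "coboundaries KF i" for i
  by (rule module_HM)

abbreviation H :: "int \<Rightarrow> ('k, 'm set set) module" where "H \<equiv> cohomology KF"
abbreviation cls :: "int \<Rightarrow> 'm \<Rightarrow> 'm set set" where "cls \<equiv> K_class E F"

lemma cls_eq: "cls i z = coboundaries KF i +>\<^bsub>cocycles KF i\<^esub> qV i z"
  by (simp add: K_class_def cohomology_class_def)

lemma left_module_H: "left_module (H i)"
  unfolding cohomology_def by (rule HM.left_module_quotient)

sublocale H: left_module "H i" for i
  by (rule left_module_H)

lemma qV_cocycle: "z \<in> Zc i \<Longrightarrow> qV i z \<in> carrier (cocycles KF i)"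
  by (auto simp: carrier_cocycles)

lemma cls_closed: "z \<in> Zc i \<Longrightarrow> cls i z \<in> carrier (H i)"
  unfolding cls_eq cohomology_def by (intro HM.coset_closed qV_cocycle)

lemma cls_surj: "h \<in> carrier (H i) \<Longrightarrow> \<exists>z\<in>Zc i. h = cls i z"
  unfolding cls_eq cohomology_def using HM.coset_surj[of h i] by (auto simp: carrier_cocycles)

lemma cls_add: "z \<in> Zc i \<Longrightarrow> z' \<in> Zc i \<Longrightarrow> cls i (z \<oplus>\<^bsub>cmod F i\<^esub> z') = cls i z \<oplus>\<^bsub>H i\<^esub> cls i z'"
  using HM.coset_add[of "qV i z" i "qV i z'"]
  by (simp add: cls_eq cohomology_def qV_cocycle) (simp add: cocycles_def qV_add Zc_closed)

lemma cls_smult: "z \<in> Zc i \<Longrightarrow> cls i (scal E a 1 \<odot>\<^bsub>cmod F i\<^esub> z) = a \<odot>\<^bsub>H i\<^esub> cls i z"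
  using HM.coset_smult[of "qV i z" i a]
  by (simp add: cls_eq cohomology_def qV_cocycle) (simp add: cocycles_def qV_smult Zc_closed)

text \<open>Two cosets have to be unfolded: that of coboundaries among cocycles, and that of \<open>(V)F\<close> in \<open>F\<close>.\<close>

lemma cls_eq_iff:
  assumes "z \<in> Zc i" "z' \<in> Zc i" shows "cls i z = cls i z' \<longleftrightarrow> z \<ominus>\<^bsub>cmod F i\<^esub> z' \<in> Bc i"
proof -
  have cz: "z \<in> carrier (cmod F i)" "z' \<in> carrier (cmod F i)" using assms Zc_closed by auto
  have "qV i z \<ominus>\<^bsub>cocycles KF i\<^esub> qV i z' = qV i (z \<ominus>\<^bsub>cmod F i\<^esub> z')"
  proof -
    have "(- 1) \<odot>\<^bsub>cocycles KF i\<^esub> qV i z' = qV i (\<ominus>\<^bsub>cmod F i\<^esub> z')"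
      using cz by (simp add: cocycles_def qV_smult F.smult_minus_one)
    then have "\<ominus>\<^bsub>cocycles KF i\<^esub> qV i z' = qV i (\<ominus>\<^bsub>cmod F i\<^esub> z')"
      using HM.smult_minus_one[OF qV_cocycle[OF assms(2)]] by simp
    then have "qV i z \<ominus>\<^bsub>cocycles KF i\<^esub> qV i z' = qV i z \<oplus>\<^bsub>cocycles KF i\<^esub> qV i (\<ominus>\<^bsub>cmod F i\<^esub> z')"
      by (simp add: HM.minus_eq)
    then show ?thesis using cz by (simp add: cocycles_def qV_add F.minus_eq)
  qed
  then have "cls i z = cls i z' \<longleftrightarrow> qV i (z \<ominus>\<^bsub>cmod F i\<^esub> z') \<in> coboundaries KF i"
    unfolding cls_eq using assms by (simp add: HM.coset_eq_iff qV_cocycle)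
  also have "\<dots> \<longleftrightarrow> z \<ominus>\<^bsub>cmod F i\<^esub> z' \<in> Bc i"
  proof
    assume "qV i (z \<ominus>\<^bsub>cmod F i\<^esub> z') \<in> coboundaries KF i"
    then obtain u where u: "u \<in> carrier (cmod F (i - 1))"
        "(z \<ominus>\<^bsub>cmod F i\<^esub> z') \<ominus>\<^bsub>cmod F i\<^esub> cdiff F (i - 1) u \<in> V_smult 1 (cmod F i)"
      using cz by (auto simp: coboundaries_KF qV_eq_iff d_simps'(1))
    have "z \<ominus>\<^bsub>cmod F i\<^esub> z' = cdiff F (i - 1) u \<oplus>\<^bsub>cmod F i\<^esub> ((z \<ominus>\<^bsub>cmod F i\<^esub> z') \<ominus>\<^bsub>cmod F i\<^esub> cdiff F (i - 1) u)"
      using cz u(1) by (intro F.coords_eqI[where i = i]) (simp_all add: F.coords_simps d_simps'(1))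
    then show "z \<ominus>\<^bsub>cmod F i\<^esub> z' \<in> Bc i" using BcI[OF u] by simp
  next
    assume "z \<ominus>\<^bsub>cmod F i\<^esub> z' \<in> Bc i"
    then obtain u r where u: "u \<in> carrier (cmod F (i - 1))" "r \<in> V_smult 1 (cmod F i)"
        "z \<ominus>\<^bsub>cmod F i\<^esub> z' = cdiff F (i - 1) u \<oplus>\<^bsub>cmod F i\<^esub> r" by (auto simp: Bc_def)
    have "(cdiff F (i - 1) u \<oplus>\<^bsub>cmod F i\<^esub> r) \<ominus>\<^bsub>cmod F i\<^esub> cdiff F (i - 1) u = r"
      using u F.V_smult_closed[OF u(2)] by (intro F.coords_eqI[where i = i]) (simp_all add: F.coords_simps d_simps'(1))
    then have "qV i (z \<ominus>\<^bsub>cmod F i\<^esub> z') = qV i (cdiff F (i - 1) u)"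
      using u F.V_smult_closed[OF u(2)] by (simp add: qV_eq_iff d_simps'(1))
    then show "qV i (z \<ominus>\<^bsub>cmod F i\<^esub> z') \<in> coboundaries KF i" using u by (auto simp: coboundaries_KF)
  qed
  finally show ?thesis .
qed

lemma cls_zero: "cls i \<zero>\<^bsub>cmod F i\<^esub> = \<zero>\<^bsub>H i\<^esub>"
  using cls_smult[of "\<zero>\<^bsub>cmod F i\<^esub>" i 0] cls_closed[of "\<zero>\<^bsub>cmod F i\<^esub>" i] by (simp add: Z.sub_zero)

lemma cls_zero_iff: "z \<in> Zc i \<Longrightarrow> cls i z = \<zero>\<^bsub>H i\<^esub> \<longleftrightarrow> z \<in> Bc i"
  using cls_eq_iff[of z i "\<zero>\<^bsub>cmod F i\<^esub>"] Zc_closed[of z i] by (simp add: cls_zero Z.sub_zero F.minus_eq)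

lemma cls_finsum: "f \<in> A \<rightarrow> Zc i \<Longrightarrow> cls i (\<Oplus>\<^bsub>cmod F i\<^esub>j\<in>A. f j) = (\<Oplus>\<^bsub>H i\<^esub>j\<in>A. cls i (f j))"
proof (induction A rule: infinite_finite_induct)
  case (insert a A)
  then have "f a \<in> Zc i" "f \<in> A \<rightarrow> Zc i" "f \<in> A \<rightarrow> carrier (cmod F i)" using Zc_closed by auto
  moreover have "(\<Oplus>\<^bsub>cmod F i\<^esub>j\<in>A. f j) \<in> Zc i"
    using \<open>f \<in> A \<rightarrow> Zc i\<close>
  proof (induction A rule: infinite_finite_induct)
    case (insert a A)
    then have "f a \<in> Zc i" "f \<in> A \<rightarrow> Zc i" "f \<in> A \<rightarrow> carrier (cmod F i)" using Zc_closed by auto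
    then show ?case using insert by (simp add: Zc_closed Z.sub_add)
  qed (simp_all add: Z.sub_zero)
  moreover have "(\<lambda>j. cls i (f j)) \<in> A \<rightarrow> carrier (H i)"
    using \<open>f \<in> A \<rightarrow> Zc i\<close> cls_closed by auto
  ultimately show ?case using insert by (simp add: Zc_closed cls_add cls_closed)
qed (simp_all add: cls_zero)

lemma cohomology_gr_eq: "cohomology_gr KF i d = cls i ` (Zc i \<inter> cgr F i d)" if "graded"
proof -
  interpret G: graded_free_E_module E n e "cmod F i" "B i" "cgr F i" by (rule graded_F[OF that])
  have gr: "cgr KF i d = qV i ` cgr F i d" by (simp add: K_tensor_def Let_def)
  have "z \<in> Zc i" if z: "z \<in> cgr F i d" "qV i z \<in> qV i ` Zc i" for z
  proof -
    obtain z' where z': "z' \<in> Zc i" "qV i z = qV i z'" using z(2) by blast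
    have cl: "z \<in> carrier (cmod F i)" "z' \<in> carrier (cmod F i)" using z z' G.gr_closed Zc_closed by auto
    then have "z \<ominus>\<^bsub>cmod F i\<^esub> z' \<in> Zc i" using z' V_smult_Zc by (simp add: qV_eq_iff)
    moreover have "z = (z \<ominus>\<^bsub>cmod F i\<^esub> z') \<oplus>\<^bsub>cmod F i\<^esub> z'"
      using cl by (simp add: F.minus_eq F.a_assoc F.l_neg)
    ultimately show ?thesis using z' Z.sub_add by metis
  qed
  then have "qV i ` Zc i \<inter> qV i ` cgr F i d = qV i ` (Zc i \<inter> cgr F i d)" by blast
  then show ?thesis
    by (simp add: cohomology_gr_def carrier_cocycles gr image_image cls_eq cohomology_class_def)
qed

section \<open>The internal grading of cohomology\<close>

text \<open>The differential has degree \<open>0\<close> and \<open>(V)F\<close> is a graded submodule, so the representatives of cocycles and of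
  coboundaries form graded submodules of \<open>F\<close>.\<close>

lemma Zc_gcomp:
  assumes "graded" "z \<in> Zc i" shows "gcomp (cmod F i) (cgr F i) z d \<in> Zc i"
proof -
  interpret G: graded_free_E_module E n e "cmod F i" "B i" "cgr F i" by (rule graded_F[OF assms(1)])
  interpret G': graded_free_E_module E n e "cmod F (i + 1)" "B (i + 1)" "cgr F (i + 1)" by (rule graded_F[OF assms(1)])
  have "gcomp (cmod F (i + 1)) (cgr F (i + 1)) (cdiff F i z) d = cdiff F i (gcomp (cmod F i) (cgr F i) z (d - 0))"
    using assms Zc_closed[OF assms(2)]
    by (intro G.gcomp_additive[OF G'.graded_left_module_axioms]) (auto simp: d_simps d_gr)
  then show ?thesis
    using assms G'.V_smult_gcomp[of "cdiff F i z" 1 d] G.gcomp_closed by (simp add: Zc_def)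
qed

lemma Bc_gcomp:
  assumes "graded" "b \<in> Bc i" shows "gcomp (cmod F i) (cgr F i) b d \<in> Bc i"
proof -
  interpret G: graded_free_E_module E n e "cmod F i" "B i" "cgr F i" by (rule graded_F[OF assms(1)])
  interpret G': graded_free_E_module E n e "cmod F (i - 1)" "B (i - 1)" "cgr F (i - 1)" by (rule graded_F[OF assms(1)])
  obtain u r where b: "b = cdiff F (i - 1) u \<oplus>\<^bsub>cmod F i\<^esub> r"
      "u \<in> carrier (cmod F (i - 1))" "r \<in> V_smult 1 (cmod F i)"
    using assms(2) by (auto simp: Bc_def)
  have r: "r \<in> carrier (cmod F i)" and u: "cdiff F (i - 1) u \<in> carrier (cmod F i)"
    using b by (auto simp: F.V_smult_closed d_simps'(1))
  have "gcomp (cmod F i) (cgr F i) (cdiff F (i - 1) u) d = cdiff F (i - 1) (gcomp (cmod F (i - 1)) (cgr F (i - 1)) u (d - 0))"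
    using assms b(2)
    by (intro G'.gcomp_additive[OF G.graded_left_module_axioms]) (auto simp: d_simps' d_gr')
  moreover have "gcomp (cmod F i) (cgr F i) b d
      = gcomp (cmod F i) (cgr F i) (cdiff F (i - 1) u) d \<oplus>\<^bsub>cmod F i\<^esub> gcomp (cmod F i) (cgr F i) r d"
    using r u G.gcomp_closed unfolding b(1)
    by (intro F.coords_eqI[where i = i]) (auto simp: F.coords_add G.coords_gcomp degree_part_def scale_left_distrib
        sum.distrib[symmetric] intro!: sum.cong)
  ultimately show ?thesis
    using BcI[OF G'.gcomp_closed[OF b(2)] G.V_smult_gcomp[OF b(3)]] by simp
qed

text \<open>The components of a class are the classes of the components of a representative.  They are unique because
  the submodule of representatives of zero is graded.\<close>

lemma H_grading:
  assumes "graded" shows "module_grading K_deg (H i) (cohomology_gr KF i)"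
proof -
  interpret G: graded_free_E_module E n e "cmod F i" "B i" "cgr F i" by (rule graded_F[OF assms])
  let ?M = "cmod F i" and ?S = "\<lambda>d. Zc i \<inter> cgr F i d"
  have gr: "cohomology_gr KF i d = cls i ` ?S d" for d using assms by (rule cohomology_gr_eq)
  have zero: "\<zero>\<^bsub>?M\<^esub> \<in> ?S d" for d by (simp add: Z.sub_zero G.gr_zero)
  have add: "x \<in> ?S d \<Longrightarrow> y \<in> ?S d \<Longrightarrow> x \<oplus>\<^bsub>?M\<^esub> y \<in> ?S d" for x y d by (simp add: Z.sub_add G.gr_add)
  have smult: "x \<in> ?S d \<Longrightarrow> scal E a 1 \<odot>\<^bsub>?M\<^esub> x \<in> ?S d" for x a d
    using G.gr_smult[OF scal_one_deg, of x d a] by (simp add: Z.sub_smult)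
  show ?thesis unfolding module_grading_def
  proof (intro conjI allI ballI)
    fix d
    show "subgroup (cohomology_gr KF i d) (add_monoid (H i))"
    proof (rule group.subgroupI)
      show "Group.group (add_monoid (H i))" by (rule H.a_group)
      show "cohomology_gr KF i d \<subseteq> carrier (add_monoid (H i))" by (auto simp: gr cls_closed)
      show "cohomology_gr KF i d \<noteq> {}" using zero by (auto simp: gr)
    next
      fix x assume "x \<in> cohomology_gr KF i d"
      then obtain z where z: "z \<in> ?S d" "x = cls i z" by (auto simp: gr)
      then have "\<ominus>\<^bsub>H i\<^esub> x = cls i (scal E (- 1) 1 \<odot>\<^bsub>?M\<^esub> z)"
        by (subst cls_smult) (auto simp: H.smult_minus_one cls_closed)
      then show "inv\<^bsub>add_monoid (H i)\<^esub> x \<in> cohomology_gr KF i d"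
        using smult[OF z(1), of "- 1"] unfolding gr a_inv_def by (metis imageI)
    next
      fix x y assume "x \<in> cohomology_gr KF i d" "y \<in> cohomology_gr KF i d"
      then obtain z z' where z: "z \<in> ?S d" "x = cls i z" "z' \<in> ?S d" "y = cls i z'" by (auto simp: gr)
      then have "x \<oplus>\<^bsub>H i\<^esub> y = cls i (z \<oplus>\<^bsub>?M\<^esub> z')" by (simp add: cls_add)
      then show "x \<otimes>\<^bsub>add_monoid (H i)\<^esub> y \<in> cohomology_gr KF i d" using add z by (auto simp: gr)
    qed
  next
    fix h assume "h \<in> carrier (H i)"
    then obtain z where z: "z \<in> Zc i" "h = cls i z" using cls_surj by blast
    let ?g = "gcomp ?M (cgr F i) z"
    have zc: "z \<in> carrier ?M" using z Zc_closed by blast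
    have gS: "?g d \<in> ?S d" for d using Zc_gcomp[OF assms z(1)] G.gcomp_in[OF zc] by simp
    let ?A = "{d. ?g d \<noteq> \<zero>\<^bsub>?M\<^esub>}"
    have sub: "{d. cls i (?g d) \<noteq> \<zero>\<^bsub>H i\<^esub>} \<subseteq> ?A" by (auto simp: cls_zero)
    have "h = (\<Oplus>\<^bsub>H i\<^esub>d\<in>?A. cls i (?g d))"
      using G.gcomp_sum[OF zc] cls_finsum[of ?g ?A i] gS z(2) by simp
    also have "\<dots> = (\<Oplus>\<^bsub>H i\<^esub>d\<in>{d. cls i (?g d) \<noteq> \<zero>\<^bsub>H i\<^esub>}. cls i (?g d))"
      using sub gS G.gcomp_finite[OF zc] by (intro H.finsum_supset[symmetric]) (auto intro: cls_closed)
    finally have ex: "(\<forall>d. cls i (?g d) \<in> cohomology_gr KF i d) \<and> finite {d. cls i (?g d) \<noteq> \<zero>\<^bsub>H i\<^esub>} \<and>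
        h = (\<Oplus>\<^bsub>H i\<^esub>d\<in>{d. cls i (?g d) \<noteq> \<zero>\<^bsub>H i\<^esub>}. cls i (?g d))"
      using gS finite_subset[OF sub] G.gcomp_finite[OF zc] by (auto simp: gr)
    \<comment> \<open>Representatives are chosen to be zero for zero classes, so that finite families stay finite.\<close>
    have rep: "\<exists>y. (\<forall>d. y d \<in> ?S d \<and> cls i (y d) = f d) \<and> {d. y d \<noteq> \<zero>\<^bsub>?M\<^esub>} \<subseteq> {d. f d \<noteq> \<zero>\<^bsub>H i\<^esub>}"
      if f: "\<forall>d. f d \<in> cohomology_gr KF i d" for f
    proof -
      have "\<forall>d. \<exists>y. y \<in> ?S d \<and> cls i y = f d \<and> (f d = \<zero>\<^bsub>H i\<^esub> \<longrightarrow> y = \<zero>\<^bsub>?M\<^esub>)"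
      proof
        fix d
        have "f d \<in> cls i ` ?S d" using f by (simp add: gr)
        then obtain y where "y \<in> ?S d" "cls i y = f d" by blast
        then show "\<exists>y. y \<in> ?S d \<and> cls i y = f d \<and> (f d = \<zero>\<^bsub>H i\<^esub> \<longrightarrow> y = \<zero>\<^bsub>?M\<^esub>)"
          using zero[of d] cls_zero[of i] by (cases "f d = \<zero>\<^bsub>H i\<^esub>") auto
      qed
      then obtain y where y: "\<forall>d. y d \<in> ?S d \<and> cls i (y d) = f d \<and> (f d = \<zero>\<^bsub>H i\<^esub> \<longrightarrow> y d = \<zero>\<^bsub>?M\<^esub>)"
        by (rule choice[THEN exE])
      show ?thesis using y by (intro exI[of _ y]) blast
    qed
    have uniq: "f = f'"
      if f: "\<forall>d. f d \<in> cohomology_gr KF i d" "finite {d. f d \<noteq> \<zero>\<^bsub>H i\<^esub>}" "h = (\<Oplus>\<^bsub>H i\<^esub>d\<in>{d. f d \<noteq> \<zero>\<^bsub>H i\<^esub>}. f d)"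
      and f': "\<forall>d. f' d \<in> cohomology_gr KF i d" "finite {d. f' d \<noteq> \<zero>\<^bsub>H i\<^esub>}" "h = (\<Oplus>\<^bsub>H i\<^esub>d\<in>{d. f' d \<noteq> \<zero>\<^bsub>H i\<^esub>}. f' d)"
      for f f'
    proof -
      obtain y where y: "\<And>d. y d \<in> ?S d" "\<And>d. cls i (y d) = f d" "{d. y d \<noteq> \<zero>\<^bsub>?M\<^esub>} \<subseteq> {d. f d \<noteq> \<zero>\<^bsub>H i\<^esub>}"
        using rep[OF f(1)] by blast
      obtain y' where y': "\<And>d. y' d \<in> ?S d" "\<And>d. cls i (y' d) = f' d" "{d. y' d \<noteq> \<zero>\<^bsub>?M\<^esub>} \<subseteq> {d. f' d \<noteq> \<zero>\<^bsub>H i\<^esub>}"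
        using rep[OF f'(1)] by blast
      let ?T = "{d. f d \<noteq> \<zero>\<^bsub>H i\<^esub>} \<union> {d. f' d \<noteq> \<zero>\<^bsub>H i\<^esub>}"
      have T: "finite ?T" using f f' by simp
      have cl: "y d \<in> carrier ?M" "y' d \<in> carrier ?M" for d using y y' Zc_closed by auto
      have fc: "f d \<in> carrier (H i)" "f' d \<in> carrier (H i)" for d
        using y(1,2) y'(1,2) cls_closed by (metis IntD1)+
      \<comment> \<open>The difference of two decompositions of \<open>h\<close> is represented by the \<open>?w d\<close>, which are the components of an element of \<open>Bc i\<close>.\<close>
      let ?w = "\<lambda>d. y d \<ominus>\<^bsub>?M\<^esub> y' d"
      have wS: "?w d \<in> Zc i" for d using y(1) y'(1) by (simp add: Z.sub_diff)
      have clw: "cls i (?w d) = f d \<ominus>\<^bsub>H i\<^esub> f' d" for d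
      proof -
        have "?w d = y d \<oplus>\<^bsub>?M\<^esub> scal E (- 1) 1 \<odot>\<^bsub>?M\<^esub> y' d"
          using cl by (simp add: F.minus_eq F.smult_minus_one)
        moreover have "scal E (- 1) 1 \<odot>\<^bsub>?M\<^esub> y' d \<in> Zc i" using y'(1) by (simp add: Z.sub_smult)
        ultimately have "cls i (?w d) = f d \<oplus>\<^bsub>H i\<^esub> (- 1) \<odot>\<^bsub>H i\<^esub> f' d"
          using y y' by (metis IntD1 cls_add cls_smult)
        then show ?thesis using fc by (simp add: H.minus_eq H.smult_minus_one)
      qed
      have "cls i (\<Oplus>\<^bsub>?M\<^esub>d\<in>?T. ?w d) = (\<Oplus>\<^bsub>H i\<^esub>d\<in>?T. f d \<ominus>\<^bsub>H i\<^esub> f' d)"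
        using wS by (subst cls_finsum) (auto simp: clw)
      also have "\<dots> = (\<Oplus>\<^bsub>H i\<^esub>d\<in>?T. f d) \<ominus>\<^bsub>H i\<^esub> (\<Oplus>\<^bsub>H i\<^esub>d\<in>?T. f' d)"
        using fc by (intro H.finsum_diff) auto
      also have "(\<Oplus>\<^bsub>H i\<^esub>d\<in>?T. f d) = h" unfolding f(3) using T fc by (intro H.finsum_supset[symmetric]) auto
      also have "(\<Oplus>\<^bsub>H i\<^esub>d\<in>?T. f' d) = h" unfolding f'(3) using T fc by (intro H.finsum_supset[symmetric]) auto
      also have "h \<ominus>\<^bsub>H i\<^esub> h = \<zero>\<^bsub>H i\<^esub>"
        unfolding z(2) using z(1) by (simp add: H.minus_eq H.r_neg cls_closed)
      finally have wB: "(\<Oplus>\<^bsub>?M\<^esub>d\<in>?T. ?w d) \<in> Bc i"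
      proof (subst cls_zero_iff[symmetric])
        have "(\<Oplus>\<^bsub>?M\<^esub>d\<in>?T. ?w d) = (\<Oplus>\<^bsub>?M\<lparr>carrier := Zc i\<rparr>\<^esub>d\<in>?T. ?w d)"
          using wS by (intro Z.finsum_sub[symmetric]) auto
        also have "\<dots> \<in> Zc i"
          using wS abelian_monoid.finsum_closed[of "?M\<lparr>carrier := Zc i\<rparr>" ?w ?T] Z.left_module_sub[of i]
          by (auto simp: left_module_def abelian_group_def)
        finally show "(\<Oplus>\<^bsub>?M\<^esub>d\<in>?T. ?w d) \<in> Zc i" .
      qed
      have "gcomp ?M (cgr F i) (\<Oplus>\<^bsub>?M\<^esub>d\<in>?T. ?w d) = ?w"
      proof (rule G.gcomp_unique[OF _ T])
        show "?w d \<in> cgr F i d" for d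
          using y(1)[of d] y'(1)[of d] subgroup.m_inv_closed[OF G.gr_subgroup] G.gr_add
          by (simp add: F.minus_eq a_inv_def)
        show "{d. ?w d \<noteq> \<zero>\<^bsub>?M\<^esub>} \<subseteq> ?T"
        proof
          fix d assume "d \<in> {d. ?w d \<noteq> \<zero>\<^bsub>?M\<^esub>}"
          then have "y d \<noteq> \<zero>\<^bsub>?M\<^esub> \<or> y' d \<noteq> \<zero>\<^bsub>?M\<^esub>" by (auto simp: F.minus_eq)
          then show "d \<in> ?T" using y(3) y'(3) by blast
        qed
      qed simp
      then have "?w d \<in> Bc i" for d using Bc_gcomp[OF assms wB] by metis
      then have "f d \<ominus>\<^bsub>H i\<^esub> f' d = \<zero>\<^bsub>H i\<^esub>" for d using clw cls_zero_iff[OF wS] by metis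
      then show ?thesis using fc H.diff_eq_zero_iff by (metis ext)
    qed
    show "\<exists>!f. (\<forall>d. f d \<in> cohomology_gr KF i d) \<and> finite {d. f d \<noteq> \<zero>\<^bsub>H i\<^esub>} \<and> h = (\<Oplus>\<^bsub>H i\<^esub>d\<in>{d. f d \<noteq> \<zero>\<^bsub>H i\<^esub>}. f d)"
      by (rule ex1I, rule ex) (rule uniq, use ex in auto)
  next
    fix a d and k :: 'k and h assume k: "k \<in> K_deg a" and h: "h \<in> cohomology_gr KF i d"
    obtain z where z: "z \<in> ?S d" "h = cls i z" using h by (auto simp: gr)
    show "k \<odot>\<^bsub>H i\<^esub> h \<in> cohomology_gr KF i (a + d)"
    proof (cases "a = 0")
      case True
      then show ?thesis using z smult[OF z(1), of k] by (auto simp: gr cls_smult[symmetric])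
    next
      case False
      then have "k = 0" using k by (simp add: K_deg_def)
      then show ?thesis using z cls_zero[of i] zero[of "a + d"] by (auto simp: gr cls_closed)
    qed
  qed
qed

end

section \<open>The action of \<open>W\<close> on cohomology\<close>

lemma (in left_module) finsum_swap:
  assumes "finite A" "\<And>s t. s \<in> A \<Longrightarrow> t \<in> B \<Longrightarrow> f s t \<in> carrier M"
  shows "(\<Oplus>s\<in>A. \<Oplus>t\<in>B. f s t) = (\<Oplus>t\<in>B. \<Oplus>s\<in>A. f s t)"
  using assms
proof (induction A rule: finite_induct)
  case (insert a A)
  have c: "(\<lambda>t. f a t) \<in> B \<rightarrow> carrier M" "(\<lambda>t. \<Oplus>s\<in>A. f s t) \<in> B \<rightarrow> carrier M"
      "(\<lambda>s. \<Oplus>t\<in>B. f s t) \<in> A \<rightarrow> carrier M"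
    using insert.prems by (auto intro!: finsum_closed)
  have "(\<Oplus>s\<in>insert a A. \<Oplus>t\<in>B. f s t) = (\<Oplus>t\<in>B. f a t) \<oplus> (\<Oplus>t\<in>B. \<Oplus>s\<in>A. f s t)"
    using c insert by simp
  also have "\<dots> = (\<Oplus>t\<in>B. f a t \<oplus> (\<Oplus>s\<in>A. f s t))"
    using c by (intro finsum_addf[symmetric])
  also have "\<dots> = (\<Oplus>t\<in>B. \<Oplus>s\<in>insert a A. f s t)"
    using insert by (intro finsum_cong') (auto intro!: finsum_closed)
  finally show ?case .
qed simp

context exterior_basis
begin

lemma dual_expand:
  assumes "w \<in> dual_space E" "v \<in> gens E"
  shows "w v = (\<Sum>s<n. coef {s} v * w (e s))"
proof -
  have add: "w (u + v) = w u + w v" if "u \<in> gens E" "v \<in> gens E" for u v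
    using assms(1) that by (simp add: dual_space_def)
  have scale: "w (scal E a v) = a * w v" if "v \<in> gens E" for a v
    using assms(1) that by (simp add: dual_space_def)
  have zero: "0 \<in> gens E" by (simp add: gens_eq_span span_zero)
  have w0: "w 0 = 0" using scale[OF zero, of 0] by simp
  have "w (\<Sum>s\<in>I. f s) = (\<Sum>s\<in>I. w (f s)) \<and> sum f I \<in> gens E"
    if "finite I" "\<And>s. s \<in> I \<Longrightarrow> f s \<in> gens E" for I :: "nat set" and f
    using that
  proof (induction I rule: finite_induct)
    case (insert s I)
    then have "f s + sum f I \<in> gens E" by (simp add: gens_eq_span span_add)
    then show ?case using insert by (simp add: add)
  qed (simp add: w0 zero)
  from this[of "{..<n}" "\<lambda>s. scal E (coef {s} v) (e s)"]
  have "w (\<Sum>s<n. scal E (coef {s} v) (e s)) = (\<Sum>s<n. w (scal E (coef {s} v) (e s)))"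
    by (simp add: gens_eq_span span_scale span_base)
  then show ?thesis using gens_expand[OF assms(2)] by (simp add: scale)
qed

lemma coef_pair:
  assumes "s < t" "t < n" "a < n" "c < n"
  shows "coef {s, t} (e a * e c) = (if a = s \<and> c = t then 1 else if a = t \<and> c = s then - 1 else 0)"
proof -
  have st: "coef {s, t} (e s * e t) = 1"
    using mon_insert_min[of "{t}" s] assms coef_mon[of "{s, t}" "{s, t}"] by (simp add: e_eq_mon[symmetric])
  have ts: "coef {s, t} (e t * e s) = - 1"
    using st gens_anticommute[of "e t" "e s"] assms by simp
  have "coef {s, t} (e a * e c) = 0" if "{a} \<inter> {c} \<noteq> {} \<or> {a} \<union> {c} \<noteq> {s, t}"
    using coef_mon_mult_zero[of "{a}" "{c}" "{s, t}"] that assms by (simp add: e_eq_mon)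
  then show ?thesis using st ts assms by (auto simp: doubleton_eq_iff)
qed

end

text \<open>A linear map acts on the leading coefficients of an element of \<open>(V)\<^sup>k M\<close> through its reduction modulo \<open>(V)\<close>: expand
  \<open>m\<close> as \<open>\<Sum>\<^sub>A e\<^sub>A m\<^sub>A\<close>; the terms with fewer than \<open>k\<close> factors vanish, and \<open>e\<^sub>A f(m\<^sub>A)\<close> has the constant term of \<open>f(m\<^sub>A)\<close> as
  its coefficient at \<open>e\<^sub>A\<close> and none at the other monomials of degree \<open>k\<close>.\<close>

lemma (in exterior_basis) leading_coefficient_hom:
  assumes M: "free_E_module E n e M B" and N: "free_E_module E n e N C" and f: "left_hom M N f"
    and m: "m \<in> V_smult k M" and A: "A \<subseteq> {..<n}" "card A = k"
  shows "coef A (coords N C (f m) b) = coef {} (coords N C (f (free_E_module.mcoef E n e M B A m)) b)"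
proof -
  interpret M: free_E_module E n e M B by (rule M)
  interpret N: free_E_module E n e N C by (rule N)
  note h = M.left_module_axioms N.left_module_axioms f
  have mc: "m \<in> carrier M" using m M.V_smult_closed by blast
  have fc: "f (M.mcoef A' m) \<in> carrier N" for A' using left_hom_closed[OF h] M.mcoef_closed[OF mc] by blast
  have "f m = f (\<Oplus>\<^bsub>M\<^esub>A'\<in>Pow {..<n}. mon A' \<odot>\<^bsub>M\<^esub> M.mcoef A' m)"
    using M.mcoef_expand[OF mc] by simp
  also have "\<dots> = (\<Oplus>\<^bsub>N\<^esub>A'\<in>Pow {..<n}. f (mon A' \<odot>\<^bsub>M\<^esub> M.mcoef A' m))"
    using mc by (intro left_hom_finsum[OF h]) (auto simp: M.mcoef_closed M.smult_closed)
  also have "\<dots> = (\<Oplus>\<^bsub>N\<^esub>A'\<in>Pow {..<n}. mon A' \<odot>\<^bsub>N\<^esub> f (M.mcoef A' m))"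
    using mc fc by (intro N.finsum_cong') (auto simp: left_hom_smult[OF h] M.mcoef_closed N.smult_closed)
  finally have "coef A (coords N C (f m) b) = (\<Sum>A'\<in>Pow {..<n}. coef A (mon A' * coords N C (f (M.mcoef A' m)) b))"
    using fc by (simp add: N.coords_finsum N.coords_smult N.smult_closed)
  also have "\<dots> = (\<Sum>A'\<in>Pow {..<n}. if A = A' then coef {} (coords N C (f (M.mcoef A' m)) b) else 0)"
  proof (intro sum.cong refl)
    fix A' assume A': "A' \<in> Pow {..<n}"
    show "coef A (mon A' * coords N C (f (M.mcoef A' m)) b) = (if A = A' then coef {} (coords N C (f (M.mcoef A' m)) b) else 0)"
    proof (cases "card A' < k")
      case True
      then have "coef A' (coords M B m b') = 0" for b'
        using m A' by (auto simp: M.V_smult_iff filt_def)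
      then have "M.mcoef A' m = \<zero>\<^bsub>M\<^esub>"
        using mc by (intro M.coords_eqI) (auto simp: M.mcoef_closed M.coords_mcoef M.coords_zero)
      then show ?thesis using True A by (auto simp: left_hom_zero[OF h] N.coords_zero)
    next
      case False
      then have "mon A' \<in> filt (card A)" using A' A(2) by (auto simp: filt_def coef_mon)
      then show ?thesis using A A' coef_leading_mult[OF A(1)] by (simp add: coef_mon)
    qed
  qed
  also have "\<dots> = coef {} (coords N C (f (M.mcoef A m)) b)" using A by simp
  finally show ?thesis .
qed

context complex_with_bases
begin

abbreviation Kcomb :: "int \<Rightarrow> (nat \<Rightarrow> 'k) \<Rightarrow> (nat \<Rightarrow> 'm) \<Rightarrow> 'm" where
  "Kcomb i c y \<equiv> (\<Oplus>\<^bsub>cmod F i\<^esub>s\<in>{..<n}. scal E (c s) 1 \<odot>\<^bsub>cmod F i\<^esub> y s)"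

abbreviation Ecomb :: "int \<Rightarrow> (nat \<Rightarrow> 'm) \<Rightarrow> 'm" where
  "Ecomb i y \<equiv> (\<Oplus>\<^bsub>cmod F i\<^esub>s\<in>{..<n}. e s \<odot>\<^bsub>cmod F i\<^esub> y s)"

lemma BcI':
  "u \<in> carrier (cmod F i) \<Longrightarrow> r \<in> V_smult 1 (cmod F (i + 1)) \<Longrightarrow> cdiff F i u \<oplus>\<^bsub>cmod F (i + 1)\<^esub> r \<in> Bc (i + 1)"
  using BcI[of u "i + 1" r] by simp

text \<open>A choice of \<open>y\<close> with \<open>m \<equiv> \<Sum>\<^sub>s e\<^sub>s y\<^sub>s\<close> modulo \<open>(V)\<^sup>2\<close>.  Allowing the \<open>y\<^sub>s\<close> to lie outside the \<open>K\<close>-span of the basis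
  makes the notion compatible with linear maps.\<close>

definition linear_part :: "int \<Rightarrow> 'm \<Rightarrow> (nat \<Rightarrow> 'm) \<Rightarrow> bool" where
  "linear_part i m y \<longleftrightarrow> (\<forall>s<n. y s \<in> carrier (cmod F i)) \<and> m \<ominus>\<^bsub>cmod F i\<^esub> Ecomb i y \<in> V_smult 2 (cmod F i)"

lemma
  assumes "\<And>s. s < n \<Longrightarrow> y s \<in> carrier (cmod F i)"
  shows Kcomb_closed: "Kcomb i c y \<in> carrier (cmod F i)"
    and Ecomb_closed: "Ecomb i y \<in> carrier (cmod F i)"
    and coords_Kcomb: "F.crd i (Kcomb i c y) b = (\<Sum>s<n. scal E (c s) (F.crd i (y s) b))"
    and coords_Ecomb: "F.crd i (Ecomb i y) b = (\<Sum>s<n. e s * F.crd i (y s) b)"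
proof -
  have *: "(\<lambda>s. r s \<odot>\<^bsub>cmod F i\<^esub> y s) \<in> {..<n} \<rightarrow> carrier (cmod F i)" for r
    using assms by (auto simp: F.smult_closed)
  show "Kcomb i c y \<in> carrier (cmod F i)" "Ecomb i y \<in> carrier (cmod F i)"
    using * by (auto intro!: F.finsum_closed)
  show "F.crd i (Kcomb i c y) b = (\<Sum>s<n. scal E (c s) (F.crd i (y s) b))"
       "F.crd i (Ecomb i y) b = (\<Sum>s<n. e s * F.crd i (y s) b)"
    using assms by (simp_all add: F.coords_finsum[OF *] F.coords_smult scal_left)
qed

lemma d_Kcomb:
  assumes "\<And>s. s < n \<Longrightarrow> y s \<in> carrier (cmod F i)"
  shows "cdiff F i (Kcomb i c y) = Kcomb (i + 1) c (\<lambda>s. cdiff F i (y s))"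
proof -
  have "cdiff F i (Kcomb i c y) = (\<Oplus>\<^bsub>cmod F (i + 1)\<^esub>s\<in>{..<n}. cdiff F i (scal E (c s) 1 \<odot>\<^bsub>cmod F i\<^esub> y s))"
    using assms by (intro d_simps) (auto simp: F.smult_closed)
  also have "\<dots> = Kcomb (i + 1) c (\<lambda>s. cdiff F i (y s))"
    using assms by (intro F.finsum_cong') (auto simp: F.smult_closed d_simps)
  finally show ?thesis .
qed

lemma d_Ecomb:
  assumes "\<And>s. s < n \<Longrightarrow> y s \<in> carrier (cmod F i)"
  shows "cdiff F i (Ecomb i y) = Ecomb (i + 1) (\<lambda>s. cdiff F i (y s))"
proof -
  have "cdiff F i (Ecomb i y) = (\<Oplus>\<^bsub>cmod F (i + 1)\<^esub>s\<in>{..<n}. cdiff F i (e s \<odot>\<^bsub>cmod F i\<^esub> y s))"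
    using assms by (intro d_simps) (auto simp: F.smult_closed)
  also have "\<dots> = Ecomb (i + 1) (\<lambda>s. cdiff F i (y s))"
    using assms by (intro F.finsum_cong') (auto simp: F.smult_closed d_simps)
  finally show ?thesis .
qed

lemma linear_part_exists: "m \<in> V_smult 1 (cmod F i) \<Longrightarrow> linear_part i m (\<lambda>s. F.mcoef i {s} m)"
  using F.linear_expansion[of m] F.V_smult_closed[of m 1] by (auto simp: linear_part_def F.mcoef_closed)

lemma linear_part_d:
  assumes "linear_part i m y" "m \<in> carrier (cmod F i)"
  shows "linear_part (i + 1) (cdiff F i m) (\<lambda>s. cdiff F i (y s))"
proof -
  have y: "y s \<in> carrier (cmod F i)" if "s < n" for s using assms that by (simp add: linear_part_def)
  have "cdiff F i (m \<ominus>\<^bsub>cmod F i\<^esub> Ecomb i y) \<in> V_smult 2 (cmod F (i + 1))"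
    using assms d_V_smult by (simp add: linear_part_def)
  then show ?thesis
    using y Ecomb_closed[of y i] assms(2) by (simp add: linear_part_def d_simps d_Ecomb)
qed

text \<open>Linear parts are unique modulo \<open>(V)\<close>, by freeness.\<close>

lemma linear_part_unique:
  assumes "linear_part i m y" "linear_part i m' y'" "m \<in> carrier (cmod F i)" "m' \<in> carrier (cmod F i)"
    "m \<ominus>\<^bsub>cmod F i\<^esub> m' \<in> V_smult 2 (cmod F i)" "s < n"
  shows "y s \<ominus>\<^bsub>cmod F i\<^esub> y' s \<in> V_smult 1 (cmod F i)"
proof (rule F.linear_coefficients_unique[where y = "\<lambda>s. y s \<ominus>\<^bsub>cmod F i\<^esub> y' s"])
  have y: "y s \<in> carrier (cmod F i)" "y' s \<in> carrier (cmod F i)" if "s < n" for s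
    using assms that by (auto simp: linear_part_def)
  show "y s \<ominus>\<^bsub>cmod F i\<^esub> y' s \<in> carrier (cmod F i)" if "s < n" for s using y that by simp
  have cl: "Ecomb i y \<in> carrier (cmod F i)" "Ecomb i y' \<in> carrier (cmod F i)"
      "Ecomb i (\<lambda>s. y s \<ominus>\<^bsub>cmod F i\<^esub> y' s) \<in> carrier (cmod F i)"
    using y by (auto intro!: Ecomb_closed)
  have "Ecomb i (\<lambda>s. y s \<ominus>\<^bsub>cmod F i\<^esub> y' s)
    = (m \<ominus>\<^bsub>cmod F i\<^esub> m') \<oplus>\<^bsub>cmod F i\<^esub> ((m' \<ominus>\<^bsub>cmod F i\<^esub> Ecomb i y') \<ominus>\<^bsub>cmod F i\<^esub> (m \<ominus>\<^bsub>cmod F i\<^esub> Ecomb i y))"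
    using y cl assms(3,4)
    by (intro F.coords_eqI[where i = i])
       (simp_all add: F.coords_add F.coords_diff coords_Ecomb right_diff_distrib sum_subtractf)
  also have "\<dots> \<in> V_smult 2 (cmod F i)"
    using assms by (auto simp: linear_part_def intro!: F.VM.sub_add F.VM.sub_diff)
  finally show "Ecomb i (\<lambda>s. y s \<ominus>\<^bsub>cmod F i\<^esub> y' s) \<in> V_smult 2 (cmod F i)" .
qed (use assms in simp)

text \<open>Applying \<open>d\<close> to \<open>d z \<equiv> \<Sum>\<^sub>s e\<^sub>s y\<^sub>s\<close> gives \<open>0 \<equiv> \<Sum>\<^sub>s e\<^sub>s d y\<^sub>s\<close>, so that \<open>d y\<^sub>s \<in> (V)F\<close> by uniqueness.\<close>

lemma linear_part_cocycle:
  assumes "z \<in> Zc i" "linear_part (i + 1) (cdiff F i z) y" "s < n"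
  shows "y s \<in> Zc (i + 1)"
proof -
  have z: "z \<in> carrier (cmod F i)" using assms Zc_closed by blast
  let ?j = "i + 1"
  have "linear_part (?j + 1) (cdiff F ?j (cdiff F i z)) (\<lambda>s. cdiff F ?j (y s))"
    using linear_part_d[OF assms(2)] z d_simps(1) by blast
  then have 1: "linear_part (?j + 1) \<zero>\<^bsub>cmod F (?j + 1)\<^esub> (\<lambda>s. cdiff F ?j (y s))"
    unfolding d_d[OF z] .
  have E0: "Ecomb (?j + 1) (\<lambda>s. \<zero>\<^bsub>cmod F (?j + 1)\<^esub>) = \<zero>\<^bsub>cmod F (?j + 1)\<^esub>"
    by (intro F.coords_eqI[where i = "?j + 1"]) (simp_all add: Ecomb_closed coords_Ecomb F.coords_zero)
  have 2: "linear_part (?j + 1) \<zero>\<^bsub>cmod F (?j + 1)\<^esub> (\<lambda>s. \<zero>\<^bsub>cmod F (?j + 1)\<^esub>)"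
    unfolding linear_part_def E0 by (simp add: F.VM.sub_zero)
  have "cdiff F ?j (y s) \<ominus>\<^bsub>cmod F (?j + 1)\<^esub> \<zero>\<^bsub>cmod F (?j + 1)\<^esub> \<in> V_smult 1 (cmod F (?j + 1))"
    by (rule linear_part_unique[OF 1 2 _ _ _ assms(3)]) (simp_all add: F.VM.sub_zero)
  moreover have "y s \<in> carrier (cmod F ?j)" using assms by (simp add: linear_part_def)
  ultimately show ?thesis
    unfolding Zc_def using d_simps(1)[of "y s" ?j] F.diff_zero_right by (simp only: mem_Collect_eq conj_absorb) 
qed

lemma Kcomb_Zc: "(\<And>s. s < n \<Longrightarrow> y s \<in> Zc i) \<Longrightarrow> Kcomb i c y \<in> Zc i"
  using Z.finsum_sub[of "\<lambda>s. scal E (c s) 1 \<odot>\<^bsub>cmod F i\<^esub> y s" "{..<n}" i]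
    abelian_monoid.finsum_closed[of "cmod F i\<lparr>carrier := Zc i\<rparr>" "\<lambda>s. scal E (c s) 1 \<odot>\<^bsub>cmod F i\<^esub> y s" "{..<n}"]
    Z.left_module_sub[of i] Z.sub_smult
  by (simp add: left_module_def abelian_group_def Pi_iff)

lemma cls_Kcomb:
  assumes "\<And>s. s < n \<Longrightarrow> y s \<in> Zc i"
  shows "cls i (Kcomb i c y) = (\<Oplus>\<^bsub>H i\<^esub>s\<in>{..<n}. c s \<odot>\<^bsub>H i\<^esub> cls i (y s))"
proof -
  have "cls i (Kcomb i c y) = (\<Oplus>\<^bsub>H i\<^esub>s\<in>{..<n}. cls i (scal E (c s) 1 \<odot>\<^bsub>cmod F i\<^esub> y s))"
    using assms by (intro cls_finsum) (auto simp: Z.sub_smult)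
  also have "\<dots> = (\<Oplus>\<^bsub>H i\<^esub>s\<in>{..<n}. c s \<odot>\<^bsub>H i\<^esub> cls i (y s))"
    using assms by (intro H.finsum_cong') (auto simp: cls_smult H.smult_closed cls_closed)
  finally show ?thesis .
qed

text \<open>The class obtained by contraction depends only on the class of \<open>z\<close>: if \<open>z\<close> changes by \<open>d u + r\<close> with
  \<open>r \<in> (V)F\<close>, then \<open>d z\<close> changes by \<open>d r\<close>, whose linear part is \<open>d\<close> of that of \<open>r\<close>.\<close>

lemma contraction_well_defined:
  assumes z: "z \<in> Zc i" "z' \<in> Zc i" "cls i z = cls i z'"
    and y: "linear_part (i + 1) (cdiff F i z) y" and y': "linear_part (i + 1) (cdiff F i z') y'"
  shows "cls (i + 1) (Kcomb (i + 1) c y) = cls (i + 1) (Kcomb (i + 1) c y')"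
proof -
  let ?j = "i + 1"
  have zc: "z \<in> carrier (cmod F i)" "z' \<in> carrier (cmod F i)" using z Zc_closed by auto
  have "z \<ominus>\<^bsub>cmod F i\<^esub> z' \<in> Bc i" using z by (simp add: cls_eq_iff)
  then obtain u r where u: "u \<in> carrier (cmod F (i - 1))" "r \<in> V_smult 1 (cmod F i)"
      "z \<ominus>\<^bsub>cmod F i\<^esub> z' = cdiff F (i - 1) u \<oplus>\<^bsub>cmod F i\<^esub> r" by (auto simp: Bc_def)
  have rc: "r \<in> carrier (cmod F i)" using u F.V_smult_closed by blast
  have "cdiff F i (z \<ominus>\<^bsub>cmod F i\<^esub> z') = cdiff F i r"
    unfolding u(3) using u rc by (simp add: d_simps d_simps' d_d')
  then have dz: "cdiff F i z \<ominus>\<^bsub>cmod F ?j\<^esub> cdiff F i z' = cdiff F i r" using zc by (simp add: d_simps)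
  let ?r = "\<lambda>s. F.mcoef i {s} r"
  have r: "?r s \<in> carrier (cmod F i)" for s using rc by (simp add: F.mcoef_closed)
  have lr: "linear_part ?j (cdiff F i r) (\<lambda>s. cdiff F i (?r s))"
    by (rule linear_part_d[OF linear_part_exists[OF u(2)] rc])
  have yc: "y s \<in> carrier (cmod F ?j)" "y' s \<in> carrier (cmod F ?j)" if "s < n" for s
    using y y' that by (auto simp: linear_part_def)
  define y'' where "y'' = (\<lambda>s. y' s \<oplus>\<^bsub>cmod F ?j\<^esub> cdiff F i (?r s))"
  have y''c: "y'' s \<in> carrier (cmod F ?j)" if "s < n" for s using yc that r by (simp add: y''_def d_simps)
  have ly'': "linear_part ?j (cdiff F i z) y''"
  proof -
    have cl: "Ecomb ?j y'' \<in> carrier (cmod F ?j)" "Ecomb ?j y' \<in> carrier (cmod F ?j)"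
        "Ecomb ?j (\<lambda>s. cdiff F i (?r s)) \<in> carrier (cmod F ?j)"
      using yc y''c r by (auto intro!: Ecomb_closed simp: d_simps)
    have "cdiff F i z = cdiff F i z' \<oplus>\<^bsub>cmod F ?j\<^esub> cdiff F i r"
      unfolding dz[symmetric] using zc by (intro F.coords_eqI[where i = ?j]) (simp_all add: F.coords_simps d_simps)
    then have "cdiff F i z \<ominus>\<^bsub>cmod F ?j\<^esub> Ecomb ?j y'' = (cdiff F i z' \<ominus>\<^bsub>cmod F ?j\<^esub> Ecomb ?j y')
        \<oplus>\<^bsub>cmod F ?j\<^esub> (cdiff F i r \<ominus>\<^bsub>cmod F ?j\<^esub> Ecomb ?j (\<lambda>s. cdiff F i (?r s)))"
      using yc y''c r cl zc rc
      by (intro F.coords_eqI[where i = ?j])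
         (simp_all add: F.coords_add F.coords_diff coords_Ecomb d_simps y''_def distrib_left sum.distrib)
    also have "\<dots> \<in> V_smult 2 (cmod F ?j)"
      using y' lr by (auto simp: linear_part_def intro: F.VM.sub_add)
    finally show ?thesis using y''c by (simp add: linear_part_def)
  qed
  let ?t = "\<lambda>s. y s \<ominus>\<^bsub>cmod F ?j\<^esub> y'' s"
  have t: "?t s \<in> V_smult 1 (cmod F ?j)" if "s < n" for s
    by (rule linear_part_unique[OF y ly'' _ _ _ that]) (simp_all add: d_simps zc F.minus_eq F.r_neg F.VM.sub_zero)
  have tc: "?t s \<in> carrier (cmod F ?j)" if "s < n" for s using t[OF that] F.V_smult_closed by blast
  have "Kcomb ?j c y \<ominus>\<^bsub>cmod F ?j\<^esub> Kcomb ?j c y' = cdiff F i (Kcomb i c ?r) \<oplus>\<^bsub>cmod F ?j\<^esub> Kcomb ?j c ?t"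
  proof -
    have cl: "Kcomb ?j c y \<in> carrier (cmod F ?j)" "Kcomb ?j c y' \<in> carrier (cmod F ?j)"
      "Kcomb ?j c (\<lambda>s. cdiff F i (?r s)) \<in> carrier (cmod F ?j)" "Kcomb ?j c ?t \<in> carrier (cmod F ?j)"
      using yc r tc by (auto intro!: Kcomb_closed simp: d_simps)
    show ?thesis
      using yc y''c r tc cl unfolding d_Kcomb[OF r]
      by (intro F.coords_eqI[where i = ?j])
         (simp_all add: F.coords_add F.coords_diff coords_Kcomb d_simps y''_def
           scale_right_diff_distrib scale_right_distrib sum.distrib sum_subtractf)
  qed
  also have "\<dots> \<in> Bc ?j"
  proof -
    have "Kcomb ?j c ?t \<in> V_smult 1 (cmod F ?j)"
      unfolding F.V_smult_iff
    proof (intro conjI allI)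
      fix b
      have "(\<Sum>s<n. scal E (c s) (F.crd ?j (?t s) b)) \<in> filt 1"
        using t unfolding F.V_smult_iff by (intro filt_sum filt_scal) auto
      then show "F.crd ?j (Kcomb ?j c ?t) b \<in> filt 1" using coords_Kcomb[OF tc] by simp
    qed (rule Kcomb_closed[OF tc])
    then show ?thesis using BcI[of "Kcomb i c ?r" ?j] r by (simp add: Kcomb_closed)
  qed
  finally show ?thesis
    using z y y' by (subst cls_eq_iff) (auto intro!: Kcomb_Zc linear_part_cocycle[of z i y] linear_part_cocycle[of z' i y'])
qed

text \<open>The connecting homomorphism is defined with arbitrary finite sums \<open>\<Sum>\<^sub>j v\<^sub>j y\<^sub>j\<close>.  Expanding the \<open>v\<^sub>j\<close> in the basis of
  \<open>V\<close> turns such a sum into one over the \<open>e\<^sub>s\<close> with the same contraction against \<open>w\<close>.\<close>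

lemma W_mult_eq:
  assumes w: "w \<in> dual_space E" and z: "z \<in> Zc i" and y: "linear_part (i + 1) (cdiff F i z) y"
  shows "W_mult E F i w (cls i z) = cls (i + 1) (Kcomb (i + 1) (\<lambda>s. w (e s)) y)"
proof -
  let ?M = "cmod F (i + 1)"
  have yc: "y s \<in> carrier ?M" if "s < n" for s using y that by (simp add: linear_part_def)
  show ?thesis unfolding W_mult_def
  proof (rule the_equality)
    show "\<exists>z' (k::nat) v y'. z' \<in> carrier (cmod F i) \<and> cdiff F i z' \<in> V_smult 1 ?M \<and> cls i z = cls i z' \<and>
       (\<forall>j<k. v j \<in> gens E \<and> y' j \<in> carrier ?M) \<and>
       cdiff F i z' \<ominus>\<^bsub>?M\<^esub> (\<Oplus>\<^bsub>?M\<^esub>j\<in>{..<k}. v j \<odot>\<^bsub>?M\<^esub> y' j) \<in> V_smult 2 ?M \<and>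
       cls (i + 1) (Kcomb (i + 1) (\<lambda>s. w (e s)) y) = cls (i + 1) (\<Oplus>\<^bsub>?M\<^esub>j\<in>{..<k}. scal E (w (v j)) 1 \<odot>\<^bsub>?M\<^esub> y' j)"
      using z y by (intro exI[of _ z] exI[of _ n] exI[of _ e] exI[of _ y]) (auto simp: Zc_def linear_part_def)
  next
    fix Y
    assume "\<exists>z' (k::nat) v y'. z' \<in> carrier (cmod F i) \<and> cdiff F i z' \<in> V_smult 1 ?M \<and> cls i z = cls i z' \<and>
       (\<forall>j<k. v j \<in> gens E \<and> y' j \<in> carrier ?M) \<and>
       cdiff F i z' \<ominus>\<^bsub>?M\<^esub> (\<Oplus>\<^bsub>?M\<^esub>j\<in>{..<k}. v j \<odot>\<^bsub>?M\<^esub> y' j) \<in> V_smult 2 ?M \<and>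
       Y = cls (i + 1) (\<Oplus>\<^bsub>?M\<^esub>j\<in>{..<k}. scal E (w (v j)) 1 \<odot>\<^bsub>?M\<^esub> y' j)"
    then obtain z' and k :: nat and v y' where *: "z' \<in> Zc i" "cls i z = cls i z'"
       "\<And>j. j < k \<Longrightarrow> v j \<in> gens E" "\<And>j. j < k \<Longrightarrow> y' j \<in> carrier ?M"
       "cdiff F i z' \<ominus>\<^bsub>?M\<^esub> (\<Oplus>\<^bsub>?M\<^esub>j\<in>{..<k}. v j \<odot>\<^bsub>?M\<^esub> y' j) \<in> V_smult 2 ?M"
       "Y = cls (i + 1) (\<Oplus>\<^bsub>?M\<^esub>j\<in>{..<k}. scal E (w (v j)) 1 \<odot>\<^bsub>?M\<^esub> y' j)"
      unfolding Zc_def by blast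
    define y'' where "y'' = (\<lambda>s. \<Oplus>\<^bsub>?M\<^esub>j\<in>{..<k}. scal E (coef {s} (v j)) 1 \<odot>\<^bsub>?M\<^esub> y' j)"
    have mem: "(\<lambda>j. r j \<odot>\<^bsub>?M\<^esub> y' j) \<in> {..<k} \<rightarrow> carrier ?M" for r using *(4) by (auto simp: F.smult_closed)
    have y''c: "y'' s \<in> carrier ?M" for s unfolding y''_def using mem by (intro F.finsum_closed)
    have cy'': "F.crd (i + 1) (y'' s) b = (\<Sum>j<k. scal E (coef {s} (v j)) (F.crd (i + 1) (y' j) b))" for s b
      unfolding y''_def F.coords_finsum[OF mem] using *(4) by (simp add: F.coords_smult scal_left)
    have 1: "(\<Oplus>\<^bsub>?M\<^esub>j\<in>{..<k}. v j \<odot>\<^bsub>?M\<^esub> y' j) = Ecomb (i + 1) y''"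
    proof (rule F.coords_eqI[where i = "i + 1"])
      fix b
      have "(\<Sum>j<k. v j * F.crd (i + 1) (y' j) b) = (\<Sum>j<k. (\<Sum>s<n. scal E (coef {s} (v j)) (e s)) * F.crd (i + 1) (y' j) b)"
        using *(3) gens_expand by (intro sum.cong) auto
      also have "\<dots> = (\<Sum>s<n. e s * (\<Sum>j<k. scal E (coef {s} (v j)) (F.crd (i + 1) (y' j) b)))"
        by (simp add: sum_distrib_left sum_distrib_right scal_left scal_right) (rule sum.swap)
      finally show "F.crd (i + 1) (\<Oplus>\<^bsub>?M\<^esub>j\<in>{..<k}. v j \<odot>\<^bsub>?M\<^esub> y' j) b = F.crd (i + 1) (Ecomb (i + 1) y'') b"
        using *(4) y''c by (simp add: F.coords_finsum[OF mem] F.coords_smult coords_Ecomb cy'')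
    qed (use mem y''c in \<open>auto intro: F.finsum_closed Ecomb_closed\<close>)
    have 2: "(\<Oplus>\<^bsub>?M\<^esub>j\<in>{..<k}. scal E (w (v j)) 1 \<odot>\<^bsub>?M\<^esub> y' j) = Kcomb (i + 1) (\<lambda>s. w (e s)) y''"
    proof (rule F.coords_eqI[where i = "i + 1"])
      fix b
      have "(\<Sum>j<k. scal E (w (v j)) (F.crd (i + 1) (y' j) b))
          = (\<Sum>j<k. scal E (\<Sum>s<n. coef {s} (v j) * w (e s)) (F.crd (i + 1) (y' j) b))"
        using *(3) dual_expand[OF w] by (intro sum.cong) auto
      also have "\<dots> = (\<Sum>s<n. scal E (w (e s)) (\<Sum>j<k. scal E (coef {s} (v j)) (F.crd (i + 1) (y' j) b)))"
        by (simp add: scale_sum_left scale_sum_right mult.commute) (rule sum.swap)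
      finally show "F.crd (i + 1) (\<Oplus>\<^bsub>?M\<^esub>j\<in>{..<k}. scal E (w (v j)) 1 \<odot>\<^bsub>?M\<^esub> y' j) b
          = F.crd (i + 1) (Kcomb (i + 1) (\<lambda>s. w (e s)) y'') b"
        using *(4) y''c by (simp add: F.coords_finsum[OF mem] F.coords_smult coords_Kcomb cy'' scal_left)
    qed (use mem y''c in \<open>auto intro: F.finsum_closed Kcomb_closed\<close>)
    have "linear_part (i + 1) (cdiff F i z') y''" using *(5) y''c by (simp add: linear_part_def 1)
    then show "Y = cls (i + 1) (Kcomb (i + 1) (\<lambda>s. w (e s)) y)"
      unfolding *(6) 2 using contraction_well_defined[OF *(1) z _ _ y] *(2) by simp
  qed
qed

text \<open>The canonical choice of linear coefficients for \<open>d z\<close>, with values in the \<open>K\<close>-span of the basis.\<close>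

definition dpart :: "int \<Rightarrow> 'm \<Rightarrow> nat \<Rightarrow> 'm" where
  "dpart i z s = F.mcoef (i + 1) {s} (cdiff F i z)"

lemma linear_part_dpart: "z \<in> Zc i \<Longrightarrow> linear_part (i + 1) (cdiff F i z) (dpart i z)"
  unfolding dpart_def using linear_part_exists by (simp add: Zc_def)

lemma dpart_Zc: "z \<in> Zc i \<Longrightarrow> s < n \<Longrightarrow> dpart i z s \<in> Zc (i + 1)"
  using linear_part_cocycle linear_part_dpart by blast

lemma W_mult_dpart:
  assumes "w \<in> dual_space E" "z \<in> Zc i"
  shows "W_mult E F i w (cls i z) = (\<Oplus>\<^bsub>H (i + 1)\<^esub>s\<in>{..<n}. w (e s) \<odot>\<^bsub>H (i + 1)\<^esub> cls (i + 1) (dpart i z s))"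
  using W_mult_eq[OF assms linear_part_dpart[OF assms(2)]] cls_Kcomb[of "dpart i z" "i + 1"] dpart_Zc[OF assms(2)]
  by simp

lemma linear_part_add:
  assumes "linear_part i m y" "linear_part i m' y'" "m \<in> carrier (cmod F i)" "m' \<in> carrier (cmod F i)"
  shows "linear_part i (m \<oplus>\<^bsub>cmod F i\<^esub> m') (\<lambda>s. y s \<oplus>\<^bsub>cmod F i\<^esub> y' s)"
proof -
  have y: "y s \<in> carrier (cmod F i)" "y' s \<in> carrier (cmod F i)" if "s < n" for s
    using assms that by (auto simp: linear_part_def)
  have "(m \<oplus>\<^bsub>cmod F i\<^esub> m') \<ominus>\<^bsub>cmod F i\<^esub> Ecomb i (\<lambda>s. y s \<oplus>\<^bsub>cmod F i\<^esub> y' s)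
      = (m \<ominus>\<^bsub>cmod F i\<^esub> Ecomb i y) \<oplus>\<^bsub>cmod F i\<^esub> (m' \<ominus>\<^bsub>cmod F i\<^esub> Ecomb i y')"
    using y assms(3,4)
    by (intro F.coords_eqI[where i = i])
       (simp_all add: F.coords_add F.coords_diff coords_Ecomb Ecomb_closed distrib_left sum.distrib)
  moreover have "\<dots> \<in> V_smult 2 (cmod F i)"
    using assms by (auto simp: linear_part_def intro: F.VM.sub_add)
  ultimately show ?thesis using y by (simp add: linear_part_def)
qed

lemma linear_part_scal:
  assumes "linear_part i m y" "m \<in> carrier (cmod F i)"
  shows "linear_part i (scal E a 1 \<odot>\<^bsub>cmod F i\<^esub> m) (\<lambda>s. scal E a 1 \<odot>\<^bsub>cmod F i\<^esub> y s)"
proof -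
  have y: "y s \<in> carrier (cmod F i)" if "s < n" for s
    using assms that by (auto simp: linear_part_def)
  have "(scal E a 1 \<odot>\<^bsub>cmod F i\<^esub> m) \<ominus>\<^bsub>cmod F i\<^esub> Ecomb i (\<lambda>s. scal E a 1 \<odot>\<^bsub>cmod F i\<^esub> y s)
      = scal E a 1 \<odot>\<^bsub>cmod F i\<^esub> (m \<ominus>\<^bsub>cmod F i\<^esub> Ecomb i y)"
    using y assms(2)
    by (intro F.coords_eqI[where i = i])
       (simp_all add: F.coords_smult F.coords_diff F.smult_closed coords_Ecomb Ecomb_closed scal_left scal_right
         scale_right_diff_distrib scale_sum_right)
  moreover have "\<dots> \<in> V_smult 2 (cmod F i)"
    using assms by (auto simp: linear_part_def intro: F.VM.sub_smult)
  ultimately show ?thesis using y by (simp add: linear_part_def F.smult_closed)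
qed

lemma W_mult_hom:
  assumes "w \<in> dual_space E" shows "left_hom (H i) (H (i + 1)) (W_mult E F i w)"
  unfolding left_hom_def
proof (intro conjI ballI allI)
  let ?c = "\<lambda>s. w (e s)"
  show "W_mult E F i w \<in> carrier (H i) \<rightarrow> carrier (H (i + 1))"
  proof
    fix h assume "h \<in> carrier (H i)"
    then obtain z where z: "z \<in> Zc i" "h = cls i z" using cls_surj by blast
    then show "W_mult E F i w h \<in> carrier (H (i + 1))"
      using W_mult_eq[OF assms z(1) linear_part_dpart[OF z(1)]] dpart_Zc[OF z(1)] by (simp add: cls_closed Kcomb_Zc)
  qed
next
  let ?c = "\<lambda>s. w (e s)"
  fix x y assume "x \<in> carrier (H i)" "y \<in> carrier (H i)"
  then obtain z z' where z: "z \<in> Zc i" "x = cls i z" "z' \<in> Zc i" "y = cls i z'" using cls_surj by metis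
  let ?M = "cmod F (i + 1)"
  have c: "z \<in> carrier (cmod F i)" "z' \<in> carrier (cmod F i)" using z Zc_closed by auto
  have dc: "dpart i z s \<in> carrier ?M" "dpart i z' s \<in> carrier ?M" if "s < n" for s
    using z dpart_Zc[OF _ that] Zc_closed by auto
  have "linear_part (i + 1) (cdiff F i (z \<oplus>\<^bsub>cmod F i\<^esub> z')) (\<lambda>s. dpart i z s \<oplus>\<^bsub>?M\<^esub> dpart i z' s)"
    using linear_part_add[OF linear_part_dpart[OF z(1)] linear_part_dpart[OF z(3)]] c by (simp add: d_simps)
  then have "W_mult E F i w (x \<oplus>\<^bsub>H i\<^esub> y) = cls (i + 1) (Kcomb (i + 1) (\<lambda>s. w (e s)) (\<lambda>s. dpart i z s \<oplus>\<^bsub>?M\<^esub> dpart i z' s))"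
    using z W_mult_eq[OF assms, of "z \<oplus>\<^bsub>cmod F i\<^esub> z'" i] by (simp add: cls_add[symmetric] Z.sub_add)
  also have "Kcomb (i + 1) (\<lambda>s. w (e s)) (\<lambda>s. dpart i z s \<oplus>\<^bsub>?M\<^esub> dpart i z' s)
      = Kcomb (i + 1) ?c (dpart i z) \<oplus>\<^bsub>?M\<^esub> Kcomb (i + 1) ?c (dpart i z')"
    using dc by (intro F.coords_eqI[where i = "i + 1"])
      (simp_all add: F.coords_add coords_Kcomb Kcomb_closed scale_right_distrib sum.distrib)
  also have "cls (i + 1) \<dots> = W_mult E F i w x \<oplus>\<^bsub>H (i + 1)\<^esub> W_mult E F i w y"
    using z dpart_Zc W_mult_eq[OF assms _ linear_part_dpart] by (simp add: cls_add Kcomb_Zc)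
  finally show "W_mult E F i w (x \<oplus>\<^bsub>H i\<^esub> y) = W_mult E F i w x \<oplus>\<^bsub>H (i + 1)\<^esub> W_mult E F i w y" .
next
  let ?c = "\<lambda>s. w (e s)"
  fix a x assume "x \<in> carrier (H i)"
  then obtain z where z: "z \<in> Zc i" "x = cls i z" using cls_surj by metis
  let ?M = "cmod F (i + 1)"
  have c: "z \<in> carrier (cmod F i)" using z Zc_closed by auto
  have dc: "dpart i z s \<in> carrier ?M" if "s < n" for s
    using z dpart_Zc[OF _ that] Zc_closed by auto
  have "linear_part (i + 1) (cdiff F i (scal E a 1 \<odot>\<^bsub>cmod F i\<^esub> z)) (\<lambda>s. scal E a 1 \<odot>\<^bsub>?M\<^esub> dpart i z s)"
    using linear_part_scal[OF linear_part_dpart[OF z(1)]] c by (simp add: d_simps)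
  then have "W_mult E F i w (a \<odot>\<^bsub>H i\<^esub> x) = cls (i + 1) (Kcomb (i + 1) (\<lambda>s. w (e s)) (\<lambda>s. scal E a 1 \<odot>\<^bsub>?M\<^esub> dpart i z s))"
    using z W_mult_eq[OF assms, of "scal E a 1 \<odot>\<^bsub>cmod F i\<^esub> z" i] by (simp add: cls_smult[symmetric] Z.sub_smult)
  also have "Kcomb (i + 1) (\<lambda>s. w (e s)) (\<lambda>s. scal E a 1 \<odot>\<^bsub>?M\<^esub> dpart i z s) = scal E a 1 \<odot>\<^bsub>?M\<^esub> Kcomb (i + 1) ?c (dpart i z)"
    using dc by (intro F.coords_eqI[where i = "i + 1"])
      (simp_all add: F.coords_smult coords_Kcomb Kcomb_closed F.smult_closed scal_left scale_sum_right mult.commute)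
  also have "cls (i + 1) \<dots> = a \<odot>\<^bsub>H (i + 1)\<^esub> W_mult E F i w x"
    using z dpart_Zc W_mult_eq[OF assms _ linear_part_dpart] by (simp add: cls_smult Kcomb_Zc)
  finally show "W_mult E F i w (a \<odot>\<^bsub>H i\<^esub> x) = a \<odot>\<^bsub>H (i + 1)\<^esub> W_mult E F i w x" .
qed

text \<open>Write \<open>d z = \<Sum>\<^sub>a e\<^sub>a y\<^sub>a + r\<close> with \<open>r \<in> (V)\<^sup>2F\<close> and \<open>d y\<^sub>a \<equiv> \<Sum>\<^sub>c e\<^sub>c y\<^sub>a\<^sub>c\<close>.  For \<open>s < t\<close> the coefficient of \<open>e\<^sub>s e\<^sub>t\<close> in
  \<open>0 = d d z\<close> is \<open>y\<^sub>s\<^sub>t - y\<^sub>t\<^sub>s + d r\<^sub>s\<^sub>t\<close> modulo \<open>(V)\<close>, where \<open>r\<^sub>s\<^sub>t\<close> is the coefficient of \<open>e\<^sub>s e\<^sub>t\<close> in \<open>r\<close>.  So the quadratic part of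
  \<open>d z\<close> contributes a coboundary, and the iterated linear parts agree in cohomology.\<close>

lemma dpart_dpart_symmetric:
  assumes z: "z \<in> Zc i" and st: "s < n" "t < n"
  shows "cls (i + 1 + 1) (dpart (i + 1) (dpart i z s) t) = cls (i + 1 + 1) (dpart (i + 1) (dpart i z t) s)"
proof -
  let ?j = "i + 1" and ?y = "\<lambda>s. dpart i z s" and ?yy = "\<lambda>s t. dpart (i + 1) (dpart i z s) t"
  have zc: "z \<in> carrier (cmod F i)" using z Zc_closed by blast
  have yZ: "?y s \<in> Zc ?j" if "s < n" for s using dpart_Zc[OF z that] .
  have yyZ: "?yy s t \<in> Zc (?j + 1)" if "s < n" "t < n" for s t using dpart_Zc[OF yZ] that by blast
  have yc: "?y s \<in> carrier (cmod F ?j)" if "s < n" for s using yZ[OF that] Zc_closed by blast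
  have yyc: "?yy s t \<in> carrier (cmod F (?j + 1))" if "s < n" "t < n" for s t using yyZ[OF that] Zc_closed by blast
  define r where "r = cdiff F i z \<ominus>\<^bsub>cmod F ?j\<^esub> Ecomb ?j ?y"
  have r: "r \<in> V_smult 2 (cmod F ?j)" using linear_part_dpart[OF z] by (simp add: linear_part_def r_def)
  have rc: "r \<in> carrier (cmod F ?j)" using r F.V_smult_closed by blast
  have dr: "cdiff F ?j r = \<ominus>\<^bsub>cmod F (?j + 1)\<^esub> Ecomb (?j + 1) (\<lambda>s. cdiff F ?j (?y s))"
  proof -
    have "cdiff F ?j r = cdiff F ?j (cdiff F i z) \<ominus>\<^bsub>cmod F (?j + 1)\<^esub> cdiff F ?j (Ecomb ?j ?y)"
      unfolding r_def using zc Ecomb_closed[OF yc] d_simps(1) by (intro d_simps(6)) auto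
    also have "cdiff F ?j (Ecomb ?j ?y) = Ecomb (?j + 1) (\<lambda>s. cdiff F ?j (?y s))" by (rule d_Ecomb[OF yc])
    finally show ?thesis unfolding d_d[OF zc]
      using Ecomb_closed[of "\<lambda>s. cdiff F ?j (?y s)" "?j + 1"] yc d_simps(1)[of _ ?j] by (simp add: F.minus_eq)
  qed
  have main: "cls (?j + 1) (?yy s t) = cls (?j + 1) (?yy t s)" if st: "s < t" "t < n" for s t
  proof -
    have s: "s < n" using st by simp
    let ?rst = "F.mcoef ?j {s, t} r"
    have rstc: "?rst \<in> carrier (cmod F ?j)" using rc by (rule F.mcoef_closed)
    have "?yy s t \<ominus>\<^bsub>cmod F (?j + 1)\<^esub> ?yy t s \<oplus>\<^bsub>cmod F (?j + 1)\<^esub> cdiff F ?j ?rst \<in> V_smult 1 (cmod F (?j + 1))"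
      unfolding F.V_smult_iff filt_1_iff
    proof (intro conjI allI)
      show "?yy s t \<ominus>\<^bsub>cmod F (?j + 1)\<^esub> ?yy t s \<oplus>\<^bsub>cmod F (?j + 1)\<^esub> cdiff F ?j ?rst \<in> carrier (cmod F (?j + 1))"
        using yyc[OF s st(2)] yyc[OF st(2) s] d_simps(1)[OF rstc] by (intro F.a_closed F.minus_closed)
      fix b
      let ?c = "F.crd (?j + 1)"
      have pair: "coef {s, t} (e a * ?c (cdiff F ?j (?y a)) b)
          = (if a = s then coef {} (?c (?yy s t) b) else if a = t then - coef {} (?c (?yy t s) b) else 0)"
        if a: "a < n" for a
      proof -
        let ?\<rho> = "cdiff F ?j (?y a) \<ominus>\<^bsub>cmod F (?j + 1)\<^esub> Ecomb (?j + 1) (?yy a)"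
        have \<rho>: "?\<rho> \<in> V_smult 2 (cmod F (?j + 1))"
          using linear_part_dpart[OF yZ[OF a]] unfolding linear_part_def by blast
        have "?c (cdiff F ?j (?y a)) b = ?c ?\<rho> b + ?c (Ecomb (?j + 1) (?yy a)) b"
          using yyc[OF a] Ecomb_closed[of "?yy a" "?j + 1"] d_simps(1)[OF yc[OF a]] by (simp add: F.coords_diff)
        also have "?c (Ecomb (?j + 1) (?yy a)) b = (\<Sum>c<n. e c * ?c (?yy a c) b)"
          by (rule coords_Ecomb) (rule yyc[OF a])
        finally have "coef {s, t} (e a * ?c (cdiff F ?j (?y a)) b)
            = coef {s, t} (e a * ?c ?\<rho> b) + (\<Sum>c<n. coef {s, t} (e a * e c * ?c (?yy a c) b))"
          by (simp add: distrib_left sum_distrib_left mult.assoc)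
        also have "coef {s, t} (e a * ?c ?\<rho> b) = 0"
        proof -
          have "e a * ?c ?\<rho> b \<in> filt (1 + 2)"
            using \<rho> e_in_filt[OF a] unfolding F.V_smult_iff by (intro filt_mult) auto
          then show ?thesis using st s by (simp add: filt_def)
        qed
        also have "(\<Sum>c<n. coef {s, t} (e a * e c * ?c (?yy a c) b))
            = (\<Sum>c<n. (if a = s \<and> c = t then 1 else if a = t \<and> c = s then - 1 else 0) * coef {} (?c (?yy a c) b))"
        proof (intro sum.cong refl)
          fix c assume c: "c \<in> {..<n}"
          have "e a * e c \<in> filt (1 + 1)" using a c by (intro filt_mult e_in_filt) auto
          moreover have "card {s, t} = 1 + 1" using st by simp
          ultimately have "e a * e c \<in> filt (card {s, t})" by (simp only:)
          then have "coef {s, t} (e a * e c * ?c (?yy a c) b) = coef {s, t} (e a * e c) * coef {} (?c (?yy a c) b)"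
            by (rule coef_leading_mult[rotated]) (use st s in simp)
          then show "coef {s, t} (e a * e c * ?c (?yy a c) b)
              = (if a = s \<and> c = t then 1 else if a = t \<and> c = s then - 1 else 0) * coef {} (?c (?yy a c) b)"
            using coef_pair[OF st a] c by simp
        qed
        also have "\<dots> = (\<Sum>c<n. if c = (if a = s then t else s) then
            (if a = s then coef {} (?c (?yy a c) b) else if a = t then - coef {} (?c (?yy a c) b) else 0) else 0)"
          using st by (intro sum.cong) auto
        also have "\<dots> = (if a = s then coef {} (?c (?yy s t) b) else if a = t then - coef {} (?c (?yy t s) b) else 0)"
          using st s by auto
        finally show ?thesis by simp
      qed
      have Ec: "cdiff F ?j (?y a) \<in> carrier (cmod F (?j + 1))" if "a < n" for a
        using d_simps(1)[OF yc[OF that]] .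
      have cl: "Ecomb (?j + 1) (\<lambda>s. cdiff F ?j (?y s)) \<in> carrier (cmod F (?j + 1))"
        by (rule Ecomb_closed) (rule Ec)
      have cE: "?c (Ecomb (?j + 1) (\<lambda>s. cdiff F ?j (?y s))) b = (\<Sum>a<n. e a * ?c (cdiff F ?j (?y a)) b)"
        by (rule coords_Ecomb) (rule Ec)
      have "coef {s, t} (?c (cdiff F ?j r) b) = - (\<Sum>a<n. coef {s, t} (e a * ?c (cdiff F ?j (?y a)) b))"
        unfolding dr F.coords_minus[OF cl] cE by simp
      also have "(\<Sum>a<n. coef {s, t} (e a * ?c (cdiff F ?j (?y a)) b))
          = (\<Sum>a<n. (if a = s then coef {} (?c (?yy s t) b) else 0) + (if a = t then - coef {} (?c (?yy t s) b) else 0))"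
      proof (intro sum.cong refl)
        fix a assume "a \<in> {..<n}"
        then have "a < n" by simp
        show "coef {s, t} (e a * ?c (cdiff F ?j (?y a)) b)
          = (if a = s then coef {} (?c (?yy s t) b) else 0) + (if a = t then - coef {} (?c (?yy t s) b) else 0)"
          unfolding pair[OF \<open>a < n\<close>] using st by auto
      qed
      also have "\<dots> = coef {} (?c (?yy s t) b) - coef {} (?c (?yy t s) b)"
        using st s by (simp add: sum.distrib)
      also have "coef {s, t} (?c (cdiff F ?j r) b) = coef {} (?c (cdiff F ?j ?rst) b)"
        using st s by (intro leading_coefficient_hom[OF F.free_E_module_axioms F.free_E_module_axioms d_hom r]) auto
      finally show "coef {} (?c (?yy s t \<ominus>\<^bsub>cmod F (?j + 1)\<^esub> ?yy t s \<oplus>\<^bsub>cmod F (?j + 1)\<^esub> cdiff F ?j ?rst) b) = 0"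
        using yyc[OF s st(2)] yyc[OF st(2) s] d_simps(1)[OF rstc]
        by (simp add: F.coords_add F.coords_diff)
    qed
    then have "cdiff F ?j (\<ominus>\<^bsub>cmod F ?j\<^esub> ?rst) \<oplus>\<^bsub>cmod F (?j + 1)\<^esub>
        (?yy s t \<ominus>\<^bsub>cmod F (?j + 1)\<^esub> ?yy t s \<oplus>\<^bsub>cmod F (?j + 1)\<^esub> cdiff F ?j ?rst) \<in> Bc (?j + 1)"
      using rstc by (intro BcI' F.a_inv_closed)
    also have "cdiff F ?j (\<ominus>\<^bsub>cmod F ?j\<^esub> ?rst) \<oplus>\<^bsub>cmod F (?j + 1)\<^esub>
        (?yy s t \<ominus>\<^bsub>cmod F (?j + 1)\<^esub> ?yy t s \<oplus>\<^bsub>cmod F (?j + 1)\<^esub> cdiff F ?j ?rst) = ?yy s t \<ominus>\<^bsub>cmod F (?j + 1)\<^esub> ?yy t s"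
      unfolding d_simps(5)[OF rstc]
      using yyc[OF s st(2)] yyc[OF st(2) s] d_simps(1)[OF rstc]
      by (intro F.coords_eqI[where i = "?j + 1"]) (simp_all add: F.coords_simps)
    finally show ?thesis using yyZ[OF s st(2)] yyZ[OF st(2) s] by (simp only: cls_eq_iff)
  qed
  consider "s < t" | "s = t" | "t < s" by linarith
  then show ?thesis using main[of s t] main[of t s] st by cases auto
qed

text \<open>Both sides are bilinear expressions in the classes of the iterated linear parts of \<open>d z\<close>, which are symmetric.\<close>

lemma W_mult_commute:
  assumes w: "w \<in> dual_space E" "w' \<in> dual_space E" and h: "h \<in> carrier (H i)"
  shows "W_mult E F (i + 1) w (W_mult E F i w' h) = W_mult E F (i + 1) w' (W_mult E F i w h)"
proof -
  obtain z where z: "z \<in> Zc i" "h = cls i z" using h cls_surj by blast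
  let ?H = "H (i + 1 + 1)" and ?x = "\<lambda>s t. cls (i + 1 + 1) (dpart (i + 1) (dpart i z s) t)"
  have yc: "cls (i + 1) (dpart i z s) \<in> carrier (H (i + 1))" if "s < n" for s
    using dpart_Zc[OF z(1) that] by (rule cls_closed)
  have xc: "?x s t \<in> carrier ?H" if "s < n" "t < n" for s t
    using dpart_Zc[OF dpart_Zc[OF z(1) that(1)] that(2)] by (rule cls_closed)
  have expand: "W_mult E F (i + 1) u (W_mult E F i u' h)
      = (\<Oplus>\<^bsub>?H\<^esub>s\<in>{..<n}. \<Oplus>\<^bsub>?H\<^esub>t\<in>{..<n}. (u' (e s) * u (e t)) \<odot>\<^bsub>?H\<^esub> ?x s t)"
    if u: "u \<in> dual_space E" "u' \<in> dual_space E" for u u'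
  proof -
    note hom = left_module_H left_module_H W_mult_hom[OF u(1), of "i + 1"]
    have "W_mult E F (i + 1) u (W_mult E F i u' h)
        = (\<Oplus>\<^bsub>?H\<^esub>s\<in>{..<n}. W_mult E F (i + 1) u (u' (e s) \<odot>\<^bsub>H (i + 1)\<^esub> cls (i + 1) (dpart i z s)))"
      unfolding z(2) W_mult_dpart[OF u(2) z(1)] using yc by (intro left_hom_finsum[OF hom]) (auto simp: H.smult_closed)
    also have "\<dots> = (\<Oplus>\<^bsub>?H\<^esub>s\<in>{..<n}. \<Oplus>\<^bsub>?H\<^esub>t\<in>{..<n}. (u' (e s) * u (e t)) \<odot>\<^bsub>?H\<^esub> ?x s t)"
    proof (intro H.finsum_cong' refl)
      fix s assume s: "s \<in> {..<n}"
      have "W_mult E F (i + 1) u (u' (e s) \<odot>\<^bsub>H (i + 1)\<^esub> cls (i + 1) (dpart i z s))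
          = u' (e s) \<odot>\<^bsub>?H\<^esub> (\<Oplus>\<^bsub>?H\<^esub>t\<in>{..<n}. u (e t) \<odot>\<^bsub>?H\<^esub> ?x s t)"
        using s yc left_hom_smult[OF hom] W_mult_dpart[OF u(1) dpart_Zc[OF z(1), of s]] by simp
      also have "\<dots> = (\<Oplus>\<^bsub>?H\<^esub>t\<in>{..<n}. u' (e s) \<odot>\<^bsub>?H\<^esub> (u (e t) \<odot>\<^bsub>?H\<^esub> ?x s t))"
        using s xc H.smult_closed[where i = "i + 1 + 1"] by (intro H.finsum_smult[where i = "i + 1 + 1"]) auto
      also have "\<dots> = (\<Oplus>\<^bsub>?H\<^esub>t\<in>{..<n}. (u' (e s) * u (e t)) \<odot>\<^bsub>?H\<^esub> ?x s t)"
        using s xc H.smult_closed[where i = "i + 1 + 1"] H.smult_assoc[where i = "i + 1 + 1"]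
        by (intro H.finsum_cong'[where i = "i + 1 + 1"]) auto
      finally show "W_mult E F (i + 1) u (u' (e s) \<odot>\<^bsub>H (i + 1)\<^esub> cls (i + 1) (dpart i z s))
          = (\<Oplus>\<^bsub>?H\<^esub>t\<in>{..<n}. (u' (e s) * u (e t)) \<odot>\<^bsub>?H\<^esub> ?x s t)" .
    next
      show "(\<lambda>s. \<Oplus>\<^bsub>?H\<^esub>t\<in>{..<n}. (u' (e s) * u (e t)) \<odot>\<^bsub>?H\<^esub> ?x s t) \<in> {..<n} \<rightarrow> carrier ?H"
        using xc H.smult_closed[where i = "i + 1 + 1"] by (auto intro!: H.finsum_closed[where i = "i + 1 + 1"])
    qed
    finally show ?thesis .
  qed
  have "(\<Oplus>\<^bsub>?H\<^esub>s\<in>{..<n}. \<Oplus>\<^bsub>?H\<^esub>t\<in>{..<n}. (w' (e s) * w (e t)) \<odot>\<^bsub>?H\<^esub> ?x s t)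
      = (\<Oplus>\<^bsub>?H\<^esub>t\<in>{..<n}. \<Oplus>\<^bsub>?H\<^esub>s\<in>{..<n}. (w' (e s) * w (e t)) \<odot>\<^bsub>?H\<^esub> ?x s t)"
    using xc H.smult_closed[where i = "i + 1 + 1"] by (intro H.finsum_swap[where i = "i + 1 + 1"]) auto
  also have "\<dots> = (\<Oplus>\<^bsub>?H\<^esub>t\<in>{..<n}. \<Oplus>\<^bsub>?H\<^esub>s\<in>{..<n}. (w (e t) * w' (e s)) \<odot>\<^bsub>?H\<^esub> ?x t s)"
  proof -
    have "(\<Oplus>\<^bsub>?H\<^esub>s\<in>{..<n}. (w' (e s) * w (e t)) \<odot>\<^bsub>?H\<^esub> ?x s t) = (\<Oplus>\<^bsub>?H\<^esub>s\<in>{..<n}. (w (e t) * w' (e s)) \<odot>\<^bsub>?H\<^esub> ?x t s)"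
      if "t < n" for t
    proof (intro H.finsum_cong'[where i = "i + 1 + 1"] refl)
      show "(\<lambda>s. (w (e t) * w' (e s)) \<odot>\<^bsub>?H\<^esub> ?x t s) \<in> {..<n} \<rightarrow> carrier ?H"
        using that xc H.smult_closed[where i = "i + 1 + 1"] by auto
      fix s assume "s \<in> {..<n}"
      then show "(w' (e s) * w (e t)) \<odot>\<^bsub>?H\<^esub> ?x s t = (w (e t) * w' (e s)) \<odot>\<^bsub>?H\<^esub> ?x t s"
        using dpart_dpart_symmetric[OF z(1), of s t] that by (metis lessThan_iff mult.commute)
    qed
    note row = this
    show ?thesis
    proof (rule H.finsum_cong'[where i = "i + 1 + 1"])
      show "(\<lambda>t. \<Oplus>\<^bsub>?H\<^esub>s\<in>{..<n}. (w (e t) * w' (e s)) \<odot>\<^bsub>?H\<^esub> ?x t s) \<in> {..<n} \<rightarrow> carrier ?H"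
        using xc H.smult_closed[where i = "i + 1 + 1"] by (auto intro!: H.finsum_closed[where i = "i + 1 + 1"])
    qed (simp_all only: row lessThan_iff)
  qed
  finally show ?thesis using expand[OF w] expand[OF w(2,1)] by simp
qed

lemma W_mult_gr:
  assumes "graded" "w \<in> dual_space E" "h \<in> cohomology_gr KF i d"
  shows "W_mult E F i w h \<in> cohomology_gr KF (i + 1) (d + 1)"
proof -
  interpret G: graded_free_E_module E n e "cmod F (i + 1)" "B (i + 1)" "cgr F (i + 1)" by (rule graded_F[OF assms(1)])
  obtain z where z: "z \<in> Zc i" "z \<in> cgr F i d" "h = cls i z"
    using assms by (auto simp: cohomology_gr_eq)
  have y: "dpart i z s \<in> cgr F (i + 1) (d + 1)" if "s < n" for s
    using G.mcoef_gr[OF d_gr[OF assms(1) z(2)], of "{s}"] that by (simp add: dpart_def)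
  have "Kcomb (i + 1) (\<lambda>s. w (e s)) (dpart i z) \<in> cgr F (i + 1) (d + 1)"
    using y G.gr_smult[OF scal_one_deg] by (intro G.gr_finsum) fastforce
  moreover have "Kcomb (i + 1) (\<lambda>s. w (e s)) (dpart i z) \<in> Zc (i + 1)"
    using z(1) by (intro Kcomb_Zc dpart_Zc)
  ultimately show ?thesis
    using W_mult_eq[OF assms(2) z(1) linear_part_dpart[OF z(1)]] z(3) assms(1) by (simp add: cohomology_gr_eq)
qed

lemma is_sym_module_H: "is_sym_module graded E (H_K_tensor E F)"
proof -
  have lin: "W_mult E F i (\<lambda>v. a * w v + a' * w' v) h
      = a \<odot>\<^bsub>H (i + 1)\<^esub> W_mult E F i w h \<oplus>\<^bsub>H (i + 1)\<^esub> a' \<odot>\<^bsub>H (i + 1)\<^esub> W_mult E F i w' h"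
    if w: "w \<in> dual_space E" "w' \<in> dual_space E" and h: "h \<in> carrier (H i)" for a a' w w' i h
  proof -
    obtain z where z: "z \<in> Zc i" "h = cls i z" using h cls_surj by blast
    have u: "(\<lambda>v. a * w v + a' * w' v) \<in> dual_space E"
      using w by (auto simp: dual_space_def algebra_simps)
    have yZ: "dpart i z s \<in> Zc (i + 1)" if "s < n" for s using dpart_Zc[OF z(1) that] .
    have yc: "dpart i z s \<in> carrier (cmod F (i + 1))" if "s < n" for s using yZ[OF that] Zc_closed by blast
    have "Kcomb (i + 1) (\<lambda>s. a * w (e s) + a' * w' (e s)) (dpart i z)
        = scal E a 1 \<odot>\<^bsub>cmod F (i + 1)\<^esub> Kcomb (i + 1) (\<lambda>s. w (e s)) (dpart i z)
          \<oplus>\<^bsub>cmod F (i + 1)\<^esub> scal E a' 1 \<odot>\<^bsub>cmod F (i + 1)\<^esub> Kcomb (i + 1) (\<lambda>s. w' (e s)) (dpart i z)"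
    proof (rule F.coords_eqI[where i = "i + 1"])
      fix b
      let ?c = "\<lambda>s. F.crd (i + 1) (dpart i z s) b"
      have "F.crd (i + 1) (Kcomb (i + 1) (\<lambda>s. a * w (e s) + a' * w' (e s)) (dpart i z)) b
          = (\<Sum>s<n. scal E (a * w (e s) + a' * w' (e s)) (?c s))"
        by (rule coords_Kcomb) (rule yc)
      also have "\<dots> = scal E a (\<Sum>s<n. scal E (w (e s)) (?c s)) + scal E a' (\<Sum>s<n. scal E (w' (e s)) (?c s))"
        by (simp add: scale_sum_right scale_left_distrib sum.distrib)
      finally show "F.crd (i + 1) (Kcomb (i + 1) (\<lambda>s. a * w (e s) + a' * w' (e s)) (dpart i z)) b
        = F.crd (i + 1) (scal E a 1 \<odot>\<^bsub>cmod F (i + 1)\<^esub> Kcomb (i + 1) (\<lambda>s. w (e s)) (dpart i z)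
          \<oplus>\<^bsub>cmod F (i + 1)\<^esub> scal E a' 1 \<odot>\<^bsub>cmod F (i + 1)\<^esub> Kcomb (i + 1) (\<lambda>s. w' (e s)) (dpart i z)) b"
        using yc by (simp add: F.coords_add F.coords_smult coords_Kcomb Kcomb_closed F.smult_closed scal_left)
    qed (use yc in \<open>auto intro!: Kcomb_closed F.smult_closed F.a_closed\<close>)
    then show ?thesis
      using W_mult_eq[OF _ z(1) linear_part_dpart[OF z(1)]] w u yZ
      by (simp add: z(2) cls_add cls_smult Kcomb_Zc Z.sub_smult)
  qed
  have closed: "W_mult E F i w h \<in> carrier (H (i + 1))" if "w \<in> dual_space E" "h \<in> carrier (H i)" for i w h
    using W_mult_hom[OF that(1), of i] that(2) by (auto simp: left_hom_def)
  have 1: "W_mult E F i (\<lambda>v. w v + w' v) h = W_mult E F i w h \<oplus>\<^bsub>H (i + 1)\<^esub> W_mult E F i w' h"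
    if "w \<in> dual_space E" "w' \<in> dual_space E" "h \<in> carrier (H i)" for w w' i h
    using lin[OF that, of 1 1] closed that by (simp add: H.smult_one)
  have 2: "W_mult E F i (\<lambda>v. a * w v) h = a \<odot>\<^bsub>H (i + 1)\<^esub> W_mult E F i w h"
    if "w \<in> dual_space E" "h \<in> carrier (H i)" for w i h a
    using lin[OF that(1,1,2), of a 0] closed that by (simp add: H.smult_closed)
  show ?thesis unfolding is_sym_module_def H_K_tensor_def sym_module.simps
  proof (intro conjI allI ballI impI)
    fix i d w assume "graded" "w \<in> dual_space E"
    then show "W_mult E F i w ` cohomology_gr KF i d \<subseteq> cohomology_gr KF (i + 1) (d + 1)"
      using W_mult_gr by blast
  qed (simp_all add: left_module_H W_mult_hom 1 2 W_mult_commute H_grading)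
qed

end

section \<open>Lifting bases from \<open>M/(V)M\<close>\<close>

definition fscale :: "'k::field \<Rightarrow> ('m \<Rightarrow> 'k) \<Rightarrow> 'm \<Rightarrow> 'k" where
  "fscale a f = (\<lambda>x. a * f x)"

interpretation fun_space: vector_space fscale
  by unfold_locales (auto simp: fscale_def fun_eq_iff algebra_simps)

lemma sum_fun_apply: "(\<Sum>i\<in>I. f i) x = (\<Sum>i\<in>I. f i x)"
  by (induction I rule: infinite_finite_induct) auto

context free_E_module
begin

text \<open>The image of \<open>m\<close> in \<open>M/(V)M\<close>, given by its coordinates in the basis induced by \<open>B\<close>.\<close>

definition bar :: "'m \<Rightarrow> 'm \<Rightarrow> 'k" where
  "bar m = (\<lambda>b. coef {} (crd m b))"

lemma bar_add: "x \<in> carrier M \<Longrightarrow> y \<in> carrier M \<Longrightarrow> bar (x \<oplus> y) = bar x + bar y"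
  by (auto simp: bar_def coords_add)

lemma bar_diff: "x \<in> carrier M \<Longrightarrow> y \<in> carrier M \<Longrightarrow> bar (x \<ominus> y) = bar x - bar y"
  by (auto simp: bar_def coords_diff)

lemma bar_smult: "x \<in> carrier M \<Longrightarrow> bar (r \<odot> x) = fscale (coef {} r) (bar x)"
  by (auto simp: bar_def fscale_def coords_smult)

lemma bar_zero: "bar \<zero> = 0"
  by (auto simp: bar_def coords_zero)

lemma bar_finsum: "f \<in> A \<rightarrow> carrier M \<Longrightarrow> bar (\<Oplus>i\<in>A. f i) = (\<Sum>i\<in>A. bar (f i))"
proof (induction A rule: infinite_finite_induct)
  case (insert a A)
  then have "f a \<in> carrier M" "f \<in> A \<rightarrow> carrier M" by auto
  then show ?case using insert by (simp add: bar_add)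
qed (simp_all add: bar_zero)

lemma bar_eq_0_iff: "m \<in> carrier M \<Longrightarrow> bar m = 0 \<longleftrightarrow> m \<in> V_smult 1 M"
  by (auto simp: bar_def V_smult_iff filt_1_iff fun_eq_iff)

lemma bar_Kcomb:
  assumes "S \<subseteq> carrier M"
  shows "bar (\<Oplus>x\<in>S. scal E (k x) 1 \<odot> x) = (\<Sum>x\<in>S. fscale (k x) (bar x))"
proof -
  have "bar (\<Oplus>x\<in>S. scal E (k x) 1 \<odot> x) = (\<Sum>x\<in>S. bar (scal E (k x) 1 \<odot> x))"
    using assms by (intro bar_finsum) (auto simp: smult_closed)
  also have "\<dots> = (\<Sum>x\<in>S. fscale (k x) (bar x))"
    using assms by (intro sum.cong) (auto simp: bar_smult)
  finally show ?thesis .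
qed

text \<open>Linear independence of the images in \<open>M/(V)M\<close> as a family indexed by \<open>X\<close>, so that distinct elements of \<open>X\<close>
  have distinct images.\<close>

definition bar_independent :: "'m set \<Rightarrow> bool" where
  "bar_independent X \<longleftrightarrow> X \<subseteq> carrier M \<and>
     (\<forall>S k. finite S \<longrightarrow> S \<subseteq> X \<longrightarrow> (\<Sum>x\<in>S. fscale (k x) (bar x)) = 0 \<longrightarrow> (\<forall>x\<in>S. k x = 0))"

lemma bar_independentD:
  "bar_independent X \<Longrightarrow> finite S \<Longrightarrow> S \<subseteq> X \<Longrightarrow> (\<Sum>x\<in>S. fscale (k x) (bar x)) = 0 \<Longrightarrow> x \<in> S \<Longrightarrow> k x = 0"
  unfolding bar_independent_def by blast

lemma bar_independent_iff:
  assumes "X \<subseteq> carrier M"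
  shows "bar_independent X \<longleftrightarrow> inj_on bar X \<and> fun_space.independent (bar ` X)"
proof
  assume X: "bar_independent X"
  show "inj_on bar X \<and> fun_space.independent (bar ` X)"
  proof
    show "inj_on bar X"
    proof (rule inj_onI, rule ccontr)
      fix x y assume xy: "x \<in> X" "y \<in> X" "bar x = bar y" "x \<noteq> y"
      have "(\<Sum>z\<in>{x, y}. fscale (if z = x then 1 else - 1) (bar z)) = 0"
        using xy by (auto simp: fscale_def fun_eq_iff sum_fun_apply)
      then have "(if x = x then 1 else - 1 :: 'k) = 0"
        using xy by (intro bar_independentD[OF X, of "{x, y}" "\<lambda>z. if z = x then 1 else - 1"]) auto
      then show False by simp
    qed
    show "fun_space.independent (bar ` X)"
      unfolding fun_space.independent_explicit_finite_subsets
    proof (intro allI impI ballI)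
      fix S u v assume S: "S \<subseteq> bar ` X" "finite S" "(\<Sum>v\<in>S. fscale (u v) v) = 0" "v \<in> S"
      obtain S' where S': "S' \<subseteq> X" "inj_on bar S'" "S = bar ` S'"
        using S(1) by (auto simp: subset_image_inj)
      then have "finite S'" using S(2) finite_imageD by blast
      moreover have "(\<Sum>x\<in>S'. fscale (u (bar x)) (bar x)) = 0"
        using S(3) S' by (simp add: sum.reindex)
      moreover obtain x where "x \<in> S'" "v = bar x" using S(4) S' by blast
      ultimately show "u v = 0" using bar_independentD[OF X, of S' "\<lambda>x. u (bar x)"] S'(1) by blast
    qed
  qed
next
  assume X: "inj_on bar X \<and> fun_space.independent (bar ` X)"
  show "bar_independent X" unfolding bar_independent_def
  proof (intro conjI allI impI ballI)
    fix S k x assume S: "finite S" "S \<subseteq> X" "(\<Sum>x\<in>S. fscale (k x) (bar x)) = 0" "x \<in> S"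
    have inj: "inj_on bar S" using X S(2) inj_on_subset by blast
    have "(\<Sum>v\<in>bar ` S. fscale (k (inv_into S bar v)) v) = (\<Sum>x\<in>S. fscale (k x) (bar x))"
      using inj by (simp add: sum.reindex)
    then have "k (inv_into S bar (bar x)) = 0"
      using X S fun_space.independentD[of "bar ` X" "bar ` S" "\<lambda>v. k (inv_into S bar v)" "bar x"] by auto
    then show "k x = 0" using inj S(4) by simp
  qed (rule assms)
qed

text \<open>Basis extension in the vector space \<open>M/(V)M\<close>.\<close>

lemma bar_independent_extend:
  assumes I: "bar_independent I" and S: "S \<subseteq> carrier M"
  obtains T where "T \<subseteq> S" "T \<inter> I = {}" "bar_independent (I \<union> T)" "bar ` S \<subseteq> fun_space.span (bar ` (I \<union> T))"
proof -
  have Ic: "I \<subseteq> carrier M" using I by (simp add: bar_independent_def)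
  have I': "inj_on bar I" "fun_space.independent (bar ` I)" using I bar_independent_iff[OF Ic] by auto
  obtain D where D: "bar ` I \<subseteq> D" "D \<subseteq> bar ` (I \<union> S)" "fun_space.independent D" "bar ` (I \<union> S) \<subseteq> fun_space.span D"
    using fun_space.maximal_independent_subset_extend[of "bar ` I" "bar ` (I \<union> S)"] I'(2) by blast
  have "D - bar ` I \<subseteq> bar ` S" using D(2) by blast
  then obtain T where T: "T \<subseteq> S" "inj_on bar T" "D - bar ` I = bar ` T"
    by (auto simp: subset_image_inj)
  have D_eq: "bar ` (I \<union> T) = D" using T(3) D(1) by blast
  have "bar x \<noteq> bar y" if "x \<in> I" "y \<in> T" for x y using T(3) that by blast
  then have "inj_on bar (I \<union> T)" "T \<inter> I = {}"
    using I'(1) T(2) unfolding inj_on_Un by blast+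
  moreover have "I \<union> T \<subseteq> carrier M" using Ic T S by blast
  ultimately have "bar_independent (I \<union> T)"
    using D(3) D_eq by (simp add: bar_independent_iff)
  moreover have "bar ` S \<subseteq> fun_space.span (bar ` (I \<union> T))" using D(4) unfolding D_eq by blast
  ultimately show ?thesis using T(1) \<open>T \<inter> I = {}\<close> by (intro that)
qed

text \<open>There are no monomials of degree greater than \<open>n\<close>, so the ideal \<open>(V)\<close> is nilpotent.\<close>

lemma V_smult_vanishes:
  assumes "m \<in> V_smult (Suc n) M" shows "m = \<zero>"
proof (rule coords_eqI)
  fix b
  have "crd m b = 0"
  proof (rule coef_eqI)
    fix A assume "A \<subseteq> {..<n}"
    then have "card A < Suc n" using card_mono[of "{..<n}" A] by simp
    then show "coef A (crd m b) = coef A 0" using assms \<open>A \<subseteq> {..<n}\<close> by (simp add: V_smult_iff filt_def)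
  qed
  then show "crd m b = crd \<zero> b" by (simp add: coords_zero)
qed (use assms V_smult_closed in auto)

text \<open>Nakayama's lemma for the nilpotent ideal \<open>(V)\<close>, by descending induction on \<open>k\<close> for the elements of \<open>(V)\<^sup>kM\<close>:
  the coefficient of \<open>e\<^sub>A\<close> in \<open>m\<close> is a combination of \<open>X\<close> up to an element of \<open>(V)M\<close>, and multiplication by
  \<open>e\<^sub>A\<close> moves the error to \<open>(V)\<^sup>k\<^sup>+\<^sup>1M\<close>.\<close>

lemma lift_generators:
  assumes X: "X \<subseteq> carrier M" and gen: "bar ` carrier M \<subseteq> fun_space.span (bar ` X)" and m: "m \<in> carrier M"
  shows "\<exists>A c. finite A \<and> A \<subseteq> X \<and> m = (\<Oplus>x\<in>A. c x \<odot> x)"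
proof -
  define P where "P m \<longleftrightarrow> (\<exists>A c. finite A \<and> A \<subseteq> X \<and> m = (\<Oplus>x\<in>A. c x \<odot> x))" for m
  have cl: "(\<lambda>x. c x \<odot> x) \<in> A \<rightarrow> carrier M" if "A \<subseteq> X" for A c
    using that X by (auto simp: smult_closed)
  have Pc: "m \<in> carrier M" if "P m" for m using that cl by (auto simp: P_def intro: finsum_closed)
  have P0: "P \<zero>" unfolding P_def by (intro exI[of _ "{}"]) simp
  have Padd: "P (m \<oplus> m')" if P: "P m" "P m'" for m m'
  proof -
    obtain A c where A: "finite A" "A \<subseteq> X" "m = (\<Oplus>x\<in>A. c x \<odot> x)" using P(1) by (auto simp: P_def)
    obtain A' c' where A': "finite A'" "A' \<subseteq> X" "m' = (\<Oplus>x\<in>A'. c' x \<odot> x)" using P(2) by (auto simp: P_def)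
    let ?d = "\<lambda>x. if x \<in> A then c x else 0" and ?d' = "\<lambda>x. if x \<in> A' then c' x else 0"
    have "m = (\<Oplus>x\<in>A. ?d x \<odot> x)" unfolding A(3) using A X by (intro finsum_cong') (auto simp: smult_closed)
    also have "\<dots> = (\<Oplus>x\<in>A \<union> A'. ?d x \<odot> x)"
      using A A' X by (intro finsum_supset) (auto simp: smult_closed)
    finally have 1: "m = (\<Oplus>x\<in>A \<union> A'. ?d x \<odot> x)" .
    have "m' = (\<Oplus>x\<in>A'. ?d' x \<odot> x)" unfolding A'(3) using A' X by (intro finsum_cong') (auto simp: smult_closed)
    also have "\<dots> = (\<Oplus>x\<in>A \<union> A'. ?d' x \<odot> x)"
      using A A' X by (intro finsum_supset) (auto simp: smult_closed)
    finally have 2: "m' = (\<Oplus>x\<in>A \<union> A'. ?d' x \<odot> x)" .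
    have "m \<oplus> m' = (\<Oplus>x\<in>A \<union> A'. ?d x \<odot> x \<oplus> ?d' x \<odot> x)"
      unfolding 1 2 using A A' X by (intro finsum_addf[symmetric]) (auto simp: smult_closed)
    also have "\<dots> = (\<Oplus>x\<in>A \<union> A'. (?d x + ?d' x) \<odot> x)"
      using A A' X by (intro finsum_cong') (auto simp: smult_closed smult_l_distr subset_iff)
    finally show ?thesis unfolding P_def using A A'
      by (intro exI[of _ "A \<union> A'"] exI[of _ "\<lambda>x. ?d x + ?d' x"]) blast
  qed
  have Psmult: "P (r \<odot> m)" if P: "P m" for r m
  proof -
    obtain A c where A: "finite A" "A \<subseteq> X" "m = (\<Oplus>x\<in>A. c x \<odot> x)" using P by (auto simp: P_def)
    have "r \<odot> m = (\<Oplus>x\<in>A. r \<odot> (c x \<odot> x))" unfolding A(3) using cl[OF A(2)] by (rule finsum_smult)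
    also have "\<dots> = (\<Oplus>x\<in>A. (r * c x) \<odot> x)"
      using A X by (intro finsum_cong') (auto simp: smult_closed smult_assoc subset_iff)
    finally show ?thesis unfolding P_def using A by (intro exI[of _ A] exI[of _ "\<lambda>x. r * c x"]) blast
  qed
  have Psum: "P (\<Oplus>i\<in>I. f i)" if "finite I" "\<And>i. i \<in> I \<Longrightarrow> P (f i)" for I :: "nat set set" and f
    using that
  proof (induction I rule: finite_induct)
    case (insert i I)
    then show ?case using Pc by (subst finsum_insert) (auto intro!: Padd)
  qed (simp add: P0)
  have mod1: "\<exists>s. P s \<and> m \<ominus> s \<in> V_smult 1 M" if m: "m \<in> carrier M" for m
  proof -
    have "bar m \<in> fun_space.span (bar ` X)" using gen m by blast
    then have "\<exists>s. P s \<and> bar s = bar m"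
    proof (induction rule: fun_space.span_induct_alt)
      case base
      then show ?case using P0 bar_zero by blast
    next
      case (step c f g)
      then obtain x s where x: "x \<in> X" "f = bar x" and s: "P s" "bar s = g" by blast
      have xc: "x \<in> carrier M" using x X by blast
      have "P (scal E c 1 \<odot> x)"
        unfolding P_def using x xc by (intro exI[of _ "{x}"] exI[of _ "\<lambda>_. scal E c 1"]) (simp add: smult_closed)
      then have "P (scal E c 1 \<odot> x \<oplus> s)" using s(1) by (rule Padd)
      moreover have "bar (scal E c 1 \<odot> x \<oplus> s) = fscale c f + g"
        using xc s Pc[OF s(1)] x(2) by (simp add: bar_add bar_smult smult_closed)
      ultimately show ?case by blast
    qed
    then obtain s where "P s" "bar s = bar m" by blast
    then show ?thesis using m Pc[of s] bar_eq_0_iff[of "m \<ominus> s"] by (auto simp: bar_diff)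
  qed
  have "\<forall>m\<in>V_smult 0 M. P m"
  proof (rule inc_induct[of 0 "Suc n" "\<lambda>k. \<forall>m\<in>V_smult k M. P m"])
    show "\<forall>m\<in>V_smult (Suc n) M. P m" using V_smult_vanishes P0 by blast
    fix k assume IH: "\<forall>m\<in>V_smult (Suc k) M. P m"
    show "\<forall>m\<in>V_smult k M. P m"
    proof
      fix m assume m: "m \<in> V_smult k M"
      then have mc: "m \<in> carrier M" by (rule V_smult_closed)
      have "P (mon A \<odot> mcoef A m)" if A: "A \<in> Pow {..<n}" for A
      proof (cases "card A < k")
        case True
        then have "mcoef A m = \<zero>"
          using m A mc by (intro coords_eqI) (auto simp: mcoef_closed coords_mcoef coords_zero V_smult_iff filt_def)
        then show ?thesis using P0 by simp
      next
        case False
        have Am: "mcoef A m \<in> carrier M" using mc by (rule mcoef_closed)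
        obtain t where t: "P t" "mcoef A m \<ominus> t \<in> V_smult 1 M" using mod1[OF Am] by blast
        have "mon A \<in> filt k" using A False by (auto simp: filt_def coef_mon)
        then have "mon A \<odot> (mcoef A m \<ominus> t) \<in> V_smult (k + 1) M" using t(2) by (rule V_smult_mult)
        then have "P (mon A \<odot> (mcoef A m \<ominus> t))" using IH by (simp add: Suc_eq_plus1)
        then have "P (mon A \<odot> t \<oplus> mon A \<odot> (mcoef A m \<ominus> t))" using Psmult[OF t(1)] by (intro Padd)
        also have "mon A \<odot> t \<oplus> mon A \<odot> (mcoef A m \<ominus> t) = mon A \<odot> mcoef A m"
          using Pc[OF t(1)] Am
          by (intro coords_eqI) (simp_all add: coords_simps smult_closed right_diff_distrib)
        finally show ?thesis .
      qed
      then have "P (\<Oplus>A\<in>Pow {..<n}. mon A \<odot> mcoef A m)" by (intro Psum) auto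
      then show "P m" using mcoef_expand[OF mc] by simp
    qed
  qed simp
  then show ?thesis using m by (simp add: P_def V_smult_iff)
qed

text \<open>If \<open>e\<^sub>A\<close> is a monomial of least degree in the coefficients of a relation, then the coefficient of \<open>e\<^sub>A\<close> in the
  relation is a relation over \<open>K\<close> between the images in \<open>M/(V)M\<close>.\<close>

lemma lift_independent:
  assumes X: "bar_independent X" and S: "finite S" "S \<subseteq> X" "(\<Oplus>x\<in>S. c x \<odot> x) = \<zero>" "x \<in> S"
  shows "c x = 0"
proof (rule ccontr)
  assume nz: "c x \<noteq> 0"
  have Xc: "S \<subseteq> carrier M" using X S by (auto simp: bar_independent_def)
  let ?Q = "\<lambda>A. A \<subseteq> {..<n} \<and> (\<exists>x\<in>S. coef A (c x) \<noteq> 0)"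
  obtain A0 where A0: "?Q A0" using nz S(4) coef_eqI[of "c x" 0] by auto
  from ex_has_least_nat[of ?Q A0 card, OF A0]
  obtain A where least: "?Q A \<and> (\<forall>A'. ?Q A' \<longrightarrow> card A \<le> card A')" by (rule exE)
  then have A: "?Q A" by (rule conjunct1)
  have min: "card A \<le> card A'" if "?Q A'" for A'
  proof -
    from least have "\<forall>A'. ?Q A' \<longrightarrow> card A \<le> card A'" by (rule conjunct2)
    then have "?Q A' \<longrightarrow> card A \<le> card A'" by (rule spec)
    then show ?thesis using that by (rule mp)
  qed
  obtain y where y: "y \<in> S" "coef A (c y) \<noteq> 0" using A by blast
  have low: "c z \<in> filt (card A)" if "z \<in> S" for z
    using min that by (auto simp: filt_def not_less[symmetric])
  have cl: "(\<lambda>z. c z \<odot> z) \<in> S \<rightarrow> carrier M" using Xc by (auto simp: smult_closed)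
  have "(\<Sum>z\<in>S. fscale (coef A (c z)) (bar z)) = 0"
  proof
    fix b
    have "coef A (c z * crd z b) = coef A (c z) * coef {} (crd z b)" if "z \<in> S" for z
      using low[OF that] A by (intro coef_leading_mult) auto
    then have "(\<Sum>z\<in>S. fscale (coef A (c z)) (bar z)) b = coef A (crd (\<Oplus>z\<in>S. c z \<odot> z) b)"
      unfolding coords_finsum[OF cl] using Xc by (simp add: sum_fun_apply fscale_def bar_def coords_smult subset_iff)
    then show "(\<Sum>z\<in>S. fscale (coef A (c z)) (bar z)) b = 0 b" by (simp add: S(3) coords_zero)
  qed
  then show False using bar_independentD[OF X S(1,2), of "\<lambda>z. coef A (c z)"] y by blast
qed

lemma lift_basis:
  assumes X: "bar_independent X" and gen: "bar ` carrier M \<subseteq> fun_space.span (bar ` X)"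
  shows "free_basis M X"
  unfolding free_basis_def
proof (intro conjI ballI)
  show Xc: "X \<subseteq> carrier M" using X by (simp add: bar_independent_def)
  fix m assume m: "m \<in> carrier M"
  obtain A c where A: "finite A" "A \<subseteq> X" "m = (\<Oplus>x\<in>A. c x \<odot> x)"
    using lift_generators[OF Xc gen m] by blast
  let ?c = "\<lambda>x. if x \<in> A then c x else 0"
  have rep: "represents M X ?c m"
    unfolding represents_def
  proof (intro conjI)
    show "finite {b. ?c b \<noteq> 0}" by (rule finite_subset[OF _ A(1)]) auto
    show "{b. ?c b \<noteq> 0} \<subseteq> X" using A(2) by auto
    have "m = (\<Oplus>x\<in>A. ?c x \<odot> x)" unfolding A(3) using A(2) Xc by (intro finsum_cong') (auto simp: smult_closed)
    also have "\<dots> = (\<Oplus>x\<in>{b. ?c b \<noteq> 0}. ?c x \<odot> x)"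
      using A Xc by (intro finsum_supset[symmetric]) (auto simp: smult_closed)
    finally show "m = (\<Oplus>x\<in>{b. ?c b \<noteq> 0}. ?c x \<odot> x)" .
  qed
  moreover have "c1 = c2" if r: "represents M X c1 m" "represents M X c2 m" for c1 c2
  proof -
    let ?S = "{b. c1 b \<noteq> 0} \<union> {b. c2 b \<noteq> 0}"
    have S: "finite ?S" "?S \<subseteq> X" using r by (auto simp: represents_def)
    have Sc: "x \<in> carrier M" if "x \<in> ?S" for x using S Xc that by blast
    have "m = (\<Oplus>x\<in>?S. c1 x \<odot> x)" "m = (\<Oplus>x\<in>?S. c2 x \<odot> x)"
    proof -
      have "(\<Oplus>x\<in>{b. c1 b \<noteq> 0}. c1 x \<odot> x) = (\<Oplus>x\<in>?S. c1 x \<odot> x)"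
        using S Sc by (intro finsum_supset) (auto simp: smult_closed)
      then show "m = (\<Oplus>x\<in>?S. c1 x \<odot> x)" using r(1) by (simp add: represents_def)
      have "(\<Oplus>x\<in>{b. c2 b \<noteq> 0}. c2 x \<odot> x) = (\<Oplus>x\<in>?S. c2 x \<odot> x)"
        using S Sc by (intro finsum_supset) (auto simp: smult_closed)
      then show "m = (\<Oplus>x\<in>?S. c2 x \<odot> x)" using r(2) by (simp add: represents_def)
    qed
    then have "\<zero> = (\<Oplus>x\<in>?S. c1 x \<odot> x) \<ominus> (\<Oplus>x\<in>?S. c2 x \<odot> x)" using m by (simp add: minus_eq r_neg)
    also have "\<dots> = (\<Oplus>x\<in>?S. c1 x \<odot> x \<ominus> c2 x \<odot> x)"
      using Sc by (intro finsum_diff[symmetric]) (auto simp: smult_closed)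
    also have "\<dots> = (\<Oplus>x\<in>?S. (c1 x - c2 x) \<odot> x)"
    proof (intro finsum_cong' refl)
      fix x assume "x \<in> ?S"
      then show "c1 x \<odot> x \<ominus> c2 x \<odot> x = (c1 x - c2 x) \<odot> x"
        using Sc[of x] by (intro coords_eqI) (simp_all add: coords_diff coords_smult smult_closed left_diff_distrib)
    qed (use Sc in \<open>auto simp: smult_closed\<close>)
    finally have "(\<Oplus>x\<in>?S. (c1 x - c2 x) \<odot> x) = \<zero>" by simp
    then have "c1 x - c2 x = 0" if "x \<in> ?S" for x
      using lift_independent[OF X S, of "\<lambda>x. c1 x - c2 x"] that by blast
    then show ?thesis by (auto simp: fun_eq_iff) (metis)
  qed
  ultimately show "\<exists>!c. represents M X c m" by blast
qed

end

section \<open>Splitting off a contractible summand\<close>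

context free_module
begin

lemma sub_basis:
  assumes Y: "Y \<subseteq> B" and S: "S = {m \<in> carrier M. \<forall>b. b \<notin> Y \<longrightarrow> crd m b = 0}"
  shows "submodule_of M S" "free_basis (M\<lparr>carrier := S\<rparr>) Y"
    "\<And>m. m \<in> S \<Longrightarrow> coords (M\<lparr>carrier := S\<rparr>) Y m = crd m"
proof -
  show sub: "submodule_of M S"
    unfolding S submodule_of_def by (auto simp: coords_zero coords_add coords_smult smult_closed)
  interpret S: module_with_submodule M S by unfold_locales (rule sub)
  have YS: "Y \<subseteq> S" using Y by (auto simp: S basis_closed coords_basis)
  have sum: "(\<Oplus>\<^bsub>M\<lparr>carrier := S\<rparr>\<^esub>b\<in>{b. c b \<noteq> 0}. c b \<odot>\<^bsub>M\<lparr>carrier := S\<rparr>\<^esub> b) = (\<Oplus>b\<in>{b. c b \<noteq> 0}. c b \<odot> b)"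
    if "{b. c b \<noteq> 0} \<subseteq> Y" for c
  proof -
    have "finsum (M\<lparr>carrier := S\<rparr>) (\<lambda>b. c b \<odot> b) {b. c b \<noteq> 0} = (\<Oplus>b\<in>{b. c b \<noteq> 0}. c b \<odot> b)"
      using that YS S.sub_smult by (intro S.finsum_sub) blast
    then show ?thesis by simp
  qed
  have rep: "represents (M\<lparr>carrier := S\<rparr>) Y c m \<longleftrightarrow> {b. c b \<noteq> 0} \<subseteq> Y \<and> represents M B c m" for c m
    using sum[of c] Y by (auto simp: represents_def)
  have ex1: "represents (M\<lparr>carrier := S\<rparr>) Y c m \<longleftrightarrow> c = crd m" if m: "m \<in> S" for c m
  proof
    assume "represents (M\<lparr>carrier := S\<rparr>) Y c m"
    then show "c = crd m" using rep coords_unique by metis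
  next
    assume "c = crd m"
    then show "represents (M\<lparr>carrier := S\<rparr>) Y c m"
      using m represents_coords[of m] unfolding rep by (auto simp: S)
  qed
  show "free_basis (M\<lparr>carrier := S\<rparr>) Y"
    unfolding free_basis_def using ex1 YS by auto
  show "coords (M\<lparr>carrier := S\<rparr>) Y m = crd m" if "m \<in> S" for m
    unfolding coords_def[of "M\<lparr>carrier := S\<rparr>"] by (rule the_equality) (simp_all add: ex1[OF that])
qed

end

lemma (in graded_free_E_module) sub_basis_grading:
  assumes Y: "Y \<subseteq> B" and S: "S = {m \<in> carrier M. \<forall>b. b \<notin> Y \<longrightarrow> crd m b = 0}"
  shows "module_grading (E_deg E) (M\<lparr>carrier := S\<rparr>) (\<lambda>d. gr d \<inter> S)"
proof -
  interpret S: module_with_submodule M S by unfold_locales (rule sub_basis(1)[OF Y S])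
  interpret SM: left_module "M\<lparr>carrier := S\<rparr>" by (rule S.left_module_sub)
  have comp: "gcomp M gr m d \<in> S" if "m \<in> S" for m d
    using that by (auto simp: S coords_gcomp gcomp_closed)
  have sum: "finsum (M\<lparr>carrier := S\<rparr>) f A = finsum M f A" if "\<And>d. f d \<in> S" for f :: "int \<Rightarrow> 'm" and A
    using that by (intro S.finsum_sub) auto
  show ?thesis unfolding module_grading_def
  proof (intro conjI allI ballI)
    fix d
    show "subgroup (gr d \<inter> S) (add_monoid (M\<lparr>carrier := S\<rparr>))"
    proof (rule group.subgroupI)
      show "Group.group (add_monoid (M\<lparr>carrier := S\<rparr>))" by (rule SM.a_group)
      show "gr d \<inter> S \<noteq> {}" using gr_zero S.sub_zero by blast
    next
      fix a assume a: "a \<in> gr d \<inter> S"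
      then have ma: "\<ominus> a \<in> gr d \<inter> S"
        using subgroup.m_inv_closed[OF gr_subgroup, of a d] S.sub_minus by (simp add: a_inv_def)
      have "(\<ominus> a) \<oplus>\<^bsub>M\<lparr>carrier := S\<rparr>\<^esub> a = \<zero>\<^bsub>M\<lparr>carrier := S\<rparr>\<^esub>"
        using a S.sub_carrier by (simp add: l_neg)
      then have "\<ominus>\<^bsub>M\<lparr>carrier := S\<rparr>\<^esub> a = \<ominus> a"
        using a ma by (intro SM.minus_equality) auto
      then show "inv\<^bsub>add_monoid (M\<lparr>carrier := S\<rparr>)\<^esub> a \<in> gr d \<inter> S" using ma by (simp add: a_inv_def)
    qed (auto intro: gr_add S.sub_add)
  next
    fix m assume "m \<in> carrier (M\<lparr>carrier := S\<rparr>)"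
    then have m: "m \<in> S" by simp
    then have mc: "m \<in> carrier M" by (rule S.sub_carrier)
    show "\<exists>!f. (\<forall>d. f d \<in> gr d \<inter> S) \<and> finite {d. f d \<noteq> \<zero>\<^bsub>M\<lparr>carrier := S\<rparr>\<^esub>} \<and>
        m = (\<Oplus>\<^bsub>M\<lparr>carrier := S\<rparr>\<^esub>d\<in>{d. f d \<noteq> \<zero>\<^bsub>M\<lparr>carrier := S\<rparr>\<^esub>}. f d)"
    proof (rule ex1I[of _ "gcomp M gr m"])
      show "(\<forall>d. gcomp M gr m d \<in> gr d \<inter> S) \<and> finite {d. gcomp M gr m d \<noteq> \<zero>\<^bsub>M\<lparr>carrier := S\<rparr>\<^esub>} \<and>
        m = (\<Oplus>\<^bsub>M\<lparr>carrier := S\<rparr>\<^esub>d\<in>{d. gcomp M gr m d \<noteq> \<zero>\<^bsub>M\<lparr>carrier := S\<rparr>\<^esub>}. gcomp M gr m d)"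
        using comp[OF m] gcomp_props[OF mc] sum[of "gcomp M gr m"] by simp
    next
      fix f assume f: "(\<forall>d. f d \<in> gr d \<inter> S) \<and> finite {d. f d \<noteq> \<zero>\<^bsub>M\<lparr>carrier := S\<rparr>\<^esub>} \<and>
        m = (\<Oplus>\<^bsub>M\<lparr>carrier := S\<rparr>\<^esub>d\<in>{d. f d \<noteq> \<zero>\<^bsub>M\<lparr>carrier := S\<rparr>\<^esub>}. f d)"
      then have "m = (\<Oplus>d\<in>{d. f d \<noteq> \<zero>}. f d)" using sum[of f "{d. f d \<noteq> \<zero>}"] by simp
      then show "f = gcomp M gr m"
        using f by (intro gcomp_unique[of f "{d. f d \<noteq> \<zero>}", symmetric]) auto
    qed
  next
    fix a d r m assume "r \<in> E_deg E a" "m \<in> gr d \<inter> S"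
    then show "r \<odot>\<^bsub>M\<lparr>carrier := S\<rparr>\<^esub> m \<in> gr (a + d) \<inter> S"
      using gr_smult S.sub_smult by simp
  qed
qed

context complex_with_bases
begin

text \<open>The elements of \<open>C\<close> are taken from the given basis, so that they are homogeneous in the graded case.\<close>

lemma d_basis_subset_exists:
  "\<exists>C. C \<subseteq> B i \<and> inj_on (cdiff F i) C \<and> F.bar_independent (i + 1) (cdiff F i ` C) \<and>
     F.bar (i + 1) ` cdiff F i ` B i \<subseteq> fun_space.span (F.bar (i + 1) ` cdiff F i ` C)"
proof -
  have e: "F.bar_independent (i + 1) {}" by (simp add: F.bar_independent_def)
  have sub: "cdiff F i ` B i \<subseteq> carrier (cmod F (i + 1))" using F.basis_closed d_simps(1) by blast
  obtain T where T: "T \<subseteq> cdiff F i ` B i" "T \<inter> {} = {}" "F.bar_independent (i + 1) ({} \<union> T)"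
      "F.bar (i + 1) ` cdiff F i ` B i \<subseteq> fun_space.span (F.bar (i + 1) ` ({} \<union> T))"
    by (rule F.bar_independent_extend[OF e sub])
  obtain C where "C \<subseteq> B i" "inj_on (cdiff F i) C" "T = cdiff F i ` C"
    using T(1) by (auto simp: subset_image_inj)
  then show ?thesis using T(3,4) by auto
qed

lemma bar_cocycle_iff:
  "m \<in> carrier (cmod F i) \<Longrightarrow> F.bar (i + 1) (cdiff F i m) = 0 \<longleftrightarrow> m \<in> Zc i"
  using F.bar_eq_0_iff[of "cdiff F i m"] d_simps(1)[of m i] by (simp add: Zc_def)

lemma homogeneous_cocycles_span:
  assumes "F.bar i ` {z \<in> Zc i. graded \<longrightarrow> z \<in> (\<Union>d. cgr F i d)} \<subseteq> fun_space.span Y"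
  shows "F.bar i ` Zc i \<subseteq> fun_space.span Y"
proof clarify
  fix z assume z: "z \<in> Zc i"
  show "F.bar i z \<in> fun_space.span Y"
  proof (cases graded)
    case True
    interpret G: graded_free_E_module E n e "cmod F i" "B i" "cgr F i" by (rule graded_F[OF True])
    have zc: "z \<in> carrier (cmod F i)" using z Zc_closed by blast
    let ?g = "gcomp (cmod F i) (cgr F i) z"
    have "F.bar i z = F.bar i (\<Oplus>\<^bsub>cmod F i\<^esub>d\<in>{d. ?g d \<noteq> \<zero>\<^bsub>cmod F i\<^esub>}. ?g d)"
      using G.gcomp_sum[OF zc] by simp
    also have "\<dots> = (\<Sum>d\<in>{d. ?g d \<noteq> \<zero>\<^bsub>cmod F i\<^esub>}. F.bar i (?g d))"
      using G.gcomp_closed[OF zc] by (intro F.bar_finsum) auto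
    also have "\<dots> \<in> fun_space.span Y"
      using assms Zc_gcomp[OF True z] G.gcomp_in[OF zc] by (intro fun_space.span_sum) blast
    finally show ?thesis .
  qed (use assms z in blast)
qed

text \<open>As the homogeneous cocycles span the cocycles, an independent family extends by homogeneous cocycles to one whose
  span contains all cocycles.\<close>

lemma cocycle_basis_exists:
  assumes I: "F.bar_independent i I"
  shows "\<exists>T. T \<subseteq> Zc i \<and> (graded \<longrightarrow> T \<subseteq> (\<Union>d. cgr F i d)) \<and> T \<inter> I = {} \<and>
    F.bar_independent i (I \<union> T) \<and> F.bar i ` Zc i \<subseteq> fun_space.span (F.bar i ` (I \<union> T))"
proof -
  let ?S = "{z \<in> Zc i. graded \<longrightarrow> z \<in> (\<Union>d. cgr F i d)}"
  have S: "?S \<subseteq> carrier (cmod F i)" using Zc_closed by blast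
  obtain T where T: "T \<subseteq> ?S" "T \<inter> I = {}" "F.bar_independent i (I \<union> T)"
      "F.bar i ` ?S \<subseteq> fun_space.span (F.bar i ` (I \<union> T))"
    by (rule F.bar_independent_extend[OF I S])
  then show ?thesis using homogeneous_cocycles_span[OF T(4)] by (intro exI[of _ T]) blast
qed

text \<open>Modulo \<open>(V)\<close>, \<open>d\<close> is a linear map with kernel spanned by \<open>Y\<close> and image spanned by \<open>d C\<close>, so \<open>Y\<close> and \<open>C\<close> together form a
  basis of its domain, which lifts to a free basis.\<close>

lemma complement_basis:
  assumes C: "C \<subseteq> B i" "inj_on (cdiff F i) C" "F.bar_independent (i + 1) (cdiff F i ` C)"
      "F.bar (i + 1) ` cdiff F i ` B i \<subseteq> fun_space.span (F.bar (i + 1) ` cdiff F i ` C)"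
    and Y: "Y \<subseteq> Zc i" "F.bar_independent i Y" "F.bar i ` Zc i \<subseteq> fun_space.span (F.bar i ` Y)"
  shows "free_basis (cmod F i) (Y \<union> C)" "Y \<inter> C = {}"
proof -
  let ?M = "cmod F i" and ?N = "cmod F (i + 1)" and ?d = "cdiff F i"
  have Cc: "C \<subseteq> carrier ?M" using C(1) F.basis_closed by blast
  have Yc: "Y \<subseteq> carrier ?M" using Y(1) Zc_closed by blast
  have CZ: "c \<notin> Zc i" if c: "c \<in> C" for c
  proof
    assume "c \<in> Zc i"
    then have "F.bar (i + 1) (?d c) = 0" using c Cc bar_cocycle_iff[of c i] by blast
    then have "(\<Sum>x\<in>{?d c}. fscale 1 (F.bar (i + 1) x)) = 0" by simp
    then have "(1 :: 'k) = 0"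
      using c by (intro F.bar_independentD[OF C(3), of "{?d c}" "\<lambda>_. 1"]) auto
    then show False by simp
  qed
  then show disj: "Y \<inter> C = {}" using Y(1) by blast
  have indep: "F.bar_independent i (Y \<union> C)"
    unfolding F.bar_independent_def
  proof (intro conjI allI impI ballI)
    show "Y \<union> C \<subseteq> carrier ?M" using Yc Cc by blast
    fix S k x assume S: "finite S" "S \<subseteq> Y \<union> C" "(\<Sum>x\<in>S. fscale (k x) (F.bar i x)) = 0" "x \<in> S"
    have Sc: "S \<subseteq> carrier ?M" using S(2) Yc Cc by blast
    let ?v = "\<Oplus>\<^bsub>?M\<^esub>x\<in>S. scal E (k x) 1 \<odot>\<^bsub>?M\<^esub> x"
    have cl: "(\<lambda>x. scal E (k x) 1 \<odot>\<^bsub>?M\<^esub> x) \<in> S \<rightarrow> carrier ?M" using Sc by (auto simp: F.smult_closed)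
    then have vc: "?v \<in> carrier ?M" by (rule F.finsum_closed)
    have "?v \<in> V_smult 1 ?M" using F.bar_eq_0_iff[OF vc] F.bar_Kcomb[OF Sc, of k] S(3) by simp
    then have "F.bar (i + 1) (?d ?v) = 0" using bar_cocycle_iff[OF vc] V_smult_Zc by blast
    moreover have "F.bar (i + 1) (?d ?v) = (\<Sum>x\<in>S. fscale (k x) (F.bar (i + 1) (?d x)))"
    proof -
      have "F.bar (i + 1) (?d ?v) = F.bar (i + 1) (\<Oplus>\<^bsub>?N\<^esub>x\<in>S. ?d (scal E (k x) 1 \<odot>\<^bsub>?M\<^esub> x))"
        by (rule arg_cong[OF d_simps(7)[OF cl]])
      also have "\<dots> = (\<Sum>x\<in>S. F.bar (i + 1) (?d (scal E (k x) 1 \<odot>\<^bsub>?M\<^esub> x)))"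
        using cl d_simps(1) by (intro F.bar_finsum) blast
      also have "\<dots> = (\<Sum>x\<in>S. fscale (k x) (F.bar (i + 1) (?d x)))"
        using Sc by (intro sum.cong) (auto simp: d_simps F.bar_smult subset_iff)
      finally show ?thesis .
    qed
    ultimately have z: "(\<Sum>x\<in>S. fscale (k x) (F.bar (i + 1) (?d x))) = 0" by simp
    have "fscale (k x) (F.bar (i + 1) (?d x)) = 0" if "x \<in> S - S \<inter> C" for x
    proof -
      have "x \<in> Y" using that S(2) by blast
      then have "F.bar (i + 1) (?d x) = 0" using Y(1) Yc bar_cocycle_iff[of x i] by blast
      then show ?thesis by simp
    qed
    then have "(\<Sum>x\<in>S \<inter> C. fscale (k x) (F.bar (i + 1) (?d x))) = 0"
      using z S(1) sum.mono_neutral_right[of S "S \<inter> C" "\<lambda>x. fscale (k x) (F.bar (i + 1) (?d x))"] by simp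
    moreover have inj: "inj_on ?d (S \<inter> C)" using C(2) inj_on_subset by blast
    ultimately have "(\<Sum>y\<in>?d ` (S \<inter> C). fscale (k (inv_into (S \<inter> C) ?d y)) (F.bar (i + 1) y)) = 0"
      by (simp add: sum.reindex)
    then have kC: "k x = 0" if "x \<in> S \<inter> C" for x
      using F.bar_independentD[OF C(3), of "?d ` (S \<inter> C)" "\<lambda>y. k (inv_into (S \<inter> C) ?d y)" "?d x"] inj that S(1)
        image_mono[OF Int_lower2, of ?d S C]
      by simp
    then have "(\<Sum>x\<in>S - C. fscale (k x) (F.bar i x)) = 0"
      using S(1,3) sum.mono_neutral_right[of S "S - C" "\<lambda>x. fscale (k x) (F.bar i x)"] by auto
    then have kY: "k x = 0" if "x \<in> S - C" for x
      using F.bar_independentD[OF Y(2), of "S - C" k x] S(1,2) that by blast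
    show "k x = 0" using kC kY S(4) by blast
  qed
  have "F.bar i m \<in> fun_space.span (F.bar i ` (Y \<union> C))" if m: "m \<in> carrier ?M" for m
  proof -
    let ?A = "{b. F.crd i m b \<noteq> 0}"
    have A: "finite ?A" "?A \<subseteq> B i" using m F.finite_coords F.coords_subset by auto
    have Ac: "b \<in> carrier ?M" if "b \<in> ?A" for b using A F.basis_closed that by blast
    have "?d (\<Oplus>\<^bsub>?M\<^esub>b\<in>?A. F.crd i m b \<odot>\<^bsub>?M\<^esub> b) = (\<Oplus>\<^bsub>?N\<^esub>b\<in>?A. ?d (F.crd i m b \<odot>\<^bsub>?M\<^esub> b))"
      using Ac by (intro d_simps(7)) (auto simp: F.smult_closed)
    then have "F.bar (i + 1) (?d m) = F.bar (i + 1) (\<Oplus>\<^bsub>?N\<^esub>b\<in>?A. ?d (F.crd i m b \<odot>\<^bsub>?M\<^esub> b))"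
      using F.expand_basis[OF m A] by simp
    also have "\<dots> = (\<Sum>b\<in>?A. F.bar (i + 1) (?d (F.crd i m b \<odot>\<^bsub>?M\<^esub> b)))"
      using Ac by (intro F.bar_finsum) (auto simp: F.smult_closed d_simps(1))
    also have "\<dots> = (\<Sum>b\<in>?A. fscale (coef {} (F.crd i m b)) (F.bar (i + 1) (?d b)))"
      using Ac by (intro sum.cong) (auto simp: d_simps F.bar_smult)
    also have "\<dots> \<in> fun_space.span (F.bar (i + 1) ` ?d ` C)"
      using C(4) A(2) by (intro fun_space.span_sum fun_space.span_scale) blast
    finally have "\<exists>u\<in>carrier ?M. F.bar i u \<in> fun_space.span (F.bar i ` C) \<and> F.bar (i + 1) (?d u) = F.bar (i + 1) (?d m)"
    proof (induction rule: fun_space.span_induct_alt)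
      case base
      show ?case
        by (rule bexI[of _ "\<zero>\<^bsub>?M\<^esub>"]) (simp_all only: F.bar_zero d_simps(4) fun_space.span_zero F.zero_closed simp_thms)
    next
      case (step a f g)
      then obtain c u where c: "c \<in> C" "f = F.bar (i + 1) (?d c)"
        and u: "u \<in> carrier ?M" "F.bar i u \<in> fun_space.span (F.bar i ` C)" "F.bar (i + 1) (?d u) = g" by blast
      have cc: "c \<in> carrier ?M" using c Cc by blast
      let ?u = "scal E a 1 \<odot>\<^bsub>?M\<^esub> c \<oplus>\<^bsub>?M\<^esub> u"
      have bu: "F.bar i ?u = fscale a (F.bar i c) + F.bar i u"
        using cc u(1) by (simp add: F.bar_add F.bar_smult F.smult_closed)
      have "fscale a (F.bar i c) + F.bar i u \<in> fun_space.span (F.bar i ` C)"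
        using c(1) by (intro fun_space.span_add[OF fun_space.span_scale u(2)] fun_space.span_base) simp
      then have "F.bar i ?u \<in> fun_space.span (F.bar i ` C)" unfolding bu .
      moreover have "F.bar (i + 1) (?d ?u) = fscale a f + g"
        using cc u by (simp add: c(2) d_simps F.bar_add F.bar_smult F.smult_closed)
      moreover have "?u \<in> carrier ?M" using cc u(1) by (simp add: F.smult_closed)
      ultimately show ?case by blast
    qed
    then obtain u where u: "u \<in> carrier ?M" "F.bar i u \<in> fun_space.span (F.bar i ` C)"
        "F.bar (i + 1) (?d u) = F.bar (i + 1) (?d m)" by blast
    have "F.bar (i + 1) (?d (m \<ominus>\<^bsub>?M\<^esub> u)) = 0"
      using m u by (simp add: d_simps F.bar_diff)
    then have "m \<ominus>\<^bsub>?M\<^esub> u \<in> Zc i" using bar_cocycle_iff m u(1) by simp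
    then have "F.bar i (m \<ominus>\<^bsub>?M\<^esub> u) \<in> fun_space.span (F.bar i ` Y)" using Y(3) by blast
    then have "F.bar i (m \<ominus>\<^bsub>?M\<^esub> u) + F.bar i u \<in> fun_space.span (F.bar i ` (Y \<union> C))"
      using u(2) fun_space.span_mono[OF image_mono[OF Un_upper1]] fun_space.span_mono[OF image_mono[OF Un_upper2]]
      by (intro fun_space.span_add) (erule rev_subsetD, assumption)+
    then show ?thesis using m u(1) by (simp add: F.bar_diff)
  qed
  then show "free_basis ?M (Y \<union> C)" by (intro F.lift_basis[OF indep]) blast
qed

abbreviation bdry :: "(int \<Rightarrow> 'm set) \<Rightarrow> int \<Rightarrow> 'm set" where
  "bdry C i \<equiv> cdiff F (i - 1) ` C (i - 1)"

lemma splitting_exists: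
  "\<exists>C T. \<forall>i. C i \<subseteq> B i \<and> inj_on (cdiff F i) (C i) \<and> T i \<subseteq> Zc i \<and> (graded \<longrightarrow> T i \<subseteq> (\<Union>d. cgr F i d)) \<and>
     T i \<inter> bdry C i = {} \<and> (bdry C i \<union> T i) \<inter> C i = {} \<and>
     free_basis (cmod F i) (bdry C i \<union> T i \<union> C i)"
proof -
  have "\<forall>i. \<exists>C. C \<subseteq> B i \<and> inj_on (cdiff F i) C \<and> F.bar_independent (i + 1) (cdiff F i ` C) \<and>
     F.bar (i + 1) ` cdiff F i ` B i \<subseteq> fun_space.span (F.bar (i + 1) ` cdiff F i ` C)"
    by (intro allI d_basis_subset_exists)
  from choice[OF this] obtain C where C': "\<forall>i. C i \<subseteq> B i \<and> inj_on (cdiff F i) (C i) \<and>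
     F.bar_independent (i + 1) (cdiff F i ` C i) \<and>
     F.bar (i + 1) ` cdiff F i ` B i \<subseteq> fun_space.span (F.bar (i + 1) ` cdiff F i ` C i)" by (rule exE)
  have C: "C i \<subseteq> B i" "inj_on (cdiff F i) (C i)" "F.bar_independent (i + 1) (cdiff F i ` C i)"
      "F.bar (i + 1) ` cdiff F i ` B i \<subseteq> fun_space.span (F.bar (i + 1) ` cdiff F i ` C i)" for i
    using spec[OF C', of i] by (simp_all only:)
  have bI: "F.bar_independent i (bdry C i)" for i using C(3)[of "i - 1"] by simp
  have "\<forall>i. \<exists>T. T \<subseteq> Zc i \<and> (graded \<longrightarrow> T \<subseteq> (\<Union>d. cgr F i d)) \<and> T \<inter> bdry C i = {} \<and>
    F.bar_independent i (bdry C i \<union> T) \<and> F.bar i ` Zc i \<subseteq> fun_space.span (F.bar i ` (bdry C i \<union> T))"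
    by (intro allI cocycle_basis_exists bI)
  from choice[OF this] obtain T where T': "\<forall>i. T i \<subseteq> Zc i \<and> (graded \<longrightarrow> T i \<subseteq> (\<Union>d. cgr F i d)) \<and>
      T i \<inter> bdry C i = {} \<and> F.bar_independent i (bdry C i \<union> T i) \<and>
      F.bar i ` Zc i \<subseteq> fun_space.span (F.bar i ` (bdry C i \<union> T i))" by (rule exE)
  have T2: "graded \<longrightarrow> T i \<subseteq> (\<Union>d. cgr F i d)" for i
    by (rule conjunct1[OF conjunct2[OF spec[OF T', of i]]])
  have T: "T i \<subseteq> Zc i" "T i \<inter> bdry C i = {}" "F.bar_independent i (bdry C i \<union> T i)"
      "F.bar i ` Zc i \<subseteq> fun_space.span (F.bar i ` (bdry C i \<union> T i))" for i
    using spec[OF T', of i] by (simp_all only:)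
  have bZ: "bdry C i \<subseteq> Zc i" for i
  proof -
    have "C (i - 1) \<subseteq> carrier (cmod F (i - 1))" using C(1) F.basis_closed by blast
    then have "bdry C i \<subseteq> Bc i" using d_Bc by blast
    then show ?thesis using Bc_subset_Zc by (rule order_trans)
  qed
  have Y: "bdry C i \<union> T i \<subseteq> Zc i" for i using bZ T(1) by blast
  show ?thesis
  proof (rule exI[of _ C], rule exI[of _ T], intro allI conjI)
    fix i
    show "free_basis (cmod F i) (bdry C i \<union> T i \<union> C i)" "(bdry C i \<union> T i) \<inter> C i = {}"
      by (rule complement_basis[OF C Y T(3,4)])+
  qed (rule C T T2)+
qed

end

locale split_complex = complex_with_bases E n e graded F B
  for E :: "('k::field, 'e::ring_1) gen_algebra" and n e graded
    and F :: "('e, 'm) cochain_complex" and B +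
  fixes C T :: "int \<Rightarrow> 'm set"
  assumes C_basis: "C i \<subseteq> B i" and d_inj: "inj_on (cdiff F i) (C i)"
    and T_cocycles: "T i \<subseteq> Zc i" and T_homogeneous: "graded \<Longrightarrow> T i \<subseteq> (\<Union>d. cgr F i d)"
    and T_bdry: "T i \<inter> bdry C i = {}" and C_disj: "(bdry C i \<union> T i) \<inter> C i = {}"
    and split_basis: "free_basis (cmod F i) (bdry C i \<union> T i \<union> C i)"
begin

abbreviation X :: "int \<Rightarrow> 'm set" where "X i \<equiv> bdry C i \<union> T i \<union> C i"

lemma homogeneous_X: "homogeneous_free_bases graded F X"
proof -
  have B: "B i \<subseteq> (\<Union>d. cgr F i d)" if graded for i
    using bases that by (auto simp: homogeneous_free_bases_def)
  have "X i \<subseteq> (\<Union>d. cgr F i d)" if graded for i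
  proof -
    have "C i \<subseteq> (\<Union>d. cgr F i d)" "C (i - 1) \<subseteq> (\<Union>d. cgr F (i - 1) d)"
      using order_trans[OF C_basis B[OF that]] by this+
    moreover have "bdry C i \<subseteq> (\<Union>d. cgr F i d)"
    proof clarify
      fix c assume "c \<in> C (i - 1)"
      then obtain d where "c \<in> cgr F (i - 1) d"
        using \<open>C (i - 1) \<subseteq> (\<Union>d. cgr F (i - 1) d)\<close> by blast
      then have "cdiff F (i - 1) c \<in> cgr F i d" by (rule d_gr'[OF that])
      then show "cdiff F (i - 1) c \<in> (\<Union>d. cgr F i d)" by blast
    qed
    ultimately show ?thesis using T_homogeneous[OF that, of i] by (intro Un_least)
  qed
  then show ?thesis using split_basis by (simp add: homogeneous_free_bases_def)
qed

sublocale X: complex_with_bases E n e graded F X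
  by unfold_locales (use cplx homogeneous_X in auto)

text \<open>The contracting homotopy of the summand spanned by \<open>C\<close> and \<open>d C\<close>, with the sign that makes
  \<open>1 + d s + s d\<close> vanish on it.\<close>

definition s_basis :: "int \<Rightarrow> 'm \<Rightarrow> 'm" where
  "s_basis i x = (if x \<in> bdry C i then \<ominus>\<^bsub>cmod F (i - 1)\<^esub> inv_into (C (i - 1)) (cdiff F (i - 1)) x
     else \<zero>\<^bsub>cmod F (i - 1)\<^esub>)"

definition s :: "int \<Rightarrow> 'm \<Rightarrow> 'm" where
  "s i = lext (cmod F i) (X i) (cmod F (i - 1)) (s_basis i)"

lemma C_closed: "c \<in> C i \<Longrightarrow> c \<in> carrier (cmod F i)"
  using C_basis F.basis_closed by blast

lemma s_basis_closed: "s_basis i \<in> X i \<rightarrow> carrier (cmod F (i - 1))"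
proof (rule Pi_I)
  fix x assume "x \<in> X i"
  show "s_basis i x \<in> carrier (cmod F (i - 1))"
  proof (cases "x \<in> bdry C i")
    case True
    then have "inv_into (C (i - 1)) (cdiff F (i - 1)) x \<in> C (i - 1)" by (rule inv_into_into)
    then show ?thesis using True C_closed by (simp add: s_basis_def)
  qed (simp add: s_basis_def)
qed

lemma s_hom: "left_hom (cmod F i) (cmod F (i - 1)) (s i)"
  unfolding s_def by (rule X.F.lext_left_hom[OF F.left_module_axioms s_basis_closed])

lemma s_hom': "left_hom (cmod F (i + 1)) (cmod F i) (s (i + 1))"
  using s_hom[of "i + 1"] by simp

lemma s_on_basis: "x \<in> X i \<Longrightarrow> s i x = s_basis i x"
  unfolding s_def by (rule X.F.lext_basis[OF F.left_module_axioms s_basis_closed])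

lemma s_T: "x \<in> T i \<Longrightarrow> s i x = \<zero>\<^bsub>cmod F (i - 1)\<^esub>"
  using T_bdry by (subst s_on_basis) (auto simp: s_basis_def)

lemma s_C: "x \<in> C i \<Longrightarrow> s i x = \<zero>\<^bsub>cmod F (i - 1)\<^esub>"
  using C_disj by (subst s_on_basis) (auto simp: s_basis_def)

lemma s_d_C: "c \<in> C i \<Longrightarrow> s (i + 1) (cdiff F i c) = \<ominus>\<^bsub>cmod F i\<^esub> c"
  using d_inj[of i] by (subst s_on_basis) (auto simp: s_basis_def)

lemma s_bdry: "c \<in> C (i - 1) \<Longrightarrow> s i (cdiff F (i - 1) c) = \<ominus>\<^bsub>cmod F (i - 1)\<^esub> c"
  using s_d_C[of c "i - 1"] by simp

lemmas s_simps =
  left_hom_closed[OF F.left_module_axioms F.left_module_axioms s_hom]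
  left_hom_zero[OF F.left_module_axioms F.left_module_axioms s_hom]

lemmas s_simps' =
  left_hom_closed[OF F.left_module_axioms F.left_module_axioms s_hom']
  left_hom_zero[OF F.left_module_axioms F.left_module_axioms s_hom']

text \<open>The projection to the span of \<open>T\<close> along the span of \<open>C\<close> and \<open>d C\<close>.\<close>

definition p :: "int \<Rightarrow> 'm \<Rightarrow> 'm" where
  "p i = X.F.cmap i (\<lambda>b y. if b \<in> T i then y else 0)"

lemma p_closed: "m \<in> carrier (cmod F i) \<Longrightarrow> p i m \<in> carrier (cmod F i)"
  unfolding p_def by (rule X.F.cmap_closed) auto

lemma coords_p: "m \<in> carrier (cmod F i) \<Longrightarrow> X.F.crd i (p i m) b = (if b \<in> T i then X.F.crd i m b else 0)"
  unfolding p_def by (subst X.F.coords_cmap) auto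

lemma p_hom: "left_hom (cmod F i) (cmod F i) (p i)"
  unfolding left_hom_def
proof (intro conjI ballI allI)
  fix x y assume "x \<in> carrier (cmod F i)" "y \<in> carrier (cmod F i)"
  then show "p i (x \<oplus>\<^bsub>cmod F i\<^esub> y) = p i x \<oplus>\<^bsub>cmod F i\<^esub> p i y"
    by (intro X.F.coords_eqI[where i = i]) (simp_all add: p_closed X.F.coords_add coords_p)
next
  fix r x assume "x \<in> carrier (cmod F i)"
  then show "p i (r \<odot>\<^bsub>cmod F i\<^esub> x) = r \<odot>\<^bsub>cmod F i\<^esub> p i x"
    by (intro X.F.coords_eqI[where i = i]) (simp_all add: p_closed F.smult_closed X.F.coords_smult coords_p)
qed (use p_closed in blast)

lemmas p_simps =
  left_hom_add[OF F.left_module_axioms F.left_module_axioms p_hom]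
  left_hom_zero[OF F.left_module_axioms F.left_module_axioms p_hom]
  left_hom_minus[OF F.left_module_axioms F.left_module_axioms p_hom]

lemma p_T: "x \<in> T i \<Longrightarrow> p i x = x"
proof (rule X.F.coords_eqI[where i = i])
  assume "x \<in> T i"
  then have x: "x \<in> X i" by blast
  then show xc: "x \<in> carrier (cmod F i)" by (rule X.F.basis_closed)
  then show "p i x \<in> carrier (cmod F i)" by (rule p_closed)
  show "X.F.crd i (p i x) b = X.F.crd i x b" for b
    unfolding coords_p[OF xc] X.F.coords_basis[OF x] using \<open>x \<in> T i\<close> by simp
qed

lemma p_not_T: assumes x: "x \<in> X i" and "x \<notin> T i" shows "p i x = \<zero>\<^bsub>cmod F i\<^esub>"
proof (rule X.F.coords_eqI[where i = i])
  have xc: "x \<in> carrier (cmod F i)" using x by (rule X.F.basis_closed)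
  then show "p i x \<in> carrier (cmod F i)" by (rule p_closed)
  show "X.F.crd i (p i x) b = X.F.crd i \<zero>\<^bsub>cmod F i\<^esub> b" for b
    unfolding coords_p[OF xc] X.F.coords_basis[OF x] X.F.coords_zero using assms(2) by auto
qed simp

lemma p_C: "x \<in> C i \<Longrightarrow> p i x = \<zero>\<^bsub>cmod F i\<^esub>"
  using C_disj by (intro p_not_T) auto

lemma p_bdry: "x \<in> bdry C i \<Longrightarrow> p i x = \<zero>\<^bsub>cmod F i\<^esub>"
  using T_bdry by (intro p_not_T) auto

lemma p_d_C: "x \<in> C i \<Longrightarrow> p (i + 1) (cdiff F i x) = \<zero>\<^bsub>cmod F (i + 1)\<^esub>"
  by (rule p_bdry) simp

lemma d_bdry: "x \<in> bdry C i \<Longrightarrow> cdiff F i x = \<zero>\<^bsub>cmod F (i + 1)\<^esub>"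
  using d_d' C_closed by blast

lemma X_cases:
  assumes "x \<in> X i"
  obtains "x \<in> T i" | "x \<in> C i" | c where "c \<in> C (i - 1)" "x = cdiff F (i - 1) c"
  using assms by blast

lemma p_s: "m \<in> carrier (cmod F i) \<Longrightarrow> p (i - 1) (s i m) = \<zero>\<^bsub>cmod F (i - 1)\<^esub>"
proof (rule X.F.left_hom_eqI[where i = i, OF F.left_module_axioms left_hom_comp[OF s_hom p_hom] left_hom_const_zero[OF F.left_module_axioms]])
  fix x assume "x \<in> X i"
  then show "p (i - 1) (s i x) = \<zero>\<^bsub>cmod F (i - 1)\<^esub>"
    by (cases rule: X_cases) (simp_all add: s_T s_C s_bdry p_simps C_closed p_C)
qed

text \<open>The span of \<open>C\<close> and \<open>d C\<close> is a subcomplex, so \<open>p d\<close> only depends on the component in the span of \<open>T\<close>.\<close>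

lemma p_d: "m \<in> carrier (cmod F i) \<Longrightarrow> p (i + 1) (cdiff F i m) = p (i + 1) (cdiff F i (p i m))"
proof (rule X.F.left_hom_eqI[where i = i, OF F.left_module_axioms left_hom_comp[OF d_hom p_hom] left_hom_comp[OF left_hom_comp[OF p_hom d_hom] p_hom]])
  fix x assume "x \<in> X i"
  then show "p (i + 1) (cdiff F i x) = p (i + 1) (cdiff F i (p i x))"
  proof (cases rule: X_cases)
    case (3 c)
    then have "x \<in> bdry C i" by blast
    then show ?thesis by (simp only: d_bdry p_bdry d_simps(4) p_simps(2))
  qed (simp_all only: p_T p_C p_d_C d_simps(4) p_simps(2))
qed

text \<open>A chain map homotopic to the identity that vanishes on the span of \<open>C\<close> and \<open>d C\<close>.  Its restriction to the span of
  \<open>T\<close> is the homotopy inverse of \<open>p\<close>.\<close>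

definition \<pi> :: "int \<Rightarrow> 'm \<Rightarrow> 'm" where
  "\<pi> i m = m \<oplus>\<^bsub>cmod F i\<^esub> (cdiff F (i - 1) (s i m) \<oplus>\<^bsub>cmod F i\<^esub> s (i + 1) (cdiff F i m))"

lemma id_hom: "left_hom M M (\<lambda>m. m)"
  by (simp add: left_hom_def)

lemma pi_hom: "left_hom (cmod F i) (cmod F i) (\<pi> i)"
  unfolding \<pi>_def
  by (intro left_hom_plus F.left_module_axioms id_hom left_hom_comp[OF s_hom d_hom'] left_hom_comp[OF d_hom s_hom'])

lemmas pi_simps =
  left_hom_closed[OF F.left_module_axioms F.left_module_axioms pi_hom]
  left_hom_zero[OF F.left_module_axioms F.left_module_axioms pi_hom]

lemma pi_C: assumes "x \<in> C i" shows "\<pi> i x = \<zero>\<^bsub>cmod F i\<^esub>"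
  using C_closed[OF assms] by (simp add: \<pi>_def s_C[OF assms] s_d_C[OF assms] d_simps' F.r_neg)

lemma pi_bdry: assumes "x \<in> bdry C i" shows "\<pi> i x = \<zero>\<^bsub>cmod F i\<^esub>"
proof -
  obtain c where c: "c \<in> C (i - 1)" "x = cdiff F (i - 1) c" using assms by blast
  have cc: "c \<in> carrier (cmod F (i - 1))" using c C_closed by blast
  show ?thesis
    unfolding \<pi>_def d_bdry[OF assms] unfolding c(2) s_bdry[OF c(1)]
    using cc by (simp add: s_simps' d_simps' F.r_neg)
qed

lemma pi_p: "m \<in> carrier (cmod F i) \<Longrightarrow> \<pi> i m = \<pi> i (p i m)"
proof (rule X.F.left_hom_eqI[where i = i, OF F.left_module_axioms pi_hom left_hom_comp[OF p_hom pi_hom]])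
  fix x assume "x \<in> X i"
  then show "\<pi> i x = \<pi> i (p i x)"
  proof (cases rule: X_cases)
    case (3 c)
    then have "x \<in> bdry C i" by blast
    then show ?thesis by (simp add: pi_bdry p_bdry pi_simps)
  qed (simp_all add: p_T p_C pi_C pi_simps)
qed

lemma p_pi: "m \<in> carrier (cmod F i) \<Longrightarrow> p i (\<pi> i m) = p i m"
proof (rule X.F.left_hom_eqI[where i = i, OF F.left_module_axioms left_hom_comp[OF pi_hom p_hom] p_hom])
  fix x assume "x \<in> X i"
  then show "p i (\<pi> i x) = p i x"
  proof (cases rule: X_cases)
    case 1
    have xc: "x \<in> carrier (cmod F i)" using 1 T_cocycles Zc_closed by blast
    have dc: "cdiff F i x \<in> carrier (cmod F (i + 1))" using xc by (rule d_simps)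
    have "p i (s (i + 1) (cdiff F i x)) = \<zero>\<^bsub>cmod F i\<^esub>" using p_s[OF dc] by simp
    then show ?thesis using xc dc by (simp add: \<pi>_def s_T[OF 1] d_simps' p_simps s_simps' p_closed)
  next
    case (3 c)
    then have "x \<in> bdry C i" by blast
    then show ?thesis by (simp add: pi_bdry p_bdry p_simps)
  qed (simp_all add: pi_C p_C p_simps)
qed

lemma d_pi: "m \<in> carrier (cmod F i) \<Longrightarrow> cdiff F i (\<pi> i m) = \<pi> (i + 1) (cdiff F i m)"
  using s_simps(1)[of m i] s_simps'(1)[of "cdiff F i m" i] d_simps(1)[of m i]
    d_simps(1)[of "s (i + 1) (cdiff F i m)" i] d_simps'(1)[of "s i m" i]
    left_hom_zero[OF F.left_module_axioms F.left_module_axioms s_hom', of "i + 1"]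
  by (simp add: \<pi>_def d_simps(2) d_d d_d')

text \<open>The minimal complex: the span of \<open>T\<close> with the compressed differential.\<close>

definition Gc :: "int \<Rightarrow> 'm set" where
  "Gc i = {m \<in> carrier (cmod F i). \<forall>b. b \<notin> T i \<longrightarrow> X.F.crd i m b = 0}"

definition min_model :: "('e, 'm) cochain_complex" where
  "min_model = \<lparr>cmod = (\<lambda>i. (cmod F i)\<lparr>carrier := Gc i\<rparr>), cdiff = (\<lambda>i m. p (i + 1) (cdiff F i m)),
     cgr = (\<lambda>i d. cgr F i d \<inter> Gc i)\<rparr>"

lemma min_model_simps [simp]:
  "cmod min_model i = (cmod F i)\<lparr>carrier := Gc i\<rparr>"
  "cdiff min_model i = (\<lambda>m. p (i + 1) (cdiff F i m))"
  "cgr min_model i d = cgr F i d \<inter> Gc i"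
  by (simp_all add: min_model_def)

lemma T_subset_X: "T i \<subseteq> X i"
  by blast

lemmas G_basis = X.F.sub_basis[OF T_subset_X Gc_def]

sublocale G: module_with_submodule "cmod F i" "Gc i" for i
  by unfold_locales (rule G_basis)

lemma p_Gc: "m \<in> carrier (cmod F i) \<Longrightarrow> p i m \<in> Gc i"
  by (simp add: Gc_def p_closed coords_p)

lemma p_id: "m \<in> Gc i \<Longrightarrow> p i m = m"
proof (rule X.F.coords_eqI[where i = i])
  assume m: "m \<in> Gc i"
  then show mc: "m \<in> carrier (cmod F i)" by (rule G.sub_carrier)
  then show "p i m \<in> carrier (cmod F i)" by (rule p_closed)
  fix b show "X.F.crd i (p i m) b = X.F.crd i m b" using m by (simp add: coords_p[OF mc] Gc_def)
qed

lemma p_V_smult: "m \<in> V_smult k (cmod F i) \<Longrightarrow> p i m \<in> V_smult k (cmod F i)"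
  by (rule ideal_smult_hom[OF F.left_module_axioms F.left_module_axioms p_hom])

lemma graded_X: "graded \<Longrightarrow> graded_free_E_module E n e (cmod F i) (X i) (cgr F i)"
  by (rule X.graded_F)

lemma p_gr: "graded \<Longrightarrow> m \<in> cgr F i d \<Longrightarrow> p i m \<in> cgr F i d"
proof -
  assume "graded" and m: "m \<in> cgr F i d"
  interpret GX: graded_free_E_module E n e "cmod F i" "X i" "cgr F i" by (rule graded_X[OF \<open>graded\<close>])
  show ?thesis
    using GX.gr_closed[OF m] GX.gr_coordsD[OF m] by (intro GX.gr_coordsI) (auto simp: p_closed coords_p)
qed

lemma s_gr: "graded \<Longrightarrow> m \<in> cgr F i d \<Longrightarrow> s i m \<in> cgr F (i - 1) d"
proof -
  assume "graded" and m: "m \<in> cgr F i d"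
  interpret GX: graded_free_E_module E n e "cmod F i" "X i" "cgr F i" by (rule graded_X[OF \<open>graded\<close>])
  interpret GX': graded_free_E_module E n e "cmod F (i - 1)" "X (i - 1)" "cgr F (i - 1)" by (rule graded_X[OF \<open>graded\<close>])
  have "s_basis i x \<in> cgr F (i - 1) (d' + 0)" if x: "x \<in> X i" "x \<in> cgr F i d'" for x d'
  proof (cases "x \<in> bdry C i")
    case True
    let ?c = "inv_into (C (i - 1)) (cdiff F (i - 1)) x"
    have c: "?c \<in> C (i - 1)" "cdiff F (i - 1) ?c = x"
      using True by (auto intro: inv_into_into f_inv_into_f)
    then obtain a where a: "?c \<in> cgr F (i - 1) a" using GX'.homogeneous_basis by blast
    then have "x \<in> cgr F i a" using d_gr'[OF \<open>graded\<close>] c(2) by metis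
    \<comment> \<open>A nonzero element has only one degree, so the element of \<open>C\<close> that \<open>d\<close> maps to \<open>x\<close> has the degree of \<open>x\<close>.\<close>
    moreover have "x \<noteq> \<zero>\<^bsub>cmod F i\<^esub>" using X.F.coords_basis[OF x(1)] X.F.coords_zero[of i x] by auto
    ultimately have "a = d'" using GX.gcomp_homogeneous[OF x(2)] GX.gcomp_homogeneous[of x a] by metis
    then have "\<ominus>\<^bsub>cmod F (i - 1)\<^esub> ?c \<in> cgr F (i - 1) d'"
      using a subgroup.m_inv_closed[OF GX'.gr_subgroup] by (simp add: a_inv_def)
    then show ?thesis using True by (simp add: s_basis_def)
  next
    case False
    then show ?thesis by (simp add: s_basis_def GX'.gr_zero)
  qed
  then have "lext (cmod F i) (X i) (cmod F (i - 1)) (s_basis i) m \<in> cgr F (i - 1) (d + 0)"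
    using m by (intro GX.lext_gr[OF GX'.graded_left_module_axioms])
  then show ?thesis by (simp add: s_def)
qed

lemma pi_gr: "graded \<Longrightarrow> m \<in> cgr F i d \<Longrightarrow> \<pi> i m \<in> cgr F i d"
proof -
  assume gr: "graded" and m: "m \<in> cgr F i d"
  interpret GX: graded_free_E_module E n e "cmod F i" "X i" "cgr F i" by (rule graded_X[OF gr])
  show ?thesis unfolding \<pi>_def
    using m d_gr'[OF gr s_gr[OF gr m]] s_gr[OF gr d_gr[OF gr m]] by (simp add: GX.gr_add)
qed

lemma min_model_complex: "is_complex graded (E_deg E) min_model"
  unfolding is_complex_def
proof (intro conjI allI impI ballI)
  fix i
  show "left_module (cmod min_model i)" by (simp add: G.left_module_sub)
  have "left_hom (cmod F i) (cmod F (i + 1)) (\<lambda>m. p (i + 1) (cdiff F i m))"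
    by (rule left_hom_comp[OF d_hom p_hom])
  then show "left_hom (cmod min_model i) (cmod min_model (i + 1)) (cdiff min_model i)"
    using p_Gc d_simps(1) G.sub_carrier by (auto simp: left_hom_def)
next
  fix i m assume "m \<in> carrier (cmod min_model i)"
  then have m: "m \<in> carrier (cmod F i)" using G.sub_carrier by simp
  show "cdiff min_model (i + 1) (cdiff min_model i m) = \<zero>\<^bsub>cmod min_model (i + 1 + 1)\<^esub>"
    using p_d[OF d_simps(1)[OF m]] d_d[OF m] by (simp add: p_simps)
next
  fix i assume gr: "graded"
  interpret GX: graded_free_E_module E n e "cmod F i" "X i" "cgr F i" by (rule graded_X[OF gr])
  show "module_grading (E_deg E) (cmod min_model i) (cgr min_model i)"
    using GX.sub_basis_grading[OF T_subset_X Gc_def] by (simp add: min_model_def)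
  show "cdiff min_model i ` cgr min_model i d \<subseteq> cgr min_model (i + 1) d" for d
    using p_gr[OF gr d_gr[OF gr]] p_Gc d_simps(1) G.sub_carrier by auto
qed

lemma min_model_bases: "homogeneous_free_bases graded min_model T"
  unfolding homogeneous_free_bases_def
proof (intro allI conjI impI)
  fix i
  show "free_basis (cmod min_model i) (T i)" by (simp add: G_basis)
  assume "graded"
  then have "T i \<subseteq> (\<Union>d. cgr F i d)" by (rule T_homogeneous)
  moreover have "T i \<subseteq> Gc i"
    using X.F.basis_closed by (auto simp: Gc_def X.F.coords_basis)
  ultimately show "T i \<subseteq> (\<Union>d. cgr min_model i d)" by auto
qed

text \<open>The elements of \<open>T\<close> are cocycles modulo \<open>(V)\<close>, and \<open>p\<close> preserves \<open>(V)F\<close>.\<close>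

lemma min_model_minimal: "minimal_complex E min_model T"
  unfolding minimal_complex_def
proof (intro allI ballI)
  fix i b b' assume b: "b \<in> T i" "b' \<in> T (i + 1)"
  have bc: "b \<in> carrier (cmod F i)" and db: "cdiff F i b \<in> V_smult 1 (cmod F (i + 1))"
    using b(1) T_cocycles[of i] by (auto simp: Zc_def)
  have "p (i + 1) (cdiff F i b) \<in> Gc (i + 1)" using p_Gc d_simps(1)[OF bc] by blast
  then have "diff_entry min_model T i b b' = X.F.crd (i + 1) (p (i + 1) (cdiff F i b)) b'"
    by (simp add: diff_entry_def G_basis)
  moreover have "X.F.crd (i + 1) (p (i + 1) (cdiff F i b)) b' \<in> filt 1"
    using p_V_smult[OF db] X.F.V_smult_iff by blast
  ultimately show "diff_entry min_model T i b b' \<in> V_ideal_power E 1"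
    by (simp only: V_ideal_power_eq)
qed

text \<open>The two maps are \<open>p\<close> and \<open>\<pi>\<close>: here \<open>p \<pi>\<close> is the identity on the span of \<open>T\<close>, and \<open>\<pi> p = \<pi>\<close> is homotopic to the
  identity through \<open>s\<close>.\<close>

lemma min_model_equivalent: "homotopy_equivalent_complexes graded F min_model"
  unfolding homotopy_equivalent_complexes_def
proof (rule exI[of _ p], rule exI[of _ \<pi>], intro conjI)
  show "chain_map graded F min_model p"
    unfolding chain_map_def
  proof (intro conjI allI impI ballI)
    fix i
    show "left_hom (cmod F i) (cmod min_model i) (p i)"
      using p_hom[of i] p_Gc[of _ i] by (auto simp: left_hom_def)
    show "p (i + 1) (cdiff F i m) = cdiff min_model i (p i m)" if "m \<in> carrier (cmod F i)" for m
      using p_d[OF that] by simp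
    show "p i ` cgr F i d \<subseteq> cgr min_model i d" if "graded" for d
    proof -
      interpret GX: graded_free_E_module E n e "cmod F i" "X i" "cgr F i" by (rule graded_X[OF that])
      show ?thesis using p_gr[OF that] p_Gc GX.gr_closed by auto
    qed
  qed
  show "chain_map graded min_model F \<pi>"
    unfolding chain_map_def
  proof (intro conjI allI impI ballI)
    fix i
    show "left_hom (cmod min_model i) (cmod F i) (\<pi> i)"
      using pi_hom[of i] G.sub_carrier[of _ i] by (auto simp: left_hom_def)
    show "\<pi> (i + 1) (cdiff min_model i m) = cdiff F i (\<pi> i m)" if "m \<in> carrier (cmod min_model i)" for m
    proof -
      have m: "m \<in> carrier (cmod F i)" using that G.sub_carrier by simp
      show ?thesis using pi_p[OF d_simps(1)[OF m]] d_pi[OF m] by simp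
    qed
    show "\<pi> i ` cgr min_model i d \<subseteq> cgr F i d" if "graded" for d
      using pi_gr[OF that] by auto
  qed
  show "chain_homotopic graded F F (\<lambda>i. \<pi> i \<circ> p i) (\<lambda>i. id)"
    unfolding chain_homotopic_def
  proof (intro exI[of _ s] conjI allI impI ballI)
    fix i
    show "left_hom (cmod F i) (cmod F (i - 1)) (s i)" by (rule s_hom)
    show "s i ` cgr F i d \<subseteq> cgr F (i - 1) d" if "graded" for d using s_gr[OF that] by blast
    show "(\<pi> i \<circ> p i) m \<ominus>\<^bsub>cmod F i\<^esub> id m = cdiff F (i - 1) (s i m) \<oplus>\<^bsub>cmod F i\<^esub> s (i + 1) (cdiff F i m)"
      if m: "m \<in> carrier (cmod F i)" for m
    proof -
      have "cdiff F (i - 1) (s i m) \<in> carrier (cmod F i)" "s (i + 1) (cdiff F i m) \<in> carrier (cmod F i)"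
        using m d_simps(1) d_simps'(1) s_simps(1) s_simps'(1) by blast+
      then have "\<pi> i m \<ominus>\<^bsub>cmod F i\<^esub> m = cdiff F (i - 1) (s i m) \<oplus>\<^bsub>cmod F i\<^esub> s (i + 1) (cdiff F i m)"
        using m unfolding \<pi>_def by (intro F.coords_eqI[where i = i]) (simp_all add: F.coords_simps)
      then show ?thesis using pi_p[OF m] by simp
    qed
  qed
  show "chain_homotopic graded min_model min_model (\<lambda>i. p i \<circ> \<pi> i) (\<lambda>i. id)"
    unfolding chain_homotopic_def
  proof (intro exI[of _ "\<lambda>i m. \<zero>\<^bsub>cmod F (i - 1)\<^esub>"] conjI allI impI ballI)
    fix i
    show "left_hom (cmod min_model i) (cmod min_model (i - 1)) (\<lambda>m. \<zero>\<^bsub>cmod F (i - 1)\<^esub>)"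
      using left_hom_const_zero[OF G.left_module_sub[of "i - 1"], of "cmod min_model i"] by simp
    show "(\<lambda>m. \<zero>\<^bsub>cmod F (i - 1)\<^esub>) ` cgr min_model i d \<subseteq> cgr min_model (i - 1) d" if "graded" for d
    proof -
      interpret GX: graded_free_E_module E n e "cmod F (i - 1)" "X (i - 1)" "cgr F (i - 1)" by (rule graded_X[OF that])
      show ?thesis using GX.gr_zero G.sub_zero by auto
    qed
    fix m assume "m \<in> carrier (cmod min_model i)"
    then have m: "m \<in> Gc i" "m \<in> carrier (cmod F i)" using G.sub_carrier by auto
    interpret L: left_module "cmod min_model i" using G.left_module_sub[of i] by simp
    have "(p i \<circ> \<pi> i) m = m" using p_pi[OF m(2)] p_id[OF m(1)] by simp
    then have "(p i \<circ> \<pi> i) m \<ominus>\<^bsub>cmod min_model i\<^esub> id m = \<zero>\<^bsub>cmod F i\<^esub>"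
      using L.r_neg[of m] L.minus_eq m(1) by simp
    moreover have "cdiff min_model (i - 1) \<zero>\<^bsub>cmod F (i - 1)\<^esub> = \<zero>\<^bsub>cmod F i\<^esub>"
      by (simp add: d_simps' p_simps)
    ultimately show "(p i \<circ> \<pi> i) m \<ominus>\<^bsub>cmod min_model i\<^esub> id m
        = cdiff min_model (i - 1) \<zero>\<^bsub>cmod F (i - 1)\<^esub> \<oplus>\<^bsub>cmod min_model i\<^esub> \<zero>\<^bsub>cmod F (i + 1 - 1)\<^esub>"
      by simp
  qed
qed

end

lemma (in complex_with_bases) lin_exists: "\<exists>L :: ('e, 'm) cochain_complex. is_lin graded E F L"
proof -
  obtain C T where h: "\<forall>i. C i \<subseteq> B i \<and> inj_on (cdiff F i) (C i) \<and> T i \<subseteq> Zc i \<and> (graded \<longrightarrow> T i \<subseteq> (\<Union>d. cgr F i d)) \<and>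
     T i \<inter> bdry C i = {} \<and> (bdry C i \<union> T i) \<inter> C i = {} \<and> free_basis (cmod F i) (bdry C i \<union> T i \<union> C i)"
    using splitting_exists by (elim exE)
  interpret S: split_complex E n e graded F B C T
  proof unfold_locales
    fix i
    show "C i \<subseteq> B i" "inj_on (cdiff F i) (C i)" "T i \<subseteq> Zc i" "T i \<inter> bdry C i = {}"
        "(bdry C i \<union> T i) \<inter> C i = {}" "free_basis (cmod F i) (bdry C i \<union> T i \<union> C i)"
      using spec[OF h, of i] by (simp_all only:)
    show "T i \<subseteq> (\<Union>d. cgr F i d)" if graded
      using spec[OF h, of i] that by (elim conjE) (rule mp)
  qed
  show ?thesis
    unfolding is_lin_def
    using S.min_model_complex S.min_model_bases S.min_model_minimal S.min_model_equivalent by blast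
qed

section \<open>The tensor product \<open>E \<otimes> N\<close>\<close>

locale tensor_space = exterior_basis E n e + N: left_module N
  for E :: "('k::field, 'e::ring_1) gen_algebra" and n e and N :: "('k, 'h) module"
begin

abbreviation FT :: "('e, 'e \<times> 'h \<Rightarrow>\<^sub>0 int) module" where "FT \<equiv> free_tensor N"
abbreviation S :: "('e \<times> 'h) set" where "S \<equiv> UNIV \<times> carrier N"
abbreviation R where "R \<equiv> tensor_relations E N"
abbreviation act :: "'e \<Rightarrow> ('e \<times> 'h \<Rightarrow>\<^sub>0 int) \<Rightarrow> ('e \<times> 'h \<Rightarrow>\<^sub>0 int)" where
  "act a \<equiv> frag_extend (\<lambda>(y, h). frag_of (a * y, h))"
abbreviation ET where "ET \<equiv> E_tensor E N"
abbreviation pt where "pt \<equiv> pure_tensor E N"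

lemma FT_simps [simp]:
  "carrier FT = {c. Poly_Mapping.keys c \<subseteq> S}" "add FT = (+)" "ring.zero FT = 0" "smult FT = act"
  by (simp_all add: free_tensor_def free_Abelian_group_def)

definition relation_generators :: "('e \<times> 'h \<Rightarrow>\<^sub>0 int) set" where
  "relation_generators =
     {frag_of (y + z, h) - frag_of (y, h) - frag_of (z, h) | y z h. h \<in> carrier N} \<union>
      {frag_of (y, h \<oplus>\<^bsub>N\<^esub> h') - frag_of (y, h) - frag_of (y, h') | y h h'.
         h \<in> carrier N \<and> h' \<in> carrier N} \<union>
      {frag_of (scal E a y, h) - frag_of (y, a \<odot>\<^bsub>N\<^esub> h) | a y h. h \<in> carrier N}"

lemma keys_diffI: "Poly_Mapping.keys a \<subseteq> A \<Longrightarrow> Poly_Mapping.keys b \<subseteq> A \<Longrightarrow> Poly_Mapping.keys (a - b) \<subseteq> A"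
  using keys_diff[of a b] by blast

lemma keys_addI: "Poly_Mapping.keys a \<subseteq> A \<Longrightarrow> Poly_Mapping.keys b \<subseteq> A \<Longrightarrow> Poly_Mapping.keys (a + b) \<subseteq> A"
  using Poly_Mapping.keys_add[of a b] by blast

lemma keys_generators: "g \<in> relation_generators \<Longrightarrow> Poly_Mapping.keys g \<subseteq> S"
  unfolding relation_generators_def by (auto simp: N.smult_closed dest!: subsetD[OF keys_diff])

lemma R_eq: "R = generate (free_Abelian_group S) relation_generators"
  by (simp add: tensor_relations_def relation_generators_def)

lemma R_induct_generators [consumes 1, case_names zero add minus gen]:
  assumes "c \<in> R" "P 0" "\<And>a b. P a \<Longrightarrow> P b \<Longrightarrow> P (a + b)" "\<And>a. P a \<Longrightarrow> P (- a)"
    and gen: "\<And>g. g \<in> relation_generators \<Longrightarrow> P g"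
  shows "P c"
  using assms(1) unfolding R_eq
proof (induction rule: generate.induct)
  case (inv h)
  then show ?case using gen assms(4) keys_generators by simp
qed (use gen assms(2,3) in \<open>simp_all\<close>)

lemma relation_generators_cases [consumes 1, case_names left right scal]:
  assumes "g \<in> relation_generators"
  obtains y z h where "h \<in> carrier N" "g = frag_of (y + z, h) - frag_of (y, h) - frag_of (z, h)"
    | y h h' where "h \<in> carrier N" "h' \<in> carrier N" "g = frag_of (y, h \<oplus>\<^bsub>N\<^esub> h') - frag_of (y, h) - frag_of (y, h')"
    | a y h where "h \<in> carrier N" "g = frag_of (scal E a y, h) - frag_of (y, a \<odot>\<^bsub>N\<^esub> h)"
  using assms unfolding relation_generators_def by blast

lemma R_gen: "g \<in> relation_generators \<Longrightarrow> g \<in> R"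
  unfolding R_eq by (rule generate.incl)

lemma R_left: "h \<in> carrier N \<Longrightarrow> frag_of (y + z, h) - frag_of (y, h) - frag_of (z, h) \<in> R"
  and R_right: "h \<in> carrier N \<Longrightarrow> h' \<in> carrier N \<Longrightarrow> frag_of (y, h \<oplus>\<^bsub>N\<^esub> h') - frag_of (y, h) - frag_of (y, h') \<in> R"
  and R_scal: "h \<in> carrier N \<Longrightarrow> frag_of (scal E a y, h) - frag_of (y, a \<odot>\<^bsub>N\<^esub> h) \<in> R"
  by (rule R_gen, unfold relation_generators_def, blast)+

lemma R_zero: "0 \<in> R"
  unfolding R_eq using generate.one[of "free_Abelian_group S"] by simp

lemma R_add: "a \<in> R \<Longrightarrow> b \<in> R \<Longrightarrow> a + b \<in> R"
  unfolding R_eq using generate.eng[of a "free_Abelian_group S" relation_generators b] by simp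

lemma R_carrier: "c \<in> R \<Longrightarrow> Poly_Mapping.keys c \<subseteq> S"
  by (induction rule: R_induct_generators) (simp_all add: keys_addI keys_generators)

lemma R_minus: "c \<in> R \<Longrightarrow> - c \<in> R"
proof -
  have gen: "- g \<in> R" if "g \<in> relation_generators" for g
    using generate.inv[OF that, of "free_Abelian_group S"] keys_generators[OF that] by (simp add: R_eq)
  have "c \<in> R \<and> - c \<in> R" if "c \<in> R"
    using that
  proof (induction rule: R_induct_generators)
    case (add a b)
    then show ?case using R_add[of "- a" "- b"] R_add[of a b] by simp
  qed (simp_all add: R_zero R_gen gen)
  then show "c \<in> R \<Longrightarrow> - c \<in> R" by blast
qed

lemma R_diff: "a \<in> R \<Longrightarrow> b \<in> R \<Longrightarrow> a - b \<in> R"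
  using R_add[of a "- b"] R_minus by simp

lemma additive_on_R:
  assumes "c \<in> R" and Q: "P 0" "\<And>a b. P a \<Longrightarrow> P b \<Longrightarrow> P (a + b)" "\<And>a. P a \<Longrightarrow> P (- a)"
    and \<phi>: "\<And>a b. \<phi> (a + b) = \<phi> a + \<phi> b" "\<And>a. \<phi> (- a) = - \<phi> a" "\<phi> 0 = 0"
    and gens: "\<And>g. g \<in> relation_generators \<Longrightarrow> P (\<phi> g)"
  shows "P (\<phi> c)"
  using assms(1)
  by (induction rule: R_induct_generators) (simp_all add: Q \<phi> gens)

lemma act_closed: "Poly_Mapping.keys c \<subseteq> S \<Longrightarrow> Poly_Mapping.keys (act a c) \<subseteq> S"
  using keys_frag_extend[of "\<lambda>(y, h). frag_of (a * y, h)" c] by fastforce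

lemma act_generators:
  assumes "g \<in> relation_generators" shows "act a g \<in> R"
  using assms
proof (cases rule: relation_generators_cases)
  case (left y z h)
  then show ?thesis using R_left[of h "a * y" "a * z"] by (simp add: frag_extend_diff distrib_left)
next
  case (right y h h')
  then show ?thesis using R_right[of h h' "a * y"] by (simp add: frag_extend_diff)
next
  case (scal b y h)
  then show ?thesis using R_scal[of h b "a * y"] by (simp add: frag_extend_diff scal_right)
qed

lemma act_R: "c \<in> R \<Longrightarrow> act a c \<in> R"
  by (rule additive_on_R[where P = "\<lambda>c. c \<in> R" and \<phi> = "act a"])
     (auto intro: R_zero R_add R_minus act_generators simp: frag_extend_add frag_extend_minus)

lemma abelian_group_FT: "abelian_group FT"
proof (rule abelian_groupI)
  fix x assume "x \<in> carrier FT"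
  then show "\<exists>y\<in>carrier FT. y \<oplus>\<^bsub>FT\<^esub> x = \<zero>\<^bsub>FT\<^esub>" by (intro bexI[of _ "- x"]) simp_all
qed (simp_all add: keys_addI add.assoc add.commute add.left_commute)

sublocale T: abelian_group FT by (rule abelian_group_FT)

lemma FT_minus: "c \<in> carrier FT \<Longrightarrow> \<ominus>\<^bsub>FT\<^esub> c = - c"
  by (rule T.minus_equality) simp_all

lemma FT_diff: "c \<in> carrier FT \<Longrightarrow> c' \<in> carrier FT \<Longrightarrow> c \<ominus>\<^bsub>FT\<^esub> c' = c - c'"
  by (simp add: T.minus_eq FT_minus del: FT_simps(1))

sublocale T: operator_subgroup FT R
proof unfold_locales
  show "x \<in> R \<Longrightarrow> \<ominus>\<^bsub>FT\<^esub> x \<in> R" for x using FT_minus[of x] R_carrier R_minus by simp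
qed (simp_all add: act_closed act_R R_zero R_add frag_extend_add R_carrier)

lemma ET_eq: "ET = T.Q"
  by (simp add: E_tensor_def)

abbreviation cs where "cs c \<equiv> R +>\<^bsub>FT\<^esub> c"

lemma cs_closed: "Poly_Mapping.keys c \<subseteq> S \<Longrightarrow> cs c \<in> carrier ET"
  unfolding ET_eq by (rule T.coset_closed) simp

lemma cs_surj: "X \<in> carrier ET \<Longrightarrow> \<exists>c. Poly_Mapping.keys c \<subseteq> S \<and> X = cs c"
  unfolding ET_eq using T.coset_surj[of X] by auto

lemma cs_eq_iff: "Poly_Mapping.keys c \<subseteq> S \<Longrightarrow> Poly_Mapping.keys c' \<subseteq> S \<Longrightarrow> cs c = cs c' \<longleftrightarrow> c - c' \<in> R"
  using T.coset_eq_iff[of c c'] FT_diff[of c c'] by simp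

lemma cs_add: "Poly_Mapping.keys c \<subseteq> S \<Longrightarrow> Poly_Mapping.keys c' \<subseteq> S \<Longrightarrow> cs c \<oplus>\<^bsub>ET\<^esub> cs c' = cs (c + c')"
  unfolding ET_eq using T.coset_add[of c c'] by simp

lemma cs_zero: "cs 0 = \<zero>\<^bsub>ET\<^esub>"
  unfolding ET_eq using T.coset_zero by simp

lemma cs_smult: "Poly_Mapping.keys c \<subseteq> S \<Longrightarrow> a \<odot>\<^bsub>ET\<^esub> cs c = cs (act a c)"
  unfolding ET_eq using T.coset_smult[of c a] by simp

text \<open>The operators only form a module structure modulo the relations, by biadditivity on the left.\<close>

lemma act_distrib:
  assumes "Poly_Mapping.keys c \<subseteq> S" shows "act (r + s) c - (act r c + act s c) \<in> R"
proof (rule free_Abelian_group_induct[OF assms])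
  fix x y assume "act (r + s) x - (act r x + act s x) \<in> R" "act (r + s) y - (act r y + act s y) \<in> R"
  then have "(act (r + s) x - (act r x + act s x)) - (act (r + s) y - (act r y + act s y)) \<in> R"
    by (rule R_diff)
  then show "act (r + s) (x - y) - (act r (x - y) + act s (x - y)) \<in> R"
    by (simp add: frag_extend_diff algebra_simps)
next
  fix a assume "a \<in> S"
  then show "act (r + s) (frag_of a) - (act r (frag_of a) + act s (frag_of a)) \<in> R"
    using R_left[of "snd a" "r * fst a" "s * fst a"]
    by (auto simp: distrib_right diff_diff_eq split: prod.splits)
qed (simp add: R_zero)

lemma act_mult: "act (r * s) c = act r (act s c)"
  using subset_UNIV by (induction c rule: frag_induction) (auto simp: frag_extend_diff mult.assoc)

lemma act_one: "act 1 c = c"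
  using subset_UNIV by (induction c rule: frag_induction) (auto simp: frag_extend_diff)

lemma left_module_ET: "left_module ET"
proof -
  have ag: "abelian_group ET" unfolding ET_eq by (rule T.abelian_group_quotient)
  show ?thesis
  proof (intro left_module.intro left_module_axioms.intro ag)
    fix X Y and r s :: 'e assume "X \<in> carrier ET" "Y \<in> carrier ET"
    then obtain c c' where c: "Poly_Mapping.keys c \<subseteq> S" "X = cs c" "Poly_Mapping.keys c' \<subseteq> S" "Y = cs c'"
      using cs_surj by metis
    show "r \<odot>\<^bsub>ET\<^esub> (X \<oplus>\<^bsub>ET\<^esub> Y) = r \<odot>\<^bsub>ET\<^esub> X \<oplus>\<^bsub>ET\<^esub> r \<odot>\<^bsub>ET\<^esub> Y"
      using c by (simp add: cs_add cs_smult act_closed keys_addI frag_extend_add)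
  next
    fix X and r s :: 'e assume "X \<in> carrier ET"
    then obtain c where c: "Poly_Mapping.keys c \<subseteq> S" "X = cs c" using cs_surj by metis
    show "r \<odot>\<^bsub>ET\<^esub> X \<in> carrier ET" using c by (simp add: cs_smult act_closed cs_closed)
    show "(r + s) \<odot>\<^bsub>ET\<^esub> X = r \<odot>\<^bsub>ET\<^esub> X \<oplus>\<^bsub>ET\<^esub> s \<odot>\<^bsub>ET\<^esub> X"
      using c act_distrib[OF c(1), of r s] by (simp add: cs_add cs_smult act_closed cs_eq_iff keys_addI)
    show "(r * s) \<odot>\<^bsub>ET\<^esub> X = r \<odot>\<^bsub>ET\<^esub> (s \<odot>\<^bsub>ET\<^esub> X)"
      using c by (simp add: cs_smult act_closed act_mult)
    show "1 \<odot>\<^bsub>ET\<^esub> X = X" by (simp only: c(2) cs_smult[OF c(1)] act_one)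
  qed
qed

sublocale ET: left_module ET by (rule left_module_ET)

lemma pt_eq: "pt y h = cs (frag_of (y, h))"
  by (simp add: pure_tensor_def)

lemma pt_closed: "h \<in> carrier N \<Longrightarrow> pt y h \<in> carrier ET"
  by (simp add: pt_eq cs_closed)

lemma pt_smult: "h \<in> carrier N \<Longrightarrow> a \<odot>\<^bsub>ET\<^esub> pt y h = pt (a * y) h"
  by (simp add: pt_eq cs_smult)

lemma pt_add_right: "h \<in> carrier N \<Longrightarrow> h' \<in> carrier N \<Longrightarrow> pt y (h \<oplus>\<^bsub>N\<^esub> h') = pt y h \<oplus>\<^bsub>ET\<^esub> pt y h'"
  using R_right[of h h' y] by (simp add: pt_eq cs_add cs_eq_iff keys_addI diff_diff_eq)

lemma pt_scal: "h \<in> carrier N \<Longrightarrow> pt (scal E a y) h = pt y (a \<odot>\<^bsub>N\<^esub> h)"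
  using R_scal[of h a y] by (simp add: pt_eq cs_eq_iff N.smult_closed)

lemma pt_zero_right: "pt y \<zero>\<^bsub>N\<^esub> = \<zero>\<^bsub>ET\<^esub>"
  using pt_scal[of "\<zero>\<^bsub>N\<^esub>" 0 y] pt_smult[of "\<zero>\<^bsub>N\<^esub>" 0 y] pt_closed[of "\<zero>\<^bsub>N\<^esub>" y] by simp

lemma pt_finsum_right: "f \<in> A \<rightarrow> carrier N \<Longrightarrow> pt y (\<Oplus>\<^bsub>N\<^esub>i\<in>A. f i) = (\<Oplus>\<^bsub>ET\<^esub>i\<in>A. pt y (f i))"
proof (induction A rule: infinite_finite_induct)
  case (insert a A)
  then have "f a \<in> carrier N" "f \<in> A \<rightarrow> carrier N" by auto
  moreover from this have "(\<lambda>i. pt y (f i)) \<in> A \<rightarrow> carrier ET" using pt_closed by auto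
  ultimately show ?case using insert by (simp add: pt_add_right pt_closed)
qed (simp_all add: pt_zero_right)

lemma cs_sum:
  "(\<And>i. i \<in> I \<Longrightarrow> Poly_Mapping.keys (f i) \<subseteq> S) \<Longrightarrow> cs (\<Sum>i\<in>I. f i) = (\<Oplus>\<^bsub>ET\<^esub>i\<in>I. cs (f i))"
proof (induction I rule: infinite_finite_induct)
  case (insert i I)
  have k: "Poly_Mapping.keys (\<Sum>i\<in>I. f i) \<subseteq> S" using insert.prems keys_sum[of f I] by blast
  have "(\<lambda>i. cs (f i)) \<in> I \<rightarrow> carrier ET" "cs (f i) \<in> carrier ET" using insert.prems cs_closed by auto
  then show ?case using insert k by (simp add: cs_add[symmetric])
qed (simp_all add: cs_zero)

lemma tensor_induct:
  assumes "X \<in> carrier ET" and pure: "\<And>y h. h \<in> carrier N \<Longrightarrow> P (pt y h)"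
    and diff: "\<And>X Y. X \<in> carrier ET \<Longrightarrow> Y \<in> carrier ET \<Longrightarrow> P X \<Longrightarrow> P Y \<Longrightarrow> P (X \<ominus>\<^bsub>ET\<^esub> Y)"
  shows "P X"
proof -
  obtain c where c: "Poly_Mapping.keys c \<subseteq> S" "X = cs c" using cs_surj assms(1) by blast
  have csd: "cs (x - y) = cs x \<ominus>\<^bsub>ET\<^esub> cs y" if k: "Poly_Mapping.keys x \<subseteq> S" "Poly_Mapping.keys y \<subseteq> S" for x y
  proof -
    have "cs (x - y) \<oplus>\<^bsub>ET\<^esub> cs y = cs x" using k by (simp add: cs_add keys_diffI)
    then have "cs x \<ominus>\<^bsub>ET\<^esub> cs y = cs (x - y) \<oplus>\<^bsub>ET\<^esub> (cs y \<oplus>\<^bsub>ET\<^esub> \<ominus>\<^bsub>ET\<^esub> cs y)"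
      using k cs_closed[of "x - y"] cs_closed[of y] keys_diffI[OF k] by (simp add: ET.minus_eq ET.a_assoc[symmetric])
    then show ?thesis using k cs_closed[of "x - y"] cs_closed[of y] keys_diffI[OF k] by (simp add: ET.r_neg)
  qed
  have "P (cs c) \<and> Poly_Mapping.keys c \<subseteq> S"
  proof (rule free_Abelian_group_induct[OF c(1)])
    have "P (pt 0 \<zero>\<^bsub>N\<^esub>)" by (rule pure) simp
    then show "P (cs 0) \<and> Poly_Mapping.keys (0 :: 'e \<times> 'h \<Rightarrow>\<^sub>0 int) \<subseteq> S" by (simp add: pt_zero_right cs_zero)
  next
    fix x y assume "Poly_Mapping.keys x \<subseteq> S" "Poly_Mapping.keys y \<subseteq> S"
      "P (cs x) \<and> Poly_Mapping.keys x \<subseteq> S" "P (cs y) \<and> Poly_Mapping.keys y \<subseteq> S"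
    then show "P (cs (x - y)) \<and> Poly_Mapping.keys (x - y) \<subseteq> S"
      using csd[of x y] diff[of "cs x" "cs y"] cs_closed keys_diffI[of x S y] by simp
  next
    fix a assume "a \<in> S"
    then show "P (cs (frag_of a)) \<and> Poly_Mapping.keys (frag_of a) \<subseteq> S"
      using pure[of "snd a" "fst a"] by (auto simp: pt_eq)
  qed
  then show ?thesis using c by simp
qed

text \<open>The universal property, in the form of a homomorphism on the free group that kills the
  relations.\<close>

lemma tensor_universal:
  assumes M: "abelian_group M"
    and closed: "\<And>y h. h \<in> carrier N \<Longrightarrow> \<beta> y h \<in> carrier M"
    and left: "\<And>y z h. h \<in> carrier N \<Longrightarrow> \<beta> (y + z) h = \<beta> y h \<oplus>\<^bsub>M\<^esub> \<beta> z h"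
    and right: "\<And>y h h'. h \<in> carrier N \<Longrightarrow> h' \<in> carrier N \<Longrightarrow> \<beta> y (h \<oplus>\<^bsub>N\<^esub> h') = \<beta> y h \<oplus>\<^bsub>M\<^esub> \<beta> y h'"
    and scal: "\<And>a y h. h \<in> carrier N \<Longrightarrow> \<beta> (scal E a y) h = \<beta> y (a \<odot>\<^bsub>N\<^esub> h)"
  obtains \<rho> where "\<And>y h. h \<in> carrier N \<Longrightarrow> \<rho> (frag_of (y, h)) = \<beta> y h"
    "\<And>c c'. Poly_Mapping.keys c \<subseteq> S \<Longrightarrow> Poly_Mapping.keys c' \<subseteq> S \<Longrightarrow> \<rho> (c + c') = \<rho> c \<oplus>\<^bsub>M\<^esub> \<rho> c'"
    "\<And>c. Poly_Mapping.keys c \<subseteq> S \<Longrightarrow> \<rho> c \<in> carrier M" "\<And>c. c \<in> R \<Longrightarrow> \<rho> c = \<zero>\<^bsub>M\<^esub>"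
proof -
  interpret M: abelian_group M by fact
  have "(\<lambda>(y, h). \<beta> y h) ` S \<subseteq> carrier (add_monoid M)" using closed by auto
  then obtain \<rho> where \<rho>: "\<rho> \<in> hom (free_Abelian_group S) (add_monoid M)"
      "\<And>x. x \<in> S \<Longrightarrow> \<rho> (frag_of x) = (\<lambda>(y, h). \<beta> y h) x"
    using comm_group.free_Abelian_group_universal[OF M.a_comm_group, of "\<lambda>(y, h). \<beta> y h" S] by metis
  have f: "\<rho> (frag_of (y, h)) = \<beta> y h" if "h \<in> carrier N" for y h using \<rho>(2)[of "(y, h)"] that by simp
  have \<rho>_add: "\<rho> (c + c') = \<rho> c \<oplus>\<^bsub>M\<^esub> \<rho> c'" if "Poly_Mapping.keys c \<subseteq> S" "Poly_Mapping.keys c' \<subseteq> S" for c c'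
    using hom_mult[OF \<rho>(1), of c c'] that by simp
  have cl: "\<rho> c \<in> carrier M" if "Poly_Mapping.keys c \<subseteq> S" for c
    using \<rho>(1) that by (auto simp: hom_def)
  have zero: "\<rho> 0 = \<zero>\<^bsub>M\<^esub>" using \<rho>_add[of 0 0] cl[of 0] by simp
  have \<rho>_minus: "\<rho> (- c) = \<ominus>\<^bsub>M\<^esub> \<rho> c" if "Poly_Mapping.keys c \<subseteq> S" for c
    using \<rho>_add[of "- c" c] that zero cl[of c] cl[of "- c"] by (simp add: M.minus_equality[symmetric])
  have diff: "\<rho> (c - c') = \<rho> c \<oplus>\<^bsub>M\<^esub> \<ominus>\<^bsub>M\<^esub> \<rho> c'" if "Poly_Mapping.keys c \<subseteq> S" "Poly_Mapping.keys c' \<subseteq> S" for c c'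
    using \<rho>_add[of c "- c'"] \<rho>_minus that by simp
  have cancel: "(a \<oplus>\<^bsub>M\<^esub> b) \<oplus>\<^bsub>M\<^esub> \<ominus>\<^bsub>M\<^esub> a \<oplus>\<^bsub>M\<^esub> \<ominus>\<^bsub>M\<^esub> b = \<zero>\<^bsub>M\<^esub>"
    if "a \<in> carrier M" "b \<in> carrier M" for a b
    using that by (simp add: M.a_comm[of a b] M.a_assoc M.r_neg)
  have gen0: "\<rho> g = \<zero>\<^bsub>M\<^esub>" if "g \<in> relation_generators" for g
    using that
  proof (cases rule: relation_generators_cases)
    case (left y z h)
    have k: "Poly_Mapping.keys (frag_of (y + z, h) - frag_of (y, h)) \<subseteq> S" using left by (intro keys_diffI) auto
    have "\<rho> g = (\<beta> y h \<oplus>\<^bsub>M\<^esub> \<beta> z h) \<oplus>\<^bsub>M\<^esub> \<ominus>\<^bsub>M\<^esub> \<beta> y h \<oplus>\<^bsub>M\<^esub> \<ominus>\<^bsub>M\<^esub> \<beta> z h"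
      using k left f diff[OF k] diff[of "frag_of (y + z, h)" "frag_of (y, h)"] assms(3) by simp
    then show ?thesis using closed[OF left(1), of y] closed[OF left(1), of z] by (simp only: cancel)
  next
    case (right y h h')
    have k: "Poly_Mapping.keys (frag_of (y, h \<oplus>\<^bsub>N\<^esub> h') - frag_of (y, h)) \<subseteq> S" using right by (intro keys_diffI) auto
    have "\<rho> g = (\<beta> y h \<oplus>\<^bsub>M\<^esub> \<beta> y h') \<oplus>\<^bsub>M\<^esub> \<ominus>\<^bsub>M\<^esub> \<beta> y h \<oplus>\<^bsub>M\<^esub> \<ominus>\<^bsub>M\<^esub> \<beta> y h'"
      using k right f diff[OF k] diff[of "frag_of (y, h \<oplus>\<^bsub>N\<^esub> h')" "frag_of (y, h)"] assms(4) by simp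
    then show ?thesis using closed[OF right(1), of y] closed[OF right(2), of y] by (simp only: cancel)
  next
    case (scal a y h)
    have "\<rho> g = \<beta> y (a \<odot>\<^bsub>N\<^esub> h) \<oplus>\<^bsub>M\<^esub> \<ominus>\<^bsub>M\<^esub> \<beta> y (a \<odot>\<^bsub>N\<^esub> h)"
      using scal f diff[of "frag_of (scal E a y, h)" "frag_of (y, a \<odot>\<^bsub>N\<^esub> h)"] assms(5) by (simp add: N.smult_closed)
    then show ?thesis using closed[of "a \<odot>\<^bsub>N\<^esub> h" y] scal by (simp add: N.smult_closed M.r_neg)
  qed
  have mz: "\<ominus>\<^bsub>M\<^esub> \<zero>\<^bsub>M\<^esub> = \<zero>\<^bsub>M\<^esub>" using M.minus_equality[of "\<zero>\<^bsub>M\<^esub>" "\<zero>\<^bsub>M\<^esub>"] by simp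
  have R0: "Poly_Mapping.keys c \<subseteq> S \<and> \<rho> c = \<zero>\<^bsub>M\<^esub>" if "c \<in> R" for c
    using that
  proof (induction rule: R_induct_generators)
    case (add a b)
    then show ?case using \<rho>_add[of a b] by (simp add: keys_addI)
  next
    case (minus a)
    then show ?case using \<rho>_minus[of a] mz by simp
  qed (simp_all add: zero gen0 keys_generators)
  show ?thesis by (rule that[OF f \<rho>_add cl]) (use R0 in auto)
qed

end

text \<open>The formula for the differential is given on the free abelian group.  It descends to tensor products because it
  sends each relation to a sum of relations of the same kind.\<close>

lemma tensor_differential:
  assumes N: "tensor_space E n e N" and N': "tensor_space E n e N'"
    and a: "\<And>s. s < n \<Longrightarrow> left_hom N N' (a s)"
  defines "D \<equiv> quotient_map (free_tensor N' :: ('e::ring_1, _) module) (tensor_relations E N')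
       (frag_extend (\<lambda>(y, h). \<Sum>s<n. frag_of (y * e s, a s h)))"
  shows "left_hom (E_tensor E N) (E_tensor E N') D"
    and "\<And>y h. h \<in> carrier N \<Longrightarrow> D (pure_tensor E N y h) = (\<Oplus>\<^bsub>E_tensor E N'\<^esub>s\<in>{..<n}. pure_tensor E N' (y * e s) (a s h))"
proof -
  interpret N: tensor_space E n e N by fact
  interpret N': tensor_space E n e N' by fact
  let ?\<delta> = "frag_extend (\<lambda>(y, h). \<Sum>s<n. frag_of (y * e s, a s h))"
  have ac: "a s h \<in> carrier N'" if "s < n" "h \<in> carrier N" for s h
    using left_hom_closed[OF N.N.left_module_axioms N'.N.left_module_axioms a] that by blast
  have closed: "Poly_Mapping.keys (?\<delta> c) \<subseteq> N'.S" if "Poly_Mapping.keys c \<subseteq> N.S" for c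
  proof -
    have "Poly_Mapping.keys ((\<lambda>(y, h). \<Sum>s<n. frag_of (y * e s, a s h)) x) \<subseteq> N'.S" if xS: "x \<in> N.S" for x
    proof -
      obtain y h where x: "x = (y, h)" "h \<in> carrier N" using xS by auto
      have "Poly_Mapping.keys (\<Sum>s<n. frag_of (y * e s, a s h)) \<subseteq> (\<Union>s<n. Poly_Mapping.keys (frag_of (y * e s, a s h)))"
        by (rule keys_sum)
      then show ?thesis using x ac by fastforce
    qed
    then show ?thesis using keys_frag_extend[of "\<lambda>(y, h). \<Sum>s<n. frag_of (y * e s, a s h)" c] that by blast
  qed
  have R'sum: "(\<Sum>s<n. f s) \<in> N'.R" if "\<And>s. s < n \<Longrightarrow> f s \<in> N'.R" for f
  proof -
    have "(\<Sum>s\<in>I. f s) \<in> N'.R" if "finite I" "I \<subseteq> {..<n}" for I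
      using that
    proof (induction I rule: finite_induct)
      case (insert s I)
      then show ?case using \<open>\<And>s. s < n \<Longrightarrow> f s \<in> N'.R\<close>[of s] by (simp add: N'.R_add)
    qed (simp add: N'.R_zero)
    then show ?thesis by simp
  qed
  have gens: "?\<delta> g \<in> N'.R" if "g \<in> N.relation_generators" for g
  proof -
    show ?thesis
      using that
    proof (cases rule: N.relation_generators_cases)
      case (left y z h)
      have "?\<delta> g = (\<Sum>s<n. frag_of (y * e s + z * e s, a s h) - frag_of (y * e s, a s h) - frag_of (z * e s, a s h))"
        unfolding left(2) by (simp add: frag_extend_diff sum_subtractf distrib_right)
      also have "\<dots> \<in> N'.R" using left ac by (intro R'sum N'.R_left)
      finally show ?thesis .
    next
      case (right y h h')
      have "?\<delta> g = (\<Sum>s<n. frag_of (y * e s, a s (h \<oplus>\<^bsub>N\<^esub> h')) - frag_of (y * e s, a s h) - frag_of (y * e s, a s h'))"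
        unfolding right(3) by (simp add: frag_extend_diff sum_subtractf)
      also have "\<dots> = (\<Sum>s<n. frag_of (y * e s, a s h \<oplus>\<^bsub>N'\<^esub> a s h') - frag_of (y * e s, a s h) - frag_of (y * e s, a s h'))"
        using left_hom_add[OF N.N.left_module_axioms N'.N.left_module_axioms a] right by (intro sum.cong) auto
      also have "\<dots> \<in> N'.R" using right ac by (intro R'sum N'.R_right)
      finally show ?thesis .
    next
      case (scal b y h)
      have "?\<delta> g = (\<Sum>s<n. frag_of (scal E b (y * e s), a s h) - frag_of (y * e s, a s (b \<odot>\<^bsub>N\<^esub> h)))"
        unfolding scal(2) by (simp add: frag_extend_diff sum_subtractf N.scal_left)
      also have "\<dots> = (\<Sum>s<n. frag_of (scal E b (y * e s), a s h) - frag_of (y * e s, b \<odot>\<^bsub>N'\<^esub> a s h))"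
        using left_hom_smult[OF N.N.left_module_axioms N'.N.left_module_axioms a] scal by (intro sum.cong) auto
      also have "\<dots> \<in> N'.R" using scal ac by (intro R'sum N'.R_scal)
      finally show ?thesis .
    qed
  qed
  have R: "?\<delta> c \<in> N'.R" if "c \<in> N.R" for c
    using that
    by (rule N.additive_on_R[where P = "\<lambda>c. c \<in> N'.R" and \<phi> = ?\<delta>])
       (auto intro: N'.R_zero N'.R_add N'.R_minus gens simp: frag_extend_add frag_extend_minus)
  have D: "D (N.cs c) = N'.cs (?\<delta> c)" if "Poly_Mapping.keys c \<subseteq> N.S" for c
    unfolding D_def using that closed R
    by (intro N.T.quotient_map_coset[OF N'.T.operator_subgroup_axioms]) (auto simp: frag_extend_add)
  have act: "?\<delta> (N.act r c) = N'.act r (?\<delta> c)" for r c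
    using subset_UNIV
  proof (induction c rule: frag_induction)
    case (one x)
    then show ?case by (cases x) (simp add: frag_extend_sum o_def mult.assoc)
  qed (auto simp: frag_extend_diff)
  show "left_hom N.ET N'.ET D"
    unfolding left_hom_def
  proof (intro conjI ballI allI)
    show "D \<in> carrier N.ET \<rightarrow> carrier N'.ET"
      using N.cs_surj D closed N'.cs_closed by fastforce
  next
    fix X Y assume "X \<in> carrier N.ET" "Y \<in> carrier N.ET"
    then obtain c c' where "Poly_Mapping.keys c \<subseteq> N.S" "X = N.cs c" "Poly_Mapping.keys c' \<subseteq> N.S" "Y = N.cs c'"
      using N.cs_surj by metis
    then show "D (X \<oplus>\<^bsub>N.ET\<^esub> Y) = D X \<oplus>\<^bsub>N'.ET\<^esub> D Y"
      by (simp add: N.cs_add D N.keys_addI N'.cs_add closed frag_extend_add)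
  next
    fix r X assume "X \<in> carrier N.ET"
    then obtain c where "Poly_Mapping.keys c \<subseteq> N.S" "X = N.cs c" using N.cs_surj by metis
    then show "D (r \<odot>\<^bsub>N.ET\<^esub> X) = r \<odot>\<^bsub>N'.ET\<^esub> D X"
      by (simp add: N.cs_smult D N.act_closed N'.cs_smult closed act)
  qed
  show "D (N.pt y h) = (\<Oplus>\<^bsub>N'.ET\<^esub>s\<in>{..<n}. N'.pt (y * e s) (a s h))" if "h \<in> carrier N" for y h
  proof -
    have "D (N.pt y h) = N'.cs (\<Sum>s<n. frag_of (y * e s, a s h))"
      unfolding N.pt_eq using that by (simp add: D)
    also have "\<dots> = (\<Oplus>\<^bsub>N'.ET\<^esub>s\<in>{..<n}. N'.pt (y * e s) (a s h))"
      unfolding N'.pt_eq by (rule N'.cs_sum) (use that ac in auto)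
    finally show ?thesis .
  qed
qed

section \<open>The module \<open>Hom(E, N)\<close>\<close>

lemma Hom_K_simps [simp]:
  "carrier (Hom_K E N) = {\<alpha>. (\<forall>y. \<alpha> y \<in> carrier N) \<and> (\<forall>y z. \<alpha> (y + z) = \<alpha> y \<oplus>\<^bsub>N\<^esub> \<alpha> z) \<and>
                   (\<forall>a y. \<alpha> (scal E a y) = a \<odot>\<^bsub>N\<^esub> \<alpha> y)}"
  "\<zero>\<^bsub>Hom_K E N\<^esub> = (\<lambda>y. \<zero>\<^bsub>N\<^esub>)" "add (Hom_K E N) = (\<lambda>\<alpha> \<beta> y. \<alpha> y \<oplus>\<^bsub>N\<^esub> \<beta> y)"
  "smult (Hom_K E N) = (\<lambda>a \<alpha> y. \<alpha> (y * a))"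
  by (simp_all add: Hom_K_def)

lemma (in exterior_basis) left_module_Hom_K:
  assumes "left_module N" shows "left_module (Hom_K E N)"
proof -
  interpret N: left_module N by fact
  have "abelian_group (Hom_K E N)"
  proof (rule abelian_groupI)
    fix \<alpha> assume a: "\<alpha> \<in> carrier (Hom_K E N)"
    have ac: "\<alpha> y \<in> carrier N" and aadd: "\<alpha> (y + z) = \<alpha> y \<oplus>\<^bsub>N\<^esub> \<alpha> z"
      and ascal: "\<alpha> (scal E k y) = k \<odot>\<^bsub>N\<^esub> \<alpha> y" for y z k using a by auto
    have "\<alpha> (- (y + z)) = \<alpha> (- y) \<oplus>\<^bsub>N\<^esub> \<alpha> (- z)" for y z
      unfolding aadd[symmetric] by (rule arg_cong[of _ _ \<alpha>]) simp
    moreover have "\<alpha> (- scal E k y) = k \<odot>\<^bsub>N\<^esub> \<alpha> (- y)" for k y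
      using ascal[of k "- y"] by simp
    ultimately have "(\<lambda>y. \<alpha> (- y)) \<in> carrier (Hom_K E N)" using ac by simp
    moreover have "\<alpha> (- y) \<oplus>\<^bsub>N\<^esub> \<alpha> y = \<zero>\<^bsub>N\<^esub>" for y
    proof -
      have "\<alpha> 0 = \<zero>\<^bsub>N\<^esub>"
      proof -
        have "\<alpha> (scal E 0 0) = 0 \<odot>\<^bsub>N\<^esub> \<alpha> 0" using a by (simp del: scale_zero_left scale_zero_right)
        then show ?thesis using a by simp
      qed
      moreover have "\<alpha> (- y + y) = \<alpha> (- y) \<oplus>\<^bsub>N\<^esub> \<alpha> y" by (rule aadd)
      ultimately show ?thesis by simp
    qed
    ultimately show "\<exists>\<beta>\<in>carrier (Hom_K E N). \<beta> \<oplus>\<^bsub>Hom_K E N\<^esub> \<alpha> = \<zero>\<^bsub>Hom_K E N\<^esub>"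
      by (intro bexI[of _ "\<lambda>y. \<alpha> (- y)"]) simp_all
  qed (auto simp: fun_eq_iff N.a_ac N.smult_r_distr N.smult_closed)
  moreover have "(\<lambda>y. \<alpha> (y * a)) \<in> carrier (Hom_K E N)" if "\<alpha> \<in> carrier (Hom_K E N)" for \<alpha> a
    using that by (simp add: distrib_right scal_left)
  ultimately show ?thesis
    by (intro left_module.intro left_module_axioms.intro)
       (simp_all add: fun_eq_iff distrib_left mult.assoc)
qed

lemma (in exterior_basis) Hom_K_expand:
  assumes N: "left_module N" and \<alpha>: "\<alpha> \<in> carrier (Hom_K E N)"
  shows "\<alpha> y = (\<Oplus>\<^bsub>N\<^esub>A\<in>Pow {..<n}. coef A y \<odot>\<^bsub>N\<^esub> \<alpha> (mon A))"
proof -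
  interpret N: left_module N by fact
  have "\<alpha> (scal E 0 0) = 0 \<odot>\<^bsub>N\<^esub> \<alpha> 0" using \<alpha> by (simp del: scale_zero_left scale_zero_right)
  then have z: "\<alpha> 0 = \<zero>\<^bsub>N\<^esub>" using \<alpha> by simp
  have "\<alpha> (\<Sum>A\<in>I. f A) = (\<Oplus>\<^bsub>N\<^esub>A\<in>I. \<alpha> (f A))" for f :: "nat set \<Rightarrow> 'e" and I
  proof (induction I rule: infinite_finite_induct)
    case (insert A I)
    then show ?case using \<alpha> by (simp add: Pi_iff)
  qed (simp_all add: z)
  then have "\<alpha> (\<Sum>A\<in>Pow {..<n}. scal E (coef A y) (mon A)) = (\<Oplus>\<^bsub>N\<^esub>A\<in>Pow {..<n}. \<alpha> (scal E (coef A y) (mon A)))" .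
  then have "\<alpha> y = (\<Oplus>\<^bsub>N\<^esub>A\<in>Pow {..<n}. \<alpha> (scal E (coef A y) (mon A)))" using expand[of y] by simp
  then show ?thesis using \<alpha> by simp
qed

lemma (in exterior_basis) Hom_K_differential:
  assumes N: "left_module N" and N': "left_module N'" and a: "\<And>s. s < n \<Longrightarrow> left_hom N N' (a s)"
  shows "left_hom (Hom_K E N) (Hom_K E N') (\<lambda>\<alpha> y. \<Oplus>\<^bsub>N'\<^esub>s\<in>{..<n}. a s (\<alpha> (e s * y)))"
proof -
  interpret N: left_module N by fact
  interpret N': left_module N' by fact
  note h = N N' a
  have mem: "(\<lambda>s. a s (\<alpha> (e s * y))) \<in> {..<n} \<rightarrow> carrier N'" if "\<alpha> \<in> carrier (Hom_K E N)" for \<alpha> y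
    using that left_hom_closed[OF h] by auto
  show ?thesis unfolding left_hom_def
  proof (intro conjI ballI allI)
    show "(\<lambda>\<alpha> y. \<Oplus>\<^bsub>N'\<^esub>s\<in>{..<n}. a s (\<alpha> (e s * y))) \<in> carrier (Hom_K E N) \<rightarrow> carrier (Hom_K E N')"
    proof
      fix \<alpha> assume \<alpha>: "\<alpha> \<in> carrier (Hom_K E N)"
      have "(\<Oplus>\<^bsub>N'\<^esub>s\<in>{..<n}. a s (\<alpha> (e s * (y + z)))) = (\<Oplus>\<^bsub>N'\<^esub>s\<in>{..<n}. a s (\<alpha> (e s * y)) \<oplus>\<^bsub>N'\<^esub> a s (\<alpha> (e s * z)))" for y z
        using \<alpha> left_hom_add[OF h] left_hom_closed[OF h]
        by (intro N'.finsum_cong') (auto simp: distrib_left)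
      then have "(\<Oplus>\<^bsub>N'\<^esub>s\<in>{..<n}. a s (\<alpha> (e s * (y + z))))
        = (\<Oplus>\<^bsub>N'\<^esub>s\<in>{..<n}. a s (\<alpha> (e s * y))) \<oplus>\<^bsub>N'\<^esub> (\<Oplus>\<^bsub>N'\<^esub>s\<in>{..<n}. a s (\<alpha> (e s * z)))" for y z
        using N'.finsum_addf[OF mem[OF \<alpha>] mem[OF \<alpha>]] by simp
      moreover have "(\<Oplus>\<^bsub>N'\<^esub>s\<in>{..<n}. a s (\<alpha> (e s * scal E k y))) = k \<odot>\<^bsub>N'\<^esub> (\<Oplus>\<^bsub>N'\<^esub>s\<in>{..<n}. a s (\<alpha> (e s * y)))" for k y
      proof -
        have "(\<Oplus>\<^bsub>N'\<^esub>s\<in>{..<n}. a s (\<alpha> (e s * scal E k y))) = (\<Oplus>\<^bsub>N'\<^esub>s\<in>{..<n}. k \<odot>\<^bsub>N'\<^esub> a s (\<alpha> (e s * y)))"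
          using \<alpha> left_hom_smult[OF h] left_hom_closed[OF h] N'.smult_closed
          by (intro N'.finsum_cong') (auto simp: scal_right)
        then show ?thesis using N'.finsum_smult[OF mem[OF \<alpha>], of k y] by simp
      qed
      ultimately show "(\<lambda>y. \<Oplus>\<^bsub>N'\<^esub>s\<in>{..<n}. a s (\<alpha> (e s * y))) \<in> carrier (Hom_K E N')"
        using N'.finsum_closed[OF mem[OF \<alpha>]] by simp
    qed
  next
    fix \<alpha> \<beta> assume \<alpha>: "\<alpha> \<in> carrier (Hom_K E N)" and \<beta>: "\<beta> \<in> carrier (Hom_K E N)"
    have "(\<Oplus>\<^bsub>N'\<^esub>s\<in>{..<n}. a s (\<alpha> (e s * y) \<oplus>\<^bsub>N\<^esub> \<beta> (e s * y))) = (\<Oplus>\<^bsub>N'\<^esub>s\<in>{..<n}. a s (\<alpha> (e s * y)) \<oplus>\<^bsub>N'\<^esub> a s (\<beta> (e s * y)))" for y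
      using \<alpha> \<beta> left_hom_add[OF h] left_hom_closed[OF h] by (intro N'.finsum_cong') auto
    then show "(\<lambda>y. \<Oplus>\<^bsub>N'\<^esub>s\<in>{..<n}. a s ((\<alpha> \<oplus>\<^bsub>Hom_K E N\<^esub> \<beta>) (e s * y)))
      = (\<lambda>y. \<Oplus>\<^bsub>N'\<^esub>s\<in>{..<n}. a s (\<alpha> (e s * y))) \<oplus>\<^bsub>Hom_K E N'\<^esub> (\<lambda>y. \<Oplus>\<^bsub>N'\<^esub>s\<in>{..<n}. a s (\<beta> (e s * y)))"
      using N'.finsum_addf[OF mem[OF \<alpha>] mem[OF \<beta>]] by simp
  qed (simp add: mult.assoc)
qed

section \<open>A free module in terms of its reduction\<close>

text \<open>By the perfect pairing, multiplication by the complementary monomial isolates the coefficient of \<open>e\<^sub>A\<close>.\<close>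

lemma (in exterior_basis) top_coef:
  assumes "A \<subseteq> {..<n}"
  shows "coef {..<n} (mon ({..<n} - A) * z) = coef {..<n} (mon ({..<n} - A) * mon A) * coef A z"
proof -
  have "coef {..<n} (mon ({..<n} - A) * z) = (\<Sum>B\<in>Pow {..<n}. coef B z * coef {..<n} (mon ({..<n} - A) * mon B))"
  proof -
    have "mon ({..<n} - A) * z = mon ({..<n} - A) * (\<Sum>B\<in>Pow {..<n}. scal E (coef B z) (mon B))"
      by (rule arg_cong[OF expand])
    then show ?thesis by (simp only: sum_distrib_left coef_sum scal_right coef_scale)
  qed
  also have "\<dots> = (\<Sum>B\<in>Pow {..<n}. if B = A then coef {..<n} (mon ({..<n} - A) * mon A) * coef A z else 0)"
  proof (intro sum.cong refl)
    fix B assume "B \<in> Pow {..<n}"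
    then show "coef B z * coef {..<n} (mon ({..<n} - A) * mon B)
        = (if B = A then coef {..<n} (mon ({..<n} - A) * mon A) * coef A z else 0)"
      using top_pairing[of "{..<n} - A" B] assms by (auto simp: double_diff mult.commute)
  qed
  finally show ?thesis using assms by simp
qed

text \<open>An identification of \<open>H\<close> with \<open>M/(V)M\<close>, in the form of a surjection \<open>\<Phi>\<close> with kernel \<open>(V)M\<close>.\<close>

locale reduction = free_E_module E n e M B + H: left_module H
  for E :: "('k::field, 'e::ring_1) gen_algebra" and n e
    and M :: "('e, 'm) module" (structure) and B and H :: "('k, 'h) module" +
  fixes \<Phi> :: "'m \<Rightarrow> 'h"
  assumes Phi_closed: "m \<in> carrier M \<Longrightarrow> \<Phi> m \<in> carrier H"
    and Phi_add: "m \<in> carrier M \<Longrightarrow> m' \<in> carrier M \<Longrightarrow> \<Phi> (m \<oplus> m') = \<Phi> m \<oplus>\<^bsub>H\<^esub> \<Phi> m'"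
    and Phi_scal: "m \<in> carrier M \<Longrightarrow> \<Phi> (scal E a 1 \<odot> m) = a \<odot>\<^bsub>H\<^esub> \<Phi> m"
    and Phi_kernel: "m \<in> carrier M \<Longrightarrow> \<Phi> m = \<zero>\<^bsub>H\<^esub> \<longleftrightarrow> m \<in> V_smult 1 M"
    and Phi_surj: "h \<in> carrier H \<Longrightarrow> \<exists>m\<in>carrier M. h = \<Phi> m"
begin

lemma Phi_zero: "\<Phi> \<zero> = \<zero>\<^bsub>H\<^esub>"
  by (simp add: Phi_kernel VM.sub_zero)

lemma Phi_minus: "m \<in> carrier M \<Longrightarrow> \<Phi> (\<ominus> m) = \<ominus>\<^bsub>H\<^esub> \<Phi> m"
  using Phi_scal[of m "- 1"] by (simp add: smult_minus_one H.smult_minus_one Phi_closed)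

lemma Phi_diff: "m \<in> carrier M \<Longrightarrow> m' \<in> carrier M \<Longrightarrow> \<Phi> (m \<ominus> m') = \<Phi> m \<ominus>\<^bsub>H\<^esub> \<Phi> m'"
  by (simp add: minus_eq H.minus_eq Phi_add Phi_minus)

lemma Phi_eqI: "m \<in> carrier M \<Longrightarrow> m' \<in> carrier M \<Longrightarrow> m \<ominus> m' \<in> V_smult 1 M \<Longrightarrow> \<Phi> m = \<Phi> m'"
  using Phi_kernel[of "m \<ominus> m'"] by (simp add: Phi_diff Phi_closed H.diff_eq_zero_iff)

lemma Phi_finsum: "f \<in> A \<rightarrow> carrier M \<Longrightarrow> \<Phi> (\<Oplus>i\<in>A. f i) = (\<Oplus>\<^bsub>H\<^esub>i\<in>A. \<Phi> (f i))"
proof (induction A rule: infinite_finite_induct)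
  case (insert a A)
  then have "f a \<in> carrier M" "f \<in> A \<rightarrow> carrier M" "(\<lambda>i. \<Phi> (f i)) \<in> A \<rightarrow> carrier H" using Phi_closed by auto
  then show ?case using insert by (simp add: Phi_add Phi_closed)
qed (simp_all add: Phi_zero)

lemma diff_mcoef_empty: "m \<in> carrier M \<Longrightarrow> m \<ominus> mcoef {} m \<in> V_smult 1 M"
  by (simp add: V_smult_iff mcoef_closed coords_diff coords_mcoef filt_1_iff)

lemma Phi_mcoef_empty: "m \<in> carrier M \<Longrightarrow> \<Phi> (mcoef {} m) = \<Phi> m"
  using Phi_eqI[OF _ _ diff_mcoef_empty] mcoef_closed by simp

lemma mcoef_mcoef: "m \<in> carrier M \<Longrightarrow> mcoef {} (mcoef A m) = mcoef A m"
  by (rule coords_eqI) (simp_all add: mcoef_closed coords_mcoef)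

lemma mcoef_basis: "b \<in> B \<Longrightarrow> mcoef {} b = b"
  using basis_closed by (intro coords_eqI) (auto simp: mcoef_closed coords_mcoef coords_basis)

lemma mcoef_finsum: "f \<in> I \<rightarrow> carrier M \<Longrightarrow> mcoef A (\<Oplus>i\<in>I. f i) = (\<Oplus>i\<in>I. mcoef A (f i))"
proof (induction I rule: infinite_finite_induct)
  case (insert a I)
  then have "f a \<in> carrier M" "f \<in> I \<rightarrow> carrier M" "(\<lambda>i. mcoef A (f i)) \<in> I \<rightarrow> carrier M" using mcoef_closed by auto
  then show ?case using insert by (simp add: mcoef_add mcoef_closed)
qed (rule coords_eqI; simp add: mcoef_closed coords_mcoef coords_zero)+

lemma mcoef_smult_const: "m \<in> carrier M \<Longrightarrow> mcoef A (r \<odot> mcoef C m) = scal E (coef A r) 1 \<odot> mcoef C m"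
  by (rule coords_eqI)
     (simp_all add: mcoef_closed smult_closed coords_mcoef coords_smult scal_left scal_right mult.commute)

text \<open>The section of \<open>\<Phi>\<close> with values in the \<open>K\<close>-span of the basis.\<close>

definition sec :: "'h \<Rightarrow> 'm" where
  "sec h = mcoef {} (SOME m. m \<in> carrier M \<and> h = \<Phi> m)"

lemma sec_Phi: assumes "m \<in> carrier M" shows "sec (\<Phi> m) = mcoef {} m"
proof -
  let ?m = "SOME m'. m' \<in> carrier M \<and> \<Phi> m = \<Phi> m'"
  have m: "?m \<in> carrier M \<and> \<Phi> m = \<Phi> ?m" by (rule someI[of _ m]) (simp add: assms)
  then have "\<Phi> (?m \<ominus> m) = \<zero>\<^bsub>H\<^esub>" using assms by (simp add: Phi_diff Phi_closed H.diff_eq_zero_iff)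
  then have "?m \<ominus> m \<in> V_smult 1 M" using m assms by (simp add: Phi_kernel)
  then have "coef {} (crd ?m b) = coef {} (crd m b)" for b
    using m assms by (simp add: V_smult_iff coords_diff filt_1_iff)
  then show ?thesis
    unfolding sec_def using m assms by (intro coords_eqI) (simp_all add: mcoef_closed coords_mcoef)
qed

lemma sec_closed: "h \<in> carrier H \<Longrightarrow> sec h \<in> carrier M"
  and Phi_sec: "h \<in> carrier H \<Longrightarrow> \<Phi> (sec h) = h"
  and sec_const: "h \<in> carrier H \<Longrightarrow> mcoef {} (sec h) = sec h"
  using Phi_surj by (auto simp: sec_Phi mcoef_closed Phi_mcoef_empty mcoef_mcoef dest!: Phi_surj)

lemma sec_add: "h \<in> carrier H \<Longrightarrow> h' \<in> carrier H \<Longrightarrow> sec (h \<oplus>\<^bsub>H\<^esub> h') = sec h \<oplus> sec h'"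
  by (auto dest!: Phi_surj simp: Phi_add[symmetric] sec_Phi mcoef_add)

lemma sec_scal: "h \<in> carrier H \<Longrightarrow> sec (a \<odot>\<^bsub>H\<^esub> h) = scal E a 1 \<odot> sec h"
  by (auto dest!: Phi_surj simp: Phi_scal[symmetric] sec_Phi mcoef_scal smult_closed)

sublocale T: tensor_space E n e H
  by unfold_locales

definition tens :: "'m \<Rightarrow> ('e \<times> 'h \<Rightarrow>\<^sub>0 int) set" where
  "tens = lext M B T.ET (\<lambda>b. T.pt 1 (\<Phi> b))"

lemma pt_basis: "(\<lambda>b. T.pt 1 (\<Phi> b)) \<in> B \<rightarrow> carrier T.ET"
  using T.pt_closed Phi_closed basis_closed by auto

lemma tens_hom: "left_hom M T.ET tens"
  unfolding tens_def by (rule lext_left_hom[OF T.left_module_ET pt_basis])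

lemmas tens_simps =
  left_hom_closed[OF left_module_axioms T.left_module_ET tens_hom]
  left_hom_smult[OF left_module_axioms T.left_module_ET tens_hom]
  left_hom_diff[OF left_module_axioms T.left_module_ET tens_hom]
  left_hom_finsum[OF left_module_axioms T.left_module_ET tens_hom]

lemma tens_const: assumes m: "m \<in> carrier M" shows "tens (mcoef {} m) = T.pt 1 (\<Phi> m)"
proof -
  let ?A = "{b. crd m b \<noteq> 0}" and ?k = "\<lambda>b. coef {} (crd m b)"
  have A: "finite ?A" "?A \<subseteq> B" using m finite_coords coords_subset by auto
  have A': "{b. crd (mcoef {} m) b \<noteq> 0} \<subseteq> ?A" using m by (auto simp: coords_mcoef)
  have c: "\<Phi> b \<in> carrier H" "b \<in> carrier M" if "b \<in> ?A" for b using that A Phi_closed basis_closed by blast+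
  have "tens (mcoef {} m) = (\<Oplus>\<^bsub>T.ET\<^esub>b\<in>?A. crd (mcoef {} m) b \<odot>\<^bsub>T.ET\<^esub> T.pt 1 (\<Phi> b))"
    unfolding tens_def using m by (intro lext_supset[OF T.left_module_ET pt_basis _ A A'] mcoef_closed)
  also have "\<dots> = (\<Oplus>\<^bsub>T.ET\<^esub>b\<in>?A. T.pt 1 (?k b \<odot>\<^bsub>H\<^esub> \<Phi> b))"
    using c m T.pt_closed H.smult_closed
    by (intro T.ET.finsum_cong') (auto simp: coords_mcoef T.pt_smult T.pt_scal)
  also have "\<dots> = T.pt 1 (\<Oplus>\<^bsub>H\<^esub>b\<in>?A. ?k b \<odot>\<^bsub>H\<^esub> \<Phi> b)"
    using c by (intro T.pt_finsum_right[symmetric]) (auto simp: H.smult_closed)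
  also have "(\<Oplus>\<^bsub>H\<^esub>b\<in>?A. ?k b \<odot>\<^bsub>H\<^esub> \<Phi> b) = (\<Oplus>\<^bsub>H\<^esub>b\<in>?A. \<Phi> (crd (mcoef {} m) b \<odot> b))"
    using c m by (intro H.finsum_cong') (auto simp: coords_mcoef Phi_scal Phi_closed smult_closed H.smult_closed)
  also have "\<dots> = \<Phi> (\<Oplus>b\<in>?A. crd (mcoef {} m) b \<odot> b)"
    using c by (intro Phi_finsum[symmetric]) (auto simp: smult_closed)
  also have "(\<Oplus>b\<in>?A. crd (mcoef {} m) b \<odot> b) = mcoef {} m"
    using m by (intro expand_basis[OF _ A A', symmetric] mcoef_closed)
  finally show ?thesis using m by (simp add: Phi_mcoef_empty)
qed

lemma tens_pure: "m \<in> carrier M \<Longrightarrow> tens (y \<odot> mcoef {} m) = T.pt y (\<Phi> m)"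
  by (simp add: tens_simps mcoef_closed tens_const T.pt_smult Phi_closed)

lemma tens_sec: "h \<in> carrier H \<Longrightarrow> tens (y \<odot> sec h) = T.pt y h"
  using tens_pure[of "sec h" y] by (simp add: sec_closed sec_const Phi_sec)

text \<open>The inverse \<open>y \<otimes> h \<mapsto> y (sec h)\<close> is constructed on the free abelian group, where it kills the relations.\<close>

lemma tens_injective: assumes m: "m \<in> carrier M" and zero: "tens m = \<zero>\<^bsub>T.ET\<^esub>" shows "m = \<zero>"
proof -
  let ?A = "{b. crd m b \<noteq> 0}"
  have A: "finite ?A" "?A \<subseteq> B" using m finite_coords coords_subset by auto
  have c: "\<Phi> b \<in> carrier H" "b \<in> carrier M" if "b \<in> ?A" for b using that A Phi_closed basis_closed by blast+
  obtain \<rho> where \<rho>: "\<And>y h. h \<in> carrier H \<Longrightarrow> \<rho> (frag_of (y, h)) = y \<odot> sec h"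
    "\<And>c c'. Poly_Mapping.keys c \<subseteq> T.S \<Longrightarrow> Poly_Mapping.keys c' \<subseteq> T.S \<Longrightarrow> \<rho> (c + c') = \<rho> c \<oplus> \<rho> c'"
    "\<And>c. Poly_Mapping.keys c \<subseteq> T.S \<Longrightarrow> \<rho> c \<in> carrier M" "\<And>c. c \<in> T.R \<Longrightarrow> \<rho> c = \<zero>"
  proof (rule T.tensor_universal[of M "\<lambda>y h. y \<odot> sec h"])
    show "abelian_group M" by (rule abelian_group_axioms)
    show "scal E a y \<odot> sec h = y \<odot> sec (a \<odot>\<^bsub>H\<^esub> h)" if "h \<in> carrier H" for a y h
    proof -
      have "y \<odot> sec (a \<odot>\<^bsub>H\<^esub> h) = (y * scal E a 1) \<odot> sec h"
        using that by (simp add: sec_scal sec_closed smult_assoc)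
      then show ?thesis by (simp add: scal_right)
    qed
  qed (auto simp: smult_closed sec_closed smult_l_distr sec_add smult_r_distr)
  have sum: "\<rho> (\<Sum>b\<in>I. frag_of (crd m b, \<Phi> b)) = (\<Oplus>b\<in>I. crd m b \<odot> b) \<and> Poly_Mapping.keys (\<Sum>b\<in>I. frag_of (crd m b, \<Phi> b)) \<subseteq> T.S"
    if "finite I" "I \<subseteq> ?A" for I
    using that
  proof (induction I rule: finite_induct)
    case empty
    then show ?case using \<rho>(4)[OF T.R_zero] by simp
  next
    case (insert b I)
    have b: "b \<in> ?A" using insert by blast
    have "\<rho> (frag_of (crd m b, \<Phi> b)) = crd m b \<odot> b"
      using c[OF b] b A by (simp add: \<rho>(1) sec_Phi mcoef_basis subset_iff)
    moreover have "(\<lambda>b. crd m b \<odot> b) \<in> I \<rightarrow> carrier M" using insert.prems c by (auto simp: smult_closed)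
    ultimately show ?case
      using insert c[OF b] \<rho>(2)[of "frag_of (crd m b, \<Phi> b)" "\<Sum>b\<in>I. frag_of (crd m b, \<Phi> b)"]
      by (simp add: smult_closed T.keys_addI)
  qed
  have "tens m = (\<Oplus>\<^bsub>T.ET\<^esub>b\<in>?A. T.pt (crd m b) (\<Phi> b))"
    unfolding tens_def lext_def using c T.pt_closed by (intro T.ET.finsum_cong') (auto simp: T.pt_smult)
  also have "\<dots> = T.cs (\<Sum>b\<in>?A. frag_of (crd m b, \<Phi> b))"
    unfolding T.pt_eq using c by (intro T.cs_sum[symmetric]) auto
  finally have "T.cs (\<Sum>b\<in>?A. frag_of (crd m b, \<Phi> b)) = T.cs 0" using zero by (simp add: T.cs_zero)
  then have "(\<Sum>b\<in>?A. frag_of (crd m b, \<Phi> b)) \<in> T.R"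
    using sum[OF A(1)] by (simp add: T.cs_eq_iff)
  then have "\<zero> = (\<Oplus>b\<in>?A. crd m b \<odot> b)" using \<rho>(4) sum[OF A(1)] by simp
  then show ?thesis using expand_basis[OF m A] by simp
qed

lemma tens_bij: "bij_betw tens (carrier M) (carrier T.ET)"
proof (rule bij_betwI')
  fix x y assume xy: "x \<in> carrier M" "y \<in> carrier M"
  show "tens x = tens y \<longleftrightarrow> x = y"
  proof
    assume "tens x = tens y"
    then have "tens (x \<ominus> y) = \<zero>\<^bsub>T.ET\<^esub>" using xy by (simp add: tens_simps T.ET.minus_eq T.ET.r_neg)
    then show "x = y" using xy tens_injective[of "x \<ominus> y"] diff_eq_zero_iff by simp
  qed simp
next
  fix X assume "X \<in> carrier T.ET"
  then show "\<exists>m\<in>carrier M. X = tens m"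
  proof (rule T.tensor_induct)
    show "\<exists>m\<in>carrier M. T.pt y h = tens m" if "h \<in> carrier H" for y h
      using tens_sec[OF that] that by (intro bexI[of _ "y \<odot> sec h"]) (simp_all add: sec_closed smult_closed)
  next
    fix X Y assume "\<exists>m\<in>carrier M. X = tens m" "\<exists>m\<in>carrier M. Y = tens m"
    then obtain x y where "x \<in> carrier M" "X = tens x" "y \<in> carrier M" "Y = tens y" by blast
    then show "\<exists>m\<in>carrier M. X \<ominus>\<^bsub>T.ET\<^esub> Y = tens m"
      by (intro bexI[of _ "x \<ominus> y"]) (simp_all add: tens_simps)
  qed
qed (rule tens_simps)

text \<open>The isomorphism with \<open>Hom(E, H)\<close> from the perfect pairing \<open>E \<times> E \<rightarrow> \<And>\<^sup>nV \<cong> K\<close>.  The scalar \<open>c\<close> leaves room for the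
  signs that a comparison of complexes requires.\<close>

definition hom_map :: "'k \<Rightarrow> 'm \<Rightarrow> 'e \<Rightarrow> 'h" where
  "hom_map c m = (\<lambda>y. c \<odot>\<^bsub>H\<^esub> \<Phi> (mcoef {..<n} (y \<odot> m)))"

lemma hom_map_hom: "left_hom M (Hom_K E H) (hom_map c)"
  unfolding left_hom_def
proof (intro conjI ballI allI)
  show "hom_map c \<in> carrier M \<rightarrow> carrier (Hom_K E H)"
  proof
    fix m assume m: "m \<in> carrier M"
    have "hom_map c m (scal E a y) = a \<odot>\<^bsub>H\<^esub> hom_map c m y" for a y
    proof -
      have "scal E a y \<odot> m = scal E a 1 \<odot> (y \<odot> m)" using m by (simp add: smult_assoc[symmetric] scal_left)
      then have "hom_map c m (scal E a y) = (c * a) \<odot>\<^bsub>H\<^esub> \<Phi> (mcoef {..<n} (y \<odot> m))"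
        using m by (simp add: hom_map_def mcoef_scal smult_closed Phi_scal mcoef_closed Phi_closed H.smult_assoc)
      also have "\<dots> = (a * c) \<odot>\<^bsub>H\<^esub> \<Phi> (mcoef {..<n} (y \<odot> m))" by (simp add: mult.commute)
      finally show ?thesis using m by (simp add: hom_map_def H.smult_assoc Phi_closed mcoef_closed smult_closed)
    qed
    then show "hom_map c m \<in> carrier (Hom_K E H)"
      using m by (simp add: hom_map_def H.smult_closed Phi_closed mcoef_closed smult_closed smult_l_distr
          mcoef_add Phi_add H.smult_r_distr)
  qed
next
  fix x y assume "x \<in> carrier M" "y \<in> carrier M"
  then show "hom_map c (x \<oplus> y) = hom_map c x \<oplus>\<^bsub>Hom_K E H\<^esub> hom_map c y"
    by (simp add: hom_map_def smult_r_distr mcoef_add smult_closed Phi_add mcoef_closed H.smult_r_distr Phi_closed)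
next
  fix r x assume "x \<in> carrier M"
  then show "hom_map c (r \<odot> x) = r \<odot>\<^bsub>Hom_K E H\<^esub> hom_map c x"
    by (simp add: hom_map_def smult_assoc)
qed

lemmas hom_map_simps =
  left_hom_closed[OF left_module_axioms left_module_Hom_K[OF H.left_module_axioms] hom_map_hom]
  left_hom_diff[OF left_module_axioms left_module_Hom_K[OF H.left_module_axioms] hom_map_hom]

lemma smult_nonzero_eq: "c \<noteq> 0 \<Longrightarrow> h \<in> carrier H \<Longrightarrow> c \<odot>\<^bsub>H\<^esub> h = \<zero>\<^bsub>H\<^esub> \<Longrightarrow> h = \<zero>\<^bsub>H\<^esub>"
  using H.smult_assoc[of h "1 / c" c] by (simp add: H.smult_one)

lemma hom_map_injective:
  assumes c: "c \<noteq> 0" and m: "m \<in> carrier M" and zero: "hom_map c m = (\<lambda>y. \<zero>\<^bsub>H\<^esub>)"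
  shows "m = \<zero>"
proof (rule coords_eqI)
  fix b
  have "crd m b = 0"
  proof (rule coef_eqI)
    fix A assume A: "A \<subseteq> {..<n}"
    let ?y = "mon ({..<n} - A)"
    let ?p = "mcoef {..<n} (?y \<odot> m)"
    have pc: "?p \<in> carrier M" using m by (simp add: mcoef_closed smult_closed)
    have "\<Phi> ?p = \<zero>\<^bsub>H\<^esub>"
    proof (rule smult_nonzero_eq[OF c Phi_closed[OF pc]])
      show "c \<odot>\<^bsub>H\<^esub> \<Phi> ?p = \<zero>\<^bsub>H\<^esub>" using fun_cong[OF zero, of ?y] by (simp add: hom_map_def)
    qed
    then have "coef {} (crd ?p b) = 0" using pc by (simp add: Phi_kernel V_smult_iff filt_1_iff)
    then have "coef {..<n} (?y * crd m b) = 0" using m by (simp add: coords_mcoef coords_smult smult_closed)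
    moreover have "coef {..<n} (?y * mon A) \<noteq> 0" using top_pairing[of "{..<n} - A" A] A by (auto simp: double_diff)
    ultimately show "coef A (crd m b) = coef A 0" using top_coef[OF A, of "crd m b"] by simp
  qed
  then show "crd m b = crd \<zero> b" by (simp add: coords_zero)
qed (use m in auto)

text \<open>The preimage of \<open>\<alpha>\<close> is assembled from the values \<open>\<alpha>(e\<^sub>A)\<close>, with the basis of \<open>E\<close> that is dual to the monomials under the
  pairing.\<close>

definition hom_inverse :: "'k \<Rightarrow> ('e \<Rightarrow> 'h) \<Rightarrow> 'm" where
  "hom_inverse c \<alpha> = (\<Oplus>A\<in>Pow {..<n}.
     scal E (1 / (c * coef {..<n} (mon A * mon ({..<n} - A)))) (mon ({..<n} - A)) \<odot> sec (\<alpha> (mon A)))"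

lemma hom_inverse_closed: "\<alpha> \<in> carrier (Hom_K E H) \<Longrightarrow> hom_inverse c \<alpha> \<in> carrier M"
  unfolding hom_inverse_def by (intro finsum_closed) (auto simp: smult_closed sec_closed)

lemma hom_map_inverse:
  assumes c: "c \<noteq> 0" and \<alpha>: "\<alpha> \<in> carrier (Hom_K E H)"
  shows "hom_map c (hom_inverse c \<alpha>) = \<alpha>"
proof
  fix y
  let ?m = "hom_inverse c \<alpha>" and ?r = "\<lambda>A. scal E (1 / (c * coef {..<n} (mon A * mon ({..<n} - A)))) (mon ({..<n} - A))"
  have \<alpha>c: "\<alpha> z \<in> carrier H" for z using \<alpha> by simp
  have mc: "?m \<in> carrier M" using \<alpha> by (rule hom_inverse_closed)
  have hm: "hom_map c ?m \<in> carrier (Hom_K E H)" using mc by (rule hom_map_simps)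
  have basis: "hom_map c ?m (mon A) = \<alpha> (mon A)" if A: "A \<subseteq> {..<n}" for A
  proof -
    have mem: "(\<lambda>A'. ?r A' \<odot> sec (\<alpha> (mon A'))) \<in> Pow {..<n} \<rightarrow> carrier M"
      using \<alpha>c by (auto simp: smult_closed sec_closed)
    have "mcoef {..<n} (mon A \<odot> ?m) = mcoef {..<n} (\<Oplus>A'\<in>Pow {..<n}. mon A \<odot> (?r A' \<odot> sec (\<alpha> (mon A'))))"
      unfolding hom_inverse_def using finsum_smult[OF mem, of "mon A"] by simp
    also have "\<dots> = (\<Oplus>A'\<in>Pow {..<n}. mcoef {..<n} (mon A \<odot> (?r A' \<odot> sec (\<alpha> (mon A')))))"
      using mem by (intro mcoef_finsum) (auto simp: smult_closed Pi_iff)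
    also have "\<dots> = (\<Oplus>A'\<in>Pow {..<n}. if A = A' then scal E (1 / c) 1 \<odot> sec (\<alpha> (mon A)) else \<zero>)"
    proof (intro finsum_cong' refl)
      fix A' assume A': "A' \<in> Pow {..<n}"
      have "mcoef {..<n} (mon A \<odot> (?r A' \<odot> sec (\<alpha> (mon A')))) = mcoef {..<n} ((mon A * ?r A') \<odot> mcoef {} (sec (\<alpha> (mon A'))))"
        using \<alpha>c by (simp add: smult_assoc sec_closed sec_const)
      also have "\<dots> = scal E (coef {..<n} (mon A * ?r A')) 1 \<odot> sec (\<alpha> (mon A'))"
        using \<alpha>c by (subst mcoef_smult_const) (simp_all add: sec_closed sec_const)
      also have "\<dots> = (if A = A' then scal E (1 / c) 1 \<odot> sec (\<alpha> (mon A)) else \<zero>)"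
      proof (cases "A = A'")
        case True
        have "coef {..<n} (mon A * mon ({..<n} - A)) \<noteq> 0" using top_pairing[of A "{..<n} - A"] A by auto
        then have "coef {..<n} (mon A * ?r A') = 1 / c" using True by (simp add: scal_right)
        then show ?thesis using True by simp
      next
        case False
        have "{..<n} - A' \<noteq> {..<n} - A" using False A A' by blast
        then have "coef {..<n} (mon A * mon ({..<n} - A')) = 0" using top_pairing[of A "{..<n} - A'"] A by auto
        then have "coef {..<n} (mon A * ?r A') = 0" by (simp add: scal_right)
        then show ?thesis using False \<alpha>c by (simp add: sec_closed)
      qed
      finally show "mcoef {..<n} (mon A \<odot> (?r A' \<odot> sec (\<alpha> (mon A')))) = (if A = A' then scal E (1 / c) 1 \<odot> sec (\<alpha> (mon A)) else \<zero>)" .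
    qed (use \<alpha>c in \<open>auto simp: smult_closed sec_closed\<close>)
    also have "\<dots> = scal E (1 / c) 1 \<odot> sec (\<alpha> (mon A))"
      using A \<alpha>c by (intro finsum_singleton) (auto simp: smult_closed sec_closed)
    finally have "hom_map c ?m (mon A) = c \<odot>\<^bsub>H\<^esub> ((1 / c) \<odot>\<^bsub>H\<^esub> \<alpha> (mon A))"
      using \<alpha>c by (simp add: hom_map_def Phi_scal sec_closed Phi_sec)
    then show ?thesis using c \<alpha>c by (simp add: H.smult_assoc[symmetric] H.smult_one)
  qed
  have "hom_map c ?m y = (\<Oplus>\<^bsub>H\<^esub>A\<in>Pow {..<n}. coef A y \<odot>\<^bsub>H\<^esub> hom_map c ?m (mon A))"
    by (rule Hom_K_expand[OF H.left_module_axioms hm])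
  also have "\<dots> = (\<Oplus>\<^bsub>H\<^esub>A\<in>Pow {..<n}. coef A y \<odot>\<^bsub>H\<^esub> \<alpha> (mon A))"
    using basis \<alpha>c by (intro H.finsum_cong') (auto simp: H.smult_closed)
  also have "\<dots> = \<alpha> y" by (rule Hom_K_expand[OF H.left_module_axioms \<alpha>, symmetric])
  finally show "hom_map c ?m y = \<alpha> y" .
qed

lemma hom_map_bij: "c \<noteq> 0 \<Longrightarrow> bij_betw (hom_map c) (carrier M) (carrier (Hom_K E H))"
proof (rule bij_betwI')
  interpret HK: left_module "Hom_K E H" by (rule left_module_Hom_K) (rule H.left_module_axioms)
  fix x y assume c: "c \<noteq> 0" and xy: "x \<in> carrier M" "y \<in> carrier M"
  show "hom_map c x = hom_map c y \<longleftrightarrow> x = y"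
  proof
    assume "hom_map c x = hom_map c y"
    then have "hom_map c (x \<ominus> y) = \<zero>\<^bsub>Hom_K E H\<^esub>"
      using xy hom_map_simps by (simp only: HK.minus_eq HK.r_neg)
    then have "hom_map c (x \<ominus> y) = (\<lambda>y. \<zero>\<^bsub>H\<^esub>)" by simp
    then show "x = y" using xy hom_map_injective[OF c, of "x \<ominus> y"] diff_eq_zero_iff by simp
  qed simp
next
  fix \<alpha> assume "c \<noteq> 0" "\<alpha> \<in> carrier (Hom_K E H)"
  then show "\<exists>m\<in>carrier M. \<alpha> = hom_map c m"
    by (intro bexI[of _ "hom_inverse c \<alpha>"]) (simp_all add: hom_map_inverse hom_inverse_closed del: Hom_K_simps(1))
qed (rule hom_map_simps)

end

locale graded_reduction = reduction E n e M B H \<Phi> + graded_free_E_module E n e M B gr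
  for E :: "('k::field, 'e::ring_1) gen_algebra" and n e
    and M :: "('e, 'm) module" (structure) and B and H :: "('k, 'h) module" and \<Phi> and gr +
  fixes Hgr :: "int \<Rightarrow> 'h set"
  assumes Phi_gr: "\<Phi> ` gr d = Hgr d"
begin

lemma Hgr_closed: "h \<in> Hgr d \<Longrightarrow> h \<in> carrier H"
  unfolding Phi_gr[symmetric] by (erule imageE) (simp add: Phi_closed gr_closed)

lemma sec_gr: "h \<in> Hgr d \<Longrightarrow> sec h \<in> gr d"
proof -
  assume "h \<in> Hgr d"
  then obtain m where m: "m \<in> gr d" "h = \<Phi> m" unfolding Phi_gr[symmetric] by (rule imageE)
  then show ?thesis using mcoef_gr[OF m(1), of "{}"] gr_closed[OF m(1)] by (simp add: sec_Phi)
qed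

lemma tens_gr:
  "tens ` gr d = {(\<Oplus>\<^bsub>T.ET\<^esub>j\<in>{..<k}. T.pt (y j) (h j)) |
       (k::nat) y h. \<forall>j<k. \<exists>a. y j \<in> E_deg E a \<and> h j \<in> Hgr (d - a)}" (is "_ = ?R")
proof
  show "tens ` gr d \<subseteq> ?R"
  proof (rule image_subsetI)
    fix m assume m: "m \<in> gr d"
    then have mc: "m \<in> carrier M" by (rule gr_closed)
    let ?A = "{b. crd m b \<noteq> 0}"
    have A: "finite ?A" "?A \<subseteq> B" using mc finite_coords coords_subset by auto
    have c: "\<Phi> b \<in> carrier H" if "b \<in> ?A" for b using that A Phi_closed basis_closed by blast
    obtain f where f: "bij_betw f {0..<card ?A} ?A" using ex_bij_betw_nat_finite[OF A(1)] by blast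
    have fA: "f j \<in> ?A" if "j < card ?A" for j using bij_betwE[OF f] that by (simp add: atLeast0LessThan)
    have "tens m = (\<Oplus>\<^bsub>T.ET\<^esub>b\<in>?A. T.pt (crd m b) (\<Phi> b))"
      unfolding tens_def lext_def using c T.pt_closed by (intro T.ET.finsum_cong') (auto simp: T.pt_smult)
    also have "?A = f ` {..<card ?A}" using f by (simp add: bij_betw_def atLeast0LessThan)
    also have "(\<Oplus>\<^bsub>T.ET\<^esub>b\<in>f ` {..<card ?A}. T.pt (crd m b) (\<Phi> b)) = (\<Oplus>\<^bsub>T.ET\<^esub>j\<in>{..<card ?A}. T.pt (crd m (f j)) (\<Phi> (f j)))"
    proof (rule T.ET.finsum_reindex)
      show "inj_on f {..<card ?A}" using f by (simp add: bij_betw_def atLeast0LessThan)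
      show "(\<lambda>b. T.pt (crd m b) (\<Phi> b)) \<in> f ` {..<card ?A} \<rightarrow> carrier T.ET"
      proof
        fix b assume "b \<in> f ` {..<card ?A}"
        then have "b \<in> ?A" using fA by blast
        then show "T.pt (crd m b) (\<Phi> b) \<in> carrier T.ET" using c T.pt_closed by blast
      qed
    qed
    finally have eq: "tens m = (\<Oplus>\<^bsub>T.ET\<^esub>j\<in>{..<card ?A}. T.pt (crd m (f j)) (\<Phi> (f j)))" .
    have deg: "\<exists>a. crd m (f j) \<in> E_deg E a \<and> \<Phi> (f j) \<in> Hgr (d - a)" if j: "j < card ?A" for j
    proof (intro exI conjI)
      show "crd m (f j) \<in> E_deg E (d - bdeg (f j))" by (rule gr_coordsD[OF m])
      have "f j \<in> gr (bdeg (f j))" using fA[OF j] A by (intro bdeg) blast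
      then show "\<Phi> (f j) \<in> Hgr (d - (d - bdeg (f j)))" using Phi_gr[of "bdeg (f j)"] by auto
    qed
    show "tens m \<in> ?R"
      using eq deg
      by (intro CollectI exI[of _ "card ?A"] exI[of _ "\<lambda>j. crd m (f j)"] exI[of _ "\<lambda>j. \<Phi> (f j)"]) simp
  qed
  show "?R \<subseteq> tens ` gr d"
  proof
    fix X assume "X \<in> ?R"
    then obtain k :: nat and y h where X: "X = (\<Oplus>\<^bsub>T.ET\<^esub>j\<in>{..<k}. T.pt (y j) (h j))"
        and yh: "\<forall>j<k. \<exists>a. y j \<in> E_deg E a \<and> h j \<in> Hgr (d - a)" by (elim CollectE exE conjE)
    have hc: "h j \<in> carrier H" if "j < k" for j using yh that Hgr_closed by blast
    have g: "y j \<odot> sec (h j) \<in> gr d" if j: "j < k" for j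
    proof -
      obtain a where "y j \<in> E_deg E a" "h j \<in> Hgr (d - a)" using yh j by blast
      then have "y j \<odot> sec (h j) \<in> gr (a + (d - a))" by (intro gr_smult sec_gr)
      then show ?thesis by simp
    qed
    have "X = (\<Oplus>\<^bsub>T.ET\<^esub>j\<in>{..<k}. tens (y j \<odot> sec (h j)))"
      unfolding X using hc T.pt_closed by (intro T.ET.finsum_cong') (auto simp: tens_sec)
    also have "\<dots> = tens (\<Oplus>j\<in>{..<k}. y j \<odot> sec (h j))"
      using hc by (intro tens_simps(4)[symmetric]) (auto simp: sec_closed smult_closed)
    finally show "X \<in> tens ` gr d" using g by (auto intro!: imageI gr_finsum)
  qed
qed

text \<open>Taking the coefficient of the top monomial, which has degree \<open>-n\<close>, raises degrees by \<open>n\<close>.\<close>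

lemma hom_map_gr:
  assumes c: "c \<noteq> 0"
  shows "hom_map c ` gr d = {\<alpha> \<in> carrier (Hom_K E H). \<forall>j. \<forall>y\<in>E_deg E j. \<alpha> y \<in> Hgr (j + (d + int n))}"
proof
  show "hom_map c ` gr d \<subseteq> {\<alpha> \<in> carrier (Hom_K E H). \<forall>j. \<forall>y\<in>E_deg E j. \<alpha> y \<in> Hgr (j + (d + int n))}"
  proof (rule image_subsetI)
    fix m assume m: "m \<in> gr d"
    have "hom_map c m y \<in> Hgr (j + (d + int n))" if y: "y \<in> E_deg E j" for y j
    proof -
      have "mcoef {..<n} (y \<odot> m) \<in> gr (j + d + int (card {..<n}))"
        by (rule mcoef_gr[OF gr_smult[OF y m]]) simp
      then have p: "mcoef {..<n} (y \<odot> m) \<in> gr (j + (d + int n))" by (simp add: add.assoc)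
      have "scal E c 1 \<odot> mcoef {..<n} (y \<odot> m) \<in> gr (0 + (j + (d + int n)))" by (rule gr_smult[OF scal_one_deg p])
      then have "\<Phi> (scal E c 1 \<odot> mcoef {..<n} (y \<odot> m)) \<in> Hgr (j + (d + int n))" using Phi_gr by auto
      then show ?thesis using gr_closed[OF p] by (simp add: hom_map_def Phi_scal)
    qed
    then show "hom_map c m \<in> {\<alpha> \<in> carrier (Hom_K E H). \<forall>j. \<forall>y\<in>E_deg E j. \<alpha> y \<in> Hgr (j + (d + int n))}"
      using hom_map_simps(1)[OF gr_closed[OF m]] by blast
  qed
  show "{\<alpha> \<in> carrier (Hom_K E H). \<forall>j. \<forall>y\<in>E_deg E j. \<alpha> y \<in> Hgr (j + (d + int n))} \<subseteq> hom_map c ` gr d"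
  proof
    fix \<alpha> assume "\<alpha> \<in> {\<alpha> \<in> carrier (Hom_K E H). \<forall>j. \<forall>y\<in>E_deg E j. \<alpha> y \<in> Hgr (j + (d + int n))}"
    then have \<alpha>: "\<alpha> \<in> carrier (Hom_K E H)" and deg: "\<And>j y. y \<in> E_deg E j \<Longrightarrow> \<alpha> y \<in> Hgr (j + (d + int n))"
      by blast+
    have "hom_inverse c \<alpha> \<in> gr d"
      unfolding hom_inverse_def
    proof (rule gr_finsum)
      fix A assume "A \<in> Pow {..<n}"
      then have A: "A \<subseteq> {..<n}" by simp
      let ?k = "1 / (c * coef {..<n} (mon A * mon ({..<n} - A)))"
      have s: "sec (\<alpha> (mon A)) \<in> gr (- int (card A) + (d + int n))" by (intro sec_gr deg mon_deg A)
      have m: "mon ({..<n} - A) \<odot> sec (\<alpha> (mon A)) \<in> gr (- int (card ({..<n} - A)) + (- int (card A) + (d + int n)))"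
        by (intro gr_smult[OF mon_deg s]) blast
      have "finite A" using A finite_subset by blast
      then have "int (card ({..<n} - A)) = int n - int (card A)"
        using A card_mono[OF finite_lessThan A] by (simp add: card_Diff_subset of_nat_diff)
      then have "mon ({..<n} - A) \<odot> sec (\<alpha> (mon A)) \<in> gr d" using m by simp
      then have "scal E ?k 1 \<odot> (mon ({..<n} - A) \<odot> sec (\<alpha> (mon A))) \<in> gr (0 + d)" by (rule gr_smult[OF scal_one_deg])
      moreover have "scal E ?k 1 \<odot> (mon ({..<n} - A) \<odot> sec (\<alpha> (mon A))) = scal E ?k (mon ({..<n} - A)) \<odot> sec (\<alpha> (mon A))"
        using gr_closed[OF s] by (simp add: smult_assoc[symmetric] scal_left)
      ultimately show "scal E ?k (mon ({..<n} - A)) \<odot> sec (\<alpha> (mon A)) \<in> gr d" by simp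
    qed
    then show "\<alpha> \<in> hom_map c ` gr d" using hom_map_inverse[OF c \<alpha>] by (metis imageI)
  qed
qed

end

section \<open>Comparison with a minimal model\<close>

lemma chain_homotopicD:
  assumes "chain_homotopic graded C D f g"
  shows "\<exists>s. (\<forall>i. left_hom (cmod C i) (cmod D (i - 1)) (s i)) \<and>
    (\<forall>i. \<forall>m\<in>carrier (cmod C i). f i m \<ominus>\<^bsub>cmod D i\<^esub> g i m
       = cdiff D (i - 1) (s i m) \<oplus>\<^bsub>cmod D i\<^esub> s (i + 1) (cdiff C i m))"
proof -
  obtain s where s: "(\<forall>i. left_hom (cmod C i) (cmod D (i - 1)) (s i)) \<and>
     (graded \<longrightarrow> (\<forall>i d. s i ` cgr C i d \<subseteq> cgr D (i - 1) d)) \<and>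
     (\<forall>i. \<forall>m\<in>carrier (cmod C i).
        f i m \<ominus>\<^bsub>cmod D i\<^esub> g i m = cdiff D (i - 1) (s i m) \<oplus>\<^bsub>cmod D i\<^esub> s (i + 1) (cdiff C i m))"
    using assms unfolding chain_homotopic_def by (rule exE)
  show ?thesis by (rule exI[of _ s]) (use s in simp)
qed

locale minimal_equivalence = exterior_basis E n e +
    F: complex_with_bases E n e graded F BF + G: complex_with_bases E n e graded G BG
  for E :: "('k::field, 'e::ring_1) gen_algebra" and n e graded
    and F :: "('e, 'm) cochain_complex" and BF and G :: "('e, 'l) cochain_complex" and BG +
  fixes f :: "int \<Rightarrow> 'm \<Rightarrow> 'l" and g :: "int \<Rightarrow> 'l \<Rightarrow> 'm" and x :: "nat \<Rightarrow> 'e \<Rightarrow> 'k"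
  assumes minimal: "minimal_complex E G BG"
    and f: "chain_map graded F G f" and g: "chain_map graded G F g"
    and gf: "chain_homotopic graded F F (\<lambda>i. g i \<circ> f i) (\<lambda>i. id)"
    and fg: "chain_homotopic graded G G (\<lambda>i. f i \<circ> g i) (\<lambda>i. id)"
    and dual: "dual_bases E n e x"
begin

lemma f_hom: "left_hom (cmod F i) (cmod G i) (f i)"
  and f_d: "m \<in> carrier (cmod F i) \<Longrightarrow> f (i + 1) (cdiff F i m) = cdiff G i (f i m)"
  using f by (auto simp: chain_map_def)

lemma f_gr: "graded \<Longrightarrow> m \<in> cgr F i d \<Longrightarrow> f i m \<in> cgr G i d"
  using f unfolding chain_map_def by blast

lemma g_hom: "left_hom (cmod G i) (cmod F i) (g i)"
  and g_d: "m \<in> carrier (cmod G i) \<Longrightarrow> g (i + 1) (cdiff G i m) = cdiff F i (g i m)"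
  using g by (auto simp: chain_map_def)

lemma g_gr: "graded \<Longrightarrow> m \<in> cgr G i d \<Longrightarrow> g i m \<in> cgr F i d"
  using g unfolding chain_map_def by blast

lemmas f_simps =
  left_hom_closed[OF F.F.left_module_axioms G.F.left_module_axioms f_hom]
  left_hom_add[OF F.F.left_module_axioms G.F.left_module_axioms f_hom]

lemmas g_simps =
  left_hom_closed[OF G.F.left_module_axioms F.F.left_module_axioms g_hom]
  left_hom_add[OF G.F.left_module_axioms F.F.left_module_axioms g_hom]
  left_hom_smult[OF G.F.left_module_axioms F.F.left_module_axioms g_hom]
  left_hom_diff[OF G.F.left_module_axioms F.F.left_module_axioms g_hom]
  left_hom_finsum[OF G.F.left_module_axioms F.F.left_module_axioms g_hom]

lemma f_V_smult: "m \<in> V_smult k (cmod F i) \<Longrightarrow> f i m \<in> V_smult k (cmod G i)"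
  by (rule ideal_smult_hom[OF F.F.left_module_axioms G.F.left_module_axioms f_hom])

lemma g_V_smult: "m \<in> V_smult k (cmod G i) \<Longrightarrow> g i m \<in> V_smult k (cmod F i)"
  by (rule ideal_smult_hom[OF G.F.left_module_axioms F.F.left_module_axioms g_hom])

lemma d_minimal:
  assumes m: "m \<in> carrier (cmod G i)" shows "cdiff G i m \<in> V_smult 1 (cmod G (i + 1))"
proof -
  let ?A = "{b. G.F.crd i m b \<noteq> 0}"
  have A: "?A \<subseteq> BG i" using m G.F.coords_subset by auto
  have c: "b \<in> carrier (cmod G i)" if "b \<in> ?A" for b using that A G.F.basis_closed by blast
  have basis: "G.F.crd (i + 1) (cdiff G i b) b' \<in> filt 1" if b: "b \<in> ?A" for b b'
  proof (cases "b' \<in> BG (i + 1)")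
    case True
    then have "diff_entry G BG i b b' \<in> V_ideal_power E 1"
      using minimal b A unfolding minimal_complex_def by blast
    then show ?thesis by (simp only: diff_entry_def V_ideal_power_eq)
  next
    case False
    then have "G.F.crd (i + 1) (cdiff G i b) b' = 0" using G.d_simps(1)[OF c[OF b]] G.F.coords_outside by blast
    then show ?thesis by simp
  qed
  have mem: "(\<lambda>b. G.F.crd i m b \<odot>\<^bsub>cmod G (i + 1)\<^esub> cdiff G i b) \<in> ?A \<rightarrow> carrier (cmod G (i + 1))"
    using c G.d_simps(1) by (auto intro!: G.F.smult_closed)
  have eq: "cdiff G i m = (\<Oplus>\<^bsub>cmod G (i + 1)\<^esub>b\<in>?A. G.F.crd i m b \<odot>\<^bsub>cmod G (i + 1)\<^esub> cdiff G i b)"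
    using G.F.left_hom_expand[OF G.F.left_module_axioms G.d_hom m] by (simp add: lext_def)
  have "G.F.crd (i + 1) (cdiff G i m) b' \<in> filt 1" for b'
    unfolding eq G.F.coords_finsum[OF mem]
  proof (rule filt_sum)
    fix b assume b: "b \<in> ?A"
    show "G.F.crd (i + 1) (G.F.crd i m b \<odot>\<^bsub>cmod G (i + 1)\<^esub> cdiff G i b) b' \<in> filt 1"
      using basis[OF b] G.d_simps(1)[OF c[OF b]] by (simp add: G.F.coords_smult filt_mult_left)
  qed
  then show ?thesis using G.d_simps(1)[OF m] by (simp add: G.F.V_smult_iff)
qed

lemma Zc_minimal: "m \<in> carrier (cmod G i) \<Longrightarrow> m \<in> G.Zc i"
  using d_minimal by (simp add: G.Zc_def)

text \<open>Since \<open>G\<close> is minimal, \<open>H\<^sup>i(K \<otimes> G)\<close> is \<open>G\<^sup>i/(V)G\<^sup>i\<close>, and \<open>g\<close> carries it to \<open>H\<^sup>i(K \<otimes> F)\<close>.\<close>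

definition \<Phi> :: "int \<Rightarrow> 'l \<Rightarrow> 'm set set" where
  "\<Phi> i m = F.cls i (g i m)"

lemma g_Zc: assumes m: "m \<in> carrier (cmod G i)" shows "g i m \<in> F.Zc i"
  using g_V_smult[OF d_minimal[OF m]] m by (simp add: F.Zc_def g_simps g_d)

text \<open>By minimality the homotopy from \<open>f g\<close> to the identity takes values in \<open>(V)G\<close>, so \<open>f g\<close> is the identity modulo
  \<open>(V)\<close>.\<close>

lemma f_g_V_smult:
  assumes m: "m \<in> carrier (cmod G i)" and V: "f i (g i m) \<in> V_smult 1 (cmod G i)"
  shows "m \<in> V_smult 1 (cmod G i)"
proof -
  obtain s where s': "(\<forall>i. left_hom (cmod G i) (cmod G (i - 1)) (s i)) \<and>
    (\<forall>i. \<forall>m\<in>carrier (cmod G i). (f i \<circ> g i) m \<ominus>\<^bsub>cmod G i\<^esub> id m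
       = cdiff G (i - 1) (s i m) \<oplus>\<^bsub>cmod G i\<^esub> s (i + 1) (cdiff G i m))"
    using chain_homotopicD[OF fg] by (rule exE)
  then have s: "\<And>i. left_hom (cmod G i) (cmod G (i - 1)) (s i)"
    "\<And>i m. m \<in> carrier (cmod G i) \<Longrightarrow> (f i \<circ> g i) m \<ominus>\<^bsub>cmod G i\<^esub> id m
       = cdiff G (i - 1) (s i m) \<oplus>\<^bsub>cmod G i\<^esub> s (i + 1) (cdiff G i m)"
    by blast+
  have sc: "s i m \<in> carrier (cmod G (i - 1))"
    using left_hom_closed[OF G.F.left_module_axioms G.F.left_module_axioms s(1)] m by blast
  have 1: "cdiff G (i - 1) (s i m) \<in> V_smult 1 (cmod G i)" using d_minimal[OF sc] by simp
  have "left_hom (cmod G (i + 1)) (cmod G i) (s (i + 1))" using s(1)[of "i + 1"] by simp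
  then have 2: "s (i + 1) (cdiff G i m) \<in> V_smult 1 (cmod G i)"
    using ideal_smult_hom[OF G.F.left_module_axioms G.F.left_module_axioms] d_minimal[OF m] by blast
  have c: "f i (g i m) \<in> carrier (cmod G i)" using m by (simp add: g_simps f_simps)
  have "f i (g i m) \<ominus>\<^bsub>cmod G i\<^esub> m \<in> V_smult 1 (cmod G i)"
    using s(2)[OF m] G.F.VM.sub_add[OF 1 2] by simp
  then have "f i (g i m) \<ominus>\<^bsub>cmod G i\<^esub> (f i (g i m) \<ominus>\<^bsub>cmod G i\<^esub> m) \<in> V_smult 1 (cmod G i)"
    using V G.F.VM.sub_diff by blast
  moreover have "f i (g i m) \<ominus>\<^bsub>cmod G i\<^esub> (f i (g i m) \<ominus>\<^bsub>cmod G i\<^esub> m) = m"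
    using m c by (intro G.F.coords_eqI[where i = i]) (simp_all add: G.F.coords_diff)
  ultimately show ?thesis by simp
qed

lemma Phi_kernel: assumes m: "m \<in> carrier (cmod G i)"
  shows "\<Phi> i m = \<zero>\<^bsub>F.H i\<^esub> \<longleftrightarrow> m \<in> V_smult 1 (cmod G i)"
proof
  assume "m \<in> V_smult 1 (cmod G i)"
  then show "\<Phi> i m = \<zero>\<^bsub>F.H i\<^esub>"
    using F.cls_zero_iff[OF g_Zc[OF m]] F.V_smult_Bc g_V_smult by (simp add: \<Phi>_def)
next
  assume "\<Phi> i m = \<zero>\<^bsub>F.H i\<^esub>"
  then have "g i m \<in> F.Bc i" using F.cls_zero_iff[OF g_Zc[OF m]] by (simp add: \<Phi>_def)
  then obtain u r where u: "g i m = cdiff F (i - 1) u \<oplus>\<^bsub>cmod F i\<^esub> r"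
      "u \<in> carrier (cmod F (i - 1))" "r \<in> V_smult 1 (cmod F i)"
    by (auto simp: F.Bc_def)
  have fu: "f (i - 1) u \<in> carrier (cmod G (i - 1))" using u by (simp add: f_simps)
  have "f i (cdiff F (i - 1) u) = cdiff G (i - 1) (f (i - 1) u)" using f_d[OF u(2)] by simp
  moreover have "cdiff G (i - 1) (f (i - 1) u) \<in> V_smult 1 (cmod G i)" using d_minimal[OF fu] by simp
  moreover have "f i (g i m) = f i (cdiff F (i - 1) u) \<oplus>\<^bsub>cmod G i\<^esub> f i r"
    unfolding u(1) using u(2,3) by (intro f_simps(2)) (auto simp: F.d_simps' F.F.V_smult_closed)
  ultimately have "f i (g i m) \<in> V_smult 1 (cmod G i)"
    using f_V_smult[OF u(3)] G.F.VM.sub_add by simp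
  then show "m \<in> V_smult 1 (cmod G i)" by (rule f_g_V_smult[OF m])
qed

text \<open>The homotopy from \<open>g f\<close> to the identity changes \<open>z\<close> by a coboundary and by a term in \<open>(V)F\<close>, because
  \<open>d z \<in> (V)F\<close>.\<close>

lemma Phi_f:
  assumes z: "z \<in> F.Zc i" shows "\<Phi> i (f i z) = F.cls i z"
proof -
  have zc: "z \<in> carrier (cmod F i)" using z F.Zc_closed by blast
  obtain s where s': "(\<forall>i. left_hom (cmod F i) (cmod F (i - 1)) (s i)) \<and>
    (\<forall>i. \<forall>m\<in>carrier (cmod F i). (g i \<circ> f i) m \<ominus>\<^bsub>cmod F i\<^esub> id m
       = cdiff F (i - 1) (s i m) \<oplus>\<^bsub>cmod F i\<^esub> s (i + 1) (cdiff F i m))"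
    using chain_homotopicD[OF gf] by (rule exE)
  then have s: "\<And>i. left_hom (cmod F i) (cmod F (i - 1)) (s i)"
    "\<And>i m. m \<in> carrier (cmod F i) \<Longrightarrow> (g i \<circ> f i) m \<ominus>\<^bsub>cmod F i\<^esub> id m
       = cdiff F (i - 1) (s i m) \<oplus>\<^bsub>cmod F i\<^esub> s (i + 1) (cdiff F i m)"
    by blast+
  have sc: "s i z \<in> carrier (cmod F (i - 1))"
    using left_hom_closed[OF F.F.left_module_axioms F.F.left_module_axioms s(1)] zc by blast
  have "left_hom (cmod F (i + 1)) (cmod F i) (s (i + 1))" using s(1)[of "i + 1"] by simp
  then have "s (i + 1) (cdiff F i z) \<in> V_smult 1 (cmod F i)"
    using ideal_smult_hom[OF F.F.left_module_axioms F.F.left_module_axioms] z by (auto simp: F.Zc_def)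
  then have "g i (f i z) \<ominus>\<^bsub>cmod F i\<^esub> z \<in> F.Bc i" using s(2)[OF zc] F.BcI[OF sc] by simp
  then show ?thesis unfolding \<Phi>_def using g_Zc[OF f_simps(1)[OF zc]] z by (simp add: F.cls_eq_iff)
qed

sublocale R: reduction E n e "cmod G i" "BG i" "F.H i" "\<Phi> i" for i
proof unfold_locales
  fix m m' a assume m: "m \<in> carrier (cmod G i)"
  show "\<Phi> i m \<in> carrier (F.H i)" using g_Zc[OF m] by (simp add: \<Phi>_def F.cls_closed)
  show "\<Phi> i (scal E a 1 \<odot>\<^bsub>cmod G i\<^esub> m) = a \<odot>\<^bsub>F.H i\<^esub> \<Phi> i m"
    using m g_Zc[OF m] by (simp add: \<Phi>_def g_simps F.cls_smult)
  show "(\<Phi> i m = \<zero>\<^bsub>F.H i\<^esub>) = (m \<in> V_smult 1 (cmod G i))" by (rule Phi_kernel[OF m])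
  show "\<Phi> i (m \<oplus>\<^bsub>cmod G i\<^esub> m') = \<Phi> i m \<oplus>\<^bsub>F.H i\<^esub> \<Phi> i m'" if "m' \<in> carrier (cmod G i)"
    using m that g_Zc[OF m] g_Zc[OF that] by (simp add: \<Phi>_def g_simps F.cls_add)
next
  fix h assume "h \<in> carrier (F.H i)"
  then obtain z where z: "z \<in> F.Zc i" "h = F.cls i z" using F.cls_surj by blast
  then show "\<exists>m\<in>carrier (cmod G i). h = \<Phi> i m"
    using Phi_f[OF z(1)] f_simps(1)[OF F.Zc_closed[OF z(1)]] by (intro bexI[of _ "f i z"]) simp_all
qed

lemma graded_R:
  assumes "graded"
  shows "graded_reduction E n e (cmod G i) (BG i) (F.H i) (\<Phi> i) (cgr G i) (cohomology_gr F.KF i)"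
proof -
  interpret GG: graded_free_E_module E n e "cmod G i" "BG i" "cgr G i" by (rule G.graded_F[OF assms])
  show ?thesis
  proof unfold_locales
    fix d
    show "\<Phi> i ` cgr G i d = cohomology_gr F.KF i d"
      unfolding F.cohomology_gr_eq[OF assms]
    proof
      show "\<Phi> i ` cgr G i d \<subseteq> F.cls i ` (F.Zc i \<inter> cgr F i d)"
        using g_Zc[OF GG.gr_closed] g_gr[OF assms] by (auto simp: \<Phi>_def)
      show "F.cls i ` (F.Zc i \<inter> cgr F i d) \<subseteq> \<Phi> i ` cgr G i d"
        using Phi_f f_gr[OF assms] by (auto simp flip: Phi_f)
    qed
  qed
qed

text \<open>As \<open>g\<close> is a chain map, it takes the linear coefficients of \<open>d m\<close> in \<open>G\<close> to linear coefficients of \<open>d (g m)\<close> in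
  \<open>F\<close>, and contraction with \<open>x\<^sub>s\<close> selects one of them.\<close>

lemma Phi_action:
  assumes s: "s < n" and m: "m \<in> carrier (cmod G i)"
  shows "W_mult E F i (x s) (\<Phi> i m) = \<Phi> (i + 1) (G.dpart i m s)"
proof -
  let ?y = "G.dpart i m" and ?y' = "\<lambda>s. g (i + 1) (G.dpart i m s)"
  have xs: "x s \<in> dual_space E" using dual s by (simp add: dual_bases_def)
  have xe: "x s (e t) = (if s = t then 1 else 0)" if "t < n" for t
    using dual s that by (simp add: dual_bases_def)
  have lp: "G.linear_part (i + 1) (cdiff G i m) ?y" using G.linear_part_dpart[OF Zc_minimal[OF m]] .
  have yc: "?y t \<in> carrier (cmod G (i + 1))" if "t < n" for t using lp that by (simp add: G.linear_part_def)
  have y'c: "?y' t \<in> carrier (cmod F (i + 1))" if "t < n" for t using yc[OF that] by (rule g_simps)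
  have Ec: "G.Ecomb (i + 1) ?y \<in> carrier (cmod G (i + 1))" by (rule G.Ecomb_closed) (rule yc)
  have "g (i + 1) (G.Ecomb (i + 1) ?y) = (\<Oplus>\<^bsub>cmod F (i + 1)\<^esub>t\<in>{..<n}. g (i + 1) (e t \<odot>\<^bsub>cmod G (i + 1)\<^esub> ?y t))"
    using yc by (intro g_simps(5)) (auto simp: G.F.smult_closed)
  also have "\<dots> = F.Ecomb (i + 1) ?y'"
    using yc y'c by (intro F.F.finsum_cong') (auto simp: g_simps F.F.smult_closed)
  finally have gE: "g (i + 1) (G.Ecomb (i + 1) ?y) = F.Ecomb (i + 1) ?y'" .
  have "g (i + 1) (cdiff G i m \<ominus>\<^bsub>cmod G (i + 1)\<^esub> G.Ecomb (i + 1) ?y) \<in> V_smult 2 (cmod F (i + 1))"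
    using lp g_V_smult by (simp add: G.linear_part_def)
  then have "F.linear_part (i + 1) (cdiff F i (g i m)) ?y'"
    using y'c g_simps(4)[OF G.d_simps(1)[OF m] Ec] g_d[OF m] gE by (simp add: F.linear_part_def)
  then have "W_mult E F i (x s) (\<Phi> i m) = F.cls (i + 1) (F.Kcomb (i + 1) (\<lambda>t. x s (e t)) ?y')"
    unfolding \<Phi>_def by (intro F.W_mult_eq xs g_Zc m s)
  also have "F.Kcomb (i + 1) (\<lambda>t. x s (e t)) ?y' = ?y' s"
  proof (rule F.F.coords_eqI[where i = "i + 1"])
    fix b
    have "F.F.crd (i + 1) (F.Kcomb (i + 1) (\<lambda>t. x s (e t)) ?y') b = (\<Sum>t<n. scal E (x s (e t)) (F.F.crd (i + 1) (?y' t) b))"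
      by (rule F.coords_Kcomb) (rule y'c)
    also have "\<dots> = (\<Sum>t<n. if s = t then F.F.crd (i + 1) (?y' t) b else 0)"
      using xe by (intro sum.cong) auto
    finally show "F.F.crd (i + 1) (F.Kcomb (i + 1) (\<lambda>t. x s (e t)) ?y') b = F.F.crd (i + 1) (?y' s) b"
      using s by simp
  qed (use y'c s in \<open>auto intro!: F.Kcomb_closed\<close>)
  finally show ?thesis by (simp add: \<Phi>_def)
qed

lemma x_hom: "s < n \<Longrightarrow> left_hom (F.H i) (F.H (i + 1)) (W_mult E F i (x s))"
  using F.W_mult_hom dual by (simp add: dual_bases_def)

section \<open>The linear part of the minimal complex\<close>

abbreviation L where "L \<equiv> erase_nonlinear E G BG"

definition lin_image :: "int \<Rightarrow> 'l \<Rightarrow> 'l" where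
  "lin_image i b = (\<Oplus>\<^bsub>cmod G (i + 1)\<^esub>b'\<in>{b'. diff_entry G BG i b b' \<noteq> 0}.
         V_component E (diff_entry G BG i b b') \<odot>\<^bsub>cmod G (i + 1)\<^esub> b')"

lemma L_simps: "cmod L i = cmod G i" "cgr L i d = cgr G i d"
  "cdiff L i = lext (cmod G i) (BG i) (cmod G (i + 1)) (lin_image i)"
  by (simp_all add: erase_nonlinear_def lext_def lin_image_def fun_eq_iff)

lemma lin_image_closed: assumes b: "b \<in> BG i"
  shows "lin_image i b \<in> carrier (cmod G (i + 1))"
    and "lin_image i b = G.Ecomb (i + 1) (G.dpart i b)"
proof -
  have bc: "b \<in> carrier (cmod G i)" using b G.F.basis_closed by blast
  have db: "cdiff G i b \<in> carrier (cmod G (i + 1))" using bc by (rule G.d_simps)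
  let ?c = "G.F.crd (i + 1) (cdiff G i b)"
  let ?A = "{b'. ?c b' \<noteq> 0}"
  have A: "finite ?A" "?A \<subseteq> BG (i + 1)" using db G.F.finite_coords G.F.coords_subset by auto
  have Ac: "b' \<in> carrier (cmod G (i + 1))" if "b' \<in> ?A" for b' using A that G.F.basis_closed by blast
  have eq: "lin_image i b = (\<Oplus>\<^bsub>cmod G (i + 1)\<^esub>b'\<in>?A. V_component E (?c b') \<odot>\<^bsub>cmod G (i + 1)\<^esub> b')"
    by (simp add: lin_image_def diff_entry_def)
  have mem: "(\<lambda>b'. V_component E (?c b') \<odot>\<^bsub>cmod G (i + 1)\<^esub> b') \<in> ?A \<rightarrow> carrier (cmod G (i + 1))"
    using Ac by (auto simp: G.F.smult_closed)
  then show cl: "lin_image i b \<in> carrier (cmod G (i + 1))" unfolding eq by (rule G.F.finsum_closed)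
  have yc: "G.dpart i b s \<in> carrier (cmod G (i + 1))" for s
    unfolding G.dpart_def using db by (rule G.F.mcoef_closed)
  show "lin_image i b = G.Ecomb (i + 1) (G.dpart i b)"
  proof (rule G.F.coords_eqI[where i = "i + 1", OF cl])
    show "G.Ecomb (i + 1) (G.dpart i b) \<in> carrier (cmod G (i + 1))" by (rule G.Ecomb_closed) (rule yc)
    fix b''
    have "G.F.crd (i + 1) (lin_image i b) b''
        = (\<Sum>b'\<in>?A. G.F.crd (i + 1) (V_component E (?c b') \<odot>\<^bsub>cmod G (i + 1)\<^esub> b') b'')"
      unfolding eq by (rule G.F.coords_finsum[OF mem])
    also have "\<dots> = (\<Sum>b'\<in>?A. if b'' = b' then V_component E (?c b') else 0)"
    proof (intro sum.cong refl)
      fix b' assume b': "b' \<in> ?A"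
      then have "b' \<in> BG (i + 1)" using A by blast
      then show "G.F.crd (i + 1) (V_component E (?c b') \<odot>\<^bsub>cmod G (i + 1)\<^esub> b') b''
          = (if b'' = b' then V_component E (?c b') else 0)"
        using Ac[OF b'] by (simp add: G.F.coords_smult G.F.coords_basis)
    qed
    also have "\<dots> = V_component E (?c b'')" using A(1) by (simp add: V_component_eq)
    also have "\<dots> = (\<Sum>s<n. e s * G.F.crd (i + 1) (G.dpart i b s) b'')"
      using db by (simp add: V_component_eq G.dpart_def G.F.coords_mcoef scal_right)
    also have "\<dots> = G.F.crd (i + 1) (G.Ecomb (i + 1) (G.dpart i b)) b''"
      by (rule G.coords_Ecomb[symmetric]) (rule yc)
    finally show "G.F.crd (i + 1) (lin_image i b) b'' = G.F.crd (i + 1) (G.Ecomb (i + 1) (G.dpart i b)) b''" .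
  qed
qed

lemma lin_image_Pi: "lin_image i \<in> BG i \<rightarrow> carrier (cmod G (i + 1))"
  using lin_image_closed by blast

lemma L_hom: "left_hom (cmod G i) (cmod G (i + 1)) (cdiff L i)"
  unfolding L_simps by (rule G.F.lext_left_hom[OF G.F.left_module_axioms lin_image_Pi])

lemma L_basis: "b \<in> BG i \<Longrightarrow> cdiff L i b = G.Ecomb (i + 1) (G.dpart i b)"
  unfolding L_simps G.F.lext_basis[OF G.F.left_module_axioms lin_image_Pi] by (rule lin_image_closed)

lemma dpart_closed: "m \<in> carrier (cmod G i) \<Longrightarrow> G.dpart i m s \<in> carrier (cmod G (i + 1))"
  unfolding G.dpart_def by (intro G.F.mcoef_closed G.d_simps)

lemma dpart_const: "m \<in> carrier (cmod G i) \<Longrightarrow> G.F.mcoef (i + 1) {} (G.dpart i m s) = G.dpart i m s"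
  unfolding G.dpart_def by (intro R.mcoef_mcoef G.d_simps)

text \<open>Both composites are linear, so they are compared on a basis element \<open>b\<close>.  There the differential of the linear part
  is \<open>\<Sum>\<^sub>s e\<^sub>s y\<^sub>s\<close>, and \<open>x\<^sub>s\<close> maps the class of \<open>b\<close> to that of \<open>y\<^sub>s\<close>.\<close>

lemma isomorphic_tensor_complex:
  "complexes_isomorphic graded 0 L (tensor_complex E n e x (H_K_tensor E F))"
  unfolding complexes_isomorphic_def
proof (intro exI[of _ "\<lambda>i. R.tens i"] conjI allI ballI impI)
  fix i
  let ?T = "tensor_complex E n e x (H_K_tensor E F)"
  have T: "cmod ?T j = E_tensor E (F.H j)" for j
    by (simp add: tensor_complex_def H_K_tensor_def)
  show "left_hom (cmod L i) (cmod ?T i) (R.tens i)" unfolding T L_simps by (rule R.tens_hom)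
  show "bij_betw (R.tens i) (carrier (cmod L i)) (carrier (cmod ?T i))" unfolding T L_simps by (rule R.tens_bij)
  have dT: "cdiff ?T i = quotient_map (free_tensor (F.H (i + 1)) :: ('e, _) module) (tensor_relations E (F.H (i + 1)))
       (frag_extend (\<lambda>(y, h). \<Sum>s<n. frag_of (y * e s, W_mult E F i (x s) h)))"
    by (simp add: tensor_complex_def H_K_tensor_def)
  have xh: "left_hom (F.H i) (F.H (i + 1)) (W_mult E F i (x s))" if "s < n" for s by (rule x_hom[OF that])
  have D1: "left_hom (E_tensor E (F.H i)) (E_tensor E (F.H (i + 1))) (cdiff ?T i)"
    unfolding dT by (rule tensor_differential(1)[OF R.T.tensor_space_axioms R.T.tensor_space_axioms]) (rule xh)
  have D2: "cdiff ?T i (pure_tensor E (F.H i) y h)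
      = (\<Oplus>\<^bsub>E_tensor E (F.H (i + 1))\<^esub>s\<in>{..<n}. pure_tensor E (F.H (i + 1)) (y * e s) (W_mult E F i (x s) h))"
    if "h \<in> carrier (F.H i)" for y h
    unfolding dT by (rule tensor_differential(2)[OF R.T.tensor_space_axioms R.T.tensor_space_axioms _ that]) (rule xh)
  have h1: "left_hom (cmod G i) (E_tensor E (F.H (i + 1))) (\<lambda>m. R.tens (i + 1) (cdiff L i m))"
    by (rule left_hom_comp[OF L_hom R.tens_hom])
  have h2: "left_hom (cmod G i) (E_tensor E (F.H (i + 1))) (\<lambda>m. cdiff ?T i (R.tens i m))"
    by (rule left_hom_comp[OF R.tens_hom D1])
  fix m assume "m \<in> carrier (cmod L i)"
  then have m: "m \<in> carrier (cmod G i)" by (simp add: L_simps)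
  show "R.tens (i + 1) (cdiff L i m) = cdiff ?T i (R.tens i m)"
  proof (rule G.F.left_hom_eqI[where i = i, OF R.T.left_module_ET h1 h2 _ m])
    fix b assume b: "b \<in> BG i"
    have bc: "b \<in> carrier (cmod G i)" using b G.F.basis_closed by blast
    have Pb: "\<Phi> i b \<in> carrier (F.H i)" by (rule R.Phi_closed[OF bc])
    have "R.tens (i + 1) (cdiff L i b) = (\<Oplus>\<^bsub>E_tensor E (F.H (i + 1))\<^esub>s\<in>{..<n}. R.tens (i + 1) (e s \<odot>\<^bsub>cmod G (i + 1)\<^esub> G.dpart i b s))"
      unfolding L_basis[OF b] using dpart_closed[OF bc] by (intro R.tens_simps(4)) (auto simp: G.F.smult_closed)
    also have "\<dots> = (\<Oplus>\<^bsub>E_tensor E (F.H (i + 1))\<^esub>s\<in>{..<n}. pure_tensor E (F.H (i + 1)) (1 * e s) (W_mult E F i (x s) (\<Phi> i b)))"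
    proof (rule R.T.ET.finsum_cong'[where i = "i + 1"])
      show "(\<lambda>s. pure_tensor E (F.H (i + 1)) (1 * e s) (W_mult E F i (x s) (\<Phi> i b))) \<in> {..<n} \<rightarrow> carrier (E_tensor E (F.H (i + 1)))"
        using R.T.pt_closed[where i = "i + 1"] left_hom_closed[OF F.left_module_H F.left_module_H x_hom _] Pb by auto
      fix s assume s: "s \<in> {..<n}"
      have "R.tens (i + 1) (e s \<odot>\<^bsub>cmod G (i + 1)\<^esub> G.dpart i b s) = pure_tensor E (F.H (i + 1)) (e s) (\<Phi> (i + 1) (G.dpart i b s))"
        using R.tens_pure[OF dpart_closed[OF bc], of "e s"] by (simp only: dpart_const[OF bc])
      then show "R.tens (i + 1) (e s \<odot>\<^bsub>cmod G (i + 1)\<^esub> G.dpart i b s) = pure_tensor E (F.H (i + 1)) (1 * e s) (W_mult E F i (x s) (\<Phi> i b))"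
        using Phi_action[OF _ bc, of s] s by simp
    qed simp
    also have "\<dots> = cdiff ?T i (pure_tensor E (F.H i) 1 (\<Phi> i b))" by (rule D2[OF Pb, symmetric])
    also have "pure_tensor E (F.H i) 1 (\<Phi> i b) = R.tens i b"
      using R.tens_const[OF bc] R.mcoef_basis[OF b] by simp
    finally show "R.tens (i + 1) (cdiff L i b) = cdiff ?T i (R.tens i b)" .
  qed
next
  fix i d assume gr: "graded"
  interpret GR: graded_reduction E n e "cmod G i" "BG i" "F.H i" "\<Phi> i" "cgr G i" "cohomology_gr F.KF i"
    by (rule graded_R[OF gr])
  show "R.tens i ` cgr L i d = cgr (tensor_complex E n e x (H_K_tensor E F)) i (d + 0)"
    unfolding L_simps using GR.tens_gr[of d] by (simp add: tensor_complex_def H_K_tensor_def)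
qed

text \<open>The identification of \<open>\<omega>\<^sub>E\<close> with \<open>E\<close> commutes with the differentials up to the sign with which
  a generator moves past elements of \<open>\<And>\<^sup>n\<^sup>-\<^sup>1V\<close>; the factors \<open>eps i\<close> absorb it.\<close>

definition eps :: "int \<Rightarrow> 'k" where
  "eps i = (if even i then 1 else (- 1) ^ (n - 1))"

lemma eps_nonzero: "eps i \<noteq> 0"
  by (simp add: eps_def)

lemma eps_step: "eps i * (- 1) ^ (n - 1) = eps (i + 1)"
  by (simp add: eps_def flip: power_add mult_2)

text \<open>On a basis element \<open>b\<close> with linear coefficients \<open>y\<^sub>s\<close>, the two composites evaluated at \<open>y\<close> are the sums over \<open>s\<close> of
  the classes of \<open>y\<^sub>s\<close>, weighted by the top coefficients of \<open>y e\<^sub>s\<close> and of \<open>e\<^sub>s y\<close>.  These differ by the sign in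
  \<open>top_commute\<close>.\<close>

lemma isomorphic_R_complex:
  "complexes_isomorphic graded (int n) L (R_complex E n e x (H_K_tensor E F))"
  unfolding complexes_isomorphic_def
proof (intro exI[of _ "\<lambda>i. R.hom_map i (eps i)"] conjI allI ballI impI)
  fix i
  let ?T = "R_complex E n e x (H_K_tensor E F)"
  have T: "cmod ?T j = Hom_K E (F.H j)" for j
    by (simp add: R_complex_def H_K_tensor_def)
  show "left_hom (cmod L i) (cmod ?T i) (R.hom_map i (eps i))" unfolding T L_simps by (rule R.hom_map_hom)
  show "bij_betw (R.hom_map i (eps i)) (carrier (cmod L i)) (carrier (cmod ?T i))"
    unfolding T L_simps by (rule R.hom_map_bij[OF eps_nonzero])
  have dT: "cdiff ?T i = (\<lambda>\<alpha> y. \<Oplus>\<^bsub>F.H (i + 1)\<^esub>s\<in>{..<n}. W_mult E F i (x s) (\<alpha> (e s * y)))"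
    by (simp add: R_complex_def H_K_tensor_def)
  have xh: "left_hom (F.H i) (F.H (i + 1)) (W_mult E F i (x s))" if "s < n" for s by (rule x_hom[OF that])
  have D: "left_hom (Hom_K E (F.H i)) (Hom_K E (F.H (i + 1))) (cdiff ?T i)"
    unfolding dT by (rule Hom_K_differential[OF F.left_module_H F.left_module_H]) (rule xh)
  have h1: "left_hom (cmod G i) (Hom_K E (F.H (i + 1))) (\<lambda>m. R.hom_map (i + 1) (eps (i + 1)) (cdiff L i m))"
    by (rule left_hom_comp[OF L_hom R.hom_map_hom])
  have h2: "left_hom (cmod G i) (Hom_K E (F.H (i + 1))) (\<lambda>m. cdiff ?T i (R.hom_map i (eps i) m))"
    by (rule left_hom_comp[OF R.hom_map_hom D])
  fix m assume "m \<in> carrier (cmod L i)"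
  then have m: "m \<in> carrier (cmod G i)" by (simp add: L_simps)
  show "R.hom_map (i + 1) (eps (i + 1)) (cdiff L i m) = cdiff ?T i (R.hom_map i (eps i) m)"
  proof (rule G.F.left_hom_eqI[where i = i, OF left_module_Hom_K[OF F.left_module_H] h1 h2 _ m])
    fix b assume b: "b \<in> BG i"
    have bc: "b \<in> carrier (cmod G i)" using b G.F.basis_closed by blast
    let ?H = "F.H (i + 1)" and ?P = "\<lambda>s. \<Phi> (i + 1) (G.dpart i b s)" and ?N = "cmod G (i + 1)"
    have Pc: "?P s \<in> carrier ?H" for s by (rule R.Phi_closed[OF dpart_closed[OF bc]])
    show "R.hom_map (i + 1) (eps (i + 1)) (cdiff L i b) = cdiff ?T i (R.hom_map i (eps i) b)"
    proof
      fix y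
      have mem: "(\<lambda>s. (y * e s) \<odot>\<^bsub>?N\<^esub> G.dpart i b s) \<in> {..<n} \<rightarrow> carrier ?N"
        using dpart_closed[OF bc] by (auto simp: G.F.smult_closed)
      have mem': "(\<lambda>s. e s \<odot>\<^bsub>?N\<^esub> G.dpart i b s) \<in> {..<n} \<rightarrow> carrier ?N"
        using dpart_closed[OF bc] by (auto simp: G.F.smult_closed)
      have "y \<odot>\<^bsub>?N\<^esub> cdiff L i b = (\<Oplus>\<^bsub>?N\<^esub>s\<in>{..<n}. y \<odot>\<^bsub>?N\<^esub> (e s \<odot>\<^bsub>?N\<^esub> G.dpart i b s))"
        unfolding L_basis[OF b] by (rule G.F.finsum_smult[OF mem'])
      also have "\<dots> = (\<Oplus>\<^bsub>?N\<^esub>s\<in>{..<n}. (y * e s) \<odot>\<^bsub>?N\<^esub> G.dpart i b s)"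
        using mem dpart_closed[OF bc] by (intro G.F.finsum_cong') (auto simp: G.F.smult_assoc)
      finally have "G.F.mcoef (i + 1) {..<n} (y \<odot>\<^bsub>?N\<^esub> cdiff L i b)
          = (\<Oplus>\<^bsub>?N\<^esub>s\<in>{..<n}. G.F.mcoef (i + 1) {..<n} ((y * e s) \<odot>\<^bsub>?N\<^esub> G.dpart i b s))"
        using R.mcoef_finsum[OF mem] by simp
      also have "\<dots> = (\<Oplus>\<^bsub>?N\<^esub>s\<in>{..<n}. scal E (coef {..<n} (y * e s)) 1 \<odot>\<^bsub>?N\<^esub> G.dpart i b s)"
      proof (rule G.F.finsum_cong'[where i = "i + 1"])
        show "(\<lambda>s. scal E (coef {..<n} (y * e s)) 1 \<odot>\<^bsub>?N\<^esub> G.dpart i b s) \<in> {..<n} \<rightarrow> carrier ?N"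
          using dpart_closed[OF bc] by (auto simp: G.F.smult_closed)
        show "G.F.mcoef (i + 1) {..<n} ((y * e s) \<odot>\<^bsub>?N\<^esub> G.dpart i b s)
            = scal E (coef {..<n} (y * e s)) 1 \<odot>\<^bsub>?N\<^esub> G.dpart i b s" for s
          using R.mcoef_smult_const[OF dpart_closed[OF bc], of "{..<n}" "y * e s" "{}"] by (simp only: dpart_const[OF bc])
      qed simp
      finally have "\<Phi> (i + 1) (G.F.mcoef (i + 1) {..<n} (y \<odot>\<^bsub>?N\<^esub> cdiff L i b))
          = \<Phi> (i + 1) (\<Oplus>\<^bsub>?N\<^esub>s\<in>{..<n}. scal E (coef {..<n} (y * e s)) 1 \<odot>\<^bsub>?N\<^esub> G.dpart i b s)" by (rule arg_cong)
      also have "\<dots> = (\<Oplus>\<^bsub>?H\<^esub>s\<in>{..<n}. \<Phi> (i + 1) (scal E (coef {..<n} (y * e s)) 1 \<odot>\<^bsub>?N\<^esub> G.dpart i b s))"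
        using dpart_closed[OF bc] by (intro R.Phi_finsum) (auto simp: G.F.smult_closed)
      also have "\<dots> = (\<Oplus>\<^bsub>?H\<^esub>s\<in>{..<n}. coef {..<n} (y * e s) \<odot>\<^bsub>?H\<^esub> ?P s)"
        using Pc by (intro F.H.finsum_cong') (auto simp: R.Phi_scal[OF dpart_closed[OF bc]] F.H.smult_closed)
      finally have "R.hom_map (i + 1) (eps (i + 1)) (cdiff L i b) y
          = eps (i + 1) \<odot>\<^bsub>?H\<^esub> (\<Oplus>\<^bsub>?H\<^esub>s\<in>{..<n}. coef {..<n} (y * e s) \<odot>\<^bsub>?H\<^esub> ?P s)"
        by (simp add: R.hom_map_def)
      also have "\<dots> = (\<Oplus>\<^bsub>?H\<^esub>s\<in>{..<n}. eps (i + 1) \<odot>\<^bsub>?H\<^esub> (coef {..<n} (y * e s) \<odot>\<^bsub>?H\<^esub> ?P s))"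
        using Pc by (intro F.H.finsum_smult) (auto simp: F.H.smult_closed)
      also have "\<dots> = (\<Oplus>\<^bsub>?H\<^esub>s\<in>{..<n}. W_mult E F i (x s) (R.hom_map i (eps i) b (e s * y)))"
      proof (rule F.H.finsum_cong'[where i = "i + 1", symmetric])
        show "(\<lambda>s. eps (i + 1) \<odot>\<^bsub>?H\<^esub> (coef {..<n} (y * e s) \<odot>\<^bsub>?H\<^esub> ?P s)) \<in> {..<n} \<rightarrow> carrier ?H"
          using Pc by (auto simp: F.H.smult_closed)
        fix s assume "s \<in> {..<n}"
        then have s: "s < n" by simp
        note xh = F.left_module_H F.left_module_H x_hom[OF s]
        have Pb: "\<Phi> i b \<in> carrier (F.H i)" by (rule R.Phi_closed[OF bc])
        have "G.F.mcoef i {..<n} ((e s * y) \<odot>\<^bsub>cmod G i\<^esub> b) = scal E (coef {..<n} (e s * y)) 1 \<odot>\<^bsub>cmod G i\<^esub> b"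
          using R.mcoef_smult_const[OF bc, of "{..<n}" "e s * y" "{}"] by (simp only: R.mcoef_basis[OF b])
        then have "R.hom_map i (eps i) b (e s * y) = (eps i * coef {..<n} (e s * y)) \<odot>\<^bsub>F.H i\<^esub> \<Phi> i b"
          using Pb by (simp add: R.hom_map_def R.Phi_scal[OF bc] F.H.smult_assoc)
        also have "eps i * coef {..<n} (e s * y) = eps (i + 1) * coef {..<n} (y * e s)"
          unfolding top_commute[OF s] eps_step[symmetric] by simp
        finally have "W_mult E F i (x s) (R.hom_map i (eps i) b (e s * y)) = (eps (i + 1) * coef {..<n} (y * e s)) \<odot>\<^bsub>?H\<^esub> ?P s"
          using left_hom_smult[OF xh] Pb Phi_action[OF s bc] by simp
        then show "W_mult E F i (x s) (R.hom_map i (eps i) b (e s * y)) = eps (i + 1) \<odot>\<^bsub>?H\<^esub> (coef {..<n} (y * e s) \<odot>\<^bsub>?H\<^esub> ?P s)"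
          using F.H.smult_assoc[OF Pc] by simp
      qed simp
      finally show "R.hom_map (i + 1) (eps (i + 1)) (cdiff L i b) y = cdiff ?T i (R.hom_map i (eps i) b) y"
        unfolding dT .
    qed
  qed
next
  fix i d assume gr: "graded"
  interpret GR: graded_reduction E n e "cmod G i" "BG i" "F.H i" "\<Phi> i" "cgr G i" "cohomology_gr F.KF i"
    by (rule graded_R[OF gr])
  show "R.hom_map i (eps i) ` cgr L i d = cgr (R_complex E n e x (H_K_tensor E F)) i (d + int n)"
    unfolding L_simps using GR.hom_map_gr[OF eps_nonzero[of i], of d] by (simp add: R_complex_def H_K_tensor_def)
qed

end

theorem theorem3p4:
  fixes E :: "('k::field, 'e::ring_1) gen_algebra"
    and F :: "('e, 'm) cochain_complex"
    and graded :: bool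
    and n :: nat and e :: "nat \<Rightarrow> 'e" and x :: "nat \<Rightarrow> 'e \<Rightarrow> 'k"
  assumes "exterior_algebra E"
    and "dual_bases E n e x"
    and "free_complex graded E F"
  shows "is_sym_module graded E (H_K_tensor E F) \<and>
    (\<exists>L :: ('e, 'm) cochain_complex. is_lin graded E F L) \<and>
    (\<forall>L :: ('e, 'n) cochain_complex. is_lin graded E F L \<longrightarrow>
       complexes_isomorphic graded (int n) L (R_complex E n e x (H_K_tensor E F)) \<and>
       complexes_isomorphic graded 0 L (tensor_complex E n e x (H_K_tensor E F)))"
proof -
  interpret exterior_basis E n e
    using assms(1,2) by (intro exterior_basisI) (simp_all add: dual_bases_def)
  obtain BF where BF: "is_complex graded (E_deg E) F" "homogeneous_free_bases graded F BF"
    using assms(3) by (auto simp: free_complex_def)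
  interpret F: complex_with_bases E n e graded F BF using BF by unfold_locales
  have "complexes_isomorphic graded (int n) L (R_complex E n e x (H_K_tensor E F)) \<and>
       complexes_isomorphic graded 0 L (tensor_complex E n e x (H_K_tensor E F))"
    if lin: "is_lin graded E F L" for L :: "('e, 'n) cochain_complex"
  proof -
    obtain G BG where G: "is_complex graded (E_deg E) G" "homogeneous_free_bases graded G BG"
        "minimal_complex E G BG" "homotopy_equivalent_complexes graded F G" "L = erase_nonlinear E G BG"
      using lin unfolding is_lin_def by (elim exE conjE)
    obtain f g where "chain_map graded F G f" "chain_map graded G F g"
        "chain_homotopic graded F F (\<lambda>i. g i \<circ> f i) (\<lambda>i. id)"
        "chain_homotopic graded G G (\<lambda>i. f i \<circ> g i) (\<lambda>i. id)"
      using G(4) unfolding homotopy_equivalent_complexes_def by (elim exE conjE)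
    then interpret minimal_equivalence E n e graded F BF G BG f g x
      using G(1-3) assms(2) by unfold_locales
    show ?thesis unfolding G(5) using isomorphic_R_complex isomorphic_tensor_complex by (rule conjI)
  qed
  then show ?thesis using F.is_sym_module_H F.lin_exists by blast
qed

end
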